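(* Let $f:[0,T]\times\mathbb{R}_+\times\mathbb{R}\times\mathbb{R}\to\mathbb{R}$ be a Borel function and $g:\mathbb{R}_+\to\mathbb{R}$ a Borel function such that: (i) there is a constant $C>0$ with $|f(t,x,y_1,z_1)-f(t,x,y_2,z_2)|\le C(|y_1-y_2|+|z_1-z_2|)$ for every $t\in[0,T]$, $x\ge 0$, $y_1,y_2,z_1,z_2\in\mathbb{R}$; (ii) the function $(t,x)\mapsto f(t,x,0,0)$ belongs to $L^{1,2}(dt\,d\mu)$; (iii) $g\in L^2(d\mu)$. Then there exists a unique weak solution $u:[0,T]\to L^2(d\mu)$, belonging to $B$, of the terminal value problem $$(\partial_t+L^\delta)u+f(\cdot,\cdot,u,\partial_x u)=0,\qquad u(T)\equiv g .$$
   Context: Fix $\delta\in(0,1)$ and $T>0$; $\mathbb{R}_+=[0,\infty)$. Let $\mu(dx)=x^{\delta-1}\mathbf 1_{\{x>0\}}dx$, and let $L^2(d\mu)$ be the real Hilbert space of (classes of) Borel functions on $\mathbb{R}_+$ square integrable with respect to $\mu$. $L^{1,2}(dt\,d\mu):=L^1([0,T];L^2(d\mu))$ (Bochner integrable functions). For a function $v$ on $[0,T]\times\mathbb{R}_+$ write $v(t)=v(t,\cdot)$. $D$ is the set of $C^2$ functions $\varphi:\mathbb{R}_+\to\mathbb{R}$ with compact support in $\mathbb{R}_+$ and $\varphi'(0)=0$. For $\varphi\in D$, $L^\delta\varphi(x)=\frac{\varphi''(x)}{2}+\frac{(\delta-1)\varphi'(x)}{2x}$ for $x>0$ (an element of $L^2(d\mu)$;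 the value at $0$ is immaterial since $\mu(\{0\})=0$). $\mathcal H$ is the space of (absolutely continuous) $h\in L^2(d\mu)$ for which there is $k\in L^2(d\mu)$ with $h(x)-h(y)=\int_y^x k(z)\,dz$ for all $x,y\ge0$; then $h'=\partial_x h:=k$, and $\|h\|_{\mathcal H}^2=\|h\|_{L^2(d\mu)}^2+\frac12\|h'\|_{L^2(d\mu)}^2$. $B:=L^1([0,T];\mathcal H)$, the Banach space of (classes of) strongly measurable $u:[0,T]\to\mathcal H$ with $\int_0^T\|u(t)\|_{\mathcal H}dt<\infty$. A function $u:[0,T]\to L^2(d\mu)$ belongs to $B$ if $u(t)\in\mathcal H$ for almost every $t$ and its class is in $B$. A Bochner integrable $u:[0,T]\to L^2(d\mu)$ with $u(t)\in\mathcal H$ for a.e. $t$ and $r\mapsto f(r,\cdot,u(r),\partial_xu(r))\in L^{1,2}(dt\,d\mu)$ is a weak solution if for all $\phi\in D$ and all $t\in[0,T]$, $$\langle u(t),\phi\rangle_{L^2(d\mu)}=\langle g,\phi\rangle_{L^2(d\mu)}+\int_t^T\langle u(s),L^\delta\phi\rangle_{L^2(d\mu)}ds+\int_t^T\langle f(s,\cdot,u(s),\partial_xu(s)),\phi\rangle_{L^2(d\mu)}ds.$$ *)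

theory Defs
  imports "HOL-Analysis.Analysis"
begin

text \<open>
  Elements of \<open>L\<^sup>2(d\<mu>)\<close> are represented by functions \<open>real \<Rightarrow> real\<close>, identified when they agree
  \<open>\<mu>\<close>-almost everywhere; values at negative arguments never matter. As \<open>\<delta>\<close> is a variable, there is
  no type for this Hilbert space, so Bochner integrability is spelled out for function-valued maps.
\<close>

definition bessel_measure :: "real \<Rightarrow> real measure" where
  "bessel_measure \<delta> =
     density (restrict_space lborel {0..}) (\<lambda>x. ennreal (x powr (\<delta> - 1) * indicator {0<..} x))"

definition L2_space :: "'a measure \<Rightarrow> ('a \<Rightarrow> real) set" where
  "L2_space M = {h \<in> borel_measurable M. integrable M (\<lambda>x. (h x)\<^sup>2)}"

definition L2_inner :: "'a measure \<Rightarrow> ('a \<Rightarrow> real) \<Rightarrow> ('a \<Rightarrow> real) \<Rightarrow> real" where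
  "L2_inner M h k = (\<integral>x. h x * k x \<partial>M)"

definition L2_norm :: "'a measure \<Rightarrow> ('a \<Rightarrow> real) \<Rightarrow> real" where
  "L2_norm M h = sqrt (L2_inner M h h)"

text \<open>
  Strongly measurable maps \<open>u\<close> on \<open>M\<close> with values (almost everywhere) in the function space \<open>V\<close> with
  norm \<open>N\<close> such that \<open>t \<mapsto> N (u t)\<close> is integrable. The norms used below are meaningful only on \<open>V\<close>,
  which is closed under differences.
\<close>

definition Bochner_L1 ::
  "'t measure \<Rightarrow> ('a \<Rightarrow> real) set \<Rightarrow> (('a \<Rightarrow> real) \<Rightarrow> real) \<Rightarrow> ('t \<Rightarrow> 'a \<Rightarrow> real) set" where
  "Bochner_L1 M V N = {u.
     (AE t in M. u t \<in> V) \<and>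
     (\<exists>s. (\<forall>n. simple_function M (s n) \<and> s n ` space M \<subseteq> V) \<and>
          (AE t in M. (\<lambda>n::nat. N (\<lambda>x. s n t x - u t x)) \<longlonglongrightarrow> 0)) \<and>
     integrable M (\<lambda>t. N (u t))}"

definition L12_space :: "real \<Rightarrow> real \<Rightarrow> (real \<Rightarrow> real \<Rightarrow> real) set" where
  "L12_space \<delta> T =
     Bochner_L1 (lebesgue_on {0..T}) (L2_space (bessel_measure \<delta>)) (L2_norm (bessel_measure \<delta>))"

text \<open>
  \<open>H_deriv \<delta> h k\<close>: the class of \<open>h\<close> has a representative \<open>h0\<close> that is a primitive of
  \<open>k \<in> L\<^sup>2(d\<mu>)\<close>; such a \<open>k\<close> is unique up to \<open>\<mu>\<close>-null sets. The interval integral is signed, and \<open>k\<close> is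
  integrable on bounded intervals because \<open>\<delta> < 2\<close>.
\<close>

definition H_deriv :: "real \<Rightarrow> (real \<Rightarrow> real) \<Rightarrow> (real \<Rightarrow> real) \<Rightarrow> bool" where
  "H_deriv \<delta> h k \<longleftrightarrow>
     k \<in> L2_space (bessel_measure \<delta>) \<and>
     (\<exists>h0. (AE x in bessel_measure \<delta>. h0 x = h x) \<and>
           (\<forall>x\<ge>0. \<forall>y\<ge>0. h0 x - h0 y = (LBINT z=ereal y..ereal x. k z)))"

definition H_space :: "real \<Rightarrow> (real \<Rightarrow> real) set" where
  "H_space \<delta> = {h \<in> L2_space (bessel_measure \<delta>). \<exists>k. H_deriv \<delta> h k}"

definition H_dx :: "real \<Rightarrow> (real \<Rightarrow> real) \<Rightarrow> real \<Rightarrow> real" where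
  "H_dx \<delta> h = (SOME k. H_deriv \<delta> h k)"

definition H_norm :: "real \<Rightarrow> (real \<Rightarrow> real) \<Rightarrow> real" where
  "H_norm \<delta> h = sqrt ((L2_norm (bessel_measure \<delta>) h)\<^sup>2
                     + 1/2 * (L2_norm (bessel_measure \<delta>) (H_dx \<delta> h))\<^sup>2)"

definition B_space :: "real \<Rightarrow> real \<Rightarrow> (real \<Rightarrow> real \<Rightarrow> real) set" where
  "B_space \<delta> T = Bochner_L1 (lebesgue_on {0..T}) (H_space \<delta>) (H_norm \<delta>)"

text \<open>Derivative on the closed half-line, one-sided at \<open>0\<close>.\<close>

definition half_line_deriv :: "(real \<Rightarrow> real) \<Rightarrow> real \<Rightarrow> real" where
  "half_line_deriv \<phi> x = vector_derivative \<phi> (at x within {0..})"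

definition test_functions :: "(real \<Rightarrow> real) set" where
  "test_functions = {\<phi>.
     \<phi> differentiable_on {0..} \<and>
     half_line_deriv \<phi> differentiable_on {0..} \<and>
     continuous_on {0..} (half_line_deriv (half_line_deriv \<phi>)) \<and>
     compact (closure {x \<in> {0..}. \<phi> x \<noteq> 0}) \<and>
     half_line_deriv \<phi> 0 = 0}"

definition bessel_generator :: "real \<Rightarrow> (real \<Rightarrow> real) \<Rightarrow> real \<Rightarrow> real" where
  "bessel_generator \<delta> \<phi> x =
     half_line_deriv (half_line_deriv \<phi>) x / 2 + (\<delta> - 1) * half_line_deriv \<phi> x / (2 * x)"

definition nonlinear_term ::
  "real \<Rightarrow> (real \<Rightarrow> real \<Rightarrow> real \<Rightarrow> real \<Rightarrow> real) \<Rightarrow> (real \<Rightarrow> real \<Rightarrow> real) \<Rightarrow> real \<Rightarrow> real \<Rightarrow> real" where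
  "nonlinear_term \<delta> f u t x = f t x (u t x) (H_dx \<delta> (u t) x)"

definition weak_solution ::
  "real \<Rightarrow> real \<Rightarrow> (real \<Rightarrow> real \<Rightarrow> real \<Rightarrow> real \<Rightarrow> real) \<Rightarrow> (real \<Rightarrow> real) \<Rightarrow> (real \<Rightarrow> real \<Rightarrow> real) \<Rightarrow> bool"
  where
  "weak_solution \<delta> T f g u \<longleftrightarrow>
     (\<forall>t\<in>{0..T}. u t \<in> L2_space (bessel_measure \<delta>)) \<and>
     u \<in> L12_space \<delta> T \<and>
     (AE t in lebesgue_on {0..T}. u t \<in> H_space \<delta>) \<and>
     nonlinear_term \<delta> f u \<in> L12_space \<delta> T \<and>
     (\<forall>\<phi>\<in>test_functions. \<forall>t\<in>{0..T}.
        L2_inner (bessel_measure \<delta>) (u t) \<phi> =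
          L2_inner (bessel_measure \<delta>) g \<phi>
          + (\<integral>s. L2_inner (bessel_measure \<delta>) (u s) (bessel_generator \<delta> \<phi>) \<partial>lebesgue_on {t..T})
          + (\<integral>s. L2_inner (bessel_measure \<delta>) (nonlinear_term \<delta> f u s) \<phi> \<partial>lebesgue_on {t..T}))"

end

theory Submission
  imports Defs
begin

section \<open>Projection onto a closed subspace of a Hilbert space\<close>

section \<open>Orthogonal projections\<close>

text \<open>Write L for minus the generator. In divergence form, x^(\<delta>-1) times the generator
  applied to \<phi> is half the derivative of x^(\<delta>-1) \<phi>'. Since \<phi>'(0) = 0 and
  \<delta> > 0, integration by parts leaves no boundary term at 0, and pairing h with the generator
  of \<phi> gives -1/2 <h', \<phi>'> for every h in the form domain
  (\<open>generator_parts\<close>). The equation is thus one for the nonnegative operator L of the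
  closed form 1/2 <h', k'>, as soon as the test functions determine the form on its whole domain.
  That they are a core (\<open>closure_test_graph\<close>) is the analytic fact peculiar to this
  operator.

  The abstract half takes a closed subspace \<open>G\<close> of pairs (h, dh) in the square of a
  Hilbert space, with form <dh, dk>. Projecting (f, 0) onto \<open>G\<close> yields J = (1 + L)^-1.
  With S = 1 - J, the partial sums of S + S^2 + ... are bounded, symmetric, nonnegative, commuting
  approximations \<open>A n\<close> of L. One monotone quantity (\<open>contr_smoothing\<close>)
  bounds their exponentials uniformly in n, so that limits exist: the semigroup \<open>P\<close> and
  its gradient \<open>Q\<close>, with norm at most t^(-1/2) (\<open>norm_Q_le\<close>). As t^(-1/2)
  is integrable, the Duhamel integral turns a source in L^1 in time into a pair (u, du) in L^1 in
  time. With a weight e^(\<beta> t) and \<beta> large, Duhamel after the Lipschitz nonlinearity is a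
  contraction (\<open>ex_contraction\<close>), and its fixed point is a mild solution
  (\<open>fixpoint_exists\<close>), hence a weak one (\<open>mild_weak\<close>).

  For uniqueness, a weak solution in the energy space agrees with the mild solution driven by its
  own nonlinear term, because the difference solves the homogeneous linear problem and an energy
  argument after applying J makes it vanish (\<open>linear_uniqueness\<close>). The contraction then
  identifies two solutions for almost every t, and the mild formula does so for every t
  (\<open>weak_sol_unique\<close>).

  The concrete half carries L^2(d\<mu>) to the fixed type \<open>l2\<close> by a unitary map
  \<open>U\<close>, shows that the gradient graph \<open>Gr\<close> is closed with dense domain
  (\<open>closed_Gr\<close>, \<open>dense_dom_Gr\<close>), and translates between the two notions of
  solution (\<open>weak_solution_imp_weak_sol\<close>,
  \<open>weak_sol_imp_weak_solution\<close>).\<close>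

lemma parallelogram:
  fixes x y :: "'a::real_inner"
  shows "(norm (x + y))\<^sup>2 + (norm (x - y))\<^sup>2 = 2 * (norm x)\<^sup>2 + 2 * (norm y)\<^sup>2"
  by (simp add: power2_norm_eq_inner inner_add inner_diff inner_commute)

text \<open>A minimising sequence is Cauchy: the midpoint of two of its members lies in
  \<open>S\<close> and cannot be closer to \<open>x\<close> than the infimum, so the parallelogram
  law leaves little room for their difference.\<close>

lemma closest_point_exists:
  fixes S :: "'a::{real_inner, complete_space} set"
  assumes S: "subspace S" "closed S"
  shows "\<exists>p\<in>S. \<forall>w\<in>S. dist x p \<le> dist x w"
proof -
  define d where "d = infdist x S"
  have ne: "S \<noteq> {}" using S(1) subspace_0 by blast
  have d0: "d \<ge> 0" by (simp add: d_def infdist_nonneg)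
  have dle: "d \<le> dist x w" if "w \<in> S" for w using that by (simp add: d_def infdist_le)
  have "\<exists>p. p \<in> S \<and> dist x p < d + 1 / real (Suc n)" for n
  proof -
    have "d < d + 1 / real (Suc n)" by simp
    then show ?thesis using ne unfolding d_def infdist_notempty[OF ne]
      using cInf_lessD[of "dist x ` S" "Inf (dist x ` S) + 1 / real (Suc n)"] by auto
  qed
  then obtain p where pS: "\<And>n. p n \<in> S" and pd: "\<And>n. dist x (p n) < d + 1 / real (Suc n)" by metis
  have dlim: "(\<lambda>n. dist x (p n)) \<longlonglongrightarrow> d"
  proof (rule tendsto_sandwich[OF always_eventually always_eventually])
    show "\<forall>n. d \<le> dist x (p n)" using dle pS by blast
    show "\<forall>n. dist x (p n) \<le> d + 1 / real (Suc n)" using pd less_imp_le by blast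
    show "(\<lambda>n. d) \<longlonglongrightarrow> d" by simp
    show "(\<lambda>n. d + 1 / real (Suc n)) \<longlonglongrightarrow> d"
      using tendsto_add[OF tendsto_const lim_inverse_n'[THEN LIMSEQ_Suc]] by (metis add_0_right)
  qed
  have key: "(dist (p m) (p n))\<^sup>2 \<le> 2 * (dist x (p m))\<^sup>2 + 2 * (dist x (p n))\<^sup>2 - 4 * d\<^sup>2" for m n
  proof -
    have mid: "(1/2) *\<^sub>R (p m + p n) \<in> S" using pS S(1) by (simp add: subspace_add subspace_scale)
    have "d \<le> dist x ((1/2) *\<^sub>R (p m + p n))" by (rule dle[OF mid])
    then have "d\<^sup>2 \<le> (norm (x - (1/2) *\<^sub>R (p m + p n)))\<^sup>2"
      using d0 by (simp add: dist_norm power_mono)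
    also have "x - (1/2) *\<^sub>R (p m + p n) = (1/2) *\<^sub>R ((x - p m) + (x - p n))"
      by (simp add: algebra_simps scaleR_add_left[symmetric])
    finally have "4 * d\<^sup>2 \<le> (norm ((x - p m) + (x - p n)))\<^sup>2" by (simp add: power_divide)
    moreover have "(norm ((x - p m) - (x - p n)))\<^sup>2 = (dist (p m) (p n))\<^sup>2"
      by (simp add: dist_norm norm_minus_commute)
    ultimately show ?thesis using parallelogram[of "x - p m" "x - p n"] by (simp add: dist_norm)
  qed
  have "Cauchy p"
  proof (rule metric_CauchyI)
    fix e :: real assume e: "e > 0"
    have "(\<lambda>n. (dist x (p n))\<^sup>2) \<longlonglongrightarrow> d\<^sup>2" by (intro tendsto_intros dlim)
    moreover have "d\<^sup>2 < d\<^sup>2 + e\<^sup>2 / 4" using e by simp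
    ultimately have "\<forall>\<^sub>F n in sequentially. (dist x (p n))\<^sup>2 < d\<^sup>2 + e\<^sup>2 / 4" by (rule order_tendstoD(2))
    then obtain N where N: "\<And>n. n \<ge> N \<Longrightarrow> (dist x (p n))\<^sup>2 < d\<^sup>2 + e\<^sup>2 / 4"
      by (auto simp: eventually_sequentially)
    show "\<exists>M. \<forall>m\<ge>M. \<forall>n\<ge>M. dist (p m) (p n) < e"
    proof (intro exI allI impI)
      fix m n assume "N \<le> m" "N \<le> n"
      then have "(dist (p m) (p n))\<^sup>2 < e\<^sup>2" using key[of m n] N[of m] N[of n] by simp
      then show "dist (p m) (p n) < e" using e by (simp add: power2_less_imp_less)
    qed
  qed
  then obtain q where q: "p \<longlonglongrightarrow> q" using Cauchy_convergent convergent_def by blast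
  have "q \<in> S" using S(2) pS q closed_sequentially by blast
  moreover have "dist x q = d"
    by (rule LIMSEQ_unique[OF _ dlim]) (intro tendsto_intros q)
  ultimately show ?thesis using dle by auto
qed

lemma orthogonal_projection_exists:
  fixes S :: "'a::{real_inner, complete_space} set"
  assumes S: "subspace S" "closed S"
  shows "\<exists>p\<in>S. \<forall>w\<in>S. (x - p) \<bullet> w = 0"
proof -
  obtain p where p: "p \<in> S" "\<And>w. w \<in> S \<Longrightarrow> dist x p \<le> dist x w"
    using closest_point_exists[OF S] by blast
  have "(x - p) \<bullet> w = 0" if w: "w \<in> S" for w
  proof (cases "w = 0")
    case False
    \<comment> \<open>The minimiser of the quadratic polynomial |x - p - t w|^2 in t. Since
      \<open>p\<close> is already closest, the gain ((x - p) \<bullet> w)^2 / (w \<bullet> w) must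
      be zero.\<close>
    define t where "t = ((x - p) \<bullet> w) / (w \<bullet> w)"
    have ww: "w \<bullet> w > 0" using False by simp
    have "p + t *\<^sub>R w \<in> S" using p(1) w S(1) by (simp add: subspace_add subspace_scale)
    from p(2)[OF this] have "(norm (x - p))\<^sup>2 \<le> (norm ((x - p) - t *\<^sub>R w))\<^sup>2"
      by (simp add: dist_norm power_mono algebra_simps)
    also have "\<dots> = (norm (x - p))\<^sup>2 - 2 * t * ((x - p) \<bullet> w) + t\<^sup>2 * (w \<bullet> w)"
      unfolding power2_norm_eq_inner
      by (simp add: inner_diff inner_commute power2_eq_square algebra_simps)
    also have "\<dots> = (norm (x - p))\<^sup>2 - ((x - p) \<bullet> w)\<^sup>2 / (w \<bullet> w)"
      using ww by (simp add: t_def power2_eq_square field_simps)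
    finally have "((x - p) \<bullet> w)\<^sup>2 / (w \<bullet> w) \<le> 0" by simp
    then have "((x - p) \<bullet> w)\<^sup>2 \<le> 0" using ww by (simp add: divide_le_0_iff)
    then show ?thesis by simp
  qed simp
  then show ?thesis using p(1) by blast
qed

definition ortho_proj :: "'a::real_inner set \<Rightarrow> 'a \<Rightarrow> 'a" where
  "ortho_proj S x = (SOME p. p \<in> S \<and> (\<forall>w\<in>S. (x - p) \<bullet> w = 0))"

lemma
  fixes S :: "'a::{real_inner, complete_space} set"
  assumes S: "subspace S" "closed S"
  shows ortho_proj_in: "ortho_proj S x \<in> S"
    and ortho_proj_orth: "w \<in> S \<Longrightarrow> ortho_proj S x \<bullet> w = x \<bullet> w"
proof -
  have "\<exists>p. p \<in> S \<and> (\<forall>w\<in>S. (x - p) \<bullet> w = 0)"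
    using orthogonal_projection_exists[OF S] by blast
  from someI_ex[OF this]
  have *: "ortho_proj S x \<in> S \<and> (\<forall>w\<in>S. (x - ortho_proj S x) \<bullet> w = 0)"
    unfolding ortho_proj_def .
  then show "ortho_proj S x \<in> S" by simp
  show "ortho_proj S x \<bullet> w = x \<bullet> w" if "w \<in> S"
    using * that by (simp add: inner_diff)
qed

text \<open>Two candidates differ by an element of \<open>S\<close> orthogonal to \<open>S\<close>.
  Linearity of the projection and its value on \<open>S\<close> are read off from this.\<close>

lemma ortho_proj_unique:
  fixes S :: "'a::{real_inner, complete_space} set"
  assumes S: "subspace S" "closed S" and "p \<in> S" "\<And>w. w \<in> S \<Longrightarrow> p \<bullet> w = x \<bullet> w"
  shows "ortho_proj S x = p"
proof -
  have "ortho_proj S x - p \<in> S" using assms ortho_proj_in[OF S] by (simp add: subspace_diff)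
  then have "(ortho_proj S x - p) \<bullet> (ortho_proj S x - p) = 0"
    using assms(4) ortho_proj_orth[OF S] by (simp add: inner_diff_left)
  then show ?thesis by simp
qed

lemma ortho_proj_id:
  fixes S :: "'a::{real_inner, complete_space} set"
  assumes S: "subspace S" "closed S" and "x \<in> S"
  shows "ortho_proj S x = x"
  by (rule ortho_proj_unique[OF S]) (use assms in auto)

lemma bounded_linear_ortho_proj:
  fixes S :: "'a::{real_inner, complete_space} set"
  assumes S: "subspace S" "closed S"
  shows "bounded_linear (ortho_proj S)"
proof (rule bounded_linear_intro[where K = 1])
  show "ortho_proj S (x + y) = ortho_proj S x + ortho_proj S y" for x y
    by (rule ortho_proj_unique[OF S])
       (auto simp: ortho_proj_in[OF S] ortho_proj_orth[OF S] subspace_add[OF S(1)] inner_add_left)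
  show "ortho_proj S (r *\<^sub>R x) = r *\<^sub>R ortho_proj S x" for r x
    by (rule ortho_proj_unique[OF S])
       (auto simp: ortho_proj_in[OF S] ortho_proj_orth[OF S] subspace_scale[OF S(1)])
  show "norm (ortho_proj S x) \<le> norm x * 1" for x
  proof -
    have "(norm (ortho_proj S x))\<^sup>2 = x \<bullet> ortho_proj S x"
      using ortho_proj_orth[OF S ortho_proj_in[OF S]] by (simp add: power2_norm_eq_inner)
    also have "\<dots> \<le> norm x * norm (ortho_proj S x)" by (rule norm_cauchy_schwarz)
    finally show ?thesis
      by (simp add: power2_eq_square) (metis mult_le_cancel_right norm_ge_zero order_le_less)
  qed
qed

text \<open>The residual of the projection is orthogonal to \<open>S\<close>, hence 0. Applied to
  closures, this proves that the range of \<open>J\<close>, the step functions and the form domain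
  are dense.\<close>

lemma closed_subspace_eq_UNIV:
  fixes S :: "'a::{real_inner, complete_space} set"
  assumes S: "subspace S" "closed S" and orth: "\<And>h. (\<And>w. w \<in> S \<Longrightarrow> h \<bullet> w = 0) \<Longrightarrow> h = 0"
  shows "S = UNIV"
proof -
  have "x \<in> S" for x
  proof -
    have "x - ortho_proj S x = 0"
      by (rule orth) (simp add: inner_diff_left ortho_proj_orth[OF S])
    then show ?thesis using ortho_proj_in[OF S, of x] by simp
  qed
  then show ?thesis by auto
qed

section \<open>Bounded operators as a Banach algebra, and exponentials of nonnegative symmetric
  ones\<close>

section \<open>Bounded operators as a Banach algebra\<close>

text \<open>A type copy on which composition is the multiplication of a Banach algebra, so that
  \<open>exp\<close> applies to operators. The sort \<open>perfect_space\<close> in the instances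
  supplies a nonzero vector, without which the identity would not have norm 1.\<close>

typedef (overloaded) 'a endo = "UNIV :: ('a::real_normed_vector \<Rightarrow>\<^sub>L 'a) set" ..

setup_lifting type_definition_endo

instantiation endo :: ("{real_normed_vector, perfect_space}") real_normed_algebra_1
begin

lift_definition zero_endo :: "'a endo" is 0 .
lift_definition one_endo :: "'a endo" is id_blinfun .
lift_definition plus_endo :: "'a endo \<Rightarrow> 'a endo \<Rightarrow> 'a endo" is "(+)" .
lift_definition minus_endo :: "'a endo \<Rightarrow> 'a endo \<Rightarrow> 'a endo" is "(-)" .
lift_definition uminus_endo :: "'a endo \<Rightarrow> 'a endo" is uminus .
lift_definition times_endo :: "'a endo \<Rightarrow> 'a endo \<Rightarrow> 'a endo" is "(o\<^sub>L)" .
lift_definition scaleR_endo :: "real \<Rightarrow> 'a endo \<Rightarrow> 'a endo" is scaleR .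
lift_definition norm_endo :: "'a endo \<Rightarrow> real" is norm .
definition dist_endo :: "'a endo \<Rightarrow> 'a endo \<Rightarrow> real" where "dist_endo a b = norm (a - b)"
definition sgn_endo :: "'a endo \<Rightarrow> 'a endo" where "sgn_endo a = inverse (norm a) *\<^sub>R a"
definition [code del]:
  "(uniformity :: ('a endo \<times> 'a endo) filter) = (INF e\<in>{0 <..}. principal {(x, y). dist x y < e})"
definition open_endo :: "'a endo set \<Rightarrow> bool" where
  [code del]: "open_endo S = (\<forall>x\<in>S. \<forall>\<^sub>F (x', y) in uniformity. x' = x \<longrightarrow> y \<in> S)"

instance
proof
  fix a b c :: "'a endo" and r q :: real
  show "dist a b = norm (a - b)" by (fact dist_endo_def)
  show "sgn a = inverse (norm a) *\<^sub>R a" by (fact sgn_endo_def)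
  show "a + b + c = a + (b + c)" "a + b = b + a" "0 + a = a" "- a + a = 0" "a - b = a + - b"
    by (transfer, simp add: algebra_simps)+
  show "r *\<^sub>R (a + b) = r *\<^sub>R a + r *\<^sub>R b" "(r + q) *\<^sub>R a = r *\<^sub>R a + q *\<^sub>R a"
    "r *\<^sub>R q *\<^sub>R a = (r * q) *\<^sub>R a" "1 *\<^sub>R a = a"
    by (transfer, simp add: algebra_simps)+
  show "a * b * c = a * (b * c)" by transfer (rule blinfun_eqI, simp)
  show "(a + b) * c = a * c + b * c" by transfer (rule blinfun_eqI, simp add: blinfun.bilinear_simps)
  show "a * (b + c) = a * b + a * c" by transfer (rule blinfun_eqI, simp add: blinfun.bilinear_simps)
  show "r *\<^sub>R a * b = r *\<^sub>R (a * b)" by transfer (rule blinfun_eqI, simp add: blinfun.bilinear_simps)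
  show "a * r *\<^sub>R b = r *\<^sub>R (a * b)" by transfer (rule blinfun_eqI, simp add: blinfun.bilinear_simps)
  show "1 * a = a" "a * 1 = a" by (transfer, rule blinfun_eqI, simp)+
  show "norm (1::'a endo) = 1" by transfer (rule norm_blinfun_id)
  show "norm (a * b) \<le> norm a * norm b" by transfer (rule norm_blinfun_compose)
  show "norm (a + b) \<le> norm a + norm b" by transfer (rule norm_triangle_ineq)
  show "norm (r *\<^sub>R a) = \<bar>r\<bar> * norm a" by transfer simp
  show "(norm a = 0) = (a = 0)" by transfer simp
  show "uniformity = (INF e\<in>{0 <..}. principal {(x, y::'a endo). dist x y < e})"
    by (fact uniformity_endo_def)
  show "open U = (\<forall>x\<in>U. \<forall>\<^sub>F (x', y) in uniformity. x' = x \<longrightarrow> y \<in> U)" for U :: "'a endo set"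
    by (fact open_endo_def)
  show "(0::'a endo) \<noteq> 1" by transfer (metis norm_blinfun_id norm_zero zero_neq_one)
qed

end

instance endo :: ("{banach, perfect_space}") banach
proof
  fix X :: "nat \<Rightarrow> 'a endo" assume "Cauchy X"
  then have "Cauchy (\<lambda>n. Rep_endo (X n))"
    unfolding Cauchy_def dist_norm by (simp add: norm_endo.rep_eq minus_endo.rep_eq)
  then obtain L where "(\<lambda>n. Rep_endo (X n)) \<longlonglongrightarrow> L" using Cauchy_convergent convergent_def by blast
  then have "X \<longlonglongrightarrow> Abs_endo L"
    unfolding lim_sequentially dist_norm
    by (simp add: norm_endo.rep_eq minus_endo.rep_eq Abs_endo_inverse)
  then show "convergent X" by (auto simp: convergent_def)
qed

lift_definition endo_app :: "'a::real_normed_vector endo \<Rightarrow> 'a \<Rightarrow> 'a" is blinfun_apply .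

lemma bounded_bilinear_endo_app:
  "bounded_bilinear (endo_app :: 'a::{real_normed_vector, perfect_space} endo \<Rightarrow> 'a \<Rightarrow> 'a)"
proof
  show "\<exists>K. \<forall>a b. norm (endo_app a b) \<le> norm (a::'a endo) * norm b * K"
    by (rule exI[of _ 1], transfer) (simp add: norm_blinfun)
qed (transfer, simp add: blinfun.bilinear_simps)+

interpretation endo_app: bounded_bilinear
  "endo_app :: 'a::{real_normed_vector, perfect_space} endo \<Rightarrow> 'a \<Rightarrow> 'a"
  by (rule bounded_bilinear_endo_app)

lemma endo_app_times [simp]: "endo_app (a * b) x = endo_app a (endo_app b x)"
  for a b :: "'a::{real_normed_vector, perfect_space} endo"
  by transfer simp

lemma endo_app_one [simp]: "endo_app (1 :: 'a::{real_normed_vector, perfect_space} endo) x = x"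
  by transfer simp

lemma norm_endo_app: "norm (endo_app a x) \<le> norm a * norm x"
  for a :: "'a::{real_normed_vector, perfect_space} endo"
  by transfer (rule norm_blinfun)

lemma ex_endo_app:
  assumes "bounded_linear f"
  shows "\<exists>a :: 'a::real_normed_vector endo. endo_app a = f"
  by (rule exI[of _ "Abs_endo (Blinfun f)"])
     (simp add: endo_app.rep_eq Abs_endo_inverse bounded_linear_Blinfun_apply[OF assms])

definition pos_sym :: "'a::{real_inner, perfect_space} endo \<Rightarrow> bool" where
  "pos_sym a \<longleftrightarrow> (\<forall>x y. endo_app a x \<bullet> y = x \<bullet> endo_app a y) \<and> (\<forall>x. 0 \<le> endo_app a x \<bullet> x)"

text \<open>The exponential e^(-tB); it is a contraction when \<open>pos_sym B\<close> and t \<ge>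
  0.\<close>

definition contr :: "'a::{banach, perfect_space} endo \<Rightarrow> real \<Rightarrow> 'a \<Rightarrow> 'a" where
  "contr B t x = endo_app (exp (t *\<^sub>R (- B))) x"

lemma bounded_linear_contr: "bounded_linear (contr B t)"
  unfolding contr_def[abs_def] by (rule endo_app.bounded_linear_right)

lemmas linear_contr = bounded_linear.linear[OF bounded_linear_contr]
lemmas contr_simps = linear_add[OF linear_contr] linear_diff[OF linear_contr]
  linear_scale[OF linear_contr] linear_0[OF linear_contr]

lemma contr_0 [simp]: "contr B 0 x = x" and contr_zero [simp]: "contr 0 t x = x"
  by (simp_all add: contr_def)

lemma contr_has_vector_derivative:
  fixes B :: "'a::{banach, perfect_space} endo"
  shows "((\<lambda>t. contr B t x) has_vector_derivative - endo_app B (contr B t x)) (at t within S)"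
proof -
  have "((\<lambda>t. contr B t x) has_vector_derivative endo_app (- B * exp (t *\<^sub>R (- B))) x) (at t within S)"
    using bounded_linear.has_vector_derivative[OF endo_app.bounded_linear_left
        exp_scaleR_has_vector_derivative_right[of "- B" t S], of x]
    by (simp only: contr_def exp_times_scaleR_commute)
  then show ?thesis unfolding contr_def by (simp add: endo_app.minus_left)
qed

text \<open>The quantity on the left is nonincreasing in \<open>t\<close>.\<close>

lemma contr_smoothing:
  fixes B :: "'a::{real_inner, banach, perfect_space} endo"
  assumes B: "pos_sym B" and t: "0 \<le> t"
  shows "(norm (contr B t x))\<^sup>2 + 2 * t * (endo_app B (contr B t x) \<bullet> contr B t x)
          + 2 * t\<^sup>2 * (norm (endo_app B (contr B t x)))\<^sup>2 \<le> (norm x)\<^sup>2"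
proof -
  define u where "u = (\<lambda>t. contr B t x)"
  define v where "v = (\<lambda>t. endo_app B (u t))"
  define w where "w = (\<lambda>t. endo_app B (v t))"
  have du: "(u has_vector_derivative - v t) (at t)" for t
    unfolding u_def v_def by (rule contr_has_vector_derivative)
  have dv: "(v has_vector_derivative - w t) (at t)" for t
    using bounded_linear.has_vector_derivative[OF endo_app.bounded_linear_right du, of B]
    by (simp add: v_def w_def endo_app.minus_right)
  have inn: "((\<lambda>t. a t \<bullet> b t) has_real_derivative a t \<bullet> b' + a' \<bullet> b t) (at t)"
    if "(a has_vector_derivative a') (at t)" "(b has_vector_derivative b') (at t)"
    for a b :: "real \<Rightarrow> 'a" and a' b' t
    using bounded_bilinear.has_vector_derivative[OF bounded_bilinear_inner that]
    by (simp add: has_real_derivative_iff_has_vector_derivative)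
  \<comment> \<open>In the derivative the two terms 2 <v, u> cancel, and so do the terms of first
    order in t because <w, u> = <v, v>. What remains is -4 t^2 <w, v>, which is nonpositive.\<close>
  define \<psi> where "\<psi> = (\<lambda>t. u t \<bullet> u t + 2 * t * (v t \<bullet> u t) + 2 * t\<^sup>2 * (v t \<bullet> v t))"
  have sym: "w t \<bullet> u t = v t \<bullet> v t" and pos: "w t \<bullet> v t \<ge> 0" for t
    using B unfolding pos_sym_def w_def v_def by metis+
  have "(\<psi> has_real_derivative - 4 * t\<^sup>2 * (w t \<bullet> v t)) (at t)" for t
    unfolding \<psi>_def
    by (rule derivative_eq_intros inn[OF du du] inn[OF dv du] inn[OF dv dv] refl)+
       (simp add: sym sym[unfolded inner_commute[of "w t" "u t" for t]] power2_eq_square algebra_simps inner_commute[of "v t" "w t"] inner_commute[of "v t" "u t"])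
  moreover have "- 4 * t\<^sup>2 * (w t \<bullet> v t) \<le> 0" for t using pos by simp
  ultimately have "\<psi> t \<le> \<psi> 0"
    by (intro DERIV_nonpos_imp_nonincreasing[OF t]) blast
  then show ?thesis by (simp add: \<psi>_def u_def v_def power2_norm_eq_inner)
qed

text \<open>All three summands in \<open>contr_smoothing\<close> are nonnegative, so each is at most
  |x|^2. None of the bounds involves the norm of \<open>B\<close>, which is why they survive the
  passage to an unbounded operator.\<close>

lemma
  fixes B :: "'a::{real_inner, banach, perfect_space} endo"
  assumes B: "pos_sym B" and t: "0 \<le> t"
  shows contr_norm_le: "norm (contr B t x) \<le> norm x"
    and contr_form_le: "2 * t * (endo_app B (contr B t x) \<bullet> contr B t x) \<le> (norm x)\<^sup>2"
    and contr_gen_le: "t * norm (endo_app B (contr B t x)) \<le> norm x"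
proof -
  have nn: "0 \<le> endo_app B (contr B t x) \<bullet> contr B t x" using B unfolding pos_sym_def by blast
  note * = contr_smoothing[OF B t, of x]
  have n2: "0 \<le> 2 * t * (endo_app B (contr B t x) \<bullet> contr B t x)"
    by (intro mult_nonneg_nonneg nn) (use t in auto)
  have n3: "0 \<le> 2 * t\<^sup>2 * (norm (endo_app B (contr B t x)))\<^sup>2"
    by (intro mult_nonneg_nonneg zero_le_power2) auto
  have n1: "0 \<le> (norm (contr B t x))\<^sup>2" by (rule zero_le_power2)
  have "(norm (contr B t x))\<^sup>2 \<le> (norm x)\<^sup>2" using * n2 n3 by linarith
  then show "norm (contr B t x) \<le> norm x" by (rule power2_le_imp_le) (rule norm_ge_zero)
  show "2 * t * (endo_app B (contr B t x) \<bullet> contr B t x) \<le> (norm x)\<^sup>2" using * n1 n3 by linarith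
  have "(t * norm (endo_app B (contr B t x)))\<^sup>2 = t\<^sup>2 * (norm (endo_app B (contr B t x)))\<^sup>2"
    by (rule power_mult_distrib)
  also have "\<dots> \<le> (norm x)\<^sup>2" using * n1 n2 n3 by linarith
  finally show "t * norm (endo_app B (contr B t x)) \<le> norm x"
    by (rule power2_le_imp_le) (rule norm_ge_zero)
qed

lemma exp_commutes:
  fixes a b :: "'a::{real_normed_algebra_1, banach}"
  assumes "a * b = b * a"
  shows "exp a * b = b * exp a"
  by (simp add: exp_def suminf_mult[symmetric] summable_exp_generic suminf_mult2
      power_commuting_commutes[OF assms])

text \<open>The product e^(-(t-s)C) e^(-sB) leads from e^(-tC) at s = 0 to e^(-tB) at s = t. As the
  operators commute, its derivative at \<open>x\<close> is a product of contractions applied to Cx -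
  Bx, and the mean value inequality applies.\<close>

lemma contr_diff_le:
  fixes B C :: "'a::{real_inner, banach, perfect_space} endo"
  assumes B: "pos_sym B" and C: "pos_sym C" and comm: "B * C = C * B" and t: "0 \<le> t"
  shows "norm (contr B t x - contr C t x) \<le> t * norm (endo_app B x - endo_app C x)"
proof -
  define V where "V = (\<lambda>s. exp ((t - s) *\<^sub>R (- C)) * exp (s *\<^sub>R (- B)))"
  have dC: "((\<lambda>s. exp ((t - s) *\<^sub>R (- C))) has_vector_derivative exp ((t - s) *\<^sub>R (- C)) * C) (at s within S)" for s S
  proof -
    have "((\<lambda>s. t - s) has_vector_derivative - 1) (at s within S)"
      by (auto intro!: derivative_eq_intros)
    from vector_diff_chain_within[OF this exp_scaleR_has_vector_derivative_right[of "- C" "t - s"]]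
    show ?thesis by (simp add: o_def)
  qed
  have BC: "exp (s *\<^sub>R (- B)) * C = C * exp (s *\<^sub>R (- B))" for s
    by (rule exp_commutes) (simp add: comm)
  have dV: "(V has_vector_derivative exp ((t - s) *\<^sub>R (- C)) * exp (s *\<^sub>R (- B)) * (C - B)) (at s within S)" for s S
  proof -
    have "exp ((t - s) *\<^sub>R (- C)) * (exp (s *\<^sub>R (- B)) * - B) + exp ((t - s) *\<^sub>R (- C)) * C * exp (s *\<^sub>R (- B))
      = exp ((t - s) *\<^sub>R (- C)) * exp (s *\<^sub>R (- B)) * (C - B)"
      using BC[of s] by (simp add: right_diff_distrib mult.assoc)
    from bounded_bilinear.has_vector_derivative[OF bounded_bilinear_mult dC[of s S]
        exp_scaleR_has_vector_derivative_right[of "- B" s S], unfolded this]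
    show ?thesis unfolding V_def .
  qed
  define G where "G = (\<lambda>s. contr C (t - s) (contr B s (endo_app C x - endo_app B x)))"
  have dA: "((\<lambda>s. endo_app (V s) x) has_derivative (\<lambda>h. h *\<^sub>R G s)) (at s within {0..t})" for s
    using bounded_linear.has_vector_derivative[OF endo_app.bounded_linear_left dV[of s "{0..t}"], of x]
    by (simp only: G_def contr_def endo_app.diff_left endo_app_times has_vector_derivative_def)
  have nG: "norm (G s) \<le> norm (endo_app C x - endo_app B x)" if s: "s \<in> {0..t}" for s
  proof -
    have "norm (G s) \<le> norm (contr B s (endo_app C x - endo_app B x))"
      unfolding G_def by (rule contr_norm_le[OF C]) (use s in simp)
    also have "\<dots> \<le> norm (endo_app C x - endo_app B x)"
      by (rule contr_norm_le[OF B]) (use s in simp)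
    finally show ?thesis .
  qed
  have on: "onorm (\<lambda>h. h *\<^sub>R G s) \<le> norm (endo_app C x - endo_app B x)" if s: "s \<in> {0..t}" for s
    by (rule onorm_bound) (simp, metis nG[OF s] abs_ge_zero mult.commute mult_right_mono norm_scaleR real_norm_def)
  have "norm (endo_app (V t) x - endo_app (V 0) x)
     \<le> norm (endo_app C x - endo_app B x) * norm (t - 0)"
    by (rule differentiable_bound[OF _ dA on]) (use t in auto)
  then show ?thesis using t by (simp add: V_def contr_def mult.commute norm_minus_commute[of "endo_app B x"])
qed

section \<open>The resolvent of a closed form and bounded approximations of its operator\<close>

section \<open>The semigroup generated by a closed form\<close>

text \<open>The usual three-term estimate: a common bound lets \<open>x\<close> be replaced by a
  nearby element of \<open>D\<close>, uniformly in n. It serves for the powers of \<open>S\<close>,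
  for the semigroup and for its time derivative.\<close>

lemma convergent_of_dense:
  fixes T :: "nat \<Rightarrow> 'a::real_normed_vector \<Rightarrow> 'b::banach"
  assumes lin: "\<And>n. linear (T n)" and bd: "\<And>n x. norm (T n x) \<le> c * norm x"
    and conv: "\<And>z. z \<in> D \<Longrightarrow> convergent (\<lambda>n. T n z)" and dense: "closure D = UNIV"
  shows "convergent (\<lambda>n. T n x)"
proof -
  have "Cauchy (\<lambda>n. T n x)"
  proof (rule metric_CauchyI)
    fix e :: real assume e: "e > 0"
    define c' where "c' = \<bar>c\<bar> + 1"
    have c': "c' > 0" "c \<le> c'" by (auto simp: c'_def)
    obtain z where z: "z \<in> D" "dist z x < e / (3 * c')"
      using dense closure_approachable[of x D] e c' by (metis UNIV_I divide_pos_pos mult_pos_pos zero_less_numeral)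
    have bz: "norm (T n x - T n z) < e / 3" for n
    proof -
      have "norm (T n x - T n z) = norm (T n (x - z))" by (simp add: linear_diff[OF lin])
      also have "\<dots> \<le> c' * norm (x - z)"
        using bd[of n "x - z"] c'(2) by (meson mult_right_mono norm_ge_zero order_trans)
      also have "\<dots> < e / 3"
        using z(2) c'(1) by (simp add: dist_norm norm_minus_commute field_simps)
      finally show ?thesis .
    qed
    have "Cauchy (\<lambda>n. T n z)" using conv[OF z(1)] by (rule convergent_Cauchy)
    then obtain N where N: "\<And>m n. m \<ge> N \<Longrightarrow> n \<ge> N \<Longrightarrow> dist (T m z) (T n z) < e / 3"
      using e unfolding Cauchy_def by (metis divide_pos_pos zero_less_numeral)
    show "\<exists>M. \<forall>m\<ge>M. \<forall>n\<ge>M. dist (T m x) (T n x) < e"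
    proof (intro exI allI impI)
      fix m n assume mn: "N \<le> m" "N \<le> n"
      have "dist (T m x) (T n x) \<le> dist (T m x) (T m z) + dist (T m z) (T n z) + dist (T n z) (T n x)"
        by (meson add_right_mono dist_triangle order_trans)
      also have "\<dots> < e"
        using bz[of m] bz[of n] N[OF mn] by (simp add: dist_norm norm_minus_commute)
      finally show "dist (T m x) (T n x) < e" .
    qed
  qed
  then show ?thesis by (rule Cauchy_convergent)
qed

lemma subspace_closure:
  fixes S :: "'a::real_normed_vector set"
  assumes "subspace S"
  shows "subspace (closure S)"
  unfolding subspace_def
proof (intro conjI ballI allI)
  show "0 \<in> closure S" using subspace_0[OF assms] closure_subset by blast
  fix x y assume "x \<in> closure S" "y \<in> closure S"
  then obtain f g where "\<And>n. f n \<in> S" "f \<longlonglongrightarrow> x" "\<And>n. g n \<in> S" "g \<longlonglongrightarrow> y"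
    unfolding closure_sequential by blast
  then show "x + y \<in> closure S"
    unfolding closure_sequential
    by (intro exI[of _ "\<lambda>n. f n + g n"]) (auto intro: tendsto_add subspace_add[OF assms])
next
  fix c :: real and x assume "x \<in> closure S"
  then obtain f where "\<And>n. f n \<in> S" "f \<longlonglongrightarrow> x"
    unfolding closure_sequential by blast
  then show "c *\<^sub>R x \<in> closure S"
    unfolding closure_sequential
    by (intro exI[of _ "\<lambda>n. c *\<^sub>R f n"]) (auto intro!: tendsto_intros subspace_scale[OF assms])
qed

text \<open>\<open>G\<close> stands for the graph of a closed gradient d, as pairs (h, dh). The form
  is <dh, dk>, and its operator is L = d'd with d' the adjoint of d. Stating everything for the
  graph keeps the unbounded operators out: only a closed subspace of the product space
  occurs.\<close>

locale form_graph =
  fixes G :: "('a::{real_inner, banach, perfect_space} \<times> 'a) set"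
  assumes subspace_G: "subspace G" and closed_G: "closed G"
    and dense_dom: "closure (fst ` G) = UNIV"
begin

text \<open>The projection of (f, 0) onto the graph is the Lax-Milgram solution of <u, p> + <du, q>
  = <f, p> for all (p, q) in \<open>G\<close>, that is, u = (1 + L)^-1 f. \<open>J\<close> is its
  first component, lifted to the operator algebra, and \<open>K\<close> its second, the gradient of
  the solution.\<close>

definition J :: "'a endo" where
  "J = (SOME j. endo_app j = (\<lambda>f. fst (ortho_proj G (f, 0))))"

definition K :: "'a \<Rightarrow> 'a" where "K f = snd (ortho_proj G (f, 0))"

lemma bounded_linear_proj: "bounded_linear (ortho_proj G)"
  by (rule bounded_linear_ortho_proj[OF subspace_G closed_G])

lemma J_apply: "endo_app J f = fst (ortho_proj G (f, 0))"
proof -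
  have "bounded_linear (\<lambda>f. fst (ortho_proj G (f, 0)))"
    by (intro bounded_linear_compose[OF bounded_linear_fst]
        bounded_linear_compose[OF bounded_linear_proj] bounded_linear_Pair
        bounded_linear_ident bounded_linear_zero)
  from someI_ex[OF ex_endo_app[OF this]]
  show ?thesis unfolding J_def by metis
qed

lemma bounded_linear_K: "bounded_linear K"
  unfolding K_def[abs_def]
  by (intro bounded_linear_compose[OF bounded_linear_snd]
      bounded_linear_compose[OF bounded_linear_proj] bounded_linear_Pair
      bounded_linear_ident bounded_linear_zero)

lemma JK_in_G: "(endo_app J f, K f) \<in> G"
  using ortho_proj_in[OF subspace_G closed_G, of "(f, 0)"] by (simp add: J_apply K_def)

lemma JK_weak:
  assumes "(p, q) \<in> G"
  shows "endo_app J f \<bullet> p + K f \<bullet> q = f \<bullet> p"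
  using ortho_proj_orth[OF subspace_G closed_G assms, of "(f, 0)"]
  by (simp add: J_apply K_def inner_prod_def)

lemma J_sym: "endo_app J x \<bullet> y = x \<bullet> endo_app J y"
proof -
  have "endo_app J x \<bullet> endo_app J y + K x \<bullet> K y = x \<bullet> endo_app J y" by (rule JK_weak[OF JK_in_G])
  moreover have "endo_app J y \<bullet> endo_app J x + K y \<bullet> K x = y \<bullet> endo_app J x" by (rule JK_weak[OF JK_in_G])
  ultimately show ?thesis by (simp add: inner_commute)
qed

text \<open>The equation in \<open>JK_weak\<close> tested with its own solution. Dropping the
  gradient term gives the firm nonexpansiveness \<open>J_firm\<close>.\<close>

lemma J_energy: "(norm (endo_app J x))\<^sup>2 + (norm (K x))\<^sup>2 = endo_app J x \<bullet> x"
  using JK_weak[OF JK_in_G, of x x] by (simp add: power2_norm_eq_inner inner_commute)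

lemma J_firm: "(norm (endo_app J x))\<^sup>2 \<le> endo_app J x \<bullet> x"
  using J_energy[of x] zero_le_power2[of "norm (K x)"] by linarith

text \<open>If Jh = 0, the energy identity gives Kh = 0 too, and \<open>JK_weak\<close> makes h
  orthogonal to the domain, which is dense.\<close>

lemma J_eq_0: "endo_app J h = 0 \<Longrightarrow> h = 0"
proof -
  assume "endo_app J h = 0"
  then have K0: "endo_app J h = 0" "K h = 0" using J_energy[of h] by auto
  have "closed {x. h \<bullet> x = 0}"
    by (rule closed_Collect_eq) (auto intro!: continuous_intros)
  moreover have "fst ` G \<subseteq> {x. h \<bullet> x = 0}" using JK_weak[of _ _ h] K0 by auto
  ultimately have "closure (fst ` G) \<subseteq> {x. h \<bullet> x = 0}" by (rule closure_minimal[rotated])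
  then have "h \<in> {x. h \<bullet> x = 0}" unfolding dense_dom by blast
  then have "h \<bullet> h = 0" by simp
  then show "h = 0" by simp
qed

text \<open>A vector orthogonal to the range is orthogonal to its own image; by
  \<open>J_firm\<close> that image is 0, and \<open>J\<close> is injective.\<close>

lemma dense_range_J: "closure (range (endo_app J)) = UNIV"
proof (rule closed_subspace_eq_UNIV)
  have "linear (endo_app J)" by (rule bounded_linear.linear[OF endo_app.bounded_linear_right])
  then show "subspace (closure (range (endo_app J)))"
    by (intro subspace_closure linear_subspace_image subspace_UNIV)
  fix h assume h: "\<And>w. w \<in> closure (range (endo_app J)) \<Longrightarrow> h \<bullet> w = 0"
  have "h \<bullet> endo_app J h = 0" by (rule h) (meson closure_subset rangeI subsetD)
  then have "endo_app J h = 0" using J_firm[of h] by (simp add: inner_commute)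
  then show "h = 0" by (rule J_eq_0)
qed simp

lemma norm_J_le: "norm (endo_app J x) \<le> norm x"
proof (cases "endo_app J x = 0")
  case False
  have "norm (endo_app J x) * norm (endo_app J x) \<le> norm (endo_app J x) * norm x"
    using J_firm[of x] norm_cauchy_schwarz[of "endo_app J x" x] by (simp add: power2_eq_square)
  then show ?thesis using False by simp
qed simp

text \<open>\<open>J = (1 + L)\<^sup>-\<^sup>1\<close> for the operator \<open>L \<ge> 0\<close> of the form, so \<open>L = S (1 - S)\<^sup>-\<^sup>1\<close> with \<open>S = 1 - J\<close>, and
  the partial sums of the geometric series are bounded approximations of \<open>L\<close>.\<close>

definition S :: "'a endo" where "S = 1 - J"

definition A :: "nat \<Rightarrow> 'a endo" where "A n = (\<Sum>k<n. S ^ Suc k)"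

lemma S_apply: "endo_app S x = x - endo_app J x"
  by (simp add: S_def endo_app.diff_left)

lemma S_sym: "endo_app S x \<bullet> y = x \<bullet> endo_app S y"
  by (simp add: S_apply inner_diff J_sym)

text \<open>Expand |x - Jx|^2 and use \<open>J_firm\<close>. The surplus |Jx|^2 is kept on the left
  because it is what telescopes in \<open>S_pow_tendsto_0\<close>.\<close>

lemma norm_S_sq: "(norm (endo_app S x))\<^sup>2 + (norm (endo_app J x))\<^sup>2 \<le> (norm x)\<^sup>2"
proof -
  have "(norm (endo_app S x))\<^sup>2 = (norm x)\<^sup>2 - 2 * (endo_app J x \<bullet> x) + (norm (endo_app J x))\<^sup>2"
    by (simp add: S_apply power2_norm_eq_inner inner_diff inner_commute)
  then show ?thesis using J_firm[of x] by linarith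
qed

lemma norm_S_le: "norm (endo_app S x) \<le> norm x"
  using norm_S_sq[of x] zero_le_power2[of "norm (endo_app J x)"]
  by (intro power2_le_imp_le[OF _ norm_ge_zero]) linarith

lemma norm_S_pow_le: "norm (endo_app (S ^ n) x) \<le> norm x"
proof (induction n)
  case (Suc n)
  have "norm (endo_app (S ^ Suc n) x) \<le> norm (endo_app (S ^ n) x)"
    by (simp add: norm_S_le)
  then show ?case using Suc by linarith
qed simp

lemma S_pow_sym: "endo_app (S ^ n) x \<bullet> y = x \<bullet> endo_app (S ^ n) y"
proof (induction n arbitrary: x y)
  case (Suc n)
  have "endo_app (S ^ Suc n) x \<bullet> y = endo_app (S ^ n) x \<bullet> endo_app S y" by (simp add: S_sym)
  also have "\<dots> = x \<bullet> endo_app (S ^ n * S) y" by (simp add: Suc)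
  finally show ?case by (simp only: power_Suc2)
qed simp

text \<open>Induction in steps of two: symmetry moves one factor \<open>S\<close> across the inner
  product, so the power n + 2 at x is the power n at Sx. The base case n = 1 is |J| \<le> 1.\<close>

lemma S_pow_pos: "0 \<le> endo_app (S ^ n) x \<bullet> x"
proof (induction n arbitrary: x rule: nat_induct2)
  case 0 then show ?case by simp
next
  case 1
  have "endo_app J x \<bullet> x \<le> norm x * norm x"
    using norm_cauchy_schwarz[of "endo_app J x" x] mult_right_mono[OF norm_J_le norm_ge_zero, of x x]
    by linarith
  then show ?case by (simp add: S_apply inner_diff flip: power2_norm_eq_inner power2_eq_square)
next
  case (step n)
  have "S ^ (n + 2) = S * (S ^ n * S)" by (simp add: numeral_2_eq_2 power_commutes)
  then have "endo_app (S ^ (n + 2)) x \<bullet> x = endo_app (S ^ n) (endo_app S x) \<bullet> endo_app S x"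
    by (simp add: S_sym)
  then show ?case using step[of "endo_app S x"] by simp
qed

lemma A_apply: "endo_app (A n) x = (\<Sum>k<n. endo_app (S ^ Suc k) x)"
  by (simp only: A_def endo_app.sum_left)

lemma pos_sym_A: "pos_sym (A n)"
  unfolding pos_sym_def A_apply inner_sum_left inner_sum_right
proof (intro conjI allI)
  show "(\<Sum>k<n. endo_app (S ^ Suc k) x \<bullet> y) = (\<Sum>k<n. x \<bullet> endo_app (S ^ Suc k) y)" for x y
    by (simp only: S_pow_sym)
  show "0 \<le> (\<Sum>k<n. endo_app (S ^ Suc k) x \<bullet> x)" for x by (rule sum_nonneg) (rule S_pow_pos)
qed

lemma A_commute: "A m * A n = A n * A m"
  by (simp only: A_def sum_product sum.swap[of _ "{..<n}"])
     (simp only: power_add[symmetric] add.commute)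

lemma A_S_commute: "A n * S = S * A n"
  by (simp add: A_def sum_distrib_left sum_distrib_right power_commutes mult.assoc)

text \<open>The geometric series telescopes, since J = 1 - S. Together with
  \<open>S_pow_tendsto_0\<close> it says that \<open>A n\<close> composed with \<open>J\<close>
  tends strongly to S = LJ.\<close>

lemma J_A: "J * A n = S - S ^ Suc n"
proof (induction n)
  case (Suc n)
  have "J * A (Suc n) = J * A n + J * S ^ Suc n" by (simp add: A_def distrib_left)
  also have "J * S ^ Suc n = S ^ Suc n - S ^ Suc (Suc n)"
    by (simp add: S_def left_diff_distrib)
  finally show ?case using Suc by simp
qed (simp add: A_def)

lemma A_J: "A n * J = S - S ^ Suc n"
proof -
  have "A n * (1 - S) = (1 - S) * A n" by (simp add: algebra_simps A_S_commute)
  then show ?thesis using J_A[of n] by (simp add: S_def)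
qed

text \<open>The squares |J S^n y|^2 are at most the decrements of |S^n y|^2, hence summable, so S^n
  tends to 0 on the range of \<open>J\<close>. By density S^n x converges for every x;
  \<open>J\<close> annihilates the limit, and \<open>J\<close> is injective.\<close>

lemma S_pow_tendsto_0: "(\<lambda>n. endo_app (S ^ n) x) \<longlonglongrightarrow> 0"
proof -
  have core: "(\<lambda>n. endo_app (S ^ n) (endo_app J y)) \<longlonglongrightarrow> 0" for y
  proof -
    define a where "a = (\<lambda>n. (norm (endo_app (S ^ n) y))\<^sup>2)"
    define b where "b = (\<lambda>n. (norm (endo_app J (endo_app (S ^ n) y)))\<^sup>2)"
    have ab: "b n \<le> a n - a (Suc n)" for n
      using norm_S_sq[of "endo_app (S ^ n) y"] by (simp add: a_def b_def)
    have b0: "b n \<ge> 0" for n by (simp add: b_def)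
    have "(\<Sum>k<n. b k) \<le> a 0 - a n" for n
      by (induction n) (use ab in \<open>auto simp: algebra_simps\<close>, use ab in \<open>smt (verit)\<close>)
    then have "(\<Sum>k<n. b k) \<le> a 0" for n
      using zero_le_power2[of "norm (endo_app (S ^ n) y)"] by (smt (verit) a_def)
    then have "summable b" by (intro summableI_nonneg_bounded[OF b0])
    then have "b \<longlonglongrightarrow> 0" by (rule summable_LIMSEQ_zero)
    then have "(\<lambda>n. sqrt (b n)) \<longlonglongrightarrow> sqrt 0" by (intro tendsto_intros)
    then have "(\<lambda>n. norm (endo_app J (endo_app (S ^ n) y))) \<longlonglongrightarrow> 0" by (simp add: b_def)
    moreover have "J * S ^ n = S ^ n * J" for n
      using power_commuting_commutes[of S J n] by (simp add: S_def algebra_simps)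
    then have "endo_app J (endo_app (S ^ n) y) = endo_app (S ^ n) (endo_app J y)" for n
      by (metis endo_app_times)
    ultimately show ?thesis by (simp add: tendsto_norm_zero_iff)
  qed
  have "convergent (\<lambda>n. endo_app (S ^ n) x)"
  proof (rule convergent_of_dense[OF _ _ _ dense_range_J])
    show "linear (endo_app (S ^ n))" for n by (rule bounded_linear.linear[OF endo_app.bounded_linear_right])
    show "norm (endo_app (S ^ n) x) \<le> 1 * norm x" for n x using norm_S_pow_le by simp
    show "convergent (\<lambda>n. endo_app (S ^ n) z)" if "z \<in> range (endo_app J)" for z
      using that core by (auto simp: convergent_def)
  qed
  then obtain l where l: "(\<lambda>n. endo_app (S ^ n) x) \<longlonglongrightarrow> l" by (auto simp: convergent_def)
  have "(\<lambda>n. endo_app J (endo_app (S ^ n) x)) \<longlonglongrightarrow> endo_app J l"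
    by (rule bounded_linear.tendsto[OF endo_app.bounded_linear_right l])
  moreover have "endo_app J (endo_app (S ^ n) x) = endo_app (S ^ n) (endo_app J x)" for n
  proof -
    have "J * S ^ n = S ^ n * J"
      using power_commuting_commutes[of S J n] by (simp add: S_def algebra_simps)
    then show ?thesis by (metis endo_app_times)
  qed
  ultimately have "endo_app J l = 0" using core[of x] LIMSEQ_unique by auto
  then show ?thesis using J_eq_0 l by blast
qed

lemma A_J_tendsto: "(\<lambda>n. endo_app (A n) (endo_app J z)) \<longlonglongrightarrow> endo_app S z"
proof -
  have "(\<lambda>n. endo_app S z - endo_app (S ^ Suc n) z) \<longlonglongrightarrow> endo_app S z - 0"
    by (intro tendsto_intros LIMSEQ_Suc[OF S_pow_tendsto_0])
  moreover have "endo_app (A n) (endo_app J z) = endo_app S z - endo_app (S ^ Suc n) z" for n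
    using A_J[of n] by (metis endo_app_times endo_app.diff_left)
  ultimately show ?thesis by simp
qed

lemma norm_A_J_le: "norm (endo_app (A n) (endo_app J z)) \<le> 2 * norm z"
proof -
  have "endo_app (A n) (endo_app J z) = endo_app S z - endo_app (S ^ Suc n) z"
    using A_J[of n] by (metis endo_app_times endo_app.diff_left)
  then show ?thesis
    using norm_triangle_ineq4[of "endo_app S z" "endo_app (S ^ Suc n) z"] norm_S_le[of z]
      norm_S_pow_le[of "Suc n" z] by simp
qed

end

section \<open>The semigroup, its time derivative and its gradient\<close>

context form_graph
begin

text \<open>\<open>P t\<close> is e^(-tL) and \<open>R t\<close> is L e^(-tL); the limits exist for
  t \<ge> 0 and for t > 0. \<open>Q t\<close> is the gradient of \<open>P t\<close>: because
  \<open>P t x\<close> is \<open>J\<close> applied to \<open>R t x + P t x\<close>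
  (\<open>P_eq_J\<close>), its gradient is \<open>K\<close> of the same vector.\<close>

definition P :: "real \<Rightarrow> 'a \<Rightarrow> 'a" where "P t x = lim (\<lambda>n. contr (A n) t x)"
definition R :: "real \<Rightarrow> 'a \<Rightarrow> 'a" where "R t x = lim (\<lambda>n. endo_app (A n) (contr (A n) t x))"
definition Q :: "real \<Rightarrow> 'a \<Rightarrow> 'a" where "Q t x = K (R t x + P t x)"

lemma contr_add: "contr B (s + t) x = contr B s (contr B t x)"
proof -
  have "exp ((s + t) *\<^sub>R - B) = exp (s *\<^sub>R - B) * exp (t *\<^sub>R - B)"
    unfolding scaleR_add_left by (rule exp_add_commuting) simp
  then show ?thesis by (simp add: contr_def)
qed

lemma contr_commute: "B * C = C * B \<Longrightarrow> endo_app C (contr B t x) = contr B t (endo_app C x)"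
proof -
  assume "B * C = C * B"
  then have "exp (t *\<^sub>R - B) * C = C * exp (t *\<^sub>R - B)" by (intro exp_commutes) simp
  then show ?thesis unfolding contr_def by (metis endo_app_times)
qed

text \<open>Pull out the contraction up to time r, then compare the remaining time t - r with the
  zero generator.\<close>

lemma contr_sub_le:
  assumes B: "pos_sym B" and "0 \<le> r" "r \<le> t"
  shows "norm (contr B t x - contr B r x) \<le> (t - r) * norm (endo_app B x)"
proof -
  have "contr B t x - contr B r x = contr B r (contr B (t - r) x - x)"
    using contr_add[of B r "t - r" x] by (simp add: contr_simps)
  then have "norm (contr B t x - contr B r x) \<le> norm (contr B (t - r) x - x)"
    using contr_norm_le[OF B, of r] assms(2) by simp
  also have "\<dots> \<le> (t - r) * norm (endo_app B x)"
    using contr_diff_le[OF B, of 0 "t - r" x] assms(3) by (simp add: pos_sym_def endo_app.zero_left)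
  finally show ?thesis .
qed

text \<open>On the range of \<open>J\<close> the vectors \<open>A n z\<close> converge, and
  \<open>contr_diff_le\<close> turns this into the Cauchy property of the exponentials. The
  contraction bound extends convergence to the whole space.\<close>

lemma P_lim: assumes t: "0 \<le> t" shows "(\<lambda>n. contr (A n) t x) \<longlonglongrightarrow> P t x"
proof -
  have "convergent (\<lambda>n. contr (A n) t x)"
  proof (rule convergent_of_dense[OF linear_contr _ _ dense_range_J, where c = 1])
    show "norm (contr (A n) t x) \<le> 1 * norm x" for n x
      using contr_norm_le[OF pos_sym_A t] by simp
    fix z assume "z \<in> range (endo_app J)"
    then obtain y where z: "z = endo_app J y" by blast
    have C: "Cauchy (\<lambda>n. endo_app (A n) z)"
      unfolding z by (rule LIMSEQ_imp_Cauchy[OF A_J_tendsto])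
    have "Cauchy (\<lambda>n. contr (A n) t z)"
    proof (rule metric_CauchyI)
      fix e :: real assume e: "e > 0"
      then have "e / (t + 1) > 0" using t by simp
      then obtain N where N: "\<And>m n. m \<ge> N \<Longrightarrow> n \<ge> N \<Longrightarrow> dist (endo_app (A m) z) (endo_app (A n) z) < e / (t + 1)"
        using C unfolding Cauchy_def by meson
      show "\<exists>M. \<forall>m\<ge>M. \<forall>n\<ge>M. dist (contr (A m) t z) (contr (A n) t z) < e"
      proof (intro exI allI impI)
        fix m n assume mn: "N \<le> m" "N \<le> n"
        have "dist (contr (A m) t z) (contr (A n) t z) \<le> t * dist (endo_app (A m) z) (endo_app (A n) z)"
          unfolding dist_norm by (rule contr_diff_le[OF pos_sym_A pos_sym_A A_commute t])
        also have "\<dots> \<le> t * (e / (t + 1))"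
          by (rule mult_left_mono[OF less_imp_le[OF N[OF mn]] t])
        also have "\<dots> < e" using t e by (simp add: field_simps)
        finally show "dist (contr (A m) t z) (contr (A n) t z) < e" .
      qed
    qed
    then show "convergent (\<lambda>n. contr (A n) t z)" by (rule Cauchy_convergent)
  qed
  then show ?thesis unfolding P_def by (rule convergent_LIMSEQ_iff[THEN iffD1])
qed

lemma P_lim_seq:
  assumes t: "0 \<le> t" and y: "y \<longlonglongrightarrow> x"
  shows "(\<lambda>n. contr (A n) t (y n)) \<longlonglongrightarrow> P t x"
proof -
  have "(\<lambda>n. contr (A n) t (y n - x)) \<longlonglongrightarrow> 0"
  proof (rule Lim_null_comparison)
    show "\<forall>\<^sub>F n in sequentially. norm (contr (A n) t (y n - x)) \<le> norm (y n - x)"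
      by (intro always_eventually allI contr_norm_le[OF pos_sym_A t])
    show "(\<lambda>n. norm (y n - x)) \<longlonglongrightarrow> 0"
      using tendsto_diff[OF y tendsto_const[of x]] tendsto_norm_zero by fastforce
  qed
  from tendsto_add[OF this P_lim[OF t, of x]] show ?thesis
    by (simp add: contr_simps)
qed

text \<open>For fixed t > 0 the operators A_n e^(-tA_n) have the common bound 1/t by
  \<open>contr_gen_le\<close>. On the range of \<open>J\<close> the factor \<open>A n\<close> is
  moved inside the exponential, where it converges.\<close>

lemma R_lim: assumes t: "0 < t" shows "(\<lambda>n. endo_app (A n) (contr (A n) t x)) \<longlonglongrightarrow> R t x"
proof -
  have t0: "0 \<le> t" using t by simp
  have "convergent (\<lambda>n. endo_app (A n) (contr (A n) t x))"
  proof (rule convergent_of_dense[OF _ _ _ dense_range_J, where c = "1 / t"])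
    show "linear (\<lambda>x. endo_app (A n) (contr (A n) t x))" for n
      by (intro bounded_linear.linear bounded_linear_compose[OF endo_app.bounded_linear_right]
          bounded_linear_contr)
    show "norm (endo_app (A n) (contr (A n) t x)) \<le> 1 / t * norm x" for n x
      using contr_gen_le[OF pos_sym_A t0, of n x] t by (simp add: field_simps)
    fix z assume "z \<in> range (endo_app J)"
    then obtain y where z: "z = endo_app J y" by blast
    have "(\<lambda>n. contr (A n) t (endo_app (A n) z)) \<longlonglongrightarrow> P t (endo_app S y)"
      unfolding z by (rule P_lim_seq[OF t0 A_J_tendsto])
    then show "convergent (\<lambda>n. endo_app (A n) (contr (A n) t z))"
      by (auto simp: convergent_def contr_commute)
  qed
  then show ?thesis unfolding R_def by (rule convergent_LIMSEQ_iff[THEN iffD1])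
qed

lemma P_0 [simp]: "P 0 x = x"
  using P_lim[of 0 x] by (simp add: LIMSEQ_const_iff)

lemma norm_P_le: "0 \<le> t \<Longrightarrow> norm (P t x) \<le> norm x"
  by (rule LIMSEQ_le_const2[OF tendsto_norm[OF P_lim]]) (auto intro: contr_norm_le[OF pos_sym_A])

lemma norm_R_le: "0 < t \<Longrightarrow> norm (R t x) \<le> norm x / t"
  by (rule LIMSEQ_le_const2[OF tendsto_norm[OF R_lim]])
     (use contr_gen_le[OF pos_sym_A, of t _ x] in \<open>auto simp: field_simps\<close>)

lemma form_le: "0 < t \<Longrightarrow> 2 * t * (R t x \<bullet> P t x) \<le> (norm x)\<^sup>2"
  by (rule LIMSEQ_le_const2[OF tendsto_mult[OF tendsto_const tendsto_inner[OF R_lim P_lim]]])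
     (auto intro!: exI[of _ 0] contr_form_le[OF pos_sym_A, of t, simplified mult.assoc] simp: mult.assoc)

lemma bounded_linear_P: assumes t: "0 \<le> t" shows "bounded_linear (P t)"
proof (rule bounded_linear_intro[where K = 1])
  show "P t (x + y) = P t x + P t y" for x y
    by (rule LIMSEQ_unique[OF P_lim[OF t]])
       (simp add: contr_simps tendsto_add P_lim[OF t])
  show "P t (r *\<^sub>R x) = r *\<^sub>R P t x" for r x
    by (rule LIMSEQ_unique[OF P_lim[OF t]])
       (simp add: contr_simps tendsto_scaleR P_lim[OF t])
  show "norm (P t x) \<le> norm x * 1" for x using norm_P_le[OF t] by simp
qed

text \<open>The semigroup law, in the form that carries joint continuity from \<open>P\<close> over
  to \<open>R\<close> on t > r.\<close>

lemma R_eq: assumes r: "0 < r" "r \<le> t" shows "R t x = P (t - r) (R r x)"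
proof (rule LIMSEQ_unique[OF R_lim])
  show "0 < t" using r by simp
  have "(\<lambda>n. contr (A n) (t - r) (endo_app (A n) (contr (A n) r x))) \<longlonglongrightarrow> P (t - r) (R r x)"
    by (rule P_lim_seq[OF _ R_lim]) (use r in auto)
  moreover have "contr (A n) (t - r) (endo_app (A n) (contr (A n) r x)) = endo_app (A n) (contr (A n) t x)" for n
    using contr_add[of "A n" "t - r" r x] by (simp add: contr_commute)
  ultimately show "(\<lambda>n. endo_app (A n) (contr (A n) t x)) \<longlonglongrightarrow> P (t - r) (R r x)" by simp
qed

lemma bounded_linear_R: assumes t: "0 < t" shows "bounded_linear (R t)"
proof (rule bounded_linear_intro[where K = "1 / t"])
  note lin = contr_simps endo_app.add_right endo_app.scaleR_right
  show "R t (x + y) = R t x + R t y" for x y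
    by (rule LIMSEQ_unique[OF R_lim[OF t]]) (simp add: lin tendsto_add R_lim[OF t])
  show "R t (r *\<^sub>R x) = r *\<^sub>R R t x" for r x
    by (rule LIMSEQ_unique[OF R_lim[OF t]]) (simp add: lin tendsto_scaleR R_lim[OF t])
  show "norm (R t x) \<le> norm x * (1 / t)" for x using norm_R_le[OF t] by simp
qed

text \<open>The identity (1 + L) P = R + P, stated through the inverse; it places
  \<open>P t x\<close> in the form domain. By \<open>J_A\<close> the error for finite n is S^(n+1)
  e^(-tA_n) x, which vanishes in the limit because the powers of \<open>S\<close> are contractions
  tending strongly to 0.\<close>

lemma P_eq_J: assumes t: "0 < t" shows "P t x = endo_app J (R t x + P t x)"
proof -
  have t0: "0 \<le> t" using t by simp
  have "(\<lambda>n. endo_app J (endo_app (A n) (contr (A n) t x))) \<longlonglongrightarrow> endo_app J (R t x)"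
    by (rule bounded_linear.tendsto[OF endo_app.bounded_linear_right R_lim[OF t]])
  moreover have "endo_app J (endo_app (A n) (contr (A n) t x))
      = endo_app S (contr (A n) t x) - endo_app (S ^ Suc n) (contr (A n) t x)" for n
    using J_A[of n] by (metis endo_app_times endo_app.diff_left)
  moreover have "(\<lambda>n. endo_app S (contr (A n) t x)) \<longlonglongrightarrow> endo_app S (P t x)"
    by (rule bounded_linear.tendsto[OF endo_app.bounded_linear_right P_lim[OF t0]])
  moreover have "(\<lambda>n. endo_app (S ^ Suc n) (contr (A n) t x)) \<longlonglongrightarrow> 0"
  proof -
    have "(\<lambda>n. endo_app (S ^ Suc n) (contr (A n) t x - P t x)) \<longlonglongrightarrow> 0"
    proof (rule Lim_null_comparison)
      show "\<forall>\<^sub>F n in sequentially. norm (endo_app (S ^ Suc n) (contr (A n) t x - P t x)) \<le> norm (contr (A n) t x - P t x)"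
        by (intro always_eventually allI norm_S_pow_le)
      show "(\<lambda>n. norm (contr (A n) t x - P t x)) \<longlonglongrightarrow> 0"
        using tendsto_diff[OF P_lim[OF t0, of x] tendsto_const[of "P t x"]] tendsto_norm_zero by fastforce
    qed
    from tendsto_add[OF this LIMSEQ_Suc[OF S_pow_tendsto_0, of "P t x"]] show ?thesis
      by (simp only: endo_app.diff_right diff_add_cancel add_0_right)
  qed
  ultimately have "(\<lambda>n. endo_app J (endo_app (A n) (contr (A n) t x))) \<longlonglongrightarrow> endo_app S (P t x) - 0"
    by (simp only: tendsto_diff)
  with \<open>(\<lambda>n. endo_app J (endo_app (A n) (contr (A n) t x))) \<longlonglongrightarrow> endo_app J (R t x)\<close>
  have "endo_app J (R t x) = endo_app S (P t x)" using LIMSEQ_unique by fastforce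
  then show ?thesis by (simp add: S_apply endo_app.add_right)
qed

lemma PQ_in_G: "0 < t \<Longrightarrow> (P t x, Q t x) \<in> G"
  using JK_in_G[of "R t x + P t x"] P_eq_J[of t x] by (simp add: Q_def)

text \<open>The weak form of L P t x = R t x, obtained by subtracting <P t x, p> from the resolvent
  equation.\<close>

lemma Q_weak: "0 < t \<Longrightarrow> (p, q) \<in> G \<Longrightarrow> Q t x \<bullet> q = R t x \<bullet> p"
  using JK_weak[of p q "R t x + P t x"] P_eq_J[of t x] by (simp add: Q_def inner_add_left)

text \<open>\<open>Q_weak\<close> tested with the pair (P t x, Q t x) itself gives |Q t x|^2 = <R t
  x, P t x>, and \<open>form_le\<close> bounds this by |x|^2 / (2t). The singularity t^(-1/2) is
  integrable at 0, which is why the nonlinearity may depend on the gradient.\<close>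

lemma norm_Q_le: assumes t: "0 < t" shows "norm (Q t x) \<le> norm x * t powr (- 1/2)"
proof -
  have "(norm (Q t x))\<^sup>2 = R t x \<bullet> P t x"
    using Q_weak[OF t PQ_in_G[OF t], of x x] by (simp add: power2_norm_eq_inner)
  also have "\<dots> \<le> (norm x)\<^sup>2 / (2 * t)"
    using form_le[OF t, of x] t by (simp add: field_simps)
  also have "\<dots> \<le> (norm x)\<^sup>2 / t" using t by (simp add: field_simps)
  also have "\<dots> = (norm x * t powr (- 1/2))\<^sup>2"
    using t by (simp add: power_mult_distrib powr_minus_divide powr_half_sqrt field_simps)
  finally show ?thesis by (rule power2_le_imp_le) simp
qed

lemma bounded_linear_Q: "0 < t \<Longrightarrow> bounded_linear (Q t)"
  unfolding Q_def[abs_def]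
  by (intro bounded_linear_compose[OF bounded_linear_K] bounded_linear_add bounded_linear_R bounded_linear_P) auto

text \<open>On the range of \<open>J\<close> the semigroup is Lipschitz in time, with constant 2 |y|
  by \<open>norm_A_J_le\<close>; in space it is a contraction, and the range is dense.\<close>

lemma continuous_on_P: "continuous_on ({0..} \<times> UNIV) (\<lambda>(t, x). P t x)"
  unfolding continuous_on_iff
proof (intro ballI allI impI)
  fix tx :: "real \<times> 'a" and e :: real assume tx: "tx \<in> {0..} \<times> UNIV" and e: "0 < e"
  obtain t x where tx_eq: "tx = (t, x)" by (cases tx)
  have t: "t \<in> {0..}" using tx by (simp add: tx_eq)
  obtain y where y: "dist (endo_app J y) x < e / 4"
    using dense_range_J closure_approachable[of x "range (endo_app J)"] e
    by (metis UNIV_I rangeE zero_less_divide_iff zero_less_numeral)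
  \<comment> \<open>The first bound controls the move in space, the second makes d * 2 |y| at most
    e/4; adding 1 to |y| avoids a zero denominator.\<close>
  define d where "d = min (e / 4) (e / (8 * (norm y + 1)))"
  have "8 * (norm y + 1) > 0" by (smt (verit) norm_ge_zero)
  then have d: "d > 0" "d \<le> e / 4" "d \<le> e / (8 * (norm y + 1))"
    unfolding d_def using e by (simp, linarith, linarith)
  have lip: "norm (P s (endo_app J y) - P r (endo_app J y)) \<le> (s - r) * (2 * norm y)" if "0 \<le> r" "r \<le> s" for r s
  proof (rule LIMSEQ_le_const2[OF tendsto_norm[OF tendsto_diff[OF P_lim P_lim]]], goal_cases)
    case 3
    show ?case
      by (intro exI allI impI order_trans[OF contr_sub_le[OF pos_sym_A that]] mult_left_mono norm_A_J_le)
         (use that in auto)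
  qed (use that in auto)
  show "\<exists>d>0. \<forall>x'\<in>{0..} \<times> UNIV. dist x' tx < d \<longrightarrow> dist (case x' of (t, x) \<Rightarrow> P t x) (case tx of (t, x) \<Rightarrow> P t x) < e"
  proof (intro exI[of _ d] conjI ballI impI d(1))
    fix x' assume x': "x' \<in> {0..} \<times> UNIV" "dist x' tx < d"
    obtain s z where sz: "x' = (s, z)" by (cases x')
    have s: "s \<in> {0..}" and ds: "dist (s, z) (t, x) < d" using x' by (auto simp: sz tx_eq)
    have "dist s t < d" "dist z x < d"
      using ds dist_fst_le[of "(s, z)" "(t, x)"] dist_snd_le[of "(s, z)" "(t, x)"] by auto
    have 1: "norm (P s z - P s (endo_app J y)) \<le> dist z (endo_app J y)"
      using norm_P_le[of s "z - endo_app J y"] s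
      by (simp add: dist_norm linear_diff[OF bounded_linear.linear[OF bounded_linear_P]])
    have 2: "norm (P t (endo_app J y) - P t x) \<le> dist (endo_app J y) x"
      using norm_P_le[of t "endo_app J y - x"] t
      by (simp add: dist_norm linear_diff[OF bounded_linear.linear[OF bounded_linear_P]])
    have "norm (P s (endo_app J y) - P t (endo_app J y)) \<le> \<bar>s - t\<bar> * (2 * norm y)"
      using lip[of s t] lip[of t s] s t by (cases "s \<le> t") (auto simp: norm_minus_commute)
    also have "\<dots> \<le> d * (2 * norm y)"
      using \<open>dist s t < d\<close> by (intro mult_right_mono) (auto simp: dist_real_def)
    also have "\<dots> \<le> e / 4"
    proof -
      have "d * (2 * norm y) \<le> e / (8 * (norm y + 1)) * (2 * (norm y + 1))"
        by (intro mult_mono d(3)) (use d e in auto)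
      also have "\<dots> = e / 4" using \<open>8 * (norm y + 1) > 0\<close> by (simp add: field_simps)
      finally show ?thesis .
    qed
    finally have 3: "norm (P s (endo_app J y) - P t (endo_app J y)) \<le> e / 4" .
    have "dist z (endo_app J y) < e / 2"
      using \<open>dist z x < d\<close> d(2) y dist_triangle2[of z "endo_app J y" x] by simp
    moreover have "dist (P s z) (P t x) \<le> norm (P s z - P s (endo_app J y))
        + norm (P s (endo_app J y) - P t (endo_app J y)) + norm (P t (endo_app J y) - P t x)"
      using norm_triangle_ineq[of "P s z - P s (endo_app J y)" "P s (endo_app J y) - P t (endo_app J y)"]
        norm_triangle_ineq[of "P s z - P t (endo_app J y)" "P t (endo_app J y) - P t x"]
      by (simp add: dist_norm)
    ultimately have "dist (P s z) (P t x) < e" using 1 2 3 y by linarith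
    then show "dist (case x' of (t, x) \<Rightarrow> P t x) (case tx of (t, x) \<Rightarrow> P t x) < e"
      by (simp add: sz tx_eq)
  qed
qed

lemma continuous_on_R: "continuous_on ({0<..} \<times> UNIV) (\<lambda>(t, x). R t x)"
proof (rule continuous_at_imp_continuous_on, clarify)
  fix t :: real and x :: 'a assume t: "0 < t"
  define U where "U = {t/2<..} \<times> (UNIV :: 'a set)"
  have U: "open U" "(t, x) \<in> U" using t by (auto simp: U_def open_Times)
  have "continuous_on U ((\<lambda>(t, x). P t x) \<circ> (\<lambda>(s, z). (s - t/2, R (t/2) z)))"
  proof (rule continuous_on_compose)
    show "continuous_on U (\<lambda>(s, z). (s - t/2, R (t/2) z))"
      unfolding case_prod_beta using t
      by (intro continuous_intros bounded_linear.continuous_on[OF bounded_linear_R]) auto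
    show "continuous_on ((\<lambda>(s, z). (s - t/2, R (t/2) z)) ` U) (\<lambda>(t, x). P t x)"
      by (rule continuous_on_subset[OF continuous_on_P]) (auto simp: U_def)
  qed
  then have "continuous_on U (\<lambda>(t, x). R t x)"
    by (rule continuous_on_eq) (use t in \<open>auto simp: U_def intro!: R_eq[symmetric]\<close>)
  then show "isCont (\<lambda>(t, x). R t x) (t, x)"
    using U continuous_on_eq_continuous_at by blast
qed

lemma continuous_on_Q: "continuous_on ({0<..} \<times> UNIV) (\<lambda>(t, x). Q t x)"
proof -
  have "continuous_on ({0<..} \<times> UNIV) (\<lambda>z. K ((\<lambda>(t, x). R t x) z + (\<lambda>(t, x). P t x) z))"
    by (intro bounded_linear.continuous_on[OF bounded_linear_K] continuous_on_add continuous_on_R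
        continuous_on_subset[OF continuous_on_P]) auto
  then show ?thesis by (simp add: Q_def case_prod_beta)
qed

lemma continuous_on_P_t: "continuous_on {0..} (\<lambda>t. P t x)"
proof -
  have "continuous_on {0..} ((\<lambda>(t, x). P t x) \<circ> (\<lambda>t. (t, x)))"
    by (intro continuous_on_compose continuous_intros continuous_on_subset[OF continuous_on_P]) auto
  then show ?thesis by (simp add: o_def)
qed

lemma continuous_on_Q_t: "continuous_on {0<..} (\<lambda>t. Q t x)"
proof -
  have "continuous_on {0<..} ((\<lambda>(t, x). Q t x) \<circ> (\<lambda>t. (t, x)))"
    by (intro continuous_on_compose continuous_intros continuous_on_subset[OF continuous_on_Q]) auto
  then show ?thesis by (simp add: o_def)
qed

text \<open>R = -dP/dt in integrated form. The fundamental theorem holds for each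
  \<open>A n\<close>, and on [r, t] the integrands are dominated by a constant because r >
  0.\<close>

lemma R_has_integral:
  assumes r: "0 < r" "r \<le> t"
  shows "((\<lambda>s. R s x \<bullet> p) has_integral (P r x \<bullet> p - P t x \<bullet> p)) {r..t}"
proof -
  define f where "f = (\<lambda>n s. endo_app (A n) (contr (A n) s x) \<bullet> p)"
  have fi: "(f n has_integral (contr (A n) r x \<bullet> p - contr (A n) t x \<bullet> p)) {r..t}" for n
  proof -
    have "((\<lambda>s. - (contr (A n) s x \<bullet> p)) has_vector_derivative f n s) (at s within {r..t})" for s
      using bounded_linear.has_vector_derivative[OF bounded_linear_inner_left
          contr_has_vector_derivative[of "A n" x s "{r..t}"], of p]
      by (auto intro!: derivative_eq_intros simp: f_def)
    from fundamental_theorem_of_calculus[OF r(2) this] show ?thesis by simp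
  qed
  have lim: "(\<lambda>n. integral {r..t} (f n)) \<longlonglongrightarrow> integral {r..t} (\<lambda>s. R s x \<bullet> p)"
    and int: "(\<lambda>s. R s x \<bullet> p) integrable_on {r..t}"
  proof -
    have "f n integrable_on {r..t}" for n using fi by blast
    moreover have "(\<lambda>s. norm x / r * norm p) integrable_on {r..t}" by (rule integrable_const_ivl)
    moreover have "norm (f n s) \<le> norm x / r * norm p" if s: "s \<in> {r..t}" for n s
    proof -
      have "norm (endo_app (A n) (contr (A n) s x)) \<le> norm x / s"
        using contr_gen_le[OF pos_sym_A, of s n x] s r by (simp add: field_simps)
      also have "\<dots> \<le> norm x / r" using s r by (intro divide_left_mono) auto
      finally show ?thesis
        unfolding f_def real_norm_def
        by (intro order_trans[OF Cauchy_Schwarz_ineq2] mult_right_mono) auto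
    qed
    moreover have "(\<lambda>n. f n s) \<longlonglongrightarrow> R s x \<bullet> p" if "s \<in> {r..t}" for s
      unfolding f_def by (intro tendsto_inner R_lim tendsto_const) (use that r in auto)
    ultimately show "(\<lambda>n. integral {r..t} (f n)) \<longlonglongrightarrow> integral {r..t} (\<lambda>s. R s x \<bullet> p)"
      "(\<lambda>s. R s x \<bullet> p) integrable_on {r..t}"
      using dominated_convergence[of f "{r..t}" "\<lambda>s. norm x / r * norm p" "\<lambda>s. R s x \<bullet> p"] by blast+
  qed
  have "(\<lambda>n. integral {r..t} (f n)) \<longlonglongrightarrow> P r x \<bullet> p - P t x \<bullet> p"
    unfolding integral_unique[OF fi]
    by (intro tendsto_diff tendsto_inner P_lim tendsto_const) (use r in auto)
  then have "integral {r..t} (\<lambda>s. R s x \<bullet> p) = P r x \<bullet> p - P t x \<bullet> p"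
    by (rule LIMSEQ_unique[OF lim])
  then show ?thesis using integrable_integral[OF int] by simp
qed

text \<open>Let r tend to 0 in \<open>R_has_integral\<close>, after <R, p> has been rewritten as <Q,
  q>. For the latter s^(-1/2) is an integrable majorant, whereas \<open>norm_R_le\<close> offers
  only 1/s.\<close>

lemma Q_weak_integral:
  assumes t: "0 \<le> t" and pq: "(p, q) \<in> G"
  shows "(\<lambda>s. Q s x \<bullet> q) absolutely_integrable_on {0<..<t}"
    and "P t x \<bullet> p = x \<bullet> p - integral {0<..<t} (\<lambda>s. Q s x \<bullet> q)"
proof -
  let ?f = "\<lambda>s. Q s x \<bullet> q"
  have bd: "norm (?f s) \<le> norm x * norm q * s powr (-1/2)" if "s \<in> {0<..<t}" for s
  proof -
    have "norm (?f s) \<le> norm (Q s x) * norm q"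
      unfolding real_norm_def by (rule Cauchy_Schwarz_ineq2)
    also have "\<dots> \<le> (norm x * s powr (-1/2)) * norm q"
      by (intro mult_right_mono norm_Q_le) (use that in auto)
    finally show ?thesis by (simp add: mult_ac)
  qed
  have "(\<lambda>s. s powr (-1/2)) integrable_on {0..t}"
    by (rule integrable_on_powr_from_0) (use t in auto)
  then have "(\<lambda>s. norm x * norm q * s powr (-1/2)) integrable_on {0..t}"
    using integrable_on_cmult_left[of "\<lambda>s. s powr (-1/2)" "{0..t}" "norm x * norm q"] by simp
  then have dom: "(\<lambda>s. norm x * norm q * s powr (-1/2)) integrable_on {0<..<t}"
    by (simp add: integrable_on_Icc_iff_Ioo)
  have "continuous_on {0<..<t} ?f"
    by (intro continuous_intros continuous_on_subset[OF continuous_on_Q_t]) auto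
  then have "?f \<in> borel_measurable (lebesgue_on {0<..<t})"
    by (rule continuous_imp_measurable_on_sets_lebesgue) auto
  then show abs: "?f absolutely_integrable_on {0<..<t}"
    by (rule measurable_bounded_by_integrable_imp_absolutely_integrable[OF _ _ dom bd]) auto
  have int: "?f integrable_on {0..t}"
    using set_lebesgue_integral_eq_integral(1)[OF abs] by (simp only: integrable_on_Icc_iff_Ioo)
  show "P t x \<bullet> p = x \<bullet> p - integral {0<..<t} ?f"
  proof (cases "t = 0")
    case False
    then have t: "0 < t" using t by simp
    have lim1: "((\<lambda>r. integral {r..t} ?f) \<longlongrightarrow> integral {0..t} ?f) (at_right 0)"
    proof -
      have "continuous_on {0..t} (\<lambda>r. integral {r..t} ?f)"
        by (rule indefinite_integral_continuous_1'[OF int])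
      then have "((\<lambda>r. integral {r..t} ?f) \<longlongrightarrow> integral {0..t} ?f) (at 0 within {0..t})"
        using t by (auto simp: continuous_on_def)
      then show ?thesis using t by (simp add: at_within_Icc_at_right)
    qed
    have lim2: "((\<lambda>r. P r x \<bullet> p - P t x \<bullet> p) \<longlongrightarrow> P 0 x \<bullet> p - P t x \<bullet> p) (at_right 0)"
    proof -
      have "((\<lambda>r. P r x) \<longlongrightarrow> P 0 x) (at 0 within {0..})"
        using continuous_on_P_t[of x, unfolded continuous_on_def, rule_format, of 0] by simp
      then have "((\<lambda>r. P r x) \<longlongrightarrow> P 0 x) (at_right 0)"
        by (rule tendsto_within_subset) auto
      then show ?thesis by (intro tendsto_intros)
    qed
    have ev: "\<forall>\<^sub>F r in at_right 0. integral {r..t} ?f = P r x \<bullet> p - P t x \<bullet> p"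
    proof -
      have "integral {r..t} ?f = P r x \<bullet> p - P t x \<bullet> p" if "0 < r" "r < t" for r
      proof -
        have "integral {r..t} ?f = integral {r..t} (\<lambda>s. R s x \<bullet> p)"
          by (rule integral_cong) (use that Q_weak[OF _ pq] in auto)
        also have "\<dots> = P r x \<bullet> p - P t x \<bullet> p"
          by (rule integral_unique[OF R_has_integral]) (use that in auto)
        finally show ?thesis .
      qed
      then show ?thesis using t by (auto simp: eventually_at_right_field)
    qed
    have "((\<lambda>r. integral {r..t} ?f) \<longlongrightarrow> P 0 x \<bullet> p - P t x \<bullet> p) (at_right 0)"
      by (rule tendsto_cong[OF ev, THEN iffD2, OF lim2])
    then have "integral {0..t} ?f = P 0 x \<bullet> p - P t x \<bullet> p"
      by (rule tendsto_unique[OF trivial_limit_at_right_real lim1])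
    then show ?thesis by (simp add: integral_open_interval_real)
  qed simp
qed

end

section \<open>The Duhamel integral and its weighted bounds\<close>

section \<open>The linear inhomogeneous problem\<close>

lemma measurable_lebesgue_on_of_borel:
  "f \<in> borel_measurable borel \<Longrightarrow> f \<in> borel_measurable (lebesgue_on S)"
  by (intro measurable_restrict_space1 measurable_completion) simp

lemma nn_integral_lebesgue_on:
  assumes f: "f \<in> borel_measurable borel" and S: "S \<in> sets borel"
  shows "(\<integral>\<^sup>+ x. f x \<partial>lebesgue_on S) = (\<integral>\<^sup>+ x. f x * indicator S x \<partial>lborel)"
proof -
  have "(\<integral>\<^sup>+ x. f x \<partial>lebesgue_on S) = (\<integral>\<^sup>+ x. f x * indicator S x \<partial>lebesgue)"
    using S by (intro nn_integral_restrict_space) auto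
  then show ?thesis by (simp add: nn_integral_completion)
qed

lemma
  fixes f :: "real \<Rightarrow> 'b::{banach, second_countable_topology}"
  assumes f: "f \<in> borel_measurable borel" and S: "S \<in> sets borel"
  shows integrable_lebesgue_on: "integrable (lebesgue_on S) f \<longleftrightarrow> integrable lborel (\<lambda>x. indicator S x *\<^sub>R f x)"
    and integral_lebesgue_on: "integral\<^sup>L (lebesgue_on S) f = (\<integral>x. indicator S x *\<^sub>R f x \<partial>lborel)"
proof -
  have m: "(\<lambda>x. indicator S x *\<^sub>R f x) \<in> borel_measurable lborel" using f S by simp
  have S': "S \<inter> space lebesgue \<in> sets lebesgue" using S by simp
  show "integrable (lebesgue_on S) f \<longleftrightarrow> integrable lborel (\<lambda>x. indicator S x *\<^sub>R f x)"
    by (simp only: integrable_restrict_space[OF S'] integrable_completion[OF m])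
  show "integral\<^sup>L (lebesgue_on S) f = (\<integral>x. indicator S x *\<^sub>R f x \<partial>lborel)"
    by (simp only: integral_restrict_space[OF S'] integral_completion[OF m])
qed

lemma AE_lebesgue_on_ne: "S \<in> sets lebesgue \<Longrightarrow> AE r in lebesgue_on S. r \<noteq> (s::real)"
  using AE_completion[OF AE_lborel_singleton[of s]] by (subst AE_restrict_space_iff) auto

locale mild_problem = form_graph G
  for G :: "('a::{real_inner, banach, perfect_space, second_countable_topology} \<times> 'a) set" +
  fixes T :: real
  assumes T_pos: "0 < T"
begin

abbreviation M :: "real measure" where "M \<equiv> lebesgue_on {0..T}"

sublocale M: finite_measure M
  by (rule finite_measure_lebesgue_on) simp

sublocale MM: pair_sigma_finite M M ..

text \<open>Because of the extension by zero to \<tau> \<le> 0, the integral over all s in [0, T] in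
  \<open>Z\<close> is really one over s > t: the problem runs backwards from T. The value at \<tau>
  = 0 is also 0, as the gradient has no limit there in general.\<close>

definition W :: "real \<Rightarrow> 'a \<Rightarrow> 'a \<times> 'a" where
  "W \<tau> x = (if 0 < \<tau> then (P \<tau> x, Q \<tau> x) else 0)"

definition Z :: "(real \<Rightarrow> 'a) \<Rightarrow> real \<Rightarrow> 'a \<times> 'a" where
  "Z F t = (\<integral>s. W (s - t) (F s) \<partial>M)"

text \<open>The majorant of the operator norm of \<open>W \<tau>\<close>: 1 comes from
  \<open>P\<close>, the singular term from \<open>Q\<close>.\<close>

definition kap :: "real \<Rightarrow> real" where
  "kap \<tau> = indicator {0<..} \<tau> * (1 + \<tau> powr (-1/2))"

lemma kap_nonneg: "0 \<le> kap \<tau>" by (simp add: kap_def)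

lemma borel_measurable_kap [measurable]: "kap \<in> borel_measurable borel"
  unfolding kap_def[abs_def] by measurable

lemma norm_W_le: "norm (W \<tau> x) \<le> kap \<tau> * norm x"
proof (cases "0 < \<tau>")
  case True
  have "norm (W \<tau> x) \<le> norm (P \<tau> x) + norm (Q \<tau> x)"
    using True by (simp add: W_def norm_Pair_le)
  also have "\<dots> \<le> norm x + norm x * \<tau> powr (-1/2)"
    by (intro add_mono norm_P_le norm_Q_le) (use True in auto)
  finally show ?thesis using True by (simp add: kap_def algebra_simps)
qed (simp add: W_def kap_def)

lemma bounded_linear_W: "bounded_linear (W \<tau>)"
  unfolding W_def[abs_def]
  by (cases "0 < \<tau>") (auto intro!: bounded_linear_Pair bounded_linear_P bounded_linear_Q bounded_linear_zero)

lemma W_in_G: "W \<tau> x \<in> G"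
  using PQ_in_G[of \<tau> x] subspace_0[OF subspace_G] by (simp add: W_def)

lemma borel_measurable_W [measurable]: "(\<lambda>z. W (fst z) (snd z)) \<in> borel_measurable borel"
proof -
  have "continuous_on ({0<..} \<times> UNIV) (\<lambda>z. ((\<lambda>(t, x). P t x) z, (\<lambda>(t, x). Q t x) z))"
    by (intro continuous_on_Pair continuous_on_Q continuous_on_subset[OF continuous_on_P]) auto
  then have "(\<lambda>z. indicator ({0<..} \<times> UNIV) z *\<^sub>R ((\<lambda>(t, x). P t x) z, (\<lambda>(t, x). Q t x) z)) \<in> borel_measurable borel"
    by (intro borel_measurable_continuous_on_indicator) (auto intro!: borel_open open_Times)
  moreover have "(\<lambda>z. indicator ({0<..} \<times> UNIV) z *\<^sub>R ((\<lambda>(t, x). P t x) z, (\<lambda>(t, x). Q t x) z)) = (\<lambda>z. W (fst z) (snd z))"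
    by (auto simp: W_def indicator_def fun_eq_iff zero_prod_def)
  ultimately show ?thesis by simp
qed

lemma measurable_W_compose [measurable (raw)]:
  assumes [measurable]: "a \<in> borel_measurable N" "b \<in> borel_measurable N"
  shows "(\<lambda>x. W (a x) (b x)) \<in> borel_measurable N"
proof -
  have "(\<lambda>x. (a x, b x)) \<in> borel_measurable N" by measurable
  from measurable_compose[OF this borel_measurable_W] show ?thesis by simp
qed

lemma ident_measurable_M [measurable]: "(\<lambda>t. t) \<in> borel_measurable M"
  by (rule measurable_lebesgue_on_of_borel) simp

lemma borel_measurable_M: "h \<in> borel_measurable borel \<Longrightarrow> h \<in> borel_measurable M"
  by (rule measurable_lebesgue_on_of_borel)

lemma kernel_measurable [measurable]:
  assumes [measurable]: "F \<in> borel_measurable M"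
  shows "(\<lambda>(t, s). W (s - t) (F s)) \<in> borel_measurable (M \<Otimes>\<^sub>M M)"
  by measurable

lemma integrable_kap: "integrable lborel (\<lambda>\<tau>. indicator {0..T} \<tau> *\<^sub>R kap \<tau>)"
proof -
  have "(\<lambda>\<tau>. 1 + \<tau> powr (-1/2)) integrable_on {0..T}"
    by (intro integrable_add integrable_on_powr_from_0) (use T_pos in auto)
  then have "kap integrable_on {0..T}"
    by (rule integrable_spike_finite[of "{0}", rotated 2]) (auto simp: kap_def)
  then have "kap absolutely_integrable_on {0..T}"
    by (intro nonnegative_absolutely_integrable_1) (auto simp: kap_nonneg)
  then have "integrable lebesgue (\<lambda>\<tau>. indicator {0..T} \<tau> *\<^sub>R kap \<tau>)"
    by (simp add: set_integrable_def)
  then show ?thesis by (subst (asm) integrable_completion) auto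
qed

text \<open>The functions e^(-n \<tau>) kap \<tau> tend to 0 pointwise and are dominated by
  \<open>kap\<close>, which is integrable on [0, T]; so their mass becomes as small as desired. A
  weight e^(\<beta> t) in time converts this small mass into a contraction factor.\<close>

lemma ex_weight:
  assumes "0 < \<eta>"
  shows "\<exists>\<beta>\<ge>0. \<forall>s\<in>{0..T}. (\<integral>\<^sup>+ t. ennreal (exp (- \<beta> * (s - t)) * kap (s - t)) \<partial>M) \<le> ennreal \<eta>"
proof -
  define k where "k = (\<lambda>n \<tau>. indicator {0..T} \<tau> *\<^sub>R (exp (- real n * \<tau>) * kap \<tau>))"
  have [measurable]: "k n \<in> borel_measurable borel" for n unfolding k_def by measurable
  have bd: "norm (k n \<tau>) \<le> indicator {0..T} \<tau> *\<^sub>R kap \<tau>" for n \<tau>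
    using kap_nonneg[of \<tau>] by (auto simp: k_def indicator_def mult_left_le_one_le)
  have "(\<lambda>n. \<integral>\<tau>. k n \<tau> \<partial>lborel) \<longlonglongrightarrow> integral\<^sup>L lborel (\<lambda>\<tau>::real. 0)"
  proof (rule integral_dominated_convergence[where w = "\<lambda>\<tau>. indicator {0..T} \<tau> *\<^sub>R kap \<tau>"])
    show "AE \<tau> in lborel. (\<lambda>n. k n \<tau>) \<longlonglongrightarrow> 0"
    proof (rule AE_I2)
      fix \<tau> :: real
      show "(\<lambda>n. k n \<tau>) \<longlonglongrightarrow> 0"
      proof (cases "0 < \<tau>")
        case True
        have "(\<lambda>n. exp (- \<tau>) ^ n) \<longlonglongrightarrow> 0" using True by (intro LIMSEQ_realpow_zero) auto
        then have "(\<lambda>n. exp (- real n * \<tau>)) \<longlonglongrightarrow> 0"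
          by (simp add: exp_of_nat_mult[symmetric])
        from tendsto_mult_right_zero[OF tendsto_mult_left_zero[OF this], of "indicator {0..T} \<tau>" "kap \<tau>"]
        show ?thesis by (simp add: k_def)
      qed (simp add: k_def kap_def)
    qed
  qed (use bd integrable_kap in \<open>auto simp del: real_norm_def\<close>)
  then have "\<forall>\<^sub>F n in sequentially. (\<integral>\<tau>. k n \<tau> \<partial>lborel) < \<eta>"
    using assms by (intro order_tendstoD(2)) auto
  then obtain n where n: "(\<integral>\<tau>. k n \<tau> \<partial>lborel) < \<eta>" by (auto simp: eventually_sequentially)
  have kint: "integrable lborel (k n)"
    by (rule Bochner_Integration.integrable_bound[OF integrable_kap]) (simp, intro AE_I2 order_trans[OF bd], simp)
  have k0: "0 \<le> k n \<tau>" for \<tau> by (simp add: k_def kap_nonneg)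
  have "(\<integral>\<^sup>+ t. ennreal (exp (- real n * (s - t)) * kap (s - t)) \<partial>M) \<le> ennreal \<eta>" if s: "s \<in> {0..T}" for s
  proof -
    have "(\<integral>\<^sup>+ t. ennreal (exp (- real n * (s - t)) * kap (s - t)) \<partial>M)
        = (\<integral>\<^sup>+ t. ennreal (exp (- real n * (s - t)) * kap (s - t)) * indicator {0..T} t \<partial>lborel)"
      by (rule nn_integral_lebesgue_on) auto
    also have "\<dots> \<le> (\<integral>\<^sup>+ t. ennreal (k n (s + (-1) * t)) \<partial>lborel)"
      by (rule nn_integral_mono) (use s in \<open>auto simp: k_def kap_def indicator_def\<close>)
    also have "\<dots> = (\<integral>\<^sup>+ \<tau>. ennreal (k n \<tau>) \<partial>lborel)"
      using nn_integral_real_affine[of "\<lambda>\<tau>. ennreal (k n \<tau>)" "-1" s] by simp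
    also have "\<dots> = ennreal (\<integral>\<tau>. k n \<tau> \<partial>lborel)"
      by (rule nn_integral_eq_integral[OF kint]) (simp add: k0)
    also have "\<dots> \<le> ennreal \<eta>" using n by (intro ennreal_leI) simp
    finally show ?thesis .
  qed
  then show ?thesis by (intro exI[of _ "real n"]) auto
qed

text \<open>Tonelli, after the weight is split as e^(\<beta> t) = e^(-\<beta> (s - t)) e^(\<beta>
  s): the first factor is absorbed by the kernel, the second by the source.\<close>

lemma kernel_bound:
  assumes [measurable]: "F \<in> borel_measurable M"
    and \<beta>: "\<And>s. s \<in> {0..T} \<Longrightarrow> (\<integral>\<^sup>+ t. ennreal (exp (- \<beta> * (s - t)) * kap (s - t)) \<partial>M) \<le> ennreal \<eta>"
  shows "(\<integral>\<^sup>+ t. (\<integral>\<^sup>+ s. ennreal (exp (\<beta> * t) * norm (W (s - t) (F s))) \<partial>M) \<partial>M)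
    \<le> ennreal \<eta> * (\<integral>\<^sup>+ s. ennreal (exp (\<beta> * s) * norm (F s)) \<partial>M)"
proof -
  have e [measurable]: "(\<lambda>t. exp (\<beta> * t)) \<in> borel_measurable M" by (rule borel_measurable_M) measurable
  have "(\<integral>\<^sup>+ t. (\<integral>\<^sup>+ s. ennreal (exp (\<beta> * t) * norm (W (s - t) (F s))) \<partial>M) \<partial>M)
     = (\<integral>\<^sup>+ s. (\<integral>\<^sup>+ t. ennreal (exp (\<beta> * t) * norm (W (s - t) (F s))) \<partial>M) \<partial>M)"
    by (rule MM.Fubini'[symmetric]) measurable
  also have "\<dots> \<le> (\<integral>\<^sup>+ s. ennreal \<eta> * ennreal (exp (\<beta> * s) * norm (F s)) \<partial>M)"
  proof (rule nn_integral_mono)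
    fix s assume "s \<in> space M"
    then have s: "s \<in> {0..T}" by simp
    have [measurable]: "(\<lambda>t. exp (- \<beta> * (s - t)) * kap (s - t)) \<in> borel_measurable M"
      by (rule borel_measurable_M) measurable
    have "(\<integral>\<^sup>+ t. ennreal (exp (\<beta> * t) * norm (W (s - t) (F s))) \<partial>M)
      \<le> (\<integral>\<^sup>+ t. ennreal (exp (- \<beta> * (s - t)) * kap (s - t)) * ennreal (exp (\<beta> * s) * norm (F s)) \<partial>M)"
    proof (rule nn_integral_mono)
      fix t
      have "exp (\<beta> * t) * norm (W (s - t) (F s)) \<le> exp (\<beta> * t) * (kap (s - t) * norm (F s))"
        by (intro mult_left_mono norm_W_le) auto
      also have "\<dots> = exp (- \<beta> * (s - t)) * kap (s - t) * (exp (\<beta> * s) * norm (F s))"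
        by (simp add: exp_diff right_diff_distrib exp_minus field_simps)
      finally show "ennreal (exp (\<beta> * t) * norm (W (s - t) (F s)))
        \<le> ennreal (exp (- \<beta> * (s - t)) * kap (s - t)) * ennreal (exp (\<beta> * s) * norm (F s))"
        by (simp add: ennreal_mult[symmetric] kap_nonneg ennreal_leI)
    qed
    also have "\<dots> = (\<integral>\<^sup>+ t. ennreal (exp (- \<beta> * (s - t)) * kap (s - t)) \<partial>M) * ennreal (exp (\<beta> * s) * norm (F s))"
      by (rule nn_integral_multc) measurable
    also have "\<dots> \<le> ennreal \<eta> * ennreal (exp (\<beta> * s) * norm (F s))"
      by (intro mult_right_mono \<beta> s) auto
    finally show "(\<integral>\<^sup>+ t. ennreal (exp (\<beta> * t) * norm (W (s - t) (F s))) \<partial>M)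
      \<le> ennreal \<eta> * ennreal (exp (\<beta> * s) * norm (F s))" .
  qed
  also have "\<dots> = ennreal \<eta> * (\<integral>\<^sup>+ s. ennreal (exp (\<beta> * s) * norm (F s)) \<partial>M)"
    by (rule nn_integral_cmult) measurable
  finally show ?thesis .
qed

lemma integrable_kernel:
  assumes F: "integrable M F"
  shows "integrable (M \<Otimes>\<^sub>M M) (\<lambda>(t, s). W (s - t) (F s))"
proof -
  have [measurable]: "F \<in> borel_measurable M" using F by simp
  obtain \<beta> where \<beta>: "\<beta> \<ge> 0" "\<And>s. s \<in> {0..T} \<Longrightarrow> (\<integral>\<^sup>+ t. ennreal (exp (- \<beta> * (s - t)) * kap (s - t)) \<partial>M) \<le> ennreal 1"
    using ex_weight[of 1] by auto
  have "(\<integral>\<^sup>+ z. norm ((\<lambda>(t, s). W (s - t) (F s)) z) \<partial>(M \<Otimes>\<^sub>M M))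
      = (\<integral>\<^sup>+ t. (\<integral>\<^sup>+ s. norm (W (s - t) (F s)) \<partial>M) \<partial>M)"
    by (subst M.nn_integral_fst[symmetric]) simp_all
  also have "\<dots> \<le> (\<integral>\<^sup>+ t. (\<integral>\<^sup>+ s. ennreal (exp (\<beta> * t) * norm (W (s - t) (F s))) \<partial>M) \<partial>M)"
    using \<beta>(1) by (intro nn_integral_mono ennreal_leI) (simp add: mult_le_cancel_right1)
  also have "\<dots> \<le> ennreal 1 * (\<integral>\<^sup>+ s. ennreal (exp (\<beta> * s) * norm (F s)) \<partial>M)"
    by (rule kernel_bound[OF _ \<beta>(2)]) auto
  also have "\<dots> \<le> (\<integral>\<^sup>+ s. ennreal (exp (\<beta> * T)) * ennreal (norm (F s)) \<partial>M)"
    unfolding ennreal_1 mult_1 using \<beta>(1)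
    by (intro nn_integral_mono) (auto simp: ennreal_mult[symmetric] intro!: ennreal_leI mult_right_mono mult_left_mono)
  also have "\<dots> = ennreal (exp (\<beta> * T)) * (\<integral>\<^sup>+ s. ennreal (norm (F s)) \<partial>M)"
    by (rule nn_integral_cmult) measurable
  also have "\<dots> < \<infinity>"
    using F by (simp add: integrable_iff_bounded ennreal_mult_less_top)
  finally show ?thesis by (intro integrableI_bounded) measurable
qed

lemma
  assumes F: "integrable M F"
  shows AE_integrable_W: "AE t in M. integrable M (\<lambda>s. W (s - t) (F s))"
    and integrable_Z: "integrable M (Z F)"
  using MM.AE_integrable_fst[OF integrable_kernel[OF F]] MM.integrable_fst[OF integrable_kernel[OF F]]
  by (simp_all add: Z_def[abs_def])

text \<open>The projection onto \<open>G\<close> is bounded and linear, so it commutes with the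
  integral and fixes it as it fixes every value of the integrand. Where the integrand is not
  integrable, the integral is 0 by convention, again in \<open>G\<close>.\<close>

lemma Z_in_G: "Z F t \<in> G"
proof (cases "integrable M (\<lambda>s. W (s - t) (F s))")
  case True
  have "ortho_proj G (Z F t) = (\<integral>s. ortho_proj G (W (s - t) (F s)) \<partial>M)"
    unfolding Z_def by (rule integral_bounded_linear[OF bounded_linear_proj True, symmetric])
  also have "\<dots> = Z F t"
    unfolding Z_def by (simp add: ortho_proj_id[OF subspace_G closed_G W_in_G])
  finally show ?thesis using ortho_proj_in[OF subspace_G closed_G] by metis
next
  case False
  then show ?thesis using subspace_0[OF subspace_G] by (simp add: Z_def not_integrable_integral_eq)
qed

lemma Z_diff_bound:
  assumes F: "integrable M F" and H: "integrable M H"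
    and \<beta>: "\<And>s. s \<in> {0..T} \<Longrightarrow> (\<integral>\<^sup>+ t. ennreal (exp (- \<beta> * (s - t)) * kap (s - t)) \<partial>M) \<le> ennreal \<eta>"
  shows "(\<integral>\<^sup>+ t. ennreal (exp (\<beta> * t) * norm (Z F t - Z H t)) \<partial>M)
    \<le> ennreal \<eta> * (\<integral>\<^sup>+ s. ennreal (exp (\<beta> * s) * norm (F s - H s)) \<partial>M)"
proof -
  have "(\<integral>\<^sup>+ t. ennreal (exp (\<beta> * t) * norm (Z F t - Z H t)) \<partial>M)
     \<le> (\<integral>\<^sup>+ t. (\<integral>\<^sup>+ s. ennreal (exp (\<beta> * t) * norm (W (s - t) (F s - H s))) \<partial>M) \<partial>M)"
  proof (rule nn_integral_mono_AE)
    show "AE t in M. ennreal (exp (\<beta> * t) * norm (Z F t - Z H t))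
        \<le> (\<integral>\<^sup>+ s. ennreal (exp (\<beta> * t) * norm (W (s - t) (F s - H s))) \<partial>M)"
      using AE_integrable_W[OF F] AE_integrable_W[OF H]
    proof eventually_elim
      case (elim t)
      have i: "integrable M (\<lambda>s. W (s - t) (F s - H s))"
        using Bochner_Integration.integrable_diff[OF elim]
        by (simp add: linear_diff[OF bounded_linear.linear[OF bounded_linear_W]])
      have "Z F t - Z H t = (\<integral>s. W (s - t) (F s - H s) \<partial>M)"
        unfolding Z_def by (simp add: elim linear_diff[OF bounded_linear.linear[OF bounded_linear_W]])
      then have "exp (\<beta> * t) * norm (Z F t - Z H t) \<le> exp (\<beta> * t) * (\<integral>s. norm (W (s - t) (F s - H s)) \<partial>M)"
        by (simp add: integral_norm_bound)
      also have "\<dots> = (\<integral>s. exp (\<beta> * t) * norm (W (s - t) (F s - H s)) \<partial>M)" by simp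
      finally have "ennreal (exp (\<beta> * t) * norm (Z F t - Z H t)) \<le> ennreal (\<integral>s. exp (\<beta> * t) * norm (W (s - t) (F s - H s)) \<partial>M)"
        by (rule ennreal_leI)
      also have "\<dots> = (\<integral>\<^sup>+ s. ennreal (exp (\<beta> * t) * norm (W (s - t) (F s - H s))) \<partial>M)"
        by (rule nn_integral_eq_integral[symmetric]) (use i in auto)
      finally show ?case .
    qed
  qed
  also have "\<dots> \<le> ennreal \<eta> * (\<integral>\<^sup>+ s. ennreal (exp (\<beta> * s) * norm (F s - H s)) \<partial>M)"
    by (rule kernel_bound[OF _ \<beta>]) (use F H in auto)
  finally show ?thesis .
qed

end

section \<open>Mild solutions, the weak equation they satisfy, and linear uniqueness\<close>

context mild_problem
begin

text \<open>\<open>mild_grad\<close> represents the pair (u, du), but only for almost every t, since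
  the singular kernel need not be integrable at each t. \<open>mild\<close> is u alone; its
  integrand is bounded by \<open>norm (F s)\<close>, so the formula is meaningful at every t and
  gives \<open>g\<close> at t = T.\<close>

definition mild_grad :: "'a \<Rightarrow> (real \<Rightarrow> 'a) \<Rightarrow> real \<Rightarrow> 'a \<times> 'a" where
  "mild_grad g F t = W (T - t) g + Z F t"

definition mild :: "'a \<Rightarrow> (real \<Rightarrow> 'a) \<Rightarrow> real \<Rightarrow> 'a" where
  "mild g F t = P (T - t) g + (\<integral>s. fst (W (s - t) (F s)) \<partial>M)"

lemma norm_fst_W_le: "norm (fst (W \<tau> x)) \<le> norm x"
  by (simp add: W_def norm_P_le)

lemma integrable_fst_W:
  assumes F: "integrable M F"
  shows "integrable M (\<lambda>s. fst (W (s - t) (F s)))"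
proof (rule Bochner_Integration.integrable_bound[OF F])
  have [measurable]: "F \<in> borel_measurable M" using F by simp
  have [measurable]: "(\<lambda>s. s - t) \<in> borel_measurable M" by measurable
  have "(\<lambda>s. W (s - t) (F s)) \<in> borel_measurable M" by measurable
  then show "(\<lambda>s. fst (W (s - t) (F s))) \<in> borel_measurable M"
    by (rule borel_measurable_continuous_onI[OF continuous_on_fst[OF continuous_on_id], THEN measurable_compose[rotated], simplified])
qed (simp add: norm_fst_W_le)

lemma integrable_W_const: "integrable M (\<lambda>t. W (T - t) g)"
proof (rule integrableI_bounded)
  show "(\<lambda>t. W (T - t) g) \<in> borel_measurable M" by measurable
  obtain \<beta> where \<beta>: "\<beta> \<ge> 0" "\<And>s. s \<in> {0..T} \<Longrightarrow> (\<integral>\<^sup>+ t. ennreal (exp (- \<beta> * (s - t)) * kap (s - t)) \<partial>M) \<le> ennreal 1"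
    using ex_weight[of 1] by auto
  have m: "(\<lambda>t. ennreal (exp (- \<beta> * (T - t)) * kap (T - t))) \<in> borel_measurable M"
    by (rule borel_measurable_M) measurable
  have "(\<integral>\<^sup>+ t. norm (W (T - t) g) \<partial>M)
      \<le> (\<integral>\<^sup>+ t. ennreal (exp (\<beta> * T) * norm g) * ennreal (exp (- \<beta> * (T - t)) * kap (T - t)) \<partial>M)"
  proof (rule nn_integral_mono)
    fix t assume "t \<in> space M"
    then have t: "0 \<le> t" "t \<le> T" by auto
    have "norm (W (T - t) g) \<le> kap (T - t) * norm g" by (rule norm_W_le)
    also have "\<dots> \<le> exp (\<beta> * t) * (kap (T - t) * norm g)"
      using t \<beta>(1) kap_nonneg[of "T - t"] by (simp add: mult_le_cancel_right1 split: if_splits) (smt (verit) mult_nonneg_nonneg norm_ge_zero)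
    also have "\<dots> = exp (\<beta> * T) * norm g * (exp (- \<beta> * (T - t)) * kap (T - t))"
      by (simp add: exp_diff right_diff_distrib exp_minus field_simps)
    finally show "ennreal (norm (W (T - t) g)) \<le> ennreal (exp (\<beta> * T) * norm g) * ennreal (exp (- \<beta> * (T - t)) * kap (T - t))"
      by (simp add: ennreal_mult[symmetric] kap_nonneg ennreal_leI)
  qed
  also have "\<dots> = ennreal (exp (\<beta> * T) * norm g) * (\<integral>\<^sup>+ t. ennreal (exp (- \<beta> * (T - t)) * kap (T - t)) \<partial>M)"
    by (rule nn_integral_cmult[OF m])
  also have "\<dots> \<le> ennreal (exp (\<beta> * T) * norm g) * ennreal 1"
    using \<beta>(2)[of T] T_pos by (intro mult_left_mono) auto
  finally show "(\<integral>\<^sup>+ t. norm (W (T - t) g) \<partial>M) < \<infinity>"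
    by (rule order.strict_trans1) simp
qed

lemma integrable_mild_grad: "integrable M F \<Longrightarrow> integrable M (mild_grad g F)"
  unfolding mild_grad_def[abs_def]
  by (intro Bochner_Integration.integrable_add integrable_W_const integrable_Z)

lemma mild_grad_in_G: "mild_grad g F t \<in> G"
  unfolding mild_grad_def by (intro subspace_add[OF subspace_G] W_in_G Z_in_G)

lemma AE_mild: 
  assumes F: "integrable M F"
  shows "AE t in M. mild g F t = fst (mild_grad g F t)"
proof -
  \<comment> \<open>At t = T the two differ: \<open>W 0 g\<close> is 0, while \<open>P 0 g\<close>
    is \<open>g\<close>.\<close>
  have "AE t in M. t \<noteq> T" by (rule AE_lebesgue_on_ne) simp
  then show ?thesis
    using AE_integrable_W[OF F] AE_space
  proof eventually_elim
    case (elim t)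
    then have "t < T" by simp
    then have "fst (W (T - t) g) = P (T - t) g" by (simp add: W_def)
    moreover have "(\<integral>s. fst (W (s - t) (F s)) \<partial>M) = fst (Z F t)"
      unfolding Z_def by (rule integral_bounded_linear[OF bounded_linear_fst elim(2)])
    ultimately show ?case by (simp add: mild_def mild_grad_def)
  qed
qed

text \<open>\<open>Q_weak_integral\<close> after the substitution \<tau> = s - r, with the range of
  r expressed over the fixed measure \<open>M\<close>; this is the shape that Fubini needs in
  \<open>mild_weak\<close>.\<close>

lemma P_weak_M:
  assumes pq: "(p, q) \<in> G" and ts: "0 \<le> t" "t \<le> s" "s \<le> T"
  shows "integrable M (\<lambda>r. indicator {t<..} r *\<^sub>R (snd (W (s - r) x) \<bullet> q))"
    and "P (s - t) x \<bullet> p = x \<bullet> p - (\<integral>r. indicator {t<..} r *\<^sub>R (snd (W (s - r) x) \<bullet> q) \<partial>M)"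
proof -
  define f where "f = (\<lambda>\<tau>. indicator {0<..<s - t} \<tau> *\<^sub>R (Q \<tau> x \<bullet> q))"
  have f_m [measurable]: "f \<in> borel_measurable borel"
    unfolding f_def
    by (intro borel_measurable_continuous_on_indicator continuous_intros
        continuous_on_subset[OF continuous_on_Q_t]) auto
  note Qw = Q_weak_integral[OF _ pq, of "s - t" x]
  have "integrable lebesgue f" using Qw(1) ts by (simp add: f_def set_integrable_def)
  then have fi: "integrable lborel f" by (simp add: integrable_completion)
  have fI: "integral {0<..<s - t} (\<lambda>\<tau>. Q \<tau> x \<bullet> q) = integral\<^sup>L lborel f"
  proof -
    have "(LINT \<tau>:{0<..<s - t}|lebesgue. Q \<tau> x \<bullet> q) = integral\<^sup>L lebesgue f"
      by (simp only: set_lebesgue_integral_def f_def)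
    also have "\<dots> = integral\<^sup>L lborel f" by (simp add: integral_completion)
    finally show ?thesis using set_lebesgue_integral_eq_integral(2)[OF Qw(1)] ts by simp
  qed
  define h where "h = (\<lambda>r. indicator {t<..} r *\<^sub>R (snd (W (s - r) x) \<bullet> q))"
  have [measurable]: "h \<in> borel_measurable borel"
  proof -
    have "(\<lambda>r. W (s - r) x) \<in> borel_measurable borel" by measurable
    from borel_measurable_continuous_onI[OF continuous_on_snd[OF continuous_on_id], THEN measurable_compose[rotated], OF this]
    have [measurable]: "(\<lambda>r. snd (W (s - r) x)) \<in> borel_measurable borel" by simp
    show ?thesis unfolding h_def by measurable
  qed
  have hf: "indicator {0..T} r *\<^sub>R h r = f (s + (-1) * r)" for r
    using ts by (auto simp: h_def f_def W_def indicator_def)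
  have "integrable M h"
    by (subst integrable_lebesgue_on) (simp_all only: hf lborel_integrable_real_affine[OF fi], simp_all)
  then show "integrable M (\<lambda>r. indicator {t<..} r *\<^sub>R (snd (W (s - r) x) \<bullet> q))" by (simp add: h_def)
  have "(\<integral>r. h r \<partial>M) = (\<integral>r. f (s + (-1) * r) \<partial>lborel)"
    by (subst integral_lebesgue_on) (simp_all only: hf, simp_all)
  also have "\<dots> = integral\<^sup>L lborel f"
    using lborel_integral_real_affine[of "-1" f s] by simp
  finally have "(\<integral>r. h r \<partial>M) = integral {0<..<s - t} (\<lambda>\<tau>. Q \<tau> x \<bullet> q)" by (simp only: fI)
  then show "P (s - t) x \<bullet> p = x \<bullet> p - (\<integral>r. indicator {t<..} r *\<^sub>R (snd (W (s - r) x) \<bullet> q) \<partial>M)"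
    using Qw(2) ts by (simp add: h_def)
qed

lemma borel_measurable_snd_inner:
  fixes f :: "'b \<Rightarrow> 'a \<times> 'a"
  assumes "f \<in> borel_measurable N"
  shows "(\<lambda>x. snd (f x) \<bullet> q) \<in> borel_measurable N"
proof -
  have "(\<lambda>z::'a \<times> 'a. snd z \<bullet> q) \<in> borel_measurable borel"
    by (intro borel_measurable_continuous_onI continuous_intros)
  from measurable_compose[OF assms this] show ?thesis .
qed

lemma bounded_linear_snd_inner: "bounded_linear (\<lambda>z::'a \<times> 'a. snd z \<bullet> q)"
  by (rule bounded_linear_compose[OF bounded_linear_inner_left bounded_linear_snd])

text \<open>For each s, \<open>P (s - t)\<close> applied to \<open>F s\<close> is replaced by
  \<open>F s\<close> minus an integral of gradients over r in (t, s). Exchanging r and s turns the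
  double integral into one over the gradient component of \<open>Z F r\<close>.\<close>

lemma mild_weak:
  assumes F: "integrable M F" and pq: "(p, q) \<in> G" and t: "t \<in> {0..T}"
  shows "mild g F t \<bullet> p = g \<bullet> p - (\<integral>s. indicator {t<..} s *\<^sub>R (snd (mild_grad g F s) \<bullet> q) \<partial>M)
     + (\<integral>s. indicator {t<..} s *\<^sub>R (F s \<bullet> p) \<partial>M)"
proof -
  have ind [measurable]: "(\<lambda>r. indicator {t<..} r :: real) \<in> borel_measurable M"
    by (rule borel_measurable_M) measurable
  have F_m [measurable]: "F \<in> borel_measurable M" using F by simp
  define k where "k = (\<lambda>r s. indicator {t<..} r *\<^sub>R (snd (W (s - r) (F s)) \<bullet> q))"
  have k_int: "integrable (M \<Otimes>\<^sub>M M) (\<lambda>(r, s). k r s)"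
  proof (rule Bochner_Integration.integrable_bound)
    show "integrable (M \<Otimes>\<^sub>M M) (\<lambda>z. (\<lambda>(r, s). snd (W (s - r) (F s)) \<bullet> q) z)"
      using integrable_bounded_linear[OF bounded_linear_snd_inner integrable_kernel[OF F], of q]
      by (simp add: case_prod_beta)
    have [measurable]: "(\<lambda>z. snd (W (snd z - fst z) (F (snd z))) \<bullet> q) \<in> borel_measurable (M \<Otimes>\<^sub>M M)"
      by (rule borel_measurable_snd_inner) measurable
    show "(\<lambda>(r, s). k r s) \<in> borel_measurable (M \<Otimes>\<^sub>M M)"
      unfolding k_def case_prod_beta by measurable
  qed (auto simp: k_def indicator_def)
  have Fi: "integrable M (\<lambda>s. indicator {t<..} s *\<^sub>R (F s \<bullet> p))"
  proof (rule Bochner_Integration.integrable_bound)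
    show "integrable M (\<lambda>s. F s \<bullet> p)" by (intro integrable_inner_left F)
  qed (auto simp: indicator_def)
  have ki: "integrable M (\<lambda>s. \<integral>r. k r s \<partial>M)"
    using MM.integrable_snd[OF k_int] .
  have "(\<integral>s. fst (W (s - t) (F s)) \<partial>M) \<bullet> p = (\<integral>s. fst (W (s - t) (F s)) \<bullet> p \<partial>M)"
    by (rule integral_inner_left[symmetric]) (rule integrable_fst_W[OF F])
  also have "\<dots> = (\<integral>s. indicator {t<..} s *\<^sub>R (F s \<bullet> p) - (\<integral>r. k r s \<partial>M) \<partial>M)"
  proof (rule Bochner_Integration.integral_cong[OF refl])
    fix s assume "s \<in> space M"
    then have s: "0 \<le> s" "s \<le> T" by auto
    show "fst (W (s - t) (F s)) \<bullet> p = indicator {t<..} s *\<^sub>R (F s \<bullet> p) - (\<integral>r. k r s \<partial>M)"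
    proof (cases "t < s")
      case True
      then show ?thesis using P_weak_M(2)[OF pq, of t s "F s"] t s by (simp add: W_def k_def)
    next
      case False
      then have "k r s = 0" for r by (auto simp: k_def W_def indicator_def)
      then show ?thesis using False by (simp add: W_def)
    qed
  qed
  also have "\<dots> = (\<integral>s. indicator {t<..} s *\<^sub>R (F s \<bullet> p) \<partial>M) - (\<integral>s. (\<integral>r. k r s \<partial>M) \<partial>M)"
    by (rule Bochner_Integration.integral_diff[OF Fi ki])
  also have "(\<integral>s. (\<integral>r. k r s \<partial>M) \<partial>M) = (\<integral>r. (\<integral>s. k r s \<partial>M) \<partial>M)"
    by (rule MM.Fubini_integral[OF k_int])
  also have "\<dots> = (\<integral>r. indicator {t<..} r *\<^sub>R (snd (Z F r) \<bullet> q) \<partial>M)"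
  proof (rule integral_cong_AE)
    show "(\<lambda>r. \<integral>s. k r s \<partial>M) \<in> borel_measurable M"
      using MM.integrable_fst[OF k_int] by simp
    have [measurable]: "(\<lambda>r. snd (Z F r) \<bullet> q) \<in> borel_measurable M"
      by (rule borel_measurable_snd_inner) (use integrable_Z[OF F] in simp)
    show "(\<lambda>r. indicator {t<..} r *\<^sub>R (snd (Z F r) \<bullet> q)) \<in> borel_measurable M" by measurable
    show "AE r in M. (\<integral>s. k r s \<partial>M) = indicator {t<..} r *\<^sub>R (snd (Z F r) \<bullet> q)"
      using AE_integrable_W[OF F]
    proof eventually_elim
      case (elim r)
      have "(\<integral>s. snd (W (s - r) (F s)) \<bullet> q \<partial>M) = snd (Z F r) \<bullet> q"
        unfolding Z_def by (rule integral_bounded_linear[OF bounded_linear_snd_inner elim])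
      then show ?case by (simp add: k_def)
    qed
  qed
  finally have A: "(\<integral>s. fst (W (s - t) (F s)) \<partial>M) \<bullet> p
     = (\<integral>s. indicator {t<..} s *\<^sub>R (F s \<bullet> p) \<partial>M) - (\<integral>r. indicator {t<..} r *\<^sub>R (snd (Z F r) \<bullet> q) \<partial>M)" .
  note Pg = P_weak_M[OF pq, of t T g]
  have Zi: "integrable M (\<lambda>r. indicator {t<..} r *\<^sub>R (snd (Z F r) \<bullet> q))"
  proof (rule Bochner_Integration.integrable_bound)
    show "integrable M (\<lambda>r. snd (Z F r) \<bullet> q)"
      by (rule integrable_bounded_linear[OF bounded_linear_snd_inner integrable_Z[OF F]])
    have [measurable]: "(\<lambda>r. snd (Z F r) \<bullet> q) \<in> borel_measurable M"
      by (rule borel_measurable_snd_inner) (use integrable_Z[OF F] in simp)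
    show "(\<lambda>r. indicator {t<..} r *\<^sub>R (snd (Z F r) \<bullet> q)) \<in> borel_measurable M" by measurable
  qed (auto simp: indicator_def)
  have "(\<integral>s. indicator {t<..} s *\<^sub>R (snd (mild_grad g F s) \<bullet> q) \<partial>M)
     = (\<integral>r. indicator {t<..} r *\<^sub>R (snd (W (T - r) g) \<bullet> q) \<partial>M) + (\<integral>r. indicator {t<..} r *\<^sub>R (snd (Z F r) \<bullet> q) \<partial>M)"
    using Bochner_Integration.integral_add[OF Pg(1) Zi] t
    by (simp add: mild_grad_def inner_add_left scaleR_add_right distrib_left)
  then show ?thesis using A Pg(2) t by (simp add: mild_def inner_add_left)
qed

text \<open>Tested with the pairs (J \<psi>, K \<psi>), the equation says that z = J w satisfies
  z(t) = integral of y over (t, T), where y = J w - w. Then |z(t)|^2 is twice the integral of <z,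
  y>, and <z, y> \<le> 0 by \<open>J_firm\<close>. So z = 0, and w = 0 by injectivity of
  \<open>J\<close>. Applying \<open>J\<close> first makes the solution absolutely continuous in
  time.\<close>

lemma linear_uniqueness:
  assumes w: "integrable M w" and w2: "integrable M w2"
    and G: "AE t in M. (w t, w2 t) \<in> G"
    and weak: "\<And>p q t. (p, q) \<in> G \<Longrightarrow> t \<in> {0..T} \<Longrightarrow>
      w t \<bullet> p = - (\<integral>s. indicator {t<..} s *\<^sub>R (w2 s \<bullet> q) \<partial>M)"
    and t: "t \<in> {0..T}"
  shows "w t = 0"
proof -
  define z where "z = (\<lambda>t. endo_app J (w t))"
  define y where "y = (\<lambda>s. z s - w s)"
  have z_int: "integrable M z"
    unfolding z_def by (rule integrable_bounded_linear[OF endo_app.bounded_linear_right w])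
  have y_int: "integrable M y" unfolding y_def by (intro Bochner_Integration.integrable_diff z_int w)
  have [measurable]: "y \<in> borel_measurable M" "z \<in> borel_measurable M" "w \<in> borel_measurable M" "w2 \<in> borel_measurable M"
    using y_int z_int w w2 by auto
  have ind [measurable]: "(\<lambda>r. indicator {t<..} r :: real) \<in> borel_measurable M" for t
    by (rule borel_measurable_M) measurable
  have yi: "integrable M (\<lambda>s. indicator {t<..} s *\<^sub>R y s)" for t
    by (rule Bochner_Integration.integrable_bound[OF y_int]) (auto simp: indicator_def)
  have zy: "z t = (\<integral>s. indicator {t<..} s *\<^sub>R y s \<partial>M)" if t: "t \<in> {0..T}" for t
  proof -
    have "z t \<bullet> \<psi> = (\<integral>s. indicator {t<..} s *\<^sub>R y s \<partial>M) \<bullet> \<psi>" for \<psi>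
    proof -
      have "z t \<bullet> \<psi> = - (\<integral>s. indicator {t<..} s *\<^sub>R (w2 s \<bullet> K \<psi>) \<partial>M)"
        using weak[OF JK_in_G t, of \<psi>] by (simp add: z_def J_sym)
      also have "(\<integral>s. indicator {t<..} s *\<^sub>R (w2 s \<bullet> K \<psi>) \<partial>M) = (\<integral>s. indicator {t<..} s *\<^sub>R (- (y s \<bullet> \<psi>)) \<partial>M)"
      proof (rule integral_cong_AE)
        show "AE s in M. indicator {t<..} s *\<^sub>R (w2 s \<bullet> K \<psi>) = indicator {t<..} s *\<^sub>R (- (y s \<bullet> \<psi>))"
          using G
        proof eventually_elim
          case (elim s)
          have "w2 s \<bullet> K \<psi> = - (y s \<bullet> \<psi>)"
          proof -
            have "K \<psi> \<bullet> w2 s = \<psi> \<bullet> w s - \<psi> \<bullet> z s"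
              using JK_weak[OF elim, of \<psi>] J_sym[of \<psi> "w s"] unfolding z_def by linarith
            then show ?thesis
              unfolding y_def inner_diff_left
              using inner_commute[of "K \<psi>" "w2 s"] inner_commute[of \<psi> "w s"] inner_commute[of \<psi> "z s"]
              by linarith
          qed
          then show ?case by simp
        qed
      qed measurable
      also have "\<dots> = - (\<integral>s. (indicator {t<..} s *\<^sub>R y s) \<bullet> \<psi> \<partial>M)" by simp
      also have "(\<integral>s. (indicator {t<..} s *\<^sub>R y s) \<bullet> \<psi> \<partial>M) = (\<integral>s. indicator {t<..} s *\<^sub>R y s \<partial>M) \<bullet> \<psi>"
        by (rule integral_inner_left) (rule yi)
      finally show ?thesis by simp
    qed
    from this[of "z t - (\<integral>s. indicator {t<..} s *\<^sub>R y s \<partial>M)"]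
    have "(z t - (\<integral>s. indicator {t<..} s *\<^sub>R y s \<partial>M)) \<bullet> (z t - (\<integral>s. indicator {t<..} s *\<^sub>R y s \<partial>M)) = 0"
      by (simp only: inner_diff_left right_minus_eq)
    then show ?thesis by (simp only: inner_eq_zero_iff right_minus_eq)
  qed
  have zy_le: "z s \<bullet> y s \<le> 0" for s
    using J_firm[of "w s"] by (simp add: y_def z_def inner_diff_right power2_norm_eq_inner)
  have z0: "z t = 0" if t: "t \<in> {0..T}" for t
  proof -
    \<comment> \<open>The square of the integral of \<open>y\<close> over (t, T] is a double
      integral; the diagonal splits the square into two triangles, each contributing
      \<open>D\<close>. This replaces differentiating |z|^2.\<close>
    define k where "k = (\<lambda>s r. indicator {t<..} s *\<^sub>R (indicator {s<..} r *\<^sub>R (y r \<bullet> y s)))"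
    have k_m [measurable]: "(\<lambda>(s, r). k s r) \<in> borel_measurable (M \<Otimes>\<^sub>M M)"
    proof -
      have "(\<lambda>z. (if fst z < snd z then 1 else 0) :: real) \<in> borel_measurable (M \<Otimes>\<^sub>M M)" by measurable
      moreover have "(\<lambda>(s, r). k s r) = (\<lambda>z. indicator {t<..} (fst z) *\<^sub>R ((if fst z < snd z then 1 else 0) *\<^sub>R (y (snd z) \<bullet> y (fst z))))"
        by (auto simp: k_def indicator_def fun_eq_iff)
      ultimately show ?thesis by simp
    qed
    have k_int: "integrable (M \<Otimes>\<^sub>M M) (\<lambda>(s, r). k s r)"
    proof (rule Bochner_Integration.integrable_bound)
      show "integrable (M \<Otimes>\<^sub>M M) (\<lambda>z. norm (y (snd z)) * norm (y (fst z)))"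
      proof (rule MM.Fubini_integrable)
        show "integrable M (\<lambda>x. \<integral>r. norm (norm (y (snd (x, r))) * norm (y (fst (x, r)))) \<partial>M)"
          using y_int by simp
      qed (use y_int in auto)
      show "AE z in M \<Otimes>\<^sub>M M. norm (case z of (s, r) \<Rightarrow> k s r) \<le> norm (norm (y (snd z)) * norm (y (fst z)))"
        by (auto simp: k_def indicator_def Cauchy_Schwarz_ineq2)
    qed (rule k_m)
    define D where "D = (\<integral>s. (\<integral>r. k s r \<partial>M) \<partial>M)"
    have D': "D = (\<integral>r. (\<integral>s. k s r \<partial>M) \<partial>M)"
      unfolding D_def by (rule MM.Fubini_integral[OF k_int, symmetric])
    have in1: "integrable M (\<lambda>s. \<integral>r. k s r \<partial>M)" by (rule MM.integrable_fst[OF k_int])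
    have in2: "integrable M (\<lambda>r. \<integral>s. k s r \<partial>M)" by (rule MM.integrable_snd[OF k_int])
    have "z t \<bullet> z t = (\<integral>s. indicator {t<..} s *\<^sub>R y s \<partial>M) \<bullet> z t" using zy[OF t] by simp
    also have "\<dots> = (\<integral>s. (indicator {t<..} s *\<^sub>R y s) \<bullet> z t \<partial>M)"
      by (rule integral_inner_left[symmetric]) (rule yi)
    also have "\<dots> = (\<integral>s. (\<integral>r. k s r \<partial>M) + (\<integral>r. k r s \<partial>M) \<partial>M)"
    proof (rule integral_cong_AE)
      show "(\<lambda>s. (\<integral>r. k s r \<partial>M) + (\<integral>r. k r s \<partial>M)) \<in> borel_measurable M"
        using in1 in2 by (intro borel_measurable_add) auto
      have ik1: "AE s in M. integrable M (\<lambda>r. k s r)" using MM.AE_integrable_fst[OF k_int] by simp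
      have ik2: "AE s in M. integrable M (\<lambda>r. k r s)" using MM.AE_integrable_snd[OF k_int] by simp
      show "AE s in M. (indicator {t<..} s *\<^sub>R y s) \<bullet> z t = (\<integral>r. k s r \<partial>M) + (\<integral>r. k r s \<partial>M)"
        using ik1 ik2
      proof eventually_elim
        case (elim s)
        have "(indicator {t<..} s *\<^sub>R y s) \<bullet> z t = (\<integral>r. indicator {t<..} r *\<^sub>R y r \<partial>M) \<bullet> (indicator {t<..} s *\<^sub>R y s)"
          unfolding zy[OF t, symmetric] by (rule inner_commute)
        also have "\<dots> = (\<integral>r. (indicator {t<..} r *\<^sub>R y r) \<bullet> (indicator {t<..} s *\<^sub>R y s) \<partial>M)"
          by (rule integral_inner_left[symmetric]) (rule yi)
        also have "\<dots> = (\<integral>r. k s r + k r s \<partial>M)"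
        proof (rule integral_cong_AE)
          have "AE r in M. r \<noteq> s" by (rule AE_lebesgue_on_ne) simp
          then show "AE r in M. (indicator {t<..} r *\<^sub>R y r) \<bullet> (indicator {t<..} s *\<^sub>R y s) = k s r + k r s"
            by eventually_elim (auto simp: k_def indicator_def inner_commute)
          show "(\<lambda>r. k s r + k r s) \<in> borel_measurable M" using elim by auto
        qed measurable
        also have "\<dots> = (\<integral>r. k s r \<partial>M) + (\<integral>r. k r s \<partial>M)"
          by (rule Bochner_Integration.integral_add[OF elim])
        finally show ?case .
      qed
    qed measurable
    also have "\<dots> = 2 * D"
      by (subst Bochner_Integration.integral_add[OF in1 in2]) (simp add: D_def[symmetric] D'[symmetric])
    also have "D \<le> 0"
    proof -
      have "(\<integral>r. k s r \<partial>M) \<le> 0" if s: "s \<in> {0..T}" for s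
      proof -
        have "(\<integral>r. k s r \<partial>M) = indicator {t<..} s *\<^sub>R (\<integral>r. (indicator {s<..} r *\<^sub>R y r) \<bullet> y s \<partial>M)"
          by (simp add: k_def)
        also have "(\<integral>r. (indicator {s<..} r *\<^sub>R y r) \<bullet> y s \<partial>M) = z s \<bullet> y s"
          unfolding zy[OF s] by (rule integral_inner_left) (rule yi)
        finally show ?thesis using zy_le[of s] by (simp add: indicator_def)
      qed
      then have "0 \<le> (\<integral>s. - (\<integral>r. k s r \<partial>M) \<partial>M)" by (intro Bochner_Integration.integral_nonneg) simp
      then show ?thesis by (simp add: D_def)
    qed
    finally have "z t \<bullet> z t \<le> 0" by simp
    then have "z t \<bullet> z t = 0" by (rule antisym) (rule inner_ge_zero)
    then show ?thesis by (simp only: inner_eq_zero_iff)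
  qed
  show ?thesis using z0[OF t] J_eq_0 by (simp add: z_def)
qed

end

section \<open>The semilinear fixed point problem in a Hilbert space\<close>

section \<open>The semilinear problem in abstract form\<close>

lemma complete_measure_lebesgue_on:
  assumes "S \<in> sets lebesgue"
  shows "complete_measure (lebesgue_on S)"
proof
  fix A B assume AB: "A \<subseteq> B" and B: "B \<in> null_sets (lebesgue_on S)"
  have "B \<in> null_sets lebesgue" "B \<subseteq> S" using B null_sets_restrict_space[OF assms] by blast+
  then have "A \<in> null_sets lebesgue" "A \<subseteq> S"
    using completion.complete2[OF AB] AB by blast+
  then have "A \<in> null_sets (lebesgue_on S)" using null_sets_restrict_space[OF assms] by blast
  then show "A \<in> sets (lebesgue_on S)" by (rule null_setsD2)
qed

text \<open>Lebesgue measure is complete, so a change on a null set keeps measurability. This is how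
  functions determined only almost everywhere in time are handled throughout.\<close>

lemma borel_measurable_lebesgue_on_AE:
  assumes f: "f \<in> borel_measurable (lebesgue_on S)" and S: "S \<in> sets lebesgue"
    and fg: "AE x in lebesgue_on S. f x = g x"
  shows "g \<in> borel_measurable (lebesgue_on S)"
proof (rule measurableI)
  interpret complete_measure "lebesgue_on S" by (rule complete_measure_lebesgue_on[OF S])
  fix A :: "'b set" assume A: "A \<in> sets borel"
  show "g -` A \<inter> space (lebesgue_on S) \<in> sets (lebesgue_on S)"
  proof (rule in_sets_AE)
    show "f -` A \<inter> space (lebesgue_on S) \<in> sets (lebesgue_on S)" by (rule measurable_sets[OF f A])
    show "AE x in lebesgue_on S. (x \<in> f -` A \<inter> space (lebesgue_on S)) = (x \<in> g -` A \<inter> space (lebesgue_on S))"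
      using fg by eventually_elim auto
  qed simp
qed simp

lemma integrable_lebesgue_on_AE:
  fixes f g :: "real \<Rightarrow> 'b::{banach, second_countable_topology}"
  assumes f: "integrable (lebesgue_on S) f" and S: "S \<in> sets lebesgue"
    and fg: "AE x in lebesgue_on S. f x = g x"
  shows "integrable (lebesgue_on S) g"
  using integrable_cong_AE[of f "lebesgue_on S" g, OF _ borel_measurable_lebesgue_on_AE[OF _ S fg] fg] f
  by auto

text \<open>The condition \<open>single\<close> says that an element of the domain has only one
  gradient; it turns equality of solutions into equality of the pairs in
  \<open>weak_sol_mild\<close>.\<close>

locale semilinear_problem = mild_problem G T
  for G :: "('a::{real_inner, banach, perfect_space, second_countable_topology} \<times> 'a) set" and T +
  fixes N :: "real \<Rightarrow> 'a \<times> 'a \<Rightarrow> 'a" and L :: real and g :: 'a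
  assumes single: "\<And>k. (0, k) \<in> G \<Longrightarrow> k = 0"
    and lip: "\<And>t a b. t \<in> {0..T} \<Longrightarrow> norm (N t a - N t b) \<le> L * norm (a - b)"
    and N_meas: "\<And>a. (\<lambda>t. N t a) \<in> borel_measurable M"
    and N_0: "integrable M (\<lambda>t. N t 0)"
    and L_nonneg: "0 \<le> L"
begin

text \<open>The composition of a Caratheodory function: along simple approximations of
  \<open>v\<close> only finitely many slices of \<open>N\<close> occur, and the Lipschitz bound
  passes to the limit.\<close>

lemma N_compose_measurable:
  assumes v: "v \<in> borel_measurable M"
  shows "(\<lambda>t. N t (v t)) \<in> borel_measurable M"
proof -
  obtain s where s: "\<And>i. simple_function M (s i)" "\<And>x. x \<in> space M \<Longrightarrow> (\<lambda>i. s i x) \<longlonglongrightarrow> v x"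
    using borel_measurable_implies_sequence_metric[OF v, of 0] by blast
  show ?thesis
  proof (rule borel_measurable_LIMSEQ_metric[of "\<lambda>i t. N t (s i t)"])
    fix i
    show "(\<lambda>t. N t (s i t)) \<in> borel_measurable M"
    proof (rule measurable_compose_countable'[where I = "s i ` space M" and f = "\<lambda>a t. N t a"])
      show "s i \<in> M \<rightarrow>\<^sub>M count_space (s i ` space M)"
        using simple_functionD[OF s(1)] by (auto simp: measurable_count_space_eq2)
      show "countable (s i ` space M)" using simple_functionD(1)[OF s(1)] by (rule countable_finite)
    qed (rule N_meas)
  next
    fix t assume t: "t \<in> space M"
    have "(\<lambda>i. N t (s i t) - N t (v t)) \<longlonglongrightarrow> 0"
    proof (rule Lim_null_comparison)
      show "\<forall>\<^sub>F i in sequentially. norm (N t (s i t) - N t (v t)) \<le> L * norm (s i t - v t)"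
        using t by (intro always_eventually allI lip) simp
      have "(\<lambda>i. s i t - v t) \<longlonglongrightarrow> 0" using s(2)[OF t] by (rule LIM_zero)
      then show "(\<lambda>i. L * norm (s i t - v t)) \<longlonglongrightarrow> 0"
        by (intro tendsto_mult_right_zero tendsto_norm_zero)
    qed
    then show "(\<lambda>i. N t (s i t)) \<longlonglongrightarrow> N t (v t)" by (rule LIM_zero_cancel)
  qed
qed

lemma N_integrable:
  assumes v: "integrable M v"
  shows "integrable M (\<lambda>t. N t (v t))"
proof (rule Bochner_Integration.integrable_bound)
  show "integrable M (\<lambda>t. L * norm (v t) + norm (N t 0))"
    using v N_0 by auto
  show "(\<lambda>t. N t (v t)) \<in> borel_measurable M" by (rule N_compose_measurable) (use v in simp)
  show "AE t in M. norm (N t (v t)) \<le> norm (L * norm (v t) + norm (N t 0))"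
  proof (rule AE_I2)
    fix t assume "t \<in> space M"
    then have "norm (N t (v t) - N t 0) \<le> L * norm (v t)" using lip[of t "v t" 0] by simp
    then have "norm (N t (v t)) \<le> L * norm (v t) + norm (N t 0)"
      using norm_triangle_sub[of "N t (v t)" "N t 0"] by linarith
    then show "norm (N t (v t)) \<le> norm (L * norm (v t) + norm (N t 0))" by simp
  qed
qed

text \<open>A fixed point is the pair (u, du) of a mild solution driven by its own nonlinear
  term.\<close>

definition step :: "(real \<Rightarrow> 'a \<times> 'a) \<Rightarrow> real \<Rightarrow> 'a \<times> 'a" where
  "step v = mild_grad g (\<lambda>s. N s (v s))"

lemma integrable_step: "integrable M v \<Longrightarrow> integrable M (step v)"
  unfolding step_def by (intro integrable_mild_grad N_integrable)

definition wnorm :: "real \<Rightarrow> (real \<Rightarrow> 'a \<times> 'a) \<Rightarrow> ennreal" where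
  "wnorm \<beta> v = (\<integral>\<^sup>+ t. ennreal (exp (\<beta> * t) * norm (v t)) \<partial>M)"

lemma exp_measurable_M [measurable]: "(\<lambda>t. exp (\<beta> * t)) \<in> borel_measurable M"
  by (rule borel_measurable_M) measurable

lemma wnorm_finite:
  assumes v: "integrable M v" and \<beta>: "0 \<le> \<beta>"
  shows "wnorm \<beta> v < \<infinity>"
proof -
  have [measurable]: "v \<in> borel_measurable M" using v by simp
  have "wnorm \<beta> v \<le> (\<integral>\<^sup>+ t. ennreal (exp (\<beta> * T)) * ennreal (norm (v t)) \<partial>M)"
    unfolding wnorm_def using \<beta>
    by (intro nn_integral_mono) (auto simp: ennreal_mult[symmetric] intro!: ennreal_leI mult_right_mono mult_left_mono)
  also have "\<dots> = ennreal (exp (\<beta> * T)) * (\<integral>\<^sup>+ t. ennreal (norm (v t)) \<partial>M)"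
    by (rule nn_integral_cmult) measurable
  also have "\<dots> < \<infinity>" using v by (simp add: integrable_iff_bounded ennreal_mult_less_top)
  finally show ?thesis .
qed

lemma wnorm_eq_0:
  assumes "v \<in> borel_measurable M" "wnorm \<beta> v = 0"
  shows "AE t in M. v t = 0"
proof -
  have [measurable]: "v \<in> borel_measurable M" by fact
  have "AE t in M. ennreal (exp (\<beta> * t) * norm (v t)) = 0"
    using assms(2) unfolding wnorm_def by (subst (asm) nn_integral_0_iff_AE) measurable
  then show ?thesis by eventually_elim (simp add: ennreal_eq_0_iff mult_le_0_iff)
qed

lemma ex_contraction:
  "\<exists>\<beta>\<ge>0. \<forall>v w. integrable M v \<longrightarrow> integrable M w \<longrightarrow>
     wnorm \<beta> (\<lambda>t. step v t - step w t) \<le> ennreal (1/2) * wnorm \<beta> (\<lambda>t. v t - w t)"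
proof -
  \<comment> \<open>With kernel mass 1 / (2 (L + 1)) and Lipschitz constant \<open>L\<close> the
    product stays below 1/2; \<open>L + 1\<close> instead of \<open>L\<close> covers
    \<open>L = 0\<close>.\<close>
  have \<eta>: "0 < 1 / (2 * (L + 1))" using L_nonneg by simp
  obtain \<beta> where \<beta>: "0 \<le> \<beta>" "\<And>s. s \<in> {0..T} \<Longrightarrow>
      (\<integral>\<^sup>+ t. ennreal (exp (- \<beta> * (s - t)) * kap (s - t)) \<partial>M) \<le> ennreal (1 / (2 * (L + 1)))"
    using ex_weight[OF \<eta>] by blast
  have "wnorm \<beta> (\<lambda>t. step v t - step w t) \<le> ennreal (1/2) * wnorm \<beta> (\<lambda>t. v t - w t)"
    if v: "integrable M v" and w: "integrable M w" for v w
  proof -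
    have [measurable]: "v \<in> borel_measurable M" "w \<in> borel_measurable M" using v w by auto
    have "wnorm \<beta> (\<lambda>t. step v t - step w t)
        = (\<integral>\<^sup>+ t. ennreal (exp (\<beta> * t) * norm (Z (\<lambda>s. N s (v s)) t - Z (\<lambda>s. N s (w s)) t)) \<partial>M)"
      by (simp add: wnorm_def step_def mild_grad_def)
    also have "\<dots> \<le> ennreal (1 / (2 * (L + 1))) * (\<integral>\<^sup>+ s. ennreal (exp (\<beta> * s) * norm (N s (v s) - N s (w s))) \<partial>M)"
      by (rule Z_diff_bound[OF N_integrable[OF v] N_integrable[OF w] \<beta>(2)])
    also have "\<dots> \<le> ennreal (1 / (2 * (L + 1))) * (\<integral>\<^sup>+ s. ennreal L * ennreal (exp (\<beta> * s) * norm (v s - w s)) \<partial>M)"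
    proof (intro mult_left_mono nn_integral_mono)
      fix s assume "s \<in> space M"
      then have "exp (\<beta> * s) * norm (N s (v s) - N s (w s)) \<le> exp (\<beta> * s) * (L * norm (v s - w s))"
        by (intro mult_left_mono lip) auto
      then show "ennreal (exp (\<beta> * s) * norm (N s (v s) - N s (w s))) \<le> ennreal L * ennreal (exp (\<beta> * s) * norm (v s - w s))"
        using L_nonneg by (simp add: ennreal_mult[symmetric] ennreal_leI mult_ac)
    qed simp
    also have "\<dots> = ennreal (1 / (2 * (L + 1))) * (ennreal L * wnorm \<beta> (\<lambda>t. v t - w t))"
      unfolding wnorm_def by (subst nn_integral_cmult) measurable
    also have "\<dots> = ennreal (1 / (2 * (L + 1)) * L) * wnorm \<beta> (\<lambda>t. v t - w t)"
      using L_nonneg by (subst ennreal_mult) (simp_all only: mult.assoc, simp)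
    also have "\<dots> \<le> ennreal (1/2) * wnorm \<beta> (\<lambda>t. v t - w t)"
      using L_nonneg by (intro mult_right_mono ennreal_leI) (auto simp: field_simps)
    finally show ?thesis .
  qed
  then show ?thesis using \<beta>(1) by blast
qed

lemma fixpoint_unique:
  assumes v: "integrable M v" "AE t in M. v t = step v t"
    and w: "integrable M w" "AE t in M. w t = step w t"
  shows "AE t in M. v t = w t"
proof -
  obtain \<beta> where \<beta>: "0 \<le> \<beta>" and c: "wnorm \<beta> (\<lambda>t. step v t - step w t) \<le> ennreal (1/2) * wnorm \<beta> (\<lambda>t. v t - w t)"
    using ex_contraction v(1) w(1) by blast
  have "wnorm \<beta> (\<lambda>t. v t - w t) = wnorm \<beta> (\<lambda>t. step v t - step w t)"
    unfolding wnorm_def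
  proof (rule nn_integral_cong_AE)
    show "AE t in M. ennreal (exp (\<beta> * t) * norm (v t - w t)) = ennreal (exp (\<beta> * t) * norm (step v t - step w t))"
      using v(2) w(2) by eventually_elim simp
  qed
  then have le: "wnorm \<beta> (\<lambda>t. v t - w t) \<le> ennreal (1/2) * wnorm \<beta> (\<lambda>t. v t - w t)" using c by simp
  have fin: "wnorm \<beta> (\<lambda>t. v t - w t) < \<infinity>" by (rule wnorm_finite[OF _ \<beta>]) (use v w in auto)
  then obtain r where r: "0 \<le> r" "wnorm \<beta> (\<lambda>t. v t - w t) = ennreal r"
    by (metis ennreal_cases infinity_ennreal_def less_irrefl)
  have "ennreal r \<le> ennreal (1/2 * r)"
    using le unfolding r(2) by (subst ennreal_mult) (use r(1) in simp_all)
  then have "r \<le> 1/2 * r" using r(1) by (subst (asm) ennreal_le_iff) auto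
  then have "r = 0" using r(1) by simp
  then have "AE t in M. v t - w t = 0" using r v w by (intro wnorm_eq_0[of _ \<beta>]) auto
  then show ?thesis by eventually_elim simp
qed

text \<open>Picard iteration from 0 in the weighted L^1 norm. The increments decay geometrically, so
  their series converges almost everywhere and in the norm, and its sum \<open>w\<close> has
  distance 0 from \<open>step w\<close>.\<close>

lemma fixpoint_exists: "\<exists>v. integrable M v \<and> (AE t in M. v t = step v t)"
proof -
  obtain \<beta> where \<beta>: "0 \<le> \<beta>" and contr: "\<And>v w. integrable M v \<Longrightarrow> integrable M w \<Longrightarrow>
     wnorm \<beta> (\<lambda>t. step v t - step w t) \<le> ennreal (1/2) * wnorm \<beta> (\<lambda>t. v t - w t)"
    using ex_contraction by blast
  define v where "v = (\<lambda>n. (step ^^ n) (\<lambda>t. 0))"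
  have v_Suc: "v (Suc n) = step (v n)" for n by (simp add: v_def)
  have v_int: "integrable M (v n)" for n
    by (induction n) (auto simp: v_Suc integrable_step, simp add: v_def)
  define d where "d = (\<lambda>n t. v (Suc n) t - v n t)"
  have d_int: "integrable M (d n)" for n unfolding d_def by (intro Bochner_Integration.integrable_diff v_int)
  have [measurable]: "d n \<in> borel_measurable M" "v n \<in> borel_measurable M" for n using d_int v_int by auto
  obtain C where C: "0 \<le> C" "wnorm \<beta> (d 0) = ennreal C"
    using wnorm_finite[OF d_int \<beta>, of 0] by (metis ennreal_cases infinity_ennreal_def less_irrefl)
  have e: "wnorm \<beta> (d n) \<le> ennreal (C * (1/2)^n)" for n
  proof (induction n)
    case (Suc n)
    have "wnorm \<beta> (d (Suc n)) \<le> ennreal (1/2) * wnorm \<beta> (d n)"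
      using contr[OF v_int[of "Suc n"] v_int[of n]] by (simp add: d_def v_Suc)
    also have "\<dots> \<le> ennreal (1/2) * ennreal (C * (1/2)^n)" by (intro mult_left_mono Suc) simp
    also have "\<dots> = ennreal (C * (1/2)^Suc n)" using C by (subst ennreal_mult[symmetric]) (auto simp: mult_ac)
    finally show ?case .
  qed (simp add: C)
  have tail: "(\<integral>\<^sup>+ t. (\<Sum>k. ennreal (exp (\<beta> * t) * norm (d (k + n) t))) \<partial>M) \<le> ennreal (2 * C * (1/2)^n)" for n
  proof -
    have "(\<integral>\<^sup>+ t. (\<Sum>k. ennreal (exp (\<beta> * t) * norm (d (k + n) t))) \<partial>M) = (\<Sum>k. wnorm \<beta> (d (k + n)))"
      unfolding wnorm_def by (rule nn_integral_suminf) measurable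
    also have "\<dots> \<le> (\<Sum>k. ennreal (C * (1/2)^(k + n)))" by (intro suminf_le e) auto
    also have "\<dots> = ennreal (\<Sum>k. C * (1/2)^(k + n))"
    proof (rule suminf_ennreal2)
      show "summable (\<lambda>k. C * (1/2)^(k + n))" by (simp add: power_add summable_mult summable_mult2 summable_geometric)
    qed (use C in auto)
    also have "(\<Sum>k. C * (1/2)^(k + n)) = 2 * C * (1/2)^n"
    proof -
      have "(\<lambda>k. (C * (1/2)^n) * (1/2)^k) sums ((C * (1/2)^n) * (1 / (1 - 1/2)))"
        by (intro sums_mult geometric_sums) simp
      then show ?thesis by (intro sums_unique[symmetric]) (simp add: power_add mult_ac)
    qed
    finally show ?thesis .
  qed
  have exp1: "norm x \<le> exp (\<beta> * t) * norm x" if "t \<in> space M" for t and x :: "'a \<times> 'a"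
    using that \<beta> by (simp add: mult_le_cancel_right1)
  have summ: "AE t in M. summable (\<lambda>k. norm (d k t))"
  proof -
    have "(\<integral>\<^sup>+ t. (\<Sum>k. ennreal (exp (\<beta> * t) * norm (d k t))) \<partial>M) \<noteq> \<infinity>"
      using tail[of 0] by (auto simp: top_unique)
    then have "AE t in M. (\<Sum>k. ennreal (exp (\<beta> * t) * norm (d k t))) \<noteq> \<infinity>"
      by (intro nn_integral_PInf_AE) measurable
    then show ?thesis
    using AE_space
    proof eventually_elim
      case (elim t)
      have "(\<Sum>k. ennreal (norm (d k t))) \<le> (\<Sum>k. ennreal (exp (\<beta> * t) * norm (d k t)))"
        by (intro suminf_le ennreal_leI exp1[OF elim(2)]) auto
      then have "(\<Sum>k. ennreal (norm (d k t))) \<noteq> top" using elim(1) by (auto simp: top_unique)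
      then show ?case by (intro summable_suminf_not_top) auto
    qed
  qed
  define w where "w = (\<lambda>t. \<Sum>k. d k t)"
  have norm_le: "(\<integral>t. norm (d k t) \<partial>M) \<le> C * (1/2)^k" for k
  proof -
    have "ennreal (\<integral>t. norm (d k t) \<partial>M) = (\<integral>\<^sup>+ t. ennreal (norm (d k t)) \<partial>M)"
      by (rule nn_integral_eq_integral[symmetric]) (use d_int in auto)
    also have "\<dots> \<le> wnorm \<beta> (d k)"
      unfolding wnorm_def by (intro nn_integral_mono ennreal_leI exp1)
    also have "\<dots> \<le> ennreal (C * (1/2)^k)" by (rule e)
    finally show ?thesis using C by (subst (asm) ennreal_le_iff) auto
  qed
  have w_int: "integrable M w"
    unfolding w_def
  proof (rule integrable_suminf[OF d_int summ])
    show "summable (\<lambda>k. \<integral>t. norm (d k t) \<partial>M)"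
      by (rule summable_comparison_test'[where g = "\<lambda>k. C * (1/2)^k" and N = 0])
         (auto intro!: summable_mult summable_geometric norm_le)
  qed
  have v_sum: "v n t = (\<Sum>k<n. d k t)" for n t
    by (induction n) (simp_all add: d_def, simp add: v_def)
  have dist: "wnorm \<beta> (\<lambda>t. w t - v n t) \<le> ennreal (2 * C * (1/2)^n)" for n
  proof -
    have "wnorm \<beta> (\<lambda>t. w t - v n t) \<le> (\<integral>\<^sup>+ t. (\<Sum>k. ennreal (exp (\<beta> * t) * norm (d (k + n) t))) \<partial>M)"
      unfolding wnorm_def
    proof (rule nn_integral_mono_AE)
      show "AE t in M. ennreal (exp (\<beta> * t) * norm (w t - v n t)) \<le> (\<Sum>k. ennreal (exp (\<beta> * t) * norm (d (k + n) t)))"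
        using summ
      proof eventually_elim
        case (elim t)
        have sd: "summable (\<lambda>k. d k t)" by (rule summable_norm_cancel[OF elim])
        have sn: "summable (\<lambda>k. norm (d (k + n) t))" using elim by (rule summable_ignore_initial_segment)
        have "w t - v n t = (\<Sum>k. d (k + n) t)"
          unfolding w_def v_sum using suminf_split_initial_segment[OF sd, of n] by simp
        then have "norm (w t - v n t) \<le> (\<Sum>k. norm (d (k + n) t))"
          using summable_norm[OF sn] by simp
        then have "exp (\<beta> * t) * norm (w t - v n t) \<le> exp (\<beta> * t) * (\<Sum>k. norm (d (k + n) t))"
          by (intro mult_left_mono) auto
        also have "\<dots> = (\<Sum>k. exp (\<beta> * t) * norm (d (k + n) t))" by (rule suminf_mult[OF sn, symmetric])
        finally have "ennreal (exp (\<beta> * t) * norm (w t - v n t)) \<le> ennreal (\<Sum>k. exp (\<beta> * t) * norm (d (k + n) t))"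
          by (rule ennreal_leI)
        also have "\<dots> = (\<Sum>k. ennreal (exp (\<beta> * t) * norm (d (k + n) t)))"
          by (rule suminf_ennreal2[symmetric]) (auto intro: summable_mult sn)
        finally show ?case .
      qed
    qed
    then show ?thesis using tail[of n] by (rule order_trans)
  qed
  have sw_int: "integrable M (step w)" by (rule integrable_step[OF w_int])
  \<comment> \<open>Both \<open>w\<close> and \<open>step w\<close> are close to
    \<open>v (Suc n)\<close>: the former by the tail estimate, the latter because
    \<open>step\<close> contracts the distance of \<open>w\<close> from \<open>v n\<close>.\<close>
  have bound: "wnorm \<beta> (\<lambda>t. w t - step w t) \<le> ennreal (4 * C * (1/2)^Suc n)" for n
  proof -
    have [measurable]: "w \<in> borel_measurable M" "step w \<in> borel_measurable M" using w_int sw_int by auto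
    have "wnorm \<beta> (\<lambda>t. w t - step w t) \<le> (\<integral>\<^sup>+ t. ennreal (exp (\<beta> * t) * norm (w t - v (Suc n) t))
        + ennreal (exp (\<beta> * t) * norm (step w t - v (Suc n) t)) \<partial>M)"
      unfolding wnorm_def
    proof (rule nn_integral_mono)
      fix t
      have "norm (w t - step w t) \<le> norm (w t - v (Suc n) t) + norm (step w t - v (Suc n) t)"
        using norm_triangle_ineq4[of "w t - v (Suc n) t" "step w t - v (Suc n) t"] by simp
      then have "exp (\<beta> * t) * norm (w t - step w t) \<le> exp (\<beta> * t) * (norm (w t - v (Suc n) t) + norm (step w t - v (Suc n) t))"
        by (intro mult_left_mono) auto
      then have "ennreal (exp (\<beta> * t) * norm (w t - step w t))
          \<le> ennreal (exp (\<beta> * t) * norm (w t - v (Suc n) t) + exp (\<beta> * t) * norm (step w t - v (Suc n) t))"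
        by (intro ennreal_leI) (simp only: distrib_left)
      also have "\<dots> = ennreal (exp (\<beta> * t) * norm (w t - v (Suc n) t)) + ennreal (exp (\<beta> * t) * norm (step w t - v (Suc n) t))"
        by (rule ennreal_plus) auto
      finally show "ennreal (exp (\<beta> * t) * norm (w t - step w t)) \<le> ennreal (exp (\<beta> * t) * norm (w t - v (Suc n) t))
        + ennreal (exp (\<beta> * t) * norm (step w t - v (Suc n) t))" .
    qed
    also have "\<dots> = wnorm \<beta> (\<lambda>t. w t - v (Suc n) t) + wnorm \<beta> (\<lambda>t. step w t - v (Suc n) t)"
      unfolding wnorm_def by (rule nn_integral_add) measurable
    also have "\<dots> \<le> ennreal (2 * C * (1/2)^Suc n) + ennreal (1/2) * ennreal (2 * C * (1/2)^n)"
    proof (intro add_mono dist)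
      have "wnorm \<beta> (\<lambda>t. step w t - v (Suc n) t) \<le> ennreal (1/2) * wnorm \<beta> (\<lambda>t. w t - v n t)"
        unfolding v_Suc by (rule contr[OF w_int v_int])
      also have "\<dots> \<le> ennreal (1/2) * ennreal (2 * C * (1/2)^n)" by (intro mult_left_mono dist) simp
      finally show "wnorm \<beta> (\<lambda>t. step w t - v (Suc n) t) \<le> ennreal (1/2) * ennreal (2 * C * (1/2)^n)" .
    qed
    also have "\<dots> = ennreal (4 * C * (1/2)^Suc n)"
    proof -
      have "ennreal (1/2) * ennreal (2 * C * (1/2)^n) = ennreal (2 * C * (1/2)^Suc n)"
        by (subst ennreal_mult[symmetric]) (use C in auto)
      moreover have "ennreal (2 * C * (1/2)^Suc n) + ennreal (2 * C * (1/2)^Suc n)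
          = ennreal (2 * C * (1/2)^Suc n + 2 * C * (1/2)^Suc n)"
        by (rule ennreal_plus[symmetric]) (use C in auto)
      ultimately show ?thesis by (simp only:) (simp add: algebra_simps)
    qed
    finally show ?thesis .
  qed
  have "wnorm \<beta> (\<lambda>t. w t - step w t) = 0"
  proof -
    have "(\<lambda>n. ennreal (4 * C * (1/2)^Suc n)) \<longlonglongrightarrow> ennreal (4 * C * 0)"
      by (intro tendsto_ennrealI tendsto_mult tendsto_const LIMSEQ_Suc LIMSEQ_realpow_zero) auto
    then have "wnorm \<beta> (\<lambda>t. w t - step w t) \<le> ennreal (4 * C * 0)"
      by (rule LIMSEQ_le_const) (use bound in auto)
    then show ?thesis by simp
  qed
  then have "AE t in M. w t - step w t = 0"
    using w_int sw_int by (intro wnorm_eq_0[of _ \<beta>]) auto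
  then have "AE t in M. w t = step w t" by eventually_elim simp
  then show ?thesis using w_int by blast
qed

text \<open>The weak equation in gradient form: the operator is replaced by the pairing of
  gradients, the test pairs range over all of \<open>G\<close>, and the integral from t to T is
  written as a cut-off over \<open>M\<close>.\<close>

definition weak_sol :: "(real \<Rightarrow> 'a) \<Rightarrow> (real \<Rightarrow> 'a) \<Rightarrow> bool" where
  "weak_sol u u' \<longleftrightarrow> integrable M u \<and> integrable M u' \<and> (AE t in M. (u t, u' t) \<in> G) \<and>
    (\<forall>(p, q)\<in>G. \<forall>t\<in>{0..T}. u t \<bullet> p = g \<bullet> p - (\<integral>s. indicator {t<..} s *\<^sub>R (u' s \<bullet> q) \<partial>M)
      + (\<integral>s. indicator {t<..} s *\<^sub>R (N s (u s, u' s) \<bullet> p) \<partial>M))"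

lemma indicator_measurable_M [measurable]: "(\<lambda>r. indicator {t<..} r :: real) \<in> borel_measurable M"
  by (rule borel_measurable_M) measurable

lemma integrable_fst: "integrable M v \<Longrightarrow> integrable M (\<lambda>t. fst (v t :: 'a \<times> 'a))"
  by (rule integrable_bounded_linear[OF bounded_linear_fst])

lemma integrable_snd: "integrable M v \<Longrightarrow> integrable M (\<lambda>t. snd (v t :: 'a \<times> 'a))"
  by (rule integrable_bounded_linear[OF bounded_linear_snd])

lemma integrable_Pair:
  fixes u u' :: "real \<Rightarrow> 'a"
  assumes "integrable M u" "integrable M u'"
  shows "integrable M (\<lambda>t. (u t, u' t))"
proof -
  have "integrable M (\<lambda>t. (u t, 0) + (0, u' t))"
    by (intro Bochner_Integration.integrable_add
        integrable_bounded_linear[OF bounded_linear_Pair[OF bounded_linear_ident bounded_linear_zero]]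
        integrable_bounded_linear[OF bounded_linear_Pair[OF bounded_linear_zero bounded_linear_ident]] assms)
  then show ?thesis by simp
qed

text \<open>The fixed point is determined only almost everywhere in time. Taking \<open>mild\<close>
  of its nonlinear term as \<open>u\<close> selects the version for which \<open>mild_weak\<close>
  holds at every t.\<close>

lemma weak_sol_exists: "\<exists>u u'. weak_sol u u'"
proof -
  obtain v where v: "integrable M v" "AE t in M. v t = step v t" using fixpoint_exists by blast
  define F where "F = (\<lambda>s. N s (v s))"
  have F: "integrable M F" unfolding F_def by (rule N_integrable[OF v(1)])
  define u where "u = mild g F"
  define u' where "u' = (\<lambda>t. snd (v t))"
  have uv: "AE t in M. fst (v t) = u t"
    using AE_mild[OF F, of g] v(2) by eventually_elim (simp add: u_def step_def F_def)
  have u_int: "integrable M u"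
    by (rule integrable_lebesgue_on_AE[OF integrable_fst[OF v(1)] _ uv]) simp
  have u'_int: "integrable M u'" unfolding u'_def by (rule integrable_snd[OF v(1)])
  have [measurable]: "u \<in> borel_measurable M" "u' \<in> borel_measurable M" "F \<in> borel_measurable M"
    "v \<in> borel_measurable M" using u_int u'_int F v by auto
  have Nm [measurable]: "(\<lambda>s. N s (u s, u' s)) \<in> borel_measurable M"
    by (rule N_compose_measurable) measurable
  have G: "AE t in M. (u t, u' t) \<in> G"
    using uv v(2)
  proof eventually_elim
    case (elim t)
    have "(u t, u' t) = step v t" using elim by (simp add: u'_def prod_eq_iff)
    then show ?case by (simp add: step_def mild_grad_in_G)
  qed
  have "u t \<bullet> p = g \<bullet> p - (\<integral>s. indicator {t<..} s *\<^sub>R (u' s \<bullet> q) \<partial>M)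
      + (\<integral>s. indicator {t<..} s *\<^sub>R (N s (u s, u' s) \<bullet> p) \<partial>M)" if pq: "(p, q) \<in> G" and t: "t \<in> {0..T}" for p q t
  proof -
    have 1: "(\<integral>s. indicator {t<..} s *\<^sub>R (snd (mild_grad g F s) \<bullet> q) \<partial>M) = (\<integral>s. indicator {t<..} s *\<^sub>R (u' s \<bullet> q) \<partial>M)"
    proof (rule integral_cong_AE)
      have [measurable]: "(\<lambda>s. snd (mild_grad g F s) \<bullet> q) \<in> borel_measurable M"
        by (rule borel_measurable_snd_inner) (use integrable_mild_grad[OF F] in auto)
      show "(\<lambda>s. indicator {t<..} s *\<^sub>R (snd (mild_grad g F s) \<bullet> q)) \<in> borel_measurable M" by measurable
      show "AE s in M. indicator {t<..} s *\<^sub>R (snd (mild_grad g F s) \<bullet> q) = indicator {t<..} s *\<^sub>R (u' s \<bullet> q)"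
        using v(2)
      proof eventually_elim
        case (elim s)
        have "snd (mild_grad g F s) = u' s" unfolding u'_def by (subst elim) (simp only: step_def F_def)
        then show ?case by simp
      qed
    qed measurable
    have 2: "(\<integral>s. indicator {t<..} s *\<^sub>R (F s \<bullet> p) \<partial>M) = (\<integral>s. indicator {t<..} s *\<^sub>R (N s (u s, u' s) \<bullet> p) \<partial>M)"
    proof (rule integral_cong_AE)
      show "AE s in M. indicator {t<..} s *\<^sub>R (F s \<bullet> p) = indicator {t<..} s *\<^sub>R (N s (u s, u' s) \<bullet> p)"
        using uv
      proof eventually_elim
        case (elim s)
        then have "(u s, u' s) = v s" by (simp add: u'_def prod_eq_iff)
        then show ?case by (simp add: F_def)
      qed
    qed measurable
    show ?thesis using mild_weak[OF F pq t, of g] unfolding 1 2 u_def[symmetric] .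
  qed
  then have "weak_sol u u'" unfolding weak_sol_def using u_int u'_int G by blast
  then show ?thesis by blast
qed

text \<open>The difference between \<open>u\<close> and the mild solution with source
  \<open>N s (u s, u' s)\<close> solves the homogeneous linear problem and lies in \<open>G\<close>
  almost everywhere, so \<open>linear_uniqueness\<close> annihilates it at every t, and
  \<open>single\<close> its gradient at almost every t.\<close>

lemma weak_sol_mild:
  assumes sol: "weak_sol u u'"
  shows "\<And>t. t \<in> {0..T} \<Longrightarrow> u t = mild g (\<lambda>s. N s (u s, u' s)) t"
    and "AE t in M. (u t, u' t) = step (\<lambda>s. (u s, u' s)) t"
proof -
  have u: "integrable M u" "integrable M u'" and G: "AE t in M. (u t, u' t) \<in> G"
    and weak: "\<And>p q t. (p, q) \<in> G \<Longrightarrow> t \<in> {0..T} \<Longrightarrow> u t \<bullet> p = g \<bullet> p - (\<integral>s. indicator {t<..} s *\<^sub>R (u' s \<bullet> q) \<partial>M)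
      + (\<integral>s. indicator {t<..} s *\<^sub>R (N s (u s, u' s) \<bullet> p) \<partial>M)"
    using sol unfolding weak_sol_def by blast+
  define F where "F = (\<lambda>s. N s (u s, u' s))"
  have F_app: "N s (u s, u' s) = F s" for s by (simp add: F_def)
  have F: "integrable M F" unfolding F_def by (rule N_integrable[OF integrable_Pair[OF u]])
  define m where "m = mild_grad g F"
  have m_int: "integrable M m" unfolding m_def by (rule integrable_mild_grad[OF F])
  have mf: "AE t in M. fst (m t) = mild g F t"
    using AE_mild[OF F, of g] by eventually_elim (simp add: m_def)
  have mild_int: "integrable M (mild g F)"
    by (rule integrable_lebesgue_on_AE[OF integrable_fst[OF m_int] _ mf]) simp
  define w where "w = (\<lambda>t. u t - mild g F t)"
  define w' where "w' = (\<lambda>t. u' t - snd (m t))"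
  have w_int: "integrable M w" "integrable M w'"
    unfolding w_def w'_def by (intro Bochner_Integration.integrable_diff u mild_int integrable_snd[OF m_int])+
  have wG: "AE t in M. (w t, w' t) \<in> G"
    using G mf
  proof eventually_elim
    case (elim t)
    have "(w t, w' t) = (u t, u' t) - m t" using elim by (simp add: w_def w'_def prod_eq_iff)
    then show ?case
      using subspace_diff[OF subspace_G elim(1)] mild_grad_in_G by (simp add: m_def)
  qed
  have w0: "w t = 0" if t: "t \<in> {0..T}" for t
  proof (rule linear_uniqueness[OF w_int wG _ t])
    fix p q t assume pq: "(p, q) \<in> G" and t: "t \<in> {0..T}"
    have i1: "integrable M (\<lambda>s. indicator {t<..} s *\<^sub>R (u' s \<bullet> q))"
    proof (rule Bochner_Integration.integrable_bound)
      show "integrable M (\<lambda>s. u' s \<bullet> q)" by (intro integrable_inner_left u)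
      have [measurable]: "u' \<in> borel_measurable M" using u by simp
      show "(\<lambda>s. indicator {t<..} s *\<^sub>R (u' s \<bullet> q)) \<in> borel_measurable M" by measurable
    qed (auto simp: indicator_def)
    have i2: "integrable M (\<lambda>s. indicator {t<..} s *\<^sub>R (snd (m s) \<bullet> q))"
    proof (rule Bochner_Integration.integrable_bound)
      show "integrable M (\<lambda>s. snd (m s) \<bullet> q)" by (intro integrable_inner_left integrable_snd m_int)
      then have [measurable]: "(\<lambda>s. snd (m s) \<bullet> q) \<in> borel_measurable M" by simp
      show "(\<lambda>s. indicator {t<..} s *\<^sub>R (snd (m s) \<bullet> q)) \<in> borel_measurable M" by measurable
    qed (auto simp: indicator_def)
    show "w t \<bullet> p = - (\<integral>s. indicator {t<..} s *\<^sub>R (w' s \<bullet> q) \<partial>M)"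
      using weak[OF pq t] mild_weak[OF F pq t, of g] Bochner_Integration.integral_diff[OF i1 i2]
      by (simp add: w_def w'_def F_app m_def[symmetric] inner_diff_left right_diff_distrib)
  qed
  then show um: "u t = mild g (\<lambda>s. N s (u s, u' s)) t" if "t \<in> {0..T}" for t
    using that by (simp add: w_def F_def)
  show "AE t in M. (u t, u' t) = step (\<lambda>s. (u s, u' s)) t"
    using wG mf AE_space
  proof eventually_elim
    case (elim t)
    have "w t = 0" using w0 elim(3) by simp
    then have "w' t = 0" using elim(1) single by simp
    then show ?case using \<open>w t = 0\<close> elim(2)
      by (simp add: w_def w'_def step_def F_app m_def[symmetric] prod_eq_iff)
  qed
qed

text \<open>The contraction identifies the pairs only for almost every t. The mild formula sees its
  source through an integral in time, which raises this to every t.\<close>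

lemma weak_sol_unique:
  assumes u: "weak_sol u u'" and w: "weak_sol w w'" and t: "t \<in> {0..T}"
  shows "u t = w t"
proof -
  have ui: "integrable M (\<lambda>t. (u t, u' t))" and wi: "integrable M (\<lambda>t. (w t, w' t))"
    using u w by (auto simp: weak_sol_def intro!: integrable_Pair)
  have eq: "AE t in M. (u t, u' t) = (w t, w' t)"
    by (rule fixpoint_unique[OF ui weak_sol_mild(2)[OF u] wi weak_sol_mild(2)[OF w]])
  have "(\<integral>s. fst (W (s - t) (N s (u s, u' s))) \<partial>M) = (\<integral>s. fst (W (s - t) (N s (w s, w' s))) \<partial>M)"
  proof (rule integral_cong_AE)
    show "(\<lambda>s. fst (W (s - t) (N s (u s, u' s)))) \<in> borel_measurable M"
      using integrable_fst_W[OF N_integrable[OF ui]] by simp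
    show "(\<lambda>s. fst (W (s - t) (N s (w s, w' s)))) \<in> borel_measurable M"
      using integrable_fst_W[OF N_integrable[OF wi]] by simp
    show "AE s in M. fst (W (s - t) (N s (u s, u' s))) = fst (W (s - t) (N s (w s, w' s)))"
      using eq by eventually_elim simp
  qed
  then show ?thesis using weak_sol_mild(1)[OF u t] weak_sol_mild(1)[OF w t] by (simp add: mild_def)
qed

end

section \<open>A separable Hilbert space of square integrable functions on the half-line\<close>

section \<open>A Hilbert space of square integrable functions\<close>

lemma L2_spaceD: "h \<in> L2_space M \<Longrightarrow> h \<in> borel_measurable M" "h \<in> L2_space M \<Longrightarrow> integrable M (\<lambda>x. (h x)\<^sup>2)"
  by (auto simp: L2_space_def)

lemma L2_mult_integrable:
  assumes "h \<in> L2_space M" "k \<in> L2_space M"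
  shows "integrable M (\<lambda>x. h x * k x)"
proof (rule Bochner_Integration.integrable_bound)
  show "integrable M (\<lambda>x. (h x)\<^sup>2 + (k x)\<^sup>2)" using assms by (auto simp: L2_space_def)
  show "(\<lambda>x. h x * k x) \<in> borel_measurable M" using assms by (auto simp: L2_space_def)
  have "\<bar>a * b\<bar> \<le> a\<^sup>2 + b\<^sup>2" for a b :: real
    using sum_squares_bound[of "\<bar>a\<bar>" "\<bar>b\<bar>"] mult_nonneg_nonneg[of "\<bar>a\<bar>" "\<bar>b\<bar>"]
    unfolding abs_mult power2_abs by linarith
  then show "AE x in M. norm (h x * k x) \<le> norm ((h x)\<^sup>2 + (k x)\<^sup>2)" by simp
qed

lemma L2_add:
  assumes "h \<in> L2_space M" "k \<in> L2_space M"
  shows "(\<lambda>x. h x + k x) \<in> L2_space M"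
proof -
  have "integrable M (\<lambda>x. (h x)\<^sup>2 + (k x)\<^sup>2 + 2 * (h x * k x))"
    using assms L2_mult_integrable[OF assms] by (auto simp: L2_space_def)
  then show ?thesis using assms by (auto simp: L2_space_def power2_sum algebra_simps)
qed

lemma L2_scale: "h \<in> L2_space M \<Longrightarrow> (\<lambda>x. c * h x) \<in> L2_space M"
  by (auto simp: L2_space_def power_mult_distrib)

lemma L2_zero [simp]: "(\<lambda>x. 0) \<in> L2_space M" by (simp add: L2_space_def)

lemma L2_uminus: "h \<in> L2_space M \<Longrightarrow> (\<lambda>x. - h x) \<in> L2_space M"
  using L2_scale[of h M "-1"] by simp

lemma L2_diff: "h \<in> L2_space M \<Longrightarrow> k \<in> L2_space M \<Longrightarrow> (\<lambda>x. h x - k x) \<in> L2_space M"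
  using L2_add[OF _ L2_uminus, of h M k] by simp

lemma L2_bound:
  assumes "h \<in> L2_space M" "k \<in> borel_measurable M" "AE x in M. \<bar>k x\<bar> \<le> \<bar>h x\<bar>"
  shows "k \<in> L2_space M"
proof -
  have "integrable M (\<lambda>x. (k x)\<^sup>2)"
  proof (rule Bochner_Integration.integrable_bound[OF L2_spaceD(2)[OF assms(1)]])
    show "AE x in M. norm ((k x)\<^sup>2) \<le> norm ((h x)\<^sup>2)"
      using assms(3) by eventually_elim (simp add: abs_le_square_iff)
  qed (use assms(2) in simp)
  then show ?thesis using assms(2) by (simp add: L2_space_def)
qed

lemma L2_cong_AE:
  assumes "h \<in> L2_space M" "k \<in> borel_measurable M" "AE x in M. k x = h x"
  shows "k \<in> L2_space M"
proof (rule L2_bound[OF assms(1,2)])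
  show "AE x in M. \<bar>k x\<bar> \<le> \<bar>h x\<bar>" using assms(3) by eventually_elim simp
qed

lemma L2_inner_cong_AE:
  assumes "h \<in> borel_measurable M" "h' \<in> borel_measurable M" "k \<in> borel_measurable M" "k' \<in> borel_measurable M"
    "AE x in M. h x = h' x" "AE x in M. k x = k' x"
  shows "L2_inner M h k = L2_inner M h' k'"
  unfolding L2_inner_def
proof (rule integral_cong_AE)
  show "AE x in M. h x * k x = h' x * k' x" using assms(5,6) by eventually_elim simp
qed (use assms in auto)

text \<open>The half-line with Lebesgue measure; \<open>L\<^sup>2(d\<mu>)\<close> for each \<open>\<delta>\<close> is isometric to its \<open>L\<^sup>2\<close> space.\<close>

definition half_line :: "real measure" where "half_line = restrict_space lborel {0..}"

lemma space_half_line [simp]: "space half_line = {0..}"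
  by (simp add: half_line_def space_restrict_space)

definition l2_rel :: "(real \<Rightarrow> real) \<Rightarrow> (real \<Rightarrow> real) \<Rightarrow> bool" where
  "l2_rel h k \<longleftrightarrow> h \<in> L2_space half_line \<and> k \<in> L2_space half_line \<and> (AE x in half_line. h x = k x)"

lemma part_equivp_l2_rel: "part_equivp l2_rel"
proof (rule part_equivpI)
  show "\<exists>x. l2_rel x x" by (rule exI[of _ "\<lambda>x. 0"]) (simp add: l2_rel_def)
  show "symp l2_rel" by (auto simp: symp_def l2_rel_def)
  show "transp l2_rel"
  proof (rule transpI)
    fix h k l assume "l2_rel h k" "l2_rel k l"
    moreover from this have "AE x in half_line. h x = k x" "AE x in half_line. k x = l x"
      by (auto simp: l2_rel_def)
    then have "AE x in half_line. h x = l x" by eventually_elim simp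
    ultimately show "l2_rel h l" by (simp add: l2_rel_def)
  qed
qed

quotient_type l2 = "real \<Rightarrow> real" / partial: l2_rel
  by (rule part_equivp_l2_rel)

instantiation l2 :: real_inner
begin

lift_definition zero_l2 :: l2 is "\<lambda>x. 0" by (simp add: l2_rel_def)

lift_definition plus_l2 :: "l2 \<Rightarrow> l2 \<Rightarrow> l2" is "\<lambda>h k x. h x + k x"
  by (auto simp: l2_rel_def intro: L2_add)

lift_definition minus_l2 :: "l2 \<Rightarrow> l2 \<Rightarrow> l2" is "\<lambda>h k x. h x - k x"
  by (auto simp: l2_rel_def intro: L2_diff)

lift_definition uminus_l2 :: "l2 \<Rightarrow> l2" is "\<lambda>h x. - h x"
  by (auto simp: l2_rel_def intro: L2_uminus)

lift_definition scaleR_l2 :: "real \<Rightarrow> l2 \<Rightarrow> l2" is "\<lambda>c h x. c * h x"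
  by (auto simp: l2_rel_def intro: L2_scale)

lift_definition inner_l2 :: "l2 \<Rightarrow> l2 \<Rightarrow> real" is "L2_inner half_line"
  by (auto simp: l2_rel_def L2_space_def intro!: L2_inner_cong_AE)

definition norm_l2 :: "l2 \<Rightarrow> real" where "norm_l2 x = sqrt (inner x x)"
definition dist_l2 :: "l2 \<Rightarrow> l2 \<Rightarrow> real" where "dist_l2 a b = norm (a - b)"
definition sgn_l2 :: "l2 \<Rightarrow> l2" where "sgn_l2 a = inverse (norm a) *\<^sub>R a"
definition uniformity_l2 :: "(l2 \<times> l2) filter" where
  "uniformity_l2 = (INF e\<in>{0 <..}. principal {(x, y). dist x y < e})"
definition open_l2 :: "l2 set \<Rightarrow> bool" where
  "open_l2 S = (\<forall>x\<in>S. \<forall>\<^sub>F (x', y) in uniformity. x' = x \<longrightarrow> y \<in> S)"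

instance
proof
  fix a b c :: l2 and r q :: real
  show "dist a b = norm (a - b)" by (fact dist_l2_def)
  show "sgn a = inverse (norm a) *\<^sub>R a" by (fact sgn_l2_def)
  show "norm a = sqrt (a \<bullet> a)" by (fact norm_l2_def)
  show "uniformity = (INF e\<in>{0 <..}. principal {(x, y::l2). dist x y < e})"
    by (fact uniformity_l2_def)
  show "open U = (\<forall>x\<in>U. \<forall>\<^sub>F (x', y) in uniformity. x' = x \<longrightarrow> y \<in> U)" for U :: "l2 set"
    by (fact open_l2_def)
  show "a + b + c = a + (b + c)" "a + b = b + a"
    by (transfer, auto simp: l2_rel_def algebra_simps intro: L2_add)+
  show "0 + a = a" by transfer (auto simp: l2_rel_def)
  show "- a + a = 0" by transfer (auto simp: l2_rel_def)
  show "a - b = a + - b" by transfer (auto simp: l2_rel_def intro: L2_diff L2_add L2_uminus)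
  show "r *\<^sub>R (a + b) = r *\<^sub>R a + r *\<^sub>R b" "(r + q) *\<^sub>R a = r *\<^sub>R a + q *\<^sub>R a"
    "r *\<^sub>R q *\<^sub>R a = (r * q) *\<^sub>R a" "1 *\<^sub>R a = a"
    by (transfer, auto simp: l2_rel_def algebra_simps intro: L2_add L2_scale)+
  show "a \<bullet> b = b \<bullet> a" by transfer (simp add: L2_inner_def mult.commute)
  show "(a + b) \<bullet> c = a \<bullet> c + b \<bullet> c"
    by transfer (simp add: L2_inner_def l2_rel_def distrib_right L2_mult_integrable)
  show "r *\<^sub>R a \<bullet> b = r * (a \<bullet> b)" by transfer (simp add: L2_inner_def mult.assoc)
  show "0 \<le> a \<bullet> a" by transfer (simp add: L2_inner_def)
  show "(a \<bullet> a = 0) = (a = 0)"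
  proof (transfer, goal_cases)
    case (1 a)
    then have a: "a \<in> L2_space half_line" by (simp add: l2_rel_def)
    have "(L2_inner half_line a a = 0) = (AE x in half_line. a x * a x = 0)"
      unfolding L2_inner_def
      by (rule integral_nonneg_eq_0_iff_AE[OF L2_mult_integrable[OF a a]]) simp
    then show ?case using a by (simp add: l2_rel_def)
  qed
qed

end

lemma abs_l2_inner:
  "h \<in> L2_space half_line \<Longrightarrow> k \<in> L2_space half_line \<Longrightarrow> abs_l2 h \<bullet> abs_l2 k = L2_inner half_line h k"
  by (rule inner_l2.abs_eq) (simp_all add: l2_rel_def)

lemma abs_l2_add:
  "h \<in> L2_space half_line \<Longrightarrow> k \<in> L2_space half_line \<Longrightarrow> abs_l2 h + abs_l2 k = abs_l2 (\<lambda>x. h x + k x)"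
  by (rule plus_l2.abs_eq) (simp_all add: l2_rel_def)

lemma abs_l2_diff:
  "h \<in> L2_space half_line \<Longrightarrow> k \<in> L2_space half_line \<Longrightarrow> abs_l2 h - abs_l2 k = abs_l2 (\<lambda>x. h x - k x)"
  by (rule minus_l2.abs_eq) (simp_all add: l2_rel_def)

lemma abs_l2_scale: "h \<in> L2_space half_line \<Longrightarrow> c *\<^sub>R abs_l2 h = abs_l2 (\<lambda>x. c * h x)"
  by (rule scaleR_l2.abs_eq) (simp_all add: l2_rel_def)

lemma abs_l2_zero: "abs_l2 (\<lambda>x. 0) = 0"
  by (simp add: zero_l2_def)

lemma abs_l2_eq_iff:
  assumes "h \<in> L2_space half_line" "k \<in> L2_space half_line"
  shows "abs_l2 h = abs_l2 k \<longleftrightarrow> (AE x in half_line. h x = k x)"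
  using Quotient3_rel[OF Quotient3_l2, of h k] assms by (auto simp: l2_rel_def)

lemma rep_l2_in: "rep_l2 a \<in> L2_space half_line"
  using Quotient3_rep_reflp[OF Quotient3_l2, of a] by (simp add: l2_rel_def)

lemma abs_rep_l2 [simp]: "abs_l2 (rep_l2 a) = a"
  by (rule Quotient3_abs_rep[OF Quotient3_l2])

lemma norm_abs_l2:
  "h \<in> L2_space half_line \<Longrightarrow> norm (abs_l2 h) = L2_norm half_line h"
  by (simp add: norm_eq_sqrt_inner abs_l2_inner L2_norm_def)

lemma norm_abs_l2_sq:
  "h \<in> L2_space half_line \<Longrightarrow> (norm (abs_l2 h))\<^sup>2 = (\<integral>x. (h x)\<^sup>2 \<partial>half_line)"
  unfolding power2_norm_eq_inner by (simp add: abs_l2_inner L2_inner_def power2_eq_square)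

lemma nn_norm_abs_l2:
  "h \<in> L2_space half_line \<Longrightarrow> (\<integral>\<^sup>+ x. ennreal ((h x)\<^sup>2) \<partial>half_line) = ennreal ((norm (abs_l2 h))\<^sup>2)"
  by (simp add: norm_abs_l2_sq nn_integral_eq_integral L2_space_def)

subsection \<open>Completeness\<close>

text \<open>Along a subsequence with increments \<open>d k\<close> of norm at most \<open>2\<^sup>-\<^sup>k\<close> the sum of
  \<open>2\<^sup>k (d k)\<^sup>2\<close> is integrable, hence finite almost everywhere, which gives pointwise convergence.\<close>

lemma fast_Cauchy_converges:
  fixes f :: "nat \<Rightarrow> l2"
  assumes fast: "\<And>k. norm (f (Suc k) - f k) \<le> (1/2)^k"
  shows "\<exists>h\<in>L2_space half_line. (AE x in half_line. (\<lambda>k. rep_l2 (f k) x) \<longlonglongrightarrow> h x) \<and> f \<longlonglongrightarrow> abs_l2 h"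
proof -
  define \<phi> where "\<phi> = (\<lambda>k. rep_l2 (f k))"
  have \<phi>: "\<phi> k \<in> L2_space half_line" for k by (simp add: \<phi>_def rep_l2_in)
  have f_eq: "f k = abs_l2 (\<phi> k)" for k by (simp add: \<phi>_def)
  have [measurable]: "\<phi> k \<in> borel_measurable half_line" for k using \<phi> by (simp add: L2_space_def)
  define d where "d = (\<lambda>k x. \<phi> (Suc k) x - \<phi> k x)"
  have d: "d k \<in> L2_space half_line" for k unfolding d_def by (intro L2_diff \<phi>)
  have [measurable]: "d k \<in> borel_measurable half_line" for k using d by (simp add: L2_space_def)
  have dn: "(\<integral>\<^sup>+ x. ennreal ((d k x)\<^sup>2) \<partial>half_line) \<le> ennreal ((1/4)^k)" for k
  proof -
    have "(\<integral>\<^sup>+ x. ennreal ((d k x)\<^sup>2) \<partial>half_line) = ennreal ((norm (f (Suc k) - f k))\<^sup>2)"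
      unfolding d_def by (simp add: nn_norm_abs_l2[OF L2_diff[OF \<phi> \<phi>]] f_eq abs_l2_diff[OF \<phi> \<phi>])
    also have "\<dots> \<le> ennreal (((1/2)^k)\<^sup>2)" by (intro ennreal_leI power_mono fast) simp
    also have "((1/2)^k)\<^sup>2 = ((1/4)^k :: real)" by (simp add: power_mult[symmetric] mult.commute[of k] power_mult power_divide)
    finally show ?thesis .
  qed
  have "(\<integral>\<^sup>+ x. (\<Sum>k. ennreal (2^k * (d k x)\<^sup>2)) \<partial>half_line) = (\<Sum>k. \<integral>\<^sup>+ x. ennreal (2^k * (d k x)\<^sup>2) \<partial>half_line)"
    by (rule nn_integral_suminf) measurable
  also have "\<dots> \<le> (\<Sum>k. ennreal ((1/2)^k))"
  proof (rule suminf_le)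
    fix k
    have "(\<integral>\<^sup>+ x. ennreal (2^k * (d k x)\<^sup>2) \<partial>half_line) = ennreal (2^k) * (\<integral>\<^sup>+ x. ennreal ((d k x)\<^sup>2) \<partial>half_line)"
      by (subst nn_integral_cmult[symmetric]) (auto simp: ennreal_mult intro!: nn_integral_cong)
    also have "\<dots> \<le> ennreal (2^k) * ennreal ((1/4)^k)" by (intro mult_left_mono dn) simp
    also have "\<dots> = ennreal ((1/2)^k)"
      by (subst ennreal_mult[symmetric]) (auto simp: power_mult_distrib[symmetric])
    finally show "(\<integral>\<^sup>+ x. ennreal (2^k * (d k x)\<^sup>2) \<partial>half_line) \<le> ennreal ((1/2)^k)" .
  qed auto
  also have "\<dots> = ennreal (\<Sum>k. (1/2)^k)" by (rule suminf_ennreal2) (auto intro: summable_geometric)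
  also have "\<dots> < \<infinity>" by simp
  finally have fin: "(\<integral>\<^sup>+ x. (\<Sum>k. ennreal (2^k * (d k x)\<^sup>2)) \<partial>half_line) < \<infinity>" .
  have "(\<lambda>x. \<Sum>k. ennreal (2^k * (d k x)\<^sup>2)) \<in> borel_measurable half_line" by measurable
  from nn_integral_PInf_AE[OF this less_imp_neq[OF fin]]
  have "AE x in half_line. (\<Sum>k. ennreal (2^k * (d k x)\<^sup>2)) \<noteq> \<infinity>" .
  then have conv: "AE x in half_line. convergent (\<lambda>k. \<phi> k x)"
  proof eventually_elim
    case (elim x)
    have s: "summable (\<lambda>k. 2^k * (d k x)\<^sup>2)" by (rule summable_suminf_not_top) (use elim in auto)
    have "summable (\<lambda>k. d k x)"
    proof (rule summable_comparison_test'[where N = 0])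
      show "summable (\<lambda>k. 2^k * (d k x)\<^sup>2 + (1/2)^k)" by (intro summable_add s summable_geometric) simp
      fix k
      \<comment> \<open>The inequality 2ab \<le> a^2 + b^2 with the factors balanced so that the
        first square is summable by assumption and the second is geometric.\<close>
      have "2 * \<bar>d k x\<bar> = 2 * (sqrt (2^k) * \<bar>d k x\<bar>) * sqrt ((1/2)^k)"
        by (simp add: real_sqrt_mult[symmetric] power_mult_distrib[symmetric])
      also have "\<dots> \<le> (sqrt (2^k) * \<bar>d k x\<bar>)\<^sup>2 + (sqrt ((1/2)^k))\<^sup>2" by (rule sum_squares_bound)
      also have "\<dots> = 2^k * (d k x)\<^sup>2 + (1/2)^k" by (simp add: power_mult_distrib)
      finally show "norm (d k x) \<le> 2^k * (d k x)\<^sup>2 + (1/2)^k" by simp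
    qed
    then have "convergent (\<lambda>n. \<Sum>k<n. d k x)" by (simp add: summable_iff_convergent)
    moreover have "(\<Sum>k<n. d k x) = \<phi> n x - \<phi> 0 x" for n by (induction n) (simp_all add: d_def)
    ultimately have "convergent (\<lambda>n. \<phi> n x - \<phi> 0 x)" by simp
    from convergent_add[OF this convergent_const[of "\<phi> 0 x"]] show ?case by simp
  qed
  define h where "h = (\<lambda>x. lim (\<lambda>k. \<phi> k x))"
  have h_m [measurable]: "h \<in> borel_measurable half_line" unfolding h_def by measurable
  have lim: "AE x in half_line. (\<lambda>k. \<phi> k x) \<longlonglongrightarrow> h x"
    using conv by eventually_elim (simp add: h_def convergent_LIMSEQ_iff)
  have tail: "norm (f (n + m) - f n) \<le> 2 * (1/2)^n" for n m
  proof -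
    have "norm (f (n + m) - f n) \<le> (\<Sum>k<m. (1/2)^(n + k))"
    proof (induction m)
      case (Suc m)
      have "norm (f (n + Suc m) - f n) \<le> norm (f (Suc (n + m)) - f (n + m)) + norm (f (n + m) - f n)"
        using norm_triangle_ineq[of "f (Suc (n + m)) - f (n + m)" "f (n + m) - f n"] by simp
      then show ?case using Suc fast[of "n + m"] by simp
    qed simp
    also have "\<dots> = (1/2)^n * (\<Sum>k<m. (1/2)^k)" by (simp add: power_add sum_distrib_left)
    also have "\<dots> \<le> (1/2)^n * 2"
    proof -
      have "(\<Sum>k<m. (1/2)^k) = 2 - 2 * (1/2 :: real)^m" by (induction m) auto
      then show ?thesis by (intro mult_left_mono) auto
    qed
    finally show ?thesis by simp
  qed
  \<comment> \<open>Fatou's lemma on the differences from index n on. It yields both that the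
    pointwise limit is square integrable and that it is the limit in norm.\<close>
  have est: "(\<integral>\<^sup>+ x. ennreal ((h x - \<phi> n x)\<^sup>2) \<partial>half_line) \<le> ennreal ((2 * (1/2)^n)\<^sup>2)" for n
  proof -
    have "(\<integral>\<^sup>+ x. ennreal ((h x - \<phi> n x)\<^sup>2) \<partial>half_line) = (\<integral>\<^sup>+ x. liminf (\<lambda>m. ennreal ((\<phi> (n + m) x - \<phi> n x)\<^sup>2)) \<partial>half_line)"
    proof (rule nn_integral_cong_AE)
      show "AE x in half_line. ennreal ((h x - \<phi> n x)\<^sup>2) = liminf (\<lambda>m. ennreal ((\<phi> (n + m) x - \<phi> n x)\<^sup>2))"
        using lim
      proof eventually_elim
        case (elim x)
        have "(\<lambda>m. \<phi> (n + m) x) \<longlonglongrightarrow> h x"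
          using LIMSEQ_ignore_initial_segment[OF elim, of n] by (simp add: add.commute)
        then have "(\<lambda>m. ennreal ((\<phi> (n + m) x - \<phi> n x)\<^sup>2)) \<longlonglongrightarrow> ennreal ((h x - \<phi> n x)\<^sup>2)"
          by (intro tendsto_ennrealI tendsto_intros)
        then show ?case by (rule lim_imp_Liminf[OF sequentially_bot, symmetric])
      qed
    qed
    also have "\<dots> \<le> liminf (\<lambda>m. \<integral>\<^sup>+ x. ennreal ((\<phi> (n + m) x - \<phi> n x)\<^sup>2) \<partial>half_line)"
      by (rule nn_integral_liminf) measurable
    also have "\<dots> \<le> ennreal ((2 * (1/2)^n)\<^sup>2)"
    proof -
      have "(\<integral>\<^sup>+ x. ennreal ((\<phi> (n + m) x - \<phi> n x)\<^sup>2) \<partial>half_line) \<le> ennreal ((2 * (1/2)^n)\<^sup>2)" for m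
      proof -
        have "(\<integral>\<^sup>+ x. ennreal ((\<phi> (n + m) x - \<phi> n x)\<^sup>2) \<partial>half_line) = ennreal ((norm (f (n + m) - f n))\<^sup>2)"
          by (simp add: nn_norm_abs_l2[OF L2_diff[OF \<phi> \<phi>]] f_eq abs_l2_diff[OF \<phi> \<phi>])
        also have "\<dots> \<le> ennreal ((2 * (1/2)^n)\<^sup>2)" by (intro ennreal_leI power_mono tail) simp
        finally show ?thesis .
      qed
      then show ?thesis by (intro Liminf_le) (auto intro: always_eventually)
    qed
    finally show ?thesis .
  qed
  have hd: "(\<lambda>x. h x - \<phi> n x) \<in> L2_space half_line" for n
  proof -
    have "(\<integral>\<^sup>+ x. ennreal (norm ((h x - \<phi> n x)\<^sup>2)) \<partial>half_line) < \<infinity>"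
      using est[of n] by (simp add: order.strict_trans1)
    then have "integrable half_line (\<lambda>x. (h x - \<phi> n x)\<^sup>2)" by (intro integrableI_bounded) auto
    then show ?thesis by (simp add: L2_space_def)
  qed
  have h: "h \<in> L2_space half_line" using L2_add[OF hd[of 0] \<phi>[of 0]] by simp
  have "norm (abs_l2 h - f n) \<le> 2 * (1/2)^n" for n
  proof -
    have "ennreal ((norm (abs_l2 h - f n))\<^sup>2) \<le> ennreal ((2 * (1/2)^n)\<^sup>2)"
      using est[of n] unfolding nn_norm_abs_l2[OF hd] f_eq abs_l2_diff[OF h \<phi>] .
    then have "(norm (abs_l2 h - f n))\<^sup>2 \<le> (2 * (1/2)^n)\<^sup>2"
      by (subst (asm) ennreal_le_iff) (rule zero_le_power2)
    then show ?thesis by (rule power2_le_imp_le) simp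
  qed
  then have "norm (f n - abs_l2 h) \<le> 2 * (1/2)^n" for n by (simp only: norm_minus_commute)
  then have "\<forall>\<^sub>F n in sequentially. norm (f n - abs_l2 h) \<le> 2 * (1/2)^n"
    by (intro always_eventually allI)
  moreover have "(\<lambda>n. 2 * (1/2)^n :: real) \<longlonglongrightarrow> 0"
    by (intro tendsto_mult_right_zero LIMSEQ_realpow_zero) auto
  ultimately have "(\<lambda>n. f n - abs_l2 h) \<longlonglongrightarrow> 0" by (rule Lim_null_comparison)
  then have "f \<longlonglongrightarrow> abs_l2 h" by (rule LIM_zero_cancel)
  then show ?thesis using h lim by (auto simp: \<phi>_def)
qed

lemma Cauchy_fast_subseq:
  fixes f :: "nat \<Rightarrow> 'a::real_normed_vector"
  assumes "Cauchy f"
  shows "\<exists>r. strict_mono r \<and> (\<forall>k. norm (f (r (Suc k)) - f (r k)) \<le> (1/2)^k)"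
proof -
  have "\<exists>N. \<forall>m\<ge>N. \<forall>n\<ge>N. norm (f m - f n) < (1/2)^k" for k
    using assms unfolding Cauchy_def dist_norm by simp
  then obtain N where N: "\<And>k m n. m \<ge> N k \<Longrightarrow> n \<ge> N k \<Longrightarrow> norm (f m - f n) < (1/2)^k" by metis
  define r where "r = rec_nat (N 0) (\<lambda>k x. max (Suc x) (N (Suc k)))"
  have r: "r 0 = N 0" "r (Suc k) = max (Suc (r k)) (N (Suc k))" for k by (simp_all add: r_def)
  have rN: "N k \<le> r k" for k by (cases k) (simp_all add: r)
  have rS: "r k < r (Suc k)" for k by (simp add: r)
  have "strict_mono r" by (simp add: strict_mono_Suc_iff rS)
  moreover have "norm (f (r (Suc k)) - f (r k)) \<le> (1/2)^k" for k
    using rS[of k] rN[of k] by (intro less_imp_le[OF N]) auto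
  ultimately show ?thesis by blast
qed

instance l2 :: complete_space
proof
  fix X :: "nat \<Rightarrow> l2" assume C: "Cauchy X"
  obtain r where r: "strict_mono r" "\<And>k. norm (X (r (Suc k)) - X (r k)) \<le> (1/2)^k"
    using Cauchy_fast_subseq[OF C] by blast
  then obtain h where "(X \<circ> r) \<longlonglongrightarrow> abs_l2 h" using fast_Cauchy_converges[of "X \<circ> r"] by auto
  then have "X \<longlonglongrightarrow> abs_l2 h" using C r(1) Cauchy_converges_subseq[OF C r(1)] by simp
  then show "convergent X" by (auto simp: convergent_def)
qed

instance l2 :: banach ..

text \<open>Convergence in norm gives convergence almost everywhere along a subsequence.\<close>

lemma l2_AE_subseq:
  assumes h: "\<And>n. h n \<in> L2_space half_line" "h0 \<in> L2_space half_line"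
    and lim: "(\<lambda>n. abs_l2 (h n)) \<longlonglongrightarrow> abs_l2 h0"
  shows "\<exists>r. strict_mono r \<and> (AE x in half_line. (\<lambda>n. h (r n) x) \<longlonglongrightarrow> h0 x)"
proof -
  obtain r where r: "strict_mono r" "\<And>k. norm (abs_l2 (h (r (Suc k))) - abs_l2 (h (r k))) \<le> (1/2)^k"
    using Cauchy_fast_subseq[OF LIMSEQ_imp_Cauchy[OF lim]] by blast
  obtain g where g: "g \<in> L2_space half_line"
    "AE x in half_line. (\<lambda>k. rep_l2 (abs_l2 (h (r k))) x) \<longlonglongrightarrow> g x" "(\<lambda>k. abs_l2 (h (r k))) \<longlonglongrightarrow> abs_l2 g"
    using fast_Cauchy_converges[of "\<lambda>k. abs_l2 (h (r k))"] r(2) by blast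
  have "(\<lambda>k. abs_l2 (h (r k))) \<longlonglongrightarrow> abs_l2 h0"
    using LIMSEQ_subseq_LIMSEQ[OF lim r(1)] by (simp add: o_def)
  then have "abs_l2 g = abs_l2 h0" using g(3) LIMSEQ_unique by blast
  then have gh: "AE x in half_line. g x = h0 x" using abs_l2_eq_iff g(1) h(2) by blast
  have "AE x in half_line. \<forall>k. rep_l2 (abs_l2 (h (r k))) x = h (r k) x"
    unfolding AE_all_countable using abs_l2_eq_iff[OF rep_l2_in h(1)] abs_rep_l2 by blast
  with g(2) gh have "AE x in half_line. (\<lambda>n. h (r n) x) \<longlonglongrightarrow> h0 x" by eventually_elim simp
  then show ?thesis using r(1) by blast
qed

section \<open>Separability, from functions determined by their integrals over intervals\<close>

subsection \<open>Separability\<close>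

text \<open>Rational half-lines approximate every half-line from the right. Half-lines form an
  intersection-stable generator, and the sets with vanishing integral form a Dynkin system since the
  total integral vanishes as well.\<close>

lemma AE_zero_of_integral_atMost:
  fixes f :: "real \<Rightarrow> real"
  assumes f: "integrable lborel f" and zero: "\<And>b. b \<in> \<rat> \<Longrightarrow> (\<integral>x. indicator {..b} x * f x \<partial>lborel) = 0"
  shows "AE x in lborel. f x = 0"
proof -
  have [measurable]: "f \<in> borel_measurable borel" using f by simp
  have bd: "AE x in lborel. norm (indicator A x * f x) \<le> norm (f x)" for A :: "real set"
    by (auto simp: indicator_def)
  have atMost: "(\<integral>x. indicator {..b} x * f x \<partial>lborel) = 0" for b
  proof -
    have "\<exists>q\<in>\<rat>. b < q \<and> q < b + 1 / real (Suc n)" for n by (rule Rats_dense_in_real) simp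
    then obtain q where q: "\<And>n. q n \<in> \<rat>" "\<And>n. b < q n" "\<And>n. q n < b + 1 / real (Suc n)" by metis
    have "(\<lambda>n. \<integral>x. indicator {..q n} x * f x \<partial>lborel) \<longlonglongrightarrow> (\<integral>x. indicator {..b} x * f x \<partial>lborel)"
    proof (rule integral_dominated_convergence[where w = "\<lambda>x. norm (f x)"])
      show "AE x in lborel. (\<lambda>n. indicator {..q n} x * f x) \<longlonglongrightarrow> indicator {..b} x * f x"
      proof (rule AE_I2)
        fix x
        show "(\<lambda>n. indicator {..q n} x * f x) \<longlonglongrightarrow> indicator {..b} x * f x"
        proof (cases "x \<le> b")
          case True
          then have "x \<le> q n" for n using q(2)[of n] by simp
          then show ?thesis using True by simp
        next
          case False
          then have "\<forall>\<^sub>F n in sequentially. 1 / real (Suc n) < x - b"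
            by (intro order_tendstoD(2)[OF LIMSEQ_Suc[OF lim_1_over_n]]) simp
          then have "\<forall>\<^sub>F n in sequentially. indicator {..q n} x * f x = 0"
          proof eventually_elim
            case (elim n)
            then have "q n < x" using q(3)[of n] by simp
            then show ?case by simp
          qed
          then show ?thesis using False by (simp add: tendsto_eventually)
        qed
      qed
    qed (use f bd in auto)
    then show ?thesis using zero[OF q(1)] by (simp add: LIMSEQ_const_iff)
  qed
  have total: "(\<integral>x. f x \<partial>lborel) = 0"
  proof -
    have "(\<lambda>n. \<integral>x. indicator {..real n} x * f x \<partial>lborel) \<longlonglongrightarrow> (\<integral>x. f x \<partial>lborel)"
    proof (rule integral_dominated_convergence[where w = "\<lambda>x. norm (f x)"])
      show "AE x in lborel. (\<lambda>n. indicator {..real n} x * f x) \<longlonglongrightarrow> f x"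
      proof (rule AE_I2)
        fix x :: real
        obtain N where "x \<le> real N" using real_arch_simple by blast
        then have "\<forall>\<^sub>F n in sequentially. indicator {..real n} x * f x = f x"
          unfolding eventually_sequentially by (intro exI[of _ N]) auto
        then show "(\<lambda>n. indicator {..real n} x * f x) \<longlonglongrightarrow> f x" by (rule tendsto_eventually)
      qed
    qed (use f bd in auto)
    then show ?thesis using atMost by (simp add: LIMSEQ_const_iff)
  qed
  have ind: "integrable lborel (\<lambda>x. indicator A x * f x)" if "A \<in> sets borel" for A
    using integrable_mult_indicator[OF _ f, of A] that by simp
  have all: "(\<integral>x. indicator A x * f x \<partial>lborel) = 0" if A: "A \<in> sets borel" for A
  proof -
    have st: "Int_stable (range (\<lambda>b. {..b::real}))" by (auto simp: Int_stable_def)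
    have sub: "range (\<lambda>b. {..b::real}) \<subseteq> Pow UNIV" by simp
    have "A \<in> sigma_sets UNIV (range (\<lambda>b. {..b::real}))" using A by (simp add: borel_eq_atMost)
    from st sub this show ?thesis
    proof (induction A rule: sigma_sets_induct_disjoint)
      case (basic A)
      then show ?case using atMost by auto
    next
      case (compl A)
      then have A: "A \<in> sets borel" by (simp add: borel_eq_atMost)
      have "(\<integral>x. indicator (UNIV - A) x * f x \<partial>lborel) = (\<integral>x. f x - indicator A x * f x \<partial>lborel)"
        by (rule Bochner_Integration.integral_cong) (auto simp: indicator_def)
      then show ?case using f ind[OF A] total compl by simp
    next
      case (union A)
      then have A: "A i \<in> sets borel" for i by (auto simp: borel_eq_atMost)
      have "(\<integral>x. indicator (\<Union>(range A)) x * f x \<partial>lborel) = (\<Sum>i. \<integral>x. indicator (A i) x * f x \<partial>lborel)"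
        using lebesgue_integral_countable_add[of A lborel f] A union(1) f
          integrable_mult_indicator[OF _ f, of "\<Union>(range A)"]
        by (simp add: set_integrable_def set_lebesgue_integral_def disjoint_family_on_def)
      then show ?case using union by simp
    qed auto
  qed
  have "AE x in lborel. f x = 0"
  proof (rule density_unique_real[OF f])
    show "integrable lborel (\<lambda>x. 0 :: real)" by simp
    show "set_lebesgue_integral lborel A f = set_lebesgue_integral lborel A (\<lambda>x. 0)" if "A \<in> sets lborel" for A
      using all[of A] that by (simp add: set_lebesgue_integral_def)
  qed
  then show ?thesis .
qed

lemma half_line_integral:
  fixes f :: "real \<Rightarrow> real"
  shows "integrable half_line f \<longleftrightarrow> integrable lborel (\<lambda>x. indicator {0..} x * f x)"
    and "integral\<^sup>L half_line f = (\<integral>x. indicator {0..} x * f x \<partial>lborel)"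
  unfolding half_line_def by (simp_all add: integrable_restrict_space integral_restrict_space)

lemma AE_half_line_iff: "(AE x in half_line. P x) \<longleftrightarrow> (AE x in lborel. 0 \<le> x \<longrightarrow> P x)"
  unfolding half_line_def by (subst AE_restrict_space_iff) auto

lemma AE_half_line_pos: "AE x in half_line. 0 < x"
  unfolding AE_half_line_iff using AE_lborel_singleton[of "0::real"] by eventually_elim simp

text \<open>Cutting off at each natural number n gives an integrable function on the line, to which
  the criterion for half-lines applies; a countable union of null sets remains.\<close>

lemma AE_zero_of_integral_Icc:
  fixes f :: "real \<Rightarrow> real"
  assumes f: "\<And>b. 0 \<le> b \<Longrightarrow> integrable lborel (\<lambda>x. indicator {0..b} x * f x)"
    and zero: "\<And>b. 0 \<le> b \<Longrightarrow> b \<in> \<rat> \<Longrightarrow> (\<integral>x. indicator {0..b} x * f x \<partial>lborel) = 0"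
  shows "AE x in half_line. f x = 0"
proof -
  have "AE x in lborel. indicator {0..real n} x * f x = 0" for n
  proof (rule AE_zero_of_integral_atMost)
    show "integrable lborel (\<lambda>x. indicator {0..real n} x * f x)" by (rule f) simp
    fix b :: real assume b: "b \<in> \<rat>"
    have eq: "indicator {..b} x * (indicator {0..real n} x * f x) = (if 0 \<le> b then indicator {0..min b (real n)} x * f x else 0)" for x
      by (auto simp: indicator_def)
    show "(\<integral>x. indicator {..b} x * (indicator {0..real n} x * f x) \<partial>lborel) = 0"
    proof (cases "0 \<le> b")
      case True
      then show ?thesis unfolding eq using zero[of "min b (real n)"] b by (simp add: min_def)
    next
      case False
      then show ?thesis unfolding eq by simp
    qed
  qed
  then have "AE x in lborel. \<forall>n. indicator {0..real n} x * f x = 0" unfolding AE_all_countable by blast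
  then show ?thesis
    unfolding AE_half_line_iff
  proof eventually_elim
    case (elim x)
    obtain n where "x \<le> real n" using real_arch_simple by blast
    then show ?case using elim[rule_format, of n] by (auto simp: indicator_def)
  qed
qed

lemma indicator_L2: "(indicator {0..b} :: real \<Rightarrow> real) \<in> L2_space half_line"
proof -
  have "indicator {0..b} \<in> borel_measurable half_line"
    unfolding half_line_def by (intro measurable_restrict_space1) simp
  moreover have "integrable half_line (\<lambda>x. (indicator {0..b} x :: real)\<^sup>2)"
  proof -
    have "(\<lambda>x. indicator {0..} x * (indicator {0..b} x)\<^sup>2) = (indicator {0..b} :: real \<Rightarrow> real)"
      by (auto simp: indicator_def)
    moreover have "integrable lborel (indicator {0..b} :: real \<Rightarrow> real)"
      by (cases "0 \<le> b") (auto intro!: integrable_real_indicator)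
    ultimately show ?thesis unfolding half_line_integral by simp
  qed
  ultimately show ?thesis by (simp add: L2_space_def)
qed

lemma L2_integrable_Icc:
  assumes "h \<in> L2_space half_line"
  shows "integrable lborel (\<lambda>x. indicator {0..b} x * h x)"
proof -
  have "(\<lambda>x. indicator {0..} x * (indicator {0..b} x * h x)) = (\<lambda>x. indicator {0..b} x * h x)"
    by (auto simp: indicator_def)
  then show ?thesis using L2_mult_integrable[OF indicator_L2 assms, of b] unfolding half_line_integral by simp
qed

definition step_l2 :: "l2 set" where
  "step_l2 = (\<lambda>b. abs_l2 (indicator {0..b})) ` \<rat>"

text \<open>Orthogonality to the indicators of [0, b] with rational b is just the vanishing of the
  integrals in \<open>AE_zero_of_integral_Icc\<close>.\<close>

lemma span_step_l2_dense: "closure (span step_l2) = UNIV"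
proof (rule closed_subspace_eq_UNIV)
  show "subspace (closure (span step_l2))" by (intro subspace_closure subspace_span)
  fix h assume orth: "\<And>w. w \<in> closure (span step_l2) \<Longrightarrow> h \<bullet> w = 0"
  let ?h = "rep_l2 h"
  have "AE x in half_line. ?h x = 0"
  proof (rule AE_zero_of_integral_Icc)
    show "integrable lborel (\<lambda>x. indicator {0..b} x * ?h x)" for b
      by (rule L2_integrable_Icc[OF rep_l2_in])
    fix b :: real assume b: "b \<in> \<rat>"
    have "abs_l2 (indicator {0..b}) \<in> closure (span step_l2)"
      using b by (intro closure_subset[THEN subsetD] span_base) (auto simp: step_l2_def)
    then have "h \<bullet> abs_l2 (indicator {0..b}) = 0" by (rule orth)
    then have "L2_inner half_line ?h (indicator {0..b}) = 0"
      using abs_l2_inner[OF rep_l2_in[of h] indicator_L2[of b]] by simp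
    moreover have "(\<lambda>x. indicator {0..} x * (?h x * indicator {0..b} x)) = (\<lambda>x. indicator {0..b} x * ?h x)"
      by (auto simp: indicator_def)
    ultimately show "(\<integral>x. indicator {0..b} x * ?h x \<partial>lborel) = 0"
      unfolding L2_inner_def half_line_integral by simp
  qed
  then have "abs_l2 ?h = abs_l2 (\<lambda>x. 0)" by (subst abs_l2_eq_iff) (auto simp: rep_l2_in)
  then show "h = 0" by (simp add: abs_l2_zero)
qed simp

text \<open>The countable set consists of the combinations with rational coefficients, coded by
  lists of pairs. Its closure contains all real multiples of elements of \<open>D\<close> and is
  closed under sums, hence contains the span.\<close>

lemma countable_dense_of_span:
  fixes D :: "'a::real_normed_vector set"
  assumes D: "countable D" and dense: "closure (span D) = UNIV"
  shows "\<exists>Q::'a set. countable Q \<and> closure Q = UNIV"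
proof -
  define comb where "comb = (\<lambda>l. sum_list (map (\<lambda>(q, v). q *\<^sub>R v) l) :: 'a)"
  define Q where "Q = comb ` lists (\<rat> \<times> D)"
  have "countable Q"
    unfolding Q_def using D by (intro countable_image countable_lists countable_SIGMA countable_rat)
  have add: "x + y \<in> closure Q" if x: "x \<in> closure Q" and y: "y \<in> closure Q" for x y
  proof -
    have QQ: "a + b \<in> Q" if a: "a \<in> Q" and b: "b \<in> Q" for a b
    proof -
      obtain l m where "l \<in> lists (\<rat> \<times> D)" "m \<in> lists (\<rat> \<times> D)" "a = comb l" "b = comb m"
        using a b unfolding Q_def by blast
      then have "a + b = comb (l @ m)" "l @ m \<in> lists (\<rat> \<times> D)" by (auto simp: comb_def)
      then show ?thesis unfolding Q_def by blast
    qed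
    obtain f g where "\<And>n. f n \<in> Q" "f \<longlonglongrightarrow> x" "\<And>n. g n \<in> Q" "g \<longlonglongrightarrow> y"
      using x y unfolding closure_sequential by blast
    then show ?thesis
      unfolding closure_sequential by (intro exI[of _ "\<lambda>n. f n + g n"]) (auto intro: tendsto_add QQ)
  qed
  have base: "c *\<^sub>R v \<in> closure Q" if v: "v \<in> D" for c v
  proof -
    have "\<exists>q\<in>\<rat>. c < q \<and> q < c + 1 / real (Suc n)" for n by (rule Rats_dense_in_real) simp
    then obtain q where q: "\<And>n. q n \<in> \<rat>" "\<And>n. c < q n" "\<And>n. q n < c + 1 / real (Suc n)" by metis
    have "(\<lambda>n. c + 1 / real (Suc n)) \<longlonglongrightarrow> c + 0" by (intro tendsto_add tendsto_const LIMSEQ_Suc[OF lim_1_over_n])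
    then have "q \<longlonglongrightarrow> c"
      by (intro tendsto_sandwich[of "\<lambda>n. c" q sequentially "\<lambda>n. c + 1 / real (Suc n)" c]
          always_eventually allI less_imp_le q tendsto_const) simp
    have "q n *\<^sub>R v \<in> Q" for n
      unfolding Q_def by (rule image_eqI[of _ _ "[(q n, v)]"]) (use q(1) v in \<open>auto simp: comb_def\<close>)
    moreover have "(\<lambda>n. q n *\<^sub>R v) \<longlonglongrightarrow> c *\<^sub>R v" by (intro tendsto_scaleR \<open>q \<longlonglongrightarrow> c\<close> tendsto_const)
    ultimately show ?thesis unfolding closure_sequential by (intro exI[of _ "\<lambda>n. q n *\<^sub>R v"]) auto
  qed
  have "0 \<in> Q" unfolding Q_def by (rule image_eqI[of _ _ "[]"]) (auto simp: comb_def)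
  then have zero: "0 \<in> closure Q" using closure_subset by blast
  have "span D \<subseteq> closure Q"
  proof
    fix x assume "x \<in> span D"
    then obtain t r where "finite t" "t \<subseteq> D" "x = (\<Sum>a\<in>t. r a *\<^sub>R a)"
      unfolding span_explicit by blast
    moreover have "(\<Sum>a\<in>t. r a *\<^sub>R a) \<in> closure Q" if "finite t" "t \<subseteq> D" for t
      using that by (induction t rule: finite_induct) (auto simp: zero intro: add base)
    ultimately show "x \<in> closure Q" by blast
  qed
  then have "closure (span D) \<subseteq> closure Q" by (intro closure_minimal) auto
  then have "closure Q = UNIV" using dense by auto
  then show ?thesis using \<open>countable Q\<close> by blast
qed

lemma topological_basis_of_dense:
  fixes Q :: "'a::metric_space set"
  assumes dense: "closure Q = UNIV"
  shows "topological_basis ((\<lambda>(q, r). ball q r) ` (Q \<times> \<rat>))"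
proof (rule topological_basisI)
  fix U :: "'a set" and x assume U: "open U" "x \<in> U"
  then obtain e where e: "e > 0" "ball x e \<subseteq> U" by (meson open_contains_ball)
  obtain r where r: "r \<in> \<rat>" "0 < r" "r < e / 2" using Rats_dense_in_real[of 0 "e / 2"] e by auto
  obtain q where q: "q \<in> Q" "dist q x < r"
    using dense closure_approachable[of x Q] r by (metis UNIV_I)
  have "ball q r \<subseteq> ball x e"
  proof
    fix y assume "y \<in> ball q r"
    then have "dist x y < r + r" using q(2) dist_triangle[of x y q] by (simp add: dist_commute)
    then show "y \<in> ball x e" using r(3) by simp
  qed
  moreover have "x \<in> ball q r" using q(2) by simp
  ultimately show "\<exists>B'\<in>(\<lambda>(q, r). ball q r) ` (Q \<times> \<rat>). x \<in> B' \<and> B' \<subseteq> U"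
    using e(2) q(1) r(1) by (intro bexI[of _ "ball q r"]) auto
qed auto

text \<open>Bochner integrals ask for a second countable Banach space; the instance of
  \<open>perfect_space\<close> that follows is what the operator algebra asks for.\<close>

instance l2 :: second_countable_topology
proof
  have "countable step_l2" unfolding step_l2_def by (intro countable_image countable_rat)
  then obtain Q :: "l2 set" where Q: "countable Q" "closure Q = UNIV"
    using countable_dense_of_span[OF _ span_step_l2_dense] by blast
  let ?B = "(\<lambda>(q, r). ball q r) ` (Q \<times> \<rat>) :: l2 set set"
  have "countable ?B" using Q(1) by (intro countable_image countable_SIGMA countable_rat)
  moreover have "open = generate_topology ?B"
    by (rule topological_basis_imp_subbasis[OF topological_basis_of_dense[OF Q(2)]])
  ultimately show "\<exists>B::l2 set set. countable B \<and> open = generate_topology B" by blast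
qed

instance l2 :: perfect_space
proof
  fix x :: l2
  let ?e = "abs_l2 (indicator {0..1}) :: l2"
  have "(norm ?e)\<^sup>2 = 1"
  proof -
    have "(\<lambda>x. indicator {0..} x * (indicator {0..1} x)\<^sup>2) = (indicator {0..1} :: real \<Rightarrow> real)"
      by (auto simp: indicator_def)
    then show ?thesis by (simp add: norm_abs_l2_sq[OF indicator_L2] half_line_integral)
  qed
  then have ne: "norm ?e = 1" by (metis norm_ge_zero one_power2 power2_eq_iff_nonneg zero_le_one)
  show "\<not> open {x}"
  proof
    assume "open {x}"
    then obtain d where d: "d > 0" "ball x d \<subseteq> {x}" by (meson insertI1 open_contains_ball)
    have "x + (d / 2) *\<^sub>R ?e \<in> ball x d" using d(1) ne by (simp add: dist_norm)
    then have "(d / 2) *\<^sub>R ?e = 0" using d(2) by auto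
    then show False using d(1) ne by auto
  qed
qed

section \<open>Primitives and integration by parts for locally integrable functions\<close>

section \<open>Primitives of locally integrable functions\<close>

definition loc_int :: "(real \<Rightarrow> real) \<Rightarrow> bool" where
  "loc_int k \<longleftrightarrow> (\<forall>b. integrable lborel (\<lambda>z. indicator {0..b} z * k z))"

definition Prim :: "(real \<Rightarrow> real) \<Rightarrow> real \<Rightarrow> real" where
  "Prim k x = (\<integral>z. indicator {0..x} z * k z \<partial>lborel)"

lemma Prim_0 [simp]: "Prim k 0 = 0"
proof -
  have "Prim k 0 = (\<integral>z. indicator {0::real} z * k 0 \<partial>lborel)"
    unfolding Prim_def by (rule Bochner_Integration.integral_cong) (auto simp: indicator_def)
  then show ?thesis by simp
qed

lemma borel_measurable_half_line_indicator:
  fixes k :: "real \<Rightarrow> real"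
  assumes "k \<in> borel_measurable half_line"
  shows "(\<lambda>z. indicator {0..b} z * k z) \<in> borel_measurable borel"
proof -
  have "(\<lambda>z. k z * indicator {0..} z) \<in> borel_measurable lborel"
    using assms borel_measurable_restrict_space_iff[of "{0..}" lborel k]
    unfolding half_line_def by (simp add: mult.commute)
  then have "(\<lambda>z. indicator {0..b} z * (k z * indicator {0..} z)) \<in> borel_measurable borel" by simp
  moreover have "(\<lambda>z. indicator {0..b} z * (k z * indicator {0..} z)) = (\<lambda>z. indicator {0..b} z * k z)"
    by (auto simp: indicator_def)
  ultimately show ?thesis by simp
qed

lemma loc_int_bound:
  assumes "loc_int k" "f \<in> borel_measurable half_line" "\<And>x. 0 \<le> x \<Longrightarrow> \<bar>f x\<bar> \<le> \<bar>k x\<bar>"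
  shows "loc_int f"
  unfolding loc_int_def
proof
  fix b
  show "integrable lborel (\<lambda>z. indicator {0..b} z * f z)"
  proof (rule Bochner_Integration.integrable_bound)
    show "integrable lborel (\<lambda>z. indicator {0..b} z * k z)" using assms(1) by (simp add: loc_int_def)
    show "(\<lambda>z. indicator {0..b} z * f z) \<in> borel_measurable lborel"
      using borel_measurable_half_line_indicator[OF assms(2)] by simp
    show "AE x in lborel. norm (indicator {0..b} x * f x) \<le> norm (indicator {0..b} x * k x)"
      using assms(3) by (auto simp: indicator_def)
  qed
qed

lemma loc_int_add: "loc_int k \<Longrightarrow> loc_int l \<Longrightarrow> loc_int (\<lambda>x. k x + l x)"
  and loc_int_diff: "loc_int k \<Longrightarrow> loc_int l \<Longrightarrow> loc_int (\<lambda>x. k x - l x)"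
  and loc_int_scale: "loc_int k \<Longrightarrow> loc_int (\<lambda>x. c * k x)"
  unfolding loc_int_def by (auto simp: distrib_left right_diff_distrib mult.left_commute[of _ c])

lemma Prim_add: "loc_int k \<Longrightarrow> loc_int l \<Longrightarrow> Prim (\<lambda>x. k x + l x) b = Prim k b + Prim l b"
  and Prim_diff: "loc_int k \<Longrightarrow> loc_int l \<Longrightarrow> Prim (\<lambda>x. k x - l x) b = Prim k b - Prim l b"
  and Prim_scale: "Prim (\<lambda>x. c * k x) b = c * Prim k b"
  unfolding loc_int_def Prim_def by (auto simp: distrib_left right_diff_distrib mult.left_commute[of _ c])

lemma Prim_cong_AE:
  assumes "AE x in half_line. k x = l x" "k \<in> borel_measurable half_line" "l \<in> borel_measurable half_line"
  shows "Prim k b = Prim l b"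
  unfolding Prim_def
proof (rule integral_cong_AE)
  show "AE x in lborel. indicator {0..b} x * k x = indicator {0..b} x * l x"
    using assms(1) unfolding AE_half_line_iff by eventually_elim (auto simp: indicator_def)
qed (use borel_measurable_half_line_indicator assms in auto)

lemma Prim_eq_integral:
  assumes "loc_int k"
  shows "k integrable_on {0..b}" and "Prim k b = integral {0..b} k"
proof -
  have i: "set_integrable lborel {0..b} k" using assms by (simp add: loc_int_def set_integrable_def)
  show "k integrable_on {0..b}" by (rule set_borel_integral_eq_integral(1)[OF i])
  show "Prim k b = integral {0..b} k"
    using set_borel_integral_eq_integral(2)[OF i] by (simp add: Prim_def set_lebesgue_integral_def)
qed

lemma continuous_on_Prim:
  assumes "loc_int k"
  shows "continuous_on {0..} (Prim k)"
proof -
  have "continuous (at x within {0..}) (Prim k)" if x: "0 \<le> x" for x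
  proof -
    have "continuous_on {0..x + 1} (\<lambda>b. integral {0..b} k)"
      by (rule indefinite_integral_continuous_1[OF Prim_eq_integral(1)[OF assms]])
    then have "continuous_on {0..x + 1} (Prim k)" by (simp add: Prim_eq_integral(2)[OF assms])
    then have "continuous (at x within {0..x + 1}) (Prim k)" using x by (auto simp: continuous_on_eq_continuous_within)
    moreover have "at x within {0..x + 1} = at x within {0..}"
    proof (rule at_within_nhd[of x "{..<x + 1}"])
      show "{0..x + 1} \<inter> {..<x + 1} - {x} = {0..} \<inter> {..<x + 1} - {x}" by auto
    qed auto
    ultimately show ?thesis by simp
  qed
  then show ?thesis by (auto simp: continuous_on_eq_continuous_within)
qed

lemma borel_measurable_half_line_continuous:
  "continuous_on {0..} f \<Longrightarrow> f \<in> borel_measurable half_line" for f :: "real \<Rightarrow> real"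
proof -
  assume "continuous_on {0..} f"
  then have "f \<in> borel_measurable (restrict_space borel {0..})"
    by (rule borel_measurable_continuous_on_restrict)
  moreover have "sets half_line = sets (restrict_space borel {0..})"
    unfolding half_line_def by (intro sets_restrict_space_cong) simp
  ultimately show ?thesis using measurable_cong_sets by blast
qed

lemma interval_integral_Prim:
  assumes k: "loc_int k" and "0 \<le> x" "0 \<le> y"
  shows "(LBINT z=ereal y..ereal x. k z) = Prim k x - Prim k y"
proof -
  have *: "(LBINT z=ereal y..ereal x. k z) = Prim k x - Prim k y" if "0 \<le> y" "y \<le> x" for x y
  proof -
    have "(LBINT z=ereal y..ereal x. k z) = (\<integral>z. indicator {y..x} z * k z \<partial>lborel)"
      using interval_integral_Icc[OF that(2), of k] by (simp add: set_lebesgue_integral_def)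
    also have "\<dots> = (\<integral>z. indicator {0..x} z * k z - indicator {0..y} z * k z \<partial>lborel)"
    proof (rule integral_cong_AE)
      have [measurable]: "(\<lambda>z. indicator {0..b} z * k z) \<in> borel_measurable lborel" for b
        by (rule borel_measurable_integrable) (use k in \<open>simp add: loc_int_def\<close>)
      show "(\<lambda>z. indicator {0..x} z * k z - indicator {0..y} z * k z) \<in> borel_measurable lborel" by measurable
      have "(\<lambda>z. indicator {y..x} z * (indicator {0..x} z * k z)) \<in> borel_measurable lborel" by measurable
      moreover have "(\<lambda>z. indicator {y..x} z * (indicator {0..x} z * k z)) = (\<lambda>z. indicator {y..x} z * k z)"
        using that by (auto simp: indicator_def)
      ultimately show "(\<lambda>z. indicator {y..x} z * k z) \<in> borel_measurable lborel" by simp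
      show "AE z in lborel. indicator {y..x} z * k z = indicator {0..x} z * k z - indicator {0..y} z * k z"
        using AE_lborel_singleton[of y] by eventually_elim (use that in \<open>auto simp: indicator_def\<close>)
    qed
    also have "\<dots> = Prim k x - Prim k y"
      unfolding Prim_def using k by (intro Bochner_Integration.integral_diff) (auto simp: loc_int_def)
    finally show ?thesis .
  qed
  show ?thesis
  proof (cases "y \<le> x")
    case False
    then show ?thesis using *[of x y] assms interval_integral_endpoints_reverse[of "ereal y" "ereal x" k] by simp
  qed (use * assms in simp)
qed

text \<open>Fubini on [0, b] x [0, b], split along the diagonal. Only local integrability of the two
  derivatives enters, so weights that are singular at 0 are covered.\<close>

lemma Prim_parts:
  assumes k: "loc_int k" and q: "loc_int q" and b: "0 \<le> b"
  shows "integrable lborel (\<lambda>x. indicator {0..b} x * ((c + Prim k x) * q x))"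
    and "(\<integral>x. indicator {0..b} x * ((c + Prim k x) * q x + k x * (d + Prim q x)) \<partial>lborel)
      = (c + Prim k b) * (d + Prim q b) - c * d"
proof -
  define K where "K = (\<lambda>z. indicator {0..b} z * k z)"
  define Q where "Q = (\<lambda>z. indicator {0..b} z * q z)"
  have K: "integrable lborel K" and Q: "integrable lborel Q"
    using k q by (simp_all add: loc_int_def K_def Q_def)
  have [measurable]: "K \<in> borel_measurable borel" "Q \<in> borel_measurable borel" using K Q by auto
  have PK: "Prim k x = (\<integral>z. indicator {..x} z * K z \<partial>lborel)" if "x \<in> {0..b}" for x
    unfolding Prim_def K_def by (rule Bochner_Integration.integral_cong) (use that in \<open>auto simp: indicator_def\<close>)
  have PQ: "Prim q x = (\<integral>z. indicator {..x} z * Q z \<partial>lborel)" if "x \<in> {0..b}" for x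
    unfolding Prim_def Q_def by (rule Bochner_Integration.integral_cong) (use that in \<open>auto simp: indicator_def\<close>)
  have prod: "integrable (lborel \<Otimes>\<^sub>M lborel) (\<lambda>(z, x). K z * Q x)"
  proof (rule lborel_pair.Fubini_integrable)
    show "integrable lborel (\<lambda>x. \<integral>y. norm (case (x, y) of (z, x) \<Rightarrow> K z * Q x) \<partial>lborel)"
      using K Q by (simp add: abs_mult)
  qed (use K Q in auto)
  define A where "A = (\<lambda>z x. (if z \<le> x then 1 else 0) * (K z * Q x))"
  define B where "B = (\<lambda>z x. (if x \<le> z then 1 else 0) * (K z * Q x))"
  have A: "integrable (lborel \<Otimes>\<^sub>M lborel) (\<lambda>(z, x). A z x)"
  proof (rule Bochner_Integration.integrable_bound[OF prod])
    show "(\<lambda>(z, x). A z x) \<in> borel_measurable (lborel \<Otimes>\<^sub>M lborel)" unfolding A_def by measurable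
  qed (auto simp: A_def)
  have B: "integrable (lborel \<Otimes>\<^sub>M lborel) (\<lambda>(z, x). B z x)"
  proof (rule Bochner_Integration.integrable_bound[OF prod])
    show "(\<lambda>(z, x). B z x) \<in> borel_measurable (lborel \<Otimes>\<^sub>M lborel)" unfolding B_def by measurable
  qed (auto simp: B_def)
  have AQ: "(\<integral>z. A z x \<partial>lborel) = indicator {0..b} x * (Prim k x * q x)" for x
  proof (cases "x \<in> {0..b}")
    case True
    have "(\<integral>z. A z x \<partial>lborel) = (\<integral>z. (indicator {..x} z * K z) * Q x \<partial>lborel)"
      by (rule Bochner_Integration.integral_cong) (auto simp: A_def indicator_def)
    also have "\<dots> = Prim k x * Q x" by (simp add: PK[OF True])
    finally show ?thesis using True by (simp add: Q_def)
  qed (auto simp: A_def Q_def)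
  have BK: "(\<integral>x. B z x \<partial>lborel) = indicator {0..b} z * (k z * Prim q z)" for z
  proof (cases "z \<in> {0..b}")
    case True
    have "(\<integral>x. B z x \<partial>lborel) = (\<integral>x. (indicator {..z} x * Q x) * K z \<partial>lborel)"
      by (rule Bochner_Integration.integral_cong) (auto simp: B_def indicator_def)
    also have "\<dots> = Prim q z * K z" by (simp add: PQ[OF True])
    finally show ?thesis using True by (simp add: K_def)
  qed (auto simp: B_def K_def)
  have iA: "integrable lborel (\<lambda>x. indicator {0..b} x * (Prim k x * q x))"
    using lborel_pair.integrable_snd[OF A] by (simp add: AQ)
  have iB: "integrable lborel (\<lambda>x. indicator {0..b} x * (k x * Prim q x))"
    using lborel_pair.integrable_fst[OF B] by (simp add: BK)
  have "Prim k b * Prim q b = (\<integral>z. K z \<partial>lborel) * (\<integral>x. Q x \<partial>lborel)"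
    by (simp add: Prim_def K_def Q_def)
  also have "\<dots> = (\<integral>z. (\<integral>x. K z * Q x \<partial>lborel) \<partial>lborel)" by simp
  also have "\<dots> = (\<integral>z. (\<integral>x. A z x \<partial>lborel) + (\<integral>x. B z x \<partial>lborel) \<partial>lborel)"
  proof (rule integral_cong_AE)
    show "(\<lambda>z. (\<integral>x. A z x \<partial>lborel) + (\<integral>x. B z x \<partial>lborel)) \<in> borel_measurable lborel"
      using lborel_pair.integrable_fst[OF A] lborel_pair.integrable_fst[OF B] by auto
    have "AE z in lborel. integrable lborel (A z)" "AE z in lborel. integrable lborel (B z)"
      using lborel_pair.AE_integrable_fst[OF A] lborel_pair.AE_integrable_fst[OF B] by auto
    then show "AE z in lborel. (\<integral>x. K z * Q x \<partial>lborel) = (\<integral>x. A z x \<partial>lborel) + (\<integral>x. B z x \<partial>lborel)"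
    proof eventually_elim
      case (elim z)
      have "(\<integral>x. K z * Q x \<partial>lborel) = (\<integral>x. A z x + B z x \<partial>lborel)"
      proof (rule integral_cong_AE)
        show "(\<lambda>x. A z x + B z x) \<in> borel_measurable lborel" using elim by auto
        show "AE x in lborel. K z * Q x = A z x + B z x"
          using AE_lborel_singleton[of z] by eventually_elim (auto simp: A_def B_def)
      qed simp
      then show ?case using elim by simp
    qed
  qed simp
  also have "\<dots> = (\<integral>z. (\<integral>x. A z x \<partial>lborel) \<partial>lborel) + (\<integral>z. (\<integral>x. B z x \<partial>lborel) \<partial>lborel)"
    by (rule Bochner_Integration.integral_add[OF lborel_pair.integrable_fst[OF A] lborel_pair.integrable_fst[OF B]])
  also have "(\<integral>z. (\<integral>x. A z x \<partial>lborel) \<partial>lborel) = (\<integral>x. (\<integral>z. A z x \<partial>lborel) \<partial>lborel)"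
    by (rule lborel_pair.Fubini_integral[OF A, symmetric])
  finally have PP: "Prim k b * Prim q b = (\<integral>x. indicator {0..b} x * (Prim k x * q x) \<partial>lborel)
      + (\<integral>x. indicator {0..b} x * (k x * Prim q x) \<partial>lborel)"
    by (simp add: AQ BK)
  have icq: "integrable lborel (\<lambda>x. c * (indicator {0..b} x * q x))" using q by (simp add: loc_int_def)
  have idk: "integrable lborel (\<lambda>x. d * (indicator {0..b} x * k x))" using k by (simp add: loc_int_def)
  show "integrable lborel (\<lambda>x. indicator {0..b} x * ((c + Prim k x) * q x))"
    using Bochner_Integration.integrable_add[OF icq iA] by (simp add: algebra_simps)
  have "(\<integral>x. indicator {0..b} x * ((c + Prim k x) * q x + k x * (d + Prim q x)) \<partial>lborel)
     = (\<integral>x. (c * (indicator {0..b} x * q x) + d * (indicator {0..b} x * k x))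
        + (indicator {0..b} x * (Prim k x * q x) + indicator {0..b} x * (k x * Prim q x)) \<partial>lborel)"
    by (rule Bochner_Integration.integral_cong) (auto simp: algebra_simps)
  also have "\<dots> = (c * Prim q b + d * Prim k b) + Prim k b * Prim q b"
    unfolding PP
    by (subst Bochner_Integration.integral_add, (intro Bochner_Integration.integrable_add icq idk iA iB)+,
        subst Bochner_Integration.integral_add[OF icq idk], subst Bochner_Integration.integral_add[OF iA iB])
       (simp add: Prim_def)
  finally show "(\<integral>x. indicator {0..b} x * ((c + Prim k x) * q x + k x * (d + Prim q x)) \<partial>lborel)
      = (c + Prim k b) * (d + Prim q b) - c * d" by (simp add: algebra_simps)
qed

lemma AE_half_line_ex:
  assumes P: "AE x in half_line. P x" and x: "0 \<le> x" and e: "0 < e"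
  shows "\<exists>y. x < y \<and> y < x + e \<and> P y"
proof (rule ccontr)
  assume "\<not> ?thesis"
  then have no: "\<And>y. x < y \<Longrightarrow> y < x + e \<Longrightarrow> \<not> P y" by blast
  have "AE y in lborel. y \<notin> {x<..<x + e}"
    using P unfolding AE_half_line_iff by eventually_elim (use no x in force)
  then have "emeasure lborel {x<..<x + e} = 0"
    by (subst (asm) AE_iff_measurable[of "{x<..<x + e}"]) auto
  then show False using e by simp
qed

text \<open>A primitive is continuous, and every point is a limit from the right of points where the
  identity holds, so it holds everywhere. At 0 it gives c = 0, and then all integrals of
  \<open>k\<close> over [0, b] vanish.\<close>

lemma AE_Prim_const:
  assumes k: "loc_int k" and P: "AE x in half_line. c + Prim k x = 0"
  shows "c = 0" and "AE x in half_line. k x = 0"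
proof -
  have *: "c + Prim k x = 0" if x: "0 \<le> x" for x
  proof -
    have "\<exists>y. x < y \<and> y < x + 1 / real (Suc n) \<and> c + Prim k y = 0" for n
      using AE_half_line_ex[OF P x] by simp
    then obtain y where y: "\<And>n. x < y n" "\<And>n. y n < x + 1 / real (Suc n)" "\<And>n. c + Prim k (y n) = 0" by metis
    have "(\<lambda>n. x + 1 / real (Suc n)) \<longlonglongrightarrow> x + 0" by (intro tendsto_add tendsto_const LIMSEQ_Suc[OF lim_1_over_n])
    then have "y \<longlonglongrightarrow> x"
      by (intro tendsto_sandwich[of "\<lambda>n. x" y sequentially "\<lambda>n. x + 1 / real (Suc n)" x]
          always_eventually allI less_imp_le y tendsto_const) simp
    then have "(\<lambda>n. Prim k (y n)) \<longlonglongrightarrow> Prim k x"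
      by (intro continuous_on_tendsto_compose[OF continuous_on_Prim[OF k]])
         (use x order_trans[OF x less_imp_le[OF y(1)]] in \<open>auto intro!: always_eventually\<close>)
    then have "(\<lambda>n. c + Prim k (y n)) \<longlonglongrightarrow> c + Prim k x" by (intro tendsto_intros)
    then show ?thesis by (simp add: y(3) LIMSEQ_const_iff)
  qed
  show c: "c = 0" using *[of 0] by simp
  show "AE x in half_line. k x = 0"
    by (rule AE_zero_of_integral_Icc) (use * c k in \<open>auto simp: Prim_def loc_int_def\<close>)
qed

section \<open>The weighted space and the closed gradient graph\<close>

section \<open>The form of the Bessel operator\<close>

text \<open>The square root of the density of \<mu>; multiplication by it carries L^2(d\<mu>)
  isometrically to L^2 of Lebesgue measure on the half-line.\<close>

definition wt :: "real \<Rightarrow> real \<Rightarrow> real" where "wt \<delta> x = x powr ((\<delta> - 1) / 2)"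

lemma wt_sq: "0 < x \<Longrightarrow> (wt \<delta> x)\<^sup>2 = x powr (\<delta> - 1)"
  by (simp add: wt_def power2_eq_square powr_add[symmetric])

lemma wt_pos: "0 < x \<Longrightarrow> 0 < wt \<delta> x" by (simp add: wt_def)

lemma borel_measurable_half_line_of_borel [measurable (raw)]:
  "f \<in> borel_measurable borel \<Longrightarrow> f \<in> borel_measurable half_line"
  unfolding half_line_def by (intro measurable_restrict_space1) simp

lemma wt_measurable [measurable]: "wt \<delta> \<in> borel_measurable half_line"
  by (rule borel_measurable_half_line_of_borel) (simp add: wt_def[abs_def])

lemma bessel_measure_density: "bessel_measure \<delta> = density half_line (\<lambda>x. ennreal ((wt \<delta> x)\<^sup>2))"
  unfolding bessel_measure_def half_line_def[symmetric]
proof (rule density_cong)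
  show "(\<lambda>x. ennreal (x powr (\<delta> - 1) * indicator {0<..} x)) \<in> borel_measurable half_line"
    by (intro borel_measurable_half_line_of_borel) measurable
  show "AE x in half_line. ennreal (x powr (\<delta> - 1) * indicator {0<..} x) = ennreal ((wt \<delta> x)\<^sup>2)"
    using AE_half_line_pos by eventually_elim (simp add: wt_sq)
qed measurable

lemma measurable_bessel [simp]: "borel_measurable (bessel_measure \<delta>) = (borel_measurable half_line :: (real \<Rightarrow> real) set)"
  unfolding bessel_measure_density by (intro measurable_cong_sets) auto

text \<open>The density is positive away from the null set {0}, so the null sets do not depend on
  \<delta>.\<close>

lemma AE_bessel_iff: "(AE x in bessel_measure \<delta>. P x) \<longleftrightarrow> (AE x in half_line. P x)"
proof -
  have "(AE x in bessel_measure \<delta>. P x) \<longleftrightarrow> (AE x in half_line. 0 < ennreal ((wt \<delta> x)\<^sup>2) \<longrightarrow> P x)"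
    unfolding bessel_measure_density by (rule AE_density) measurable
  also have "\<dots> \<longleftrightarrow> (AE x in half_line. P x)"
  proof
    assume "AE x in half_line. 0 < ennreal ((wt \<delta> x)\<^sup>2) \<longrightarrow> P x"
    then show "AE x in half_line. P x"
      using AE_half_line_pos by eventually_elim (use wt_pos in \<open>simp add: less_imp_neq[symmetric]\<close>)
  next
    assume "AE x in half_line. P x"
    then show "AE x in half_line. 0 < ennreal ((wt \<delta> x)\<^sup>2) \<longrightarrow> P x" by eventually_elim simp
  qed
  finally show ?thesis .
qed

lemma
  fixes f :: "real \<Rightarrow> real"
  assumes f: "f \<in> borel_measurable half_line"
  shows integrable_bessel: "integrable (bessel_measure \<delta>) f \<longleftrightarrow> integrable half_line (\<lambda>x. (wt \<delta> x)\<^sup>2 * f x)"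
    and integral_bessel: "integral\<^sup>L (bessel_measure \<delta>) f = (\<integral>x. (wt \<delta> x)\<^sup>2 * f x \<partial>half_line)"
proof -
  have [measurable]: "f \<in> borel_measurable half_line" by (rule f)
  have w: "(\<lambda>x. (wt \<delta> x)\<^sup>2) \<in> borel_measurable half_line" by measurable
  show "integrable (bessel_measure \<delta>) f \<longleftrightarrow> integrable half_line (\<lambda>x. (wt \<delta> x)\<^sup>2 * f x)"
    unfolding bessel_measure_density by (rule integrable_real_density[OF w _ f]) simp
  show "integral\<^sup>L (bessel_measure \<delta>) f = (\<integral>x. (wt \<delta> x)\<^sup>2 * f x \<partial>half_line)"
    unfolding bessel_measure_density by (rule integral_real_density[OF w _ f]) simp
qed

lemma L2_bessel_iff: "h \<in> L2_space (bessel_measure \<delta>) \<longleftrightarrow>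
    h \<in> borel_measurable half_line \<and> (\<lambda>x. wt \<delta> x * h x) \<in> L2_space half_line"
  unfolding L2_space_def by (auto simp: integrable_bessel power_mult_distrib)

text \<open>The unitary map from \<open>L\<^sup>2(d\<mu>)\<close> onto the square integrable functions on the half-line,
  and a section of it.\<close>

definition U :: "real \<Rightarrow> (real \<Rightarrow> real) \<Rightarrow> l2" where "U \<delta> h = abs_l2 (\<lambda>x. wt \<delta> x * h x)"

definition V :: "real \<Rightarrow> l2 \<Rightarrow> real \<Rightarrow> real" where
  "V \<delta> a x = x powr ((1 - \<delta>) / 2) * rep_l2 a x"

abbreviation L2b :: "real \<Rightarrow> (real \<Rightarrow> real) set" where "L2b \<delta> \<equiv> L2_space (bessel_measure \<delta>)"

lemma U_inner: "h \<in> L2b \<delta> \<Longrightarrow> k \<in> L2b \<delta> \<Longrightarrow> U \<delta> h \<bullet> U \<delta> k = L2_inner (bessel_measure \<delta>) h k"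
  unfolding U_def by (subst abs_l2_inner)
    (auto simp: L2_bessel_iff L2_inner_def integral_bessel power2_eq_square mult_ac)

lemma norm_U: "h \<in> L2b \<delta> \<Longrightarrow> norm (U \<delta> h) = L2_norm (bessel_measure \<delta>) h"
  by (simp add: norm_eq_sqrt_inner U_inner L2_norm_def)

lemma U_add: "h \<in> L2b \<delta> \<Longrightarrow> k \<in> L2b \<delta> \<Longrightarrow> U \<delta> (\<lambda>x. h x + k x) = U \<delta> h + U \<delta> k"
  unfolding U_def by (subst abs_l2_add) (auto simp: L2_bessel_iff distrib_left)

lemma U_diff: "h \<in> L2b \<delta> \<Longrightarrow> k \<in> L2b \<delta> \<Longrightarrow> U \<delta> (\<lambda>x. h x - k x) = U \<delta> h - U \<delta> k"
  unfolding U_def by (subst abs_l2_diff) (auto simp: L2_bessel_iff right_diff_distrib)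

lemma U_scale: "h \<in> L2b \<delta> \<Longrightarrow> U \<delta> (\<lambda>x. c * h x) = c *\<^sub>R U \<delta> h"
  unfolding U_def by (subst abs_l2_scale) (auto simp: L2_bessel_iff mult_ac)

lemma U_zero [simp]: "U \<delta> (\<lambda>x. 0) = 0" by (simp add: U_def abs_l2_zero)

lemma U_eq_iff:
  assumes "h \<in> L2b \<delta>" "k \<in> L2b \<delta>"
  shows "U \<delta> h = U \<delta> k \<longleftrightarrow> (AE x in half_line. h x = k x)"
proof -
  have "U \<delta> h = U \<delta> k \<longleftrightarrow> (AE x in half_line. wt \<delta> x * h x = wt \<delta> x * k x)"
    unfolding U_def by (rule abs_l2_eq_iff) (use assms in \<open>auto simp: L2_bessel_iff\<close>)
  also have "\<dots> \<longleftrightarrow> (AE x in half_line. h x = k x)"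
  proof
    assume "AE x in half_line. wt \<delta> x * h x = wt \<delta> x * k x"
    then show "AE x in half_line. h x = k x"
      using AE_half_line_pos
    proof eventually_elim
      case (elim x)
      then show ?case using wt_pos[of x \<delta>] by simp
    qed
  next
    assume "AE x in half_line. h x = k x"
    then show "AE x in half_line. wt \<delta> x * h x = wt \<delta> x * k x" by eventually_elim simp
  qed
  finally show ?thesis .
qed

lemma wt_V: "0 < x \<Longrightarrow> wt \<delta> x * V \<delta> a x = rep_l2 a x"
  by (simp add: wt_def V_def powr_add[symmetric] mult.assoc[symmetric] add_divide_distrib[symmetric])

lemma V_in_L2b: "V \<delta> a \<in> L2b \<delta>" and U_V [simp]: "U \<delta> (V \<delta> a) = a"
proof -
  have [measurable]: "rep_l2 a \<in> borel_measurable half_line" using rep_l2_in[of a] by (simp add: L2_space_def)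
  have [measurable]: "(\<lambda>x. x powr ((1 - \<delta>) / 2)) \<in> borel_measurable half_line"
    by (rule borel_measurable_half_line_of_borel) measurable
  have m: "V \<delta> a \<in> borel_measurable half_line" unfolding V_def[abs_def] by measurable
  have ae: "AE x in half_line. wt \<delta> x * V \<delta> a x = rep_l2 a x"
    using AE_half_line_pos by eventually_elim (rule wt_V)
  have L: "(\<lambda>x. wt \<delta> x * V \<delta> a x) \<in> L2_space half_line"
    by (rule L2_cong_AE[OF rep_l2_in[of a] _ ae]) (use m in measurable)
  show "V \<delta> a \<in> L2b \<delta>" using m L by (simp add: L2_bessel_iff)
  have "U \<delta> (V \<delta> a) = abs_l2 (rep_l2 a)" unfolding U_def by (subst abs_l2_eq_iff[OF L rep_l2_in]) (rule ae)
  then show "U \<delta> (V \<delta> a) = a" by simp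
qed

lemma L2b_measurable: "h \<in> L2b \<delta> \<Longrightarrow> h \<in> borel_measurable half_line"
  by (simp add: L2_bessel_iff)

locale bessel =
  fixes \<delta> :: real
  assumes \<delta>0: "0 < \<delta>" and \<delta>1: "\<delta> < 1"
begin

text \<open>Testing against \<open>eval_vec b\<close> gives \<open>\<integral>\<^sub>0\<^sup>b k\<close> (no weight).\<close>

definition eval_fun :: "real \<Rightarrow> real \<Rightarrow> real" where
  "eval_fun b x = indicator {0..b} x * x powr ((1 - \<delta>) / 2)"

lemma eval_fun_L2: "eval_fun b \<in> L2_space half_line"
proof (rule L2_bound)
  show "(\<lambda>x. b powr ((1 - \<delta>) / 2) * indicator {0..b} x) \<in> L2_space half_line"
    by (rule L2_scale[OF indicator_L2])
  show "eval_fun b \<in> borel_measurable half_line"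
    unfolding eval_fun_def by (rule borel_measurable_half_line_of_borel) measurable
  show "AE x in half_line. \<bar>eval_fun b x\<bar> \<le> \<bar>b powr ((1 - \<delta>) / 2) * indicator {0..b} x\<bar>"
    using \<delta>1 by (intro AE_I2) (auto simp: eval_fun_def indicator_def intro!: powr_mono2)
qed

lemma eval_fun_mult: "0 < x \<Longrightarrow> (wt \<delta> x * k x) * eval_fun b x = indicator {0..b} x * k x"
  by (simp add: wt_def eval_fun_def powr_add[symmetric] mult_ac add_divide_distrib[symmetric])

text \<open>As \<delta> < 1, the function \<open>eval_fun b\<close> is bounded, so the integral of k
  over [0, b] is a bounded functional on L^2(d\<mu>). Hence derivatives in L^2(d\<mu>) are locally
  integrable, and their primitives converge pointwise under norm convergence.\<close>

lemma
  assumes k: "k \<in> L2b \<delta>"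
  shows L2b_loc_int: "loc_int k" and Prim_inner: "Prim k b = U \<delta> k \<bullet> abs_l2 (eval_fun b)"
proof -
  have wk: "(\<lambda>x. wt \<delta> x * k x) \<in> L2_space half_line" and km: "k \<in> borel_measurable half_line"
    using k by (auto simp: L2_bessel_iff)
  have i: "integrable half_line (\<lambda>x. (wt \<delta> x * k x) * eval_fun b x)" for b
    by (rule L2_mult_integrable[OF wk eval_fun_L2])
  have [measurable]: "(\<lambda>x. indicator {0..b} x * k x) \<in> borel_measurable half_line" for b
    by (rule borel_measurable_half_line_of_borel[OF borel_measurable_half_line_indicator[OF km]])
  have ae: "AE x in half_line. (wt \<delta> x * k x) * eval_fun b x = indicator {0..b} x * k x" for b
    using AE_half_line_pos by eventually_elim (rule eval_fun_mult)
  have i': "integrable half_line (\<lambda>x. indicator {0..b} x * k x)" for b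
    by (rule integrable_cong_AE_imp[OF i[of b] _ ae]) measurable
  have eq: "(\<lambda>x. indicator {0..} x * (indicator {0..b} x * k x)) = (\<lambda>x. indicator {0..b} x * k x)" for b
    by (auto simp: indicator_def)
  show "loc_int k" using i' unfolding loc_int_def half_line_integral eq by simp
  have "U \<delta> k \<bullet> abs_l2 (eval_fun b) = (\<integral>x. (wt \<delta> x * k x) * eval_fun b x \<partial>half_line)"
    unfolding U_def by (simp add: abs_l2_inner[OF wk eval_fun_L2] L2_inner_def)
  also have "\<dots> = (\<integral>x. indicator {0..b} x * k x \<partial>half_line)"
    by (rule integral_cong_AE[OF _ _ ae]) (use i in auto)
  also have "\<dots> = Prim k b" unfolding half_line_integral eq Prim_def ..
  finally show "Prim k b = U \<delta> k \<bullet> abs_l2 (eval_fun b)" by simp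
qed

text \<open>The working form of \<open>H_deriv\<close>, free of interval integrals and of the chosen
  representative: the constant is the value of the representative at 0.\<close>

lemma H_deriv_iff:
  "H_deriv \<delta> h k \<longleftrightarrow> k \<in> L2b \<delta> \<and> (\<exists>c. AE x in half_line. h x = c + Prim k x)"
proof
  assume H: "H_deriv \<delta> h k"
  then obtain h0 where k: "k \<in> L2b \<delta>" and h0: "AE x in half_line. h0 x = h x"
    "\<And>x y. 0 \<le> x \<Longrightarrow> 0 \<le> y \<Longrightarrow> h0 x - h0 y = (LBINT z=ereal y..ereal x. k z)"
    unfolding H_deriv_def AE_bessel_iff by blast
  have eq: "h0 x = h0 0 + Prim k x" if "0 \<le> x" for x
    using h0(2)[of x 0] interval_integral_Prim[OF L2b_loc_int[OF k], of x 0] that by simp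
  have "AE x in half_line. h x = h0 0 + Prim k x"
    using h0(1) AE_half_line_pos
  proof eventually_elim
    case (elim x)
    from elim(1)[symmetric] eq[OF less_imp_le[OF elim(2)]] show ?case by (rule trans)
  qed
  then show "k \<in> L2b \<delta> \<and> (\<exists>c. AE x in half_line. h x = c + Prim k x)" using k by blast
next
  assume R: "k \<in> L2b \<delta> \<and> (\<exists>c. AE x in half_line. h x = c + Prim k x)"
  then obtain c where c: "AE x in half_line. h x = c + Prim k x" and k: "k \<in> L2b \<delta>" by blast
  show "H_deriv \<delta> h k"
    unfolding H_deriv_def AE_bessel_iff
  proof (intro conjI exI[of _ "\<lambda>x. c + Prim k x"] allI impI k)
    show "AE x in half_line. c + Prim k x = h x" using c by eventually_elim simp
    show "c + Prim k x - (c + Prim k y) = (LBINT z=ereal y..ereal x. k z)" if "0 \<le> x" "0 \<le> y" for x y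
      using interval_integral_Prim[OF L2b_loc_int[OF k] that] by simp
  qed
qed

lemma H_deriv_add:
  assumes "H_deriv \<delta> h k" "H_deriv \<delta> h' k'"
  shows "H_deriv \<delta> (\<lambda>x. h x + h' x) (\<lambda>x. k x + k' x)"
proof -
  obtain c c' where c: "AE x in half_line. h x = c + Prim k x" "AE x in half_line. h' x = c' + Prim k' x"
    and k: "k \<in> L2b \<delta>" "k' \<in> L2b \<delta>" using assms by (auto simp: H_deriv_iff)
  have "AE x in half_line. h x + h' x = (c + c') + Prim (\<lambda>x. k x + k' x) x"
    using c by eventually_elim (simp add: Prim_add L2b_loc_int k)
  then show ?thesis using L2_add[OF k] by (auto simp: H_deriv_iff)
qed

lemma H_deriv_scale:
  assumes "H_deriv \<delta> h k"
  shows "H_deriv \<delta> (\<lambda>x. a * h x) (\<lambda>x. a * k x)"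
proof -
  obtain c where c: "AE x in half_line. h x = c + Prim k x" and k: "k \<in> L2b \<delta>"
    using assms by (auto simp: H_deriv_iff)
  have "AE x in half_line. a * h x = a * c + Prim (\<lambda>x. a * k x) x"
    using c by eventually_elim (simp add: Prim_scale algebra_simps)
  then show ?thesis using L2_scale[OF k] by (auto simp: H_deriv_iff)
qed

lemma H_deriv_diff:
  assumes "H_deriv \<delta> h k" "H_deriv \<delta> h' k'"
  shows "H_deriv \<delta> (\<lambda>x. h x - h' x) (\<lambda>x. k x - k' x)"
  using H_deriv_add[OF assms(1) H_deriv_scale[OF assms(2), of "-1"]] by simp

lemma H_deriv_cong:
  assumes "H_deriv \<delta> h k" "AE x in half_line. h' x = h x"
  shows "H_deriv \<delta> h' k"
proof -
  obtain c where c: "AE x in half_line. h x = c + Prim k x" and k: "k \<in> L2b \<delta>"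
    using assms(1) by (auto simp: H_deriv_iff)
  have "AE x in half_line. h' x = c + Prim k x" using assms(2) c by eventually_elim simp
  then show ?thesis using k by (auto simp: H_deriv_iff)
qed

text \<open>Applied to differences, this shows that the derivative depends only on the class of h,
  so the choice in \<open>H_dx\<close> is immaterial up to null sets.\<close>

lemma H_deriv_zero:
  assumes "H_deriv \<delta> h k" "AE x in half_line. h x = 0"
  shows "AE x in half_line. k x = 0"
proof -
  obtain c where c: "AE x in half_line. h x = c + Prim k x" and k: "k \<in> L2b \<delta>"
    using assms(1) by (auto simp: H_deriv_iff)
  have "AE x in half_line. c + Prim k x = 0" using assms(2) c by eventually_elim simp
  then show ?thesis by (rule AE_Prim_const(2)[OF L2b_loc_int[OF k]])
qed

lemma H_deriv_unique:
  assumes "H_deriv \<delta> h k" "H_deriv \<delta> h' k'" "AE x in half_line. h x = h' x"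
  shows "AE x in half_line. k x = k' x"
proof -
  have "AE x in half_line. h x - h' x = 0" using assms(3) by eventually_elim simp
  from H_deriv_zero[OF H_deriv_diff[OF assms(1,2)] this] show ?thesis by eventually_elim simp
qed

text \<open>The factor 1 / sqrt 2 makes the product norm of the pair equal to \<open>H_norm\<close>,
  and the pairing of second components equal to the form 1/2 <h', k'>.\<close>

definition Gr :: "(l2 \<times> l2) set" where
  "Gr = {(U \<delta> h, (1 / sqrt 2) *\<^sub>R U \<delta> k) | h k. h \<in> L2b \<delta> \<and> H_deriv \<delta> h k}"

lemma GrI: "h \<in> L2b \<delta> \<Longrightarrow> H_deriv \<delta> h k \<Longrightarrow> (U \<delta> h, (1 / sqrt 2) *\<^sub>R U \<delta> k) \<in> Gr"
  by (auto simp: Gr_def)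

lemma H_deriv_L2b: "H_deriv \<delta> h k \<Longrightarrow> k \<in> L2b \<delta>" by (simp add: H_deriv_iff)

lemma subspace_Gr: "subspace Gr"
  unfolding subspace_def
proof (intro conjI ballI allI)
  have "H_deriv \<delta> (\<lambda>x. 0) (\<lambda>x. 0)"
    unfolding H_deriv_iff by (auto intro!: exI[of _ 0] simp: Prim_def)
  from GrI[OF _ this] show "0 \<in> Gr" by (simp add: zero_prod_def)
  fix p q assume "p \<in> Gr" "q \<in> Gr"
  then obtain h k h' k' where *: "h \<in> L2b \<delta>" "H_deriv \<delta> h k" "h' \<in> L2b \<delta>" "H_deriv \<delta> h' k'"
    "p = (U \<delta> h, (1 / sqrt 2) *\<^sub>R U \<delta> k)" "q = (U \<delta> h', (1 / sqrt 2) *\<^sub>R U \<delta> k')"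
    by (auto simp: Gr_def)
  have "p + q = (U \<delta> (\<lambda>x. h x + h' x), (1 / sqrt 2) *\<^sub>R U \<delta> (\<lambda>x. k x + k' x))"
    using * by (simp add: U_add H_deriv_L2b scaleR_add_right)
  then show "p + q \<in> Gr" using GrI[OF L2_add[OF *(1,3)] H_deriv_add[OF *(2,4)]] by simp
next
  fix a p assume "p \<in> Gr"
  then obtain h k where *: "h \<in> L2b \<delta>" "H_deriv \<delta> h k" "p = (U \<delta> h, (1 / sqrt 2) *\<^sub>R U \<delta> k)"
    by (auto simp: Gr_def)
  have "a *\<^sub>R p = (U \<delta> (\<lambda>x. a * h x), (1 / sqrt 2) *\<^sub>R U \<delta> (\<lambda>x. a * k x))"
    using * by (simp add: U_scale H_deriv_L2b)
  then show "a *\<^sub>R p \<in> Gr" using GrI[OF L2_scale[OF *(1)] H_deriv_scale[OF *(2)]] by simp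
qed

lemma Gr_iff: "(a, b) \<in> Gr \<longleftrightarrow> H_deriv \<delta> (V \<delta> a) (V \<delta> (sqrt 2 *\<^sub>R b))"
proof
  assume "(a, b) \<in> Gr"
  then obtain h k where *: "h \<in> L2b \<delta>" "H_deriv \<delta> h k" "a = U \<delta> h" "b = (1 / sqrt 2) *\<^sub>R U \<delta> k"
    by (auto simp: Gr_def)
  have k: "k \<in> L2b \<delta>" by (rule H_deriv_L2b[OF *(2)])
  have "AE x in half_line. V \<delta> a x = h x" using U_eq_iff[OF V_in_L2b *(1)] *(3) by simp
  then have 1: "H_deriv \<delta> (V \<delta> a) k" by (rule H_deriv_cong[OF *(2)])
  have ae: "AE x in half_line. k x = V \<delta> (sqrt 2 *\<^sub>R b) x"
    using U_eq_iff[OF k V_in_L2b, of "sqrt 2 *\<^sub>R b"] *(4) by simp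
  have "Prim k x = Prim (V \<delta> (sqrt 2 *\<^sub>R b)) x" for x
    by (rule Prim_cong_AE[OF ae]) (use k V_in_L2b in \<open>auto simp: L2_bessel_iff\<close>)
  then show "H_deriv \<delta> (V \<delta> a) (V \<delta> (sqrt 2 *\<^sub>R b))"
    using 1 V_in_L2b by (simp add: H_deriv_iff)
next
  assume "H_deriv \<delta> (V \<delta> a) (V \<delta> (sqrt 2 *\<^sub>R b))"
  from GrI[OF V_in_L2b this] show "(a, b) \<in> Gr" by simp
qed

text \<open>The derivatives converge in norm, so their primitives converge at every point. Along a
  subsequence the functions themselves converge almost everywhere. Hence the integration constants
  converge, as one common point of convergence shows.\<close>

lemma closed_Gr: "closed Gr"
  unfolding closed_sequential_limits
proof (intro allI impI, elim conjE)
  fix p :: "nat \<Rightarrow> l2 \<times> l2" and l assume p: "\<forall>n. p n \<in> Gr" and lim: "p \<longlonglongrightarrow> l"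
  obtain a b where l: "l = (a, b)" by (cases l)
  define h where "h = (\<lambda>n. V \<delta> (fst (p n)))"
  define k where "k = (\<lambda>n. V \<delta> (sqrt 2 *\<^sub>R snd (p n)))"
  have hk: "H_deriv \<delta> (h n) (k n)" for n using p Gr_iff[of "fst (p n)" "snd (p n)"] by (simp add: h_def k_def)
  obtain c where c: "\<And>n. AE x in half_line. h n x = c n + Prim (k n) x"
    using hk unfolding H_deriv_iff by metis
  have la: "(\<lambda>n. fst (p n)) \<longlonglongrightarrow> a" and lb: "(\<lambda>n. snd (p n)) \<longlonglongrightarrow> b"
    using tendsto_fst[OF lim] tendsto_snd[OF lim] by (simp_all add: l)
  have Plim: "(\<lambda>n. Prim (k n) x) \<longlonglongrightarrow> Prim (V \<delta> (sqrt 2 *\<^sub>R b)) x" for x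
    unfolding Prim_inner[OF V_in_L2b] k_def by (simp only: U_V) (intro tendsto_intros lb)
  have hw: "(\<lambda>x. wt \<delta> x * h n x) \<in> L2_space half_line" for n
    using V_in_L2b[of \<delta> "fst (p n)"] by (simp add: h_def L2_bessel_iff)
  have aw: "(\<lambda>x. wt \<delta> x * V \<delta> a x) \<in> L2_space half_line"
    using V_in_L2b[of \<delta> a] by (simp add: L2_bessel_iff)
  have "(\<lambda>n. abs_l2 (\<lambda>x. wt \<delta> x * h n x)) \<longlonglongrightarrow> abs_l2 (\<lambda>x. wt \<delta> x * V \<delta> a x)"
    using la by (simp add: h_def U_def[symmetric])
  from l2_AE_subseq[OF hw aw this] obtain r where r: "strict_mono r"
    "AE x in half_line. (\<lambda>n. wt \<delta> x * h (r n) x) \<longlonglongrightarrow> wt \<delta> x * V \<delta> a x" by blast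
  have conv: "AE x in half_line. (\<lambda>n. c (r n)) \<longlonglongrightarrow> V \<delta> a x - Prim (V \<delta> (sqrt 2 *\<^sub>R b)) x"
  proof -
    have "AE x in half_line. \<forall>n. h n x = c n + Prim (k n) x" unfolding AE_all_countable using c by blast
    then show ?thesis
      using r(2) AE_half_line_pos
    proof eventually_elim
      case (elim x)
      have w: "wt \<delta> x \<noteq> 0" using wt_pos[OF elim(3)] by (simp add: less_imp_neq[symmetric])
      have "(\<lambda>n. inverse (wt \<delta> x) * (wt \<delta> x * h (r n) x)) \<longlonglongrightarrow> inverse (wt \<delta> x) * (wt \<delta> x * V \<delta> a x)"
        by (intro tendsto_intros elim(2))
      then have "(\<lambda>n. h (r n) x) \<longlonglongrightarrow> V \<delta> a x" using w by (simp add: mult.assoc[symmetric])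
      moreover have "(\<lambda>n. Prim (k (r n)) x) \<longlonglongrightarrow> Prim (V \<delta> (sqrt 2 *\<^sub>R b)) x"
        using LIMSEQ_subseq_LIMSEQ[OF Plim r(1)] by (simp add: o_def)
      ultimately have "(\<lambda>n. h (r n) x - Prim (k (r n)) x) \<longlonglongrightarrow> V \<delta> a x - Prim (V \<delta> (sqrt 2 *\<^sub>R b)) x"
        by (rule tendsto_diff)
      then show ?case using elim(1) by simp
    qed
  qed
  obtain y where "(\<lambda>n. c (r n)) \<longlonglongrightarrow> V \<delta> a y - Prim (V \<delta> (sqrt 2 *\<^sub>R b)) y"
    using AE_half_line_ex[OF conv, of 0 1] by auto
  then obtain c0 where c0: "(\<lambda>n. c (r n)) \<longlonglongrightarrow> c0" by blast
  have "AE x in half_line. V \<delta> a x = c0 + Prim (V \<delta> (sqrt 2 *\<^sub>R b)) x"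
    using conv
  proof eventually_elim
    case (elim x)
    from LIMSEQ_unique[OF elim c0] show ?case by simp
  qed
  then have "H_deriv \<delta> (V \<delta> a) (V \<delta> (sqrt 2 *\<^sub>R b))" using V_in_L2b by (auto simp: H_deriv_iff)
  then show "l \<in> Gr" by (simp add: l Gr_iff)
qed

lemma single_Gr: "(0, b) \<in> Gr \<Longrightarrow> b = 0"
proof -
  assume "(0, b) \<in> Gr"
  then obtain h k where *: "h \<in> L2b \<delta>" "H_deriv \<delta> h k" "U \<delta> h = 0" "b = (1 / sqrt 2) *\<^sub>R U \<delta> k"
    by (auto simp: Gr_def)
  have "AE x in half_line. h x = 0" using U_eq_iff[OF *(1) L2_zero] *(3) by simp
  then have "AE x in half_line. k x = 0" by (rule H_deriv_zero[OF *(2)])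
  then have "U \<delta> k = 0" using U_eq_iff[OF H_deriv_L2b[OF *(2)] L2_zero] by simp
  then show "b = 0" using *(4) by simp
qed

end

section \<open>Test functions and the integration by parts against the generator\<close>

subsection \<open>Test functions\<close>

lemma at_within_half_line_neq_bot: "0 \<le> x \<Longrightarrow> at x within {0..} \<noteq> (bot :: real filter)"
proof -
  assume x: "0 \<le> x"
  have "at_right x \<le> at x within {0..}" by (rule at_le) (use x in auto)
  then show ?thesis using trivial_limit_at_right_real[of x] by (auto simp: bot_unique)
qed

lemma half_line_deriv_eq:
  assumes "0 \<le> x" "(f has_real_derivative y) (at x within {0..})"
  shows "half_line_deriv f x = y"
  unfolding half_line_deriv_def
  using vector_derivative_within[OF at_within_half_line_neq_bot[OF assms(1)]] assms(2)
  by (simp add: has_real_derivative_iff_has_vector_derivative)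

lemma half_line_deriv_works:
  assumes "f differentiable_on {0..}" "0 \<le> x"
  shows "(f has_real_derivative half_line_deriv f x) (at x within {0..})"
  using assms unfolding half_line_deriv_def differentiable_on_def has_real_derivative_iff_has_vector_derivative
  by (auto simp: vector_derivative_works)

lemma test_functionI:
  assumes d1: "\<And>x. 0 \<le> x \<Longrightarrow> (f has_real_derivative f' x) (at x within {0..})"
    and d2: "\<And>x. 0 \<le> x \<Longrightarrow> (f' has_real_derivative f'' x) (at x within {0..})"
    and cont: "continuous_on {0..} f''" and f'0: "f' 0 = 0" and R: "\<And>x. R \<le> x \<Longrightarrow> 0 \<le> x \<Longrightarrow> f x = 0"
  shows "f \<in> test_functions"
proof -
  have e1: "half_line_deriv f x = f' x" if "0 \<le> x" for x by (rule half_line_deriv_eq[OF that d1[OF that]])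
  have d2': "(half_line_deriv f has_real_derivative f'' x) (at x within {0..})" if x: "0 \<le> x" for x
    using has_vector_derivative_transform[of x "{0..}" "half_line_deriv f" f' "f'' x"] d2[OF x] x e1
    by (simp add: has_real_derivative_iff_has_vector_derivative)
  have e2: "half_line_deriv (half_line_deriv f) x = f'' x" if "0 \<le> x" for x
    by (rule half_line_deriv_eq[OF that d2'[OF that]])
  have "f differentiable_on {0..}" "half_line_deriv f differentiable_on {0..}"
    using d1 d2' unfolding differentiable_on_def real_differentiable_def by auto
  moreover have "continuous_on {0..} (half_line_deriv (half_line_deriv f))"
    by (rule continuous_on_eq[OF cont]) (simp add: e2)
  moreover have "compact (closure {x \<in> {0..}. f x \<noteq> 0})"
  proof -
    have "{x \<in> {0..}. f x \<noteq> 0} \<subseteq> {0..R}"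
    proof
      fix x assume "x \<in> {x \<in> {0..}. f x \<noteq> 0}"
      then show "x \<in> {0..R}" using R[of x] by (cases "R \<le> x") auto
    qed
    then have "bounded {x \<in> {0..}. f x \<noteq> 0}" using bounded_closed_interval bounded_subset by blast
    then show ?thesis by (simp add: compact_closure)
  qed
  ultimately show ?thesis using e1[of 0] f'0 by (simp add: test_functions_def)
qed

lemma at_within_half_line: "0 < x \<Longrightarrow> at x within {0..} = at (x::real)"
  by (rule at_within_open_subset[of x "{0<..}"]) auto

lemma zero_derivative_beyond:
  assumes d: "\<And>x. 0 \<le> x \<Longrightarrow> (f has_real_derivative f' x) (at x within {0..})"
    and R: "\<And>x. R \<le> x \<Longrightarrow> f x = 0" and x: "0 \<le> R" "R < x"
  shows "f' x = 0"
proof -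
  have "(f has_real_derivative f' x) (at x)"
    using d[of x] x by (simp add: at_within_half_line)
  moreover have "(f has_real_derivative 0) (at x)"
    by (rule has_field_derivative_transform_within_open[of "\<lambda>x. 0" _ _ "{R<..}"]) (use x R in auto)
  ultimately show ?thesis by (rule DERIV_unique)
qed

lemma test_functionE:
  assumes "f \<in> test_functions"
  obtains f'' R where
    "\<And>x. 0 \<le> x \<Longrightarrow> (f has_real_derivative half_line_deriv f x) (at x within {0..})"
    "\<And>x. 0 \<le> x \<Longrightarrow> (half_line_deriv f has_real_derivative f'' x) (at x within {0..})"
    "continuous_on {0..} f''" "half_line_deriv f 0 = 0" "0 < R"
    "\<And>x. R \<le> x \<Longrightarrow> f x = 0" "\<And>x. R \<le> x \<Longrightarrow> half_line_deriv f x = 0" "\<And>x. R \<le> x \<Longrightarrow> f'' x = 0"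
    "\<And>x. bessel_generator \<delta> f x = f'' x / 2 + (\<delta> - 1) * half_line_deriv f x / (2 * x)"
proof -
  let ?f' = "half_line_deriv f" and ?f'' = "half_line_deriv (half_line_deriv f)"
  have d1: "(f has_real_derivative ?f' x) (at x within {0..})" if "0 \<le> x" for x
    using assms that by (intro half_line_deriv_works) (auto simp: test_functions_def)
  have d2: "(?f' has_real_derivative ?f'' x) (at x within {0..})" if "0 \<le> x" for x
    using assms that by (intro half_line_deriv_works) (auto simp: test_functions_def)
  have "bounded {x \<in> {0..}. f x \<noteq> 0}"
    using assms compact_imp_bounded bounded_subset closure_subset by (auto simp: test_functions_def)
  then obtain B where B: "\<And>x. 0 \<le> x \<Longrightarrow> f x \<noteq> 0 \<Longrightarrow> norm x \<le> B" by (auto simp: bounded_iff)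
  define R where "R = \<bar>B\<bar> + 1"
  have R: "f x = 0" if "R \<le> x" for x using B[of x] that by (force simp: R_def)
  have R0: "0 \<le> R" by (simp add: R_def)
  \<comment> \<open>\<open>zero_derivative_beyond\<close> gives zeros strictly beyond the previous
    bound. Each differentiation therefore shifts the bound by 1 to keep a weak inequality, whence
    \<open>R + 2\<close> in the end.\<close>
  have R': "?f' x = 0" if "R + 1 \<le> x" for x
    by (rule zero_derivative_beyond[OF d1 R R0]) (use that in auto)
  have R'': "?f'' x = 0" if "R + 2 \<le> x" for x
    by (rule zero_derivative_beyond[of ?f' ?f'' "R + 1" x, OF d2 R']) (use that R0 in auto)
  show thesis
    by (rule that[of ?f'' "R + 2"])
       (use d1 d2 R R' R'' R0 assms in \<open>auto simp: test_functions_def bessel_generator_def\<close>)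
qed

context bessel
begin

text \<open>The exponent exceeds -1 because \<delta> > 0. Thus \<mu> is finite on bounded intervals,
  and bounded measurable functions with bounded support lie in L^2(d\<mu>).\<close>

lemma powr_loc_int: "loc_int (\<lambda>x. x powr (\<delta> - 1))"
  unfolding loc_int_def
proof
  fix b
  show "integrable lborel (\<lambda>z. indicator {0..b} z * z powr (\<delta> - 1))"
  proof (cases "0 \<le> b")
    case True
    have "(\<lambda>x. x powr (\<delta> - 1)) integrable_on {0..b}"
      by (rule integrable_on_powr_from_0) (use \<delta>0 True in auto)
    then have "(\<lambda>x. x powr (\<delta> - 1)) absolutely_integrable_on {0..b}"
      by (intro nonnegative_absolutely_integrable_1) auto
    then have "integrable lebesgue (\<lambda>x. indicator {0..b} x * x powr (\<delta> - 1))"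
      by (simp add: set_integrable_def)
    then show ?thesis by (subst (asm) integrable_completion) auto
  qed simp
qed

lemma indicator_L2b: "(indicator {0..b} :: real \<Rightarrow> real) \<in> L2b \<delta>"
proof -
  have m [measurable]: "(indicator {0..b} :: real \<Rightarrow> real) \<in> borel_measurable half_line"
    by (rule borel_measurable_half_line_of_borel) simp
  have "integrable half_line (\<lambda>x. indicator {0..b} x * x powr (\<delta> - 1))"
  proof -
    have "(\<lambda>x. indicator {0..} x * (indicator {0..b} x * x powr (\<delta> - 1))) = (\<lambda>x. indicator {0..b} x * x powr (\<delta> - 1))"
      by (auto simp: indicator_def)
    then show ?thesis using powr_loc_int unfolding half_line_integral loc_int_def by simp
  qed
  then have "integrable half_line (\<lambda>x. (wt \<delta> x * indicator {0..b} x)\<^sup>2)"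
  proof (rule integrable_cong_AE_imp)
    show "AE x in half_line. indicator {0..b} x * x powr (\<delta> - 1) = (wt \<delta> x * indicator {0..b} x)\<^sup>2"
      using AE_half_line_pos by eventually_elim (auto simp: power_mult_distrib wt_sq indicator_def)
  qed measurable
  then have "(\<lambda>x. wt \<delta> x * indicator {0..b} x) \<in> L2_space half_line"
    unfolding L2_space_def by simp
  then show ?thesis using m by (simp add: L2_bessel_iff)
qed

lemma L2b_bounded:
  assumes "f \<in> borel_measurable half_line" "\<And>x. 0 \<le> x \<Longrightarrow> \<bar>f x\<bar> \<le> C * indicator {0..R} x"
  shows "f \<in> L2b \<delta>"
proof (rule L2_bound[OF L2_scale[OF indicator_L2b]])
  show "AE x in bessel_measure \<delta>. \<bar>f x\<bar> \<le> \<bar>C * indicator {0..R} x\<bar>"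
    unfolding AE_bessel_iff
  proof (rule AE_I2)
    fix x :: real assume "x \<in> space half_line"
    then show "\<bar>f x\<bar> \<le> \<bar>C * indicator {0..R} x\<bar>" using assms(2)[of x] by simp
  qed
qed (use assms(1) in simp)

lemma continuous_bounded_L2b:
  assumes c: "continuous_on {0..} f" and R: "\<And>x. R \<le> x \<Longrightarrow> f x = 0"
  shows "f \<in> L2b \<delta>"
proof -
  have "bounded (f ` {0..R})"
    by (intro compact_imp_bounded compact_continuous_image continuous_on_subset[OF c]) auto
  then obtain C where "\<forall>y\<in>f ` {0..R}. norm y \<le> C" unfolding bounded_iff by blast
  then have C: "\<And>x. x \<in> {0..R} \<Longrightarrow> \<bar>f x\<bar> \<le> C" by simp
  show ?thesis
  proof (rule L2b_bounded[OF borel_measurable_half_line_continuous[OF c]])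
    fix x :: real assume "0 \<le> x"
    then show "\<bar>f x\<bar> \<le> C * indicator {0..R} x" using C[of x] R[of x] by (cases "x \<le> R") auto
  qed
qed

lemma DERIV_continuous_half_line:
  "(\<And>x. 0 \<le> x \<Longrightarrow> (f has_real_derivative f' x) (at x within {0..})) \<Longrightarrow> continuous_on {0..} f"
  by (rule DERIV_continuous_on) auto

lemma Prim_of_derivative:
  assumes d: "\<And>x. 0 \<le> x \<Longrightarrow> (f has_real_derivative f' x) (at x within {0..})" and f': "loc_int f'" and x: "0 \<le> x"
  shows "f x = f 0 + Prim f' x"
proof -
  have "(f' has_integral (f x - f 0)) {0..x}"
  proof (rule fundamental_theorem_of_calculus[OF x])
    fix y assume "y \<in> {0..x}"
    then have "(f has_real_derivative f' y) (at y within {0..x})"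
      by (intro has_field_derivative_subset[OF d]) auto
    then show "(f has_vector_derivative f' y) (at y within {0..x})"
      by (simp add: has_real_derivative_iff_has_vector_derivative)
  qed
  then show ?thesis by (simp add: Prim_eq_integral(2)[OF f'] integral_unique)
qed

lemma
  assumes "f \<in> test_functions"
  shows test_L2b: "f \<in> L2b \<delta>" and test_deriv_L2b: "half_line_deriv f \<in> L2b \<delta>"
    and test_H_deriv: "H_deriv \<delta> f (half_line_deriv f)"
    and generator_measurable: "bessel_generator \<delta> f \<in> borel_measurable half_line"
proof -
  obtain f'' R where
    d1: "\<And>x. 0 \<le> x \<Longrightarrow> (f has_real_derivative half_line_deriv f x) (at x within {0..})"
    and d2: "\<And>x. 0 \<le> x \<Longrightarrow> (half_line_deriv f has_real_derivative f'' x) (at x within {0..})"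
    and c: "continuous_on {0..} f''"
    and R: "\<And>x. R \<le> x \<Longrightarrow> f x = 0" "\<And>x. R \<le> x \<Longrightarrow> half_line_deriv f x = 0"
    and g: "\<And>x. bessel_generator \<delta> f x = f'' x / 2 + (\<delta> - 1) * half_line_deriv f x / (2 * x)"
    by (rule test_functionE[OF assms]) blast
  show "f \<in> L2b \<delta>" by (rule continuous_bounded_L2b[OF DERIV_continuous_half_line[OF d1] R(1)])
  show f': "half_line_deriv f \<in> L2b \<delta>" by (rule continuous_bounded_L2b[OF DERIV_continuous_half_line[OF d2] R(2)])
  have "AE x in half_line. f x = f 0 + Prim (half_line_deriv f) x"
    using AE_half_line_pos by eventually_elim (rule Prim_of_derivative[OF d1 L2b_loc_int[OF f']], auto)
  then show "H_deriv \<delta> f (half_line_deriv f)" using f' by (auto simp: H_deriv_iff)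
  have [measurable]: "f'' \<in> borel_measurable half_line" "half_line_deriv f \<in> borel_measurable half_line"
    "(\<lambda>x. x) \<in> borel_measurable half_line"
    using borel_measurable_half_line_continuous[OF c] L2b_measurable[OF f']
    by (auto intro: borel_measurable_half_line_of_borel)
  show "bessel_generator \<delta> f \<in> borel_measurable half_line" unfolding g[abs_def] by measurable
qed

lemma half_line_integral_cutoff:
  assumes "\<And>x. R \<le> x \<Longrightarrow> f x = (0::real)"
  shows "integral\<^sup>L half_line f = (\<integral>x. indicator {0..R} x * f x \<partial>lborel)"
  unfolding half_line_integral
  by (rule Bochner_Integration.integral_cong) (use assms in \<open>auto simp: indicator_def\<close>)

text \<open>For x > 0 the density times the generator of f is q/2, where q is the derivative of p =
  x^(\<delta>-1) f'. With h = c + Prim k and p = Prim q, the claim is \<open>Prim_parts\<close> on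
  [0, R]; the boundary terms disappear since p vanishes at both ends.\<close>

lemma generator_parts:
  assumes h: "h \<in> L2b \<delta>" "H_deriv \<delta> h k" and f: "f \<in> test_functions"
  shows "L2_inner (bessel_measure \<delta>) h (bessel_generator \<delta> f)
    = - (1/2) * L2_inner (bessel_measure \<delta>) k (half_line_deriv f)"
proof -
  obtain f'' R where
    d1: "\<And>x. 0 \<le> x \<Longrightarrow> (f has_real_derivative half_line_deriv f x) (at x within {0..})"
    and d2: "\<And>x. 0 \<le> x \<Longrightarrow> (half_line_deriv f has_real_derivative f'' x) (at x within {0..})"
    and c: "continuous_on {0..} f''" and f'0: "half_line_deriv f 0 = 0" and R: "0 < R"
    "\<And>x. R \<le> x \<Longrightarrow> f x = 0" "\<And>x. R \<le> x \<Longrightarrow> half_line_deriv f x = 0" "\<And>x. R \<le> x \<Longrightarrow> f'' x = 0"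
    and g: "\<And>x. bessel_generator \<delta> f x = f'' x / 2 + (\<delta> - 1) * half_line_deriv f x / (2 * x)"
    by (rule test_functionE[OF f]) blast
  define f' where "f' = half_line_deriv f"
  have k: "k \<in> L2b \<delta>" by (rule H_deriv_L2b[OF h(2)])
  obtain C where C: "\<And>x. 0 \<le> x \<Longrightarrow> \<bar>f'' x\<bar> \<le> C"
  proof -
    have "bounded (f'' ` {0..R})"
      by (intro compact_imp_bounded compact_continuous_image continuous_on_subset[OF c]) auto
    then obtain C where "\<forall>y\<in>f'' ` {0..R}. norm y \<le> C" unfolding bounded_iff by blast
    then have "\<And>x. x \<in> {0..R} \<Longrightarrow> \<bar>f'' x\<bar> \<le> C" by simp
    then have "\<bar>f'' x\<bar> \<le> \<bar>C\<bar>" if "0 \<le> x" for x using that R(4)[of x] by (cases "x \<le> R") force+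
    then show thesis by (rule that)
  qed
  have C0: "0 \<le> C" using C[of 0] by simp
  \<comment> \<open>Here f'(0) = 0 enters: f'(x) / x stays bounded, so \<open>q\<close> is locally
    integrable, and p is of order x^\<delta>, hence continuous at 0 with value 0.\<close>
  have f'_le: "\<bar>f' x\<bar> \<le> C * x" if x: "0 \<le> x" for x
    using field_differentiable_bound[of "{0..}" f' f'' C x 0] d2 C x f'0 by (simp add: f'_def)
  have [measurable]: "f'' \<in> borel_measurable half_line" "f' \<in> borel_measurable half_line"
    "(\<lambda>x. x) \<in> borel_measurable half_line" "(\<lambda>x. x powr (\<delta> - 1)) \<in> borel_measurable half_line"
    using borel_measurable_half_line_continuous[OF c] L2b_measurable[OF test_deriv_L2b[OF f]]
    by (auto simp: f'_def intro!: borel_measurable_half_line_of_borel)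
  define q where "q = (\<lambda>x. x powr (\<delta> - 1) * (f'' x + (\<delta> - 1) * (f' x / x)))"
  have q: "loc_int q"
  proof (rule loc_int_bound[OF loc_int_scale[OF powr_loc_int, of "2 * C"]])
    show "q \<in> borel_measurable half_line" unfolding q_def by measurable
    fix x :: real assume x: "0 \<le> x"
    have "\<bar>f' x / x\<bar> \<le> C" using f'_le[OF x] x C0 by (cases "x = 0") (auto simp: field_simps)
    moreover have "\<bar>(\<delta> - 1) * (f' x / x)\<bar> \<le> 1 * \<bar>f' x / x\<bar>"
      unfolding abs_mult by (rule mult_right_mono) (use \<delta>0 \<delta>1 in auto)
    ultimately have "\<bar>f'' x + (\<delta> - 1) * (f' x / x)\<bar> \<le> 2 * C" using C[OF x] by linarith
    then have "x powr (\<delta> - 1) * \<bar>f'' x + (\<delta> - 1) * (f' x / x)\<bar> \<le> x powr (\<delta> - 1) * (2 * C)"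
      by (rule mult_left_mono) simp
    then show "\<bar>q x\<bar> \<le> \<bar>2 * C * x powr (\<delta> - 1)\<bar>" using C0 by (simp add: q_def abs_mult mult_ac)
  qed
  define p where "p = (\<lambda>x. x powr (\<delta> - 1) * f' x)"
  have p_cont: "continuous_on {0..} p"
    unfolding continuous_on_eq_continuous_within
  proof
    fix x :: real assume "x \<in> {0..}"
    show "continuous (at x within {0..}) p"
    proof (cases "x = 0")
      case True
      have "continuous_on {0..} (\<lambda>y. C * y powr \<delta>)"
        by (intro continuous_intros continuous_on_powr') (use \<delta>0 in auto)
      then have lim: "((\<lambda>y. C * y powr \<delta>) \<longlongrightarrow> C * 0 powr \<delta>) (at 0 within {0..})"
        unfolding continuous_on_def by (rule bspec) simp
      have "(p \<longlongrightarrow> 0) (at 0 within {0..})"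
      proof (rule Lim_null_comparison)
        show "\<forall>\<^sub>F y in at 0 within {0..}. norm (p y) \<le> C * y powr \<delta>"
          unfolding eventually_at_filter
        proof (intro always_eventually allI impI)
          fix y :: real assume y: "y \<noteq> 0" "y \<in> {0..}"
          have "\<bar>p y\<bar> \<le> y powr (\<delta> - 1) * (C * y)"
            unfolding p_def abs_mult using f'_le[of y] y by (intro mult_mono) auto
          also have "\<dots> = C * y powr \<delta>" using y by (simp add: powr_diff)
          finally show "norm (p y) \<le> C * y powr \<delta>" by simp
        qed
        show "((\<lambda>y. C * y powr \<delta>) \<longlongrightarrow> 0) (at 0 within {0..})" using lim \<delta>0 by simp
      qed
      then show ?thesis unfolding True continuous_within by (simp add: p_def)
    next
      case False
      have "continuous_on {0..} f'" unfolding f'_def by (rule DERIV_continuous_half_line[OF d2])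
      then have "continuous (at x within {0..}) f'" using \<open>x \<in> {0..}\<close> by (simp add: continuous_on_eq_continuous_within)
      then show ?thesis unfolding p_def using False by (intro continuous_intros) auto
    qed
  qed
  have Pq: "Prim q x = p x" if x: "0 \<le> x" for x
  proof -
    have "(q has_integral (p x - p 0)) {0..x}"
    proof (rule fundamental_theorem_of_calculus_interior[OF x])
      show "continuous_on {0..x} p" by (rule continuous_on_subset[OF p_cont]) auto
      fix y assume y: "y \<in> {0<..<x}"
      have "(f' has_real_derivative f'' y) (at y)"
        using d2[of y] y by (simp add: f'_def at_within_half_line)
      moreover have "((\<lambda>y. y powr (\<delta> - 1)) has_real_derivative (\<delta> - 1) * y powr (\<delta> - 1 - 1)) (at y)"
        using y by (intro has_real_derivative_powr) simp
      ultimately have "(p has_real_derivative (\<delta> - 1) * y powr (\<delta> - 1 - 1) * f' y + f'' y * y powr (\<delta> - 1)) (at y)"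
        unfolding p_def by (rule DERIV_mult[rotated])
      moreover have "(\<delta> - 1) * y powr (\<delta> - 1 - 1) * f' y + f'' y * y powr (\<delta> - 1) = q y"
      proof -
        have e: "y powr (\<delta> - 1 - 1) = y powr (\<delta> - 1) / y"
          unfolding powr_diff[of y "\<delta> - 1" 1] using y by simp
        show ?thesis unfolding e q_def by (simp add: distrib_left mult_ac)
      qed
      ultimately have "(p has_real_derivative q y) (at y)" by simp
      then show "(p has_vector_derivative q y) (at y)"
        by (simp add: has_real_derivative_iff_has_vector_derivative)
    qed
    then show ?thesis by (simp add: Prim_eq_integral(2)[OF q] integral_unique p_def)
  qed
  have pR: "p x = 0" if "R \<le> x" for x using R(3)[OF that] by (simp add: p_def f'_def)
  have qR: "q x = 0" if "R \<le> x" for x using R(3,4)[OF that] by (simp add: q_def f'_def)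
  obtain c where c: "AE x in half_line. h x = c + Prim k x" using h(2) by (auto simp: H_deriv_iff)
  note kl = L2b_loc_int[OF k]
  have [measurable]: "h \<in> borel_measurable half_line" "k \<in> borel_measurable half_line"
    "bessel_generator \<delta> f \<in> borel_measurable half_line" "Prim k \<in> borel_measurable half_line"
    "q \<in> borel_measurable half_line" "p \<in> borel_measurable half_line"
    using h(1) k generator_measurable[OF f] borel_measurable_half_line_continuous[OF continuous_on_Prim[OF kl]]
      borel_measurable_half_line_continuous[OF p_cont]
    by (auto simp: L2_bessel_iff q_def)
  have "L2_inner (bessel_measure \<delta>) h (bessel_generator \<delta> f) = (\<integral>x. (1/2) * ((c + Prim k x) * q x) \<partial>half_line)"
    unfolding L2_inner_def
  proof (subst integral_bessel, measurable, rule integral_cong_AE)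
    show "AE x in half_line. (wt \<delta> x)\<^sup>2 * (h x * bessel_generator \<delta> f x) = (1/2) * ((c + Prim k x) * q x)"
      using c AE_half_line_pos
    proof eventually_elim
      case (elim x)
      have "(wt \<delta> x)\<^sup>2 * bessel_generator \<delta> f x = (1/2) * q x"
        using elim(2) by (simp add: wt_sq g q_def f'_def field_simps)
      moreover have "(wt \<delta> x)\<^sup>2 * (h x * bessel_generator \<delta> f x) = h x * ((wt \<delta> x)\<^sup>2 * bessel_generator \<delta> f x)"
        by (simp only: mult_ac)
      ultimately show ?case unfolding elim(1) by simp
    qed
  qed measurable
  also have "\<dots> = (1/2) * (\<integral>x. (c + Prim k x) * q x \<partial>half_line)" by simp
  also have "(\<integral>x. (c + Prim k x) * q x \<partial>half_line) = (\<integral>x. indicator {0..R} x * ((c + Prim k x) * q x) \<partial>lborel)"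
    by (rule half_line_integral_cutoff) (simp add: qR)
  finally have L: "L2_inner (bessel_measure \<delta>) h (bessel_generator \<delta> f)
      = (1/2) * (\<integral>x. indicator {0..R} x * ((c + Prim k x) * q x) \<partial>lborel)" .
  have "L2_inner (bessel_measure \<delta>) k f' = (\<integral>x. k x * p x \<partial>half_line)"
    unfolding L2_inner_def
  proof (subst integral_bessel, measurable, rule integral_cong_AE)
    show "AE x in half_line. (wt \<delta> x)\<^sup>2 * (k x * f' x) = k x * p x"
      using AE_half_line_pos by eventually_elim (simp add: wt_sq p_def)
  qed measurable
  also have "\<dots> = (\<integral>x. indicator {0..R} x * (k x * p x) \<partial>lborel)"
    by (rule half_line_integral_cutoff) (simp add: pR)
  also have "\<dots> = (\<integral>x. indicator {0..R} x * ((0 + Prim q x) * k x) \<partial>lborel)"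
    by (rule Bochner_Integration.integral_cong) (auto simp: indicator_def Pq)
  finally have K: "L2_inner (bessel_measure \<delta>) k f' = (\<integral>x. indicator {0..R} x * ((0 + Prim q x) * k x) \<partial>lborel)" .
  have "(\<integral>x. indicator {0..R} x * ((c + Prim k x) * q x) \<partial>lborel) + (\<integral>x. indicator {0..R} x * ((0 + Prim q x) * k x) \<partial>lborel)
     = (\<integral>x. indicator {0..R} x * ((c + Prim k x) * q x) + indicator {0..R} x * ((0 + Prim q x) * k x) \<partial>lborel)"
    by (rule Bochner_Integration.integral_add[symmetric, OF Prim_parts(1)[OF kl q] Prim_parts(1)[OF q kl]])
       (use R in auto)
  also have "\<dots> = (\<integral>x. indicator {0..R} x * ((c + Prim k x) * q x + k x * (0 + Prim q x)) \<partial>lborel)"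
    by (simp add: algebra_simps)
  also have "\<dots> = (c + Prim k R) * (0 + Prim q R) - c * 0"
    by (rule Prim_parts(2)[OF kl q]) (use R in auto)
  also have "\<dots> = 0" using Pq[of R] pR[of R] R(1) by simp
  finally show ?thesis unfolding L K[unfolded f'_def] by (simp add: f'_def)
qed

end

section \<open>Hat functions as limits of test functions, and density of the form domain\<close>

subsection \<open>Density of the test functions in the form domain\<close>

context bessel
begin

lemma U_dominated:
  assumes m: "\<And>n. f n \<in> L2b \<delta>" "f0 \<in> L2b \<delta>"
    and bd: "\<And>n x. 0 < x \<Longrightarrow> \<bar>f n x - f0 x\<bar> \<le> C * indicator {0..b} x"
    and lim: "\<And>x. 0 < x \<Longrightarrow> (\<lambda>n. f n x) \<longlonglongrightarrow> f0 x"
  shows "(\<lambda>n. U \<delta> (f n)) \<longlonglongrightarrow> U \<delta> f0"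
proof -
  have d: "(\<lambda>x. f n x - f0 x) \<in> L2b \<delta>" for n by (intro L2_diff m)
  have [measurable]: "f n \<in> borel_measurable half_line" "f0 \<in> borel_measurable half_line" for n
    using m by (auto simp: L2_bessel_iff)
  have ind: "(\<lambda>x. C * indicator {0..b} x) \<in> L2b \<delta>" by (rule L2_scale[OF indicator_L2b])
  have n2: "(norm (U \<delta> (f n) - U \<delta> f0))\<^sup>2 = (\<integral>x. (f n x - f0 x)\<^sup>2 \<partial>bessel_measure \<delta>)" for n
    by (simp add: U_diff[OF m, symmetric] power2_norm_eq_inner U_inner[OF d d] L2_inner_def flip: power2_eq_square)
  have "(\<lambda>n. \<integral>x. (f n x - f0 x)\<^sup>2 \<partial>bessel_measure \<delta>) \<longlonglongrightarrow> (\<integral>x. 0 \<partial>bessel_measure \<delta>)"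
  proof (rule integral_dominated_convergence)
    show "integrable (bessel_measure \<delta>) (\<lambda>x. (C * indicator {0..b} x)\<^sup>2)" using L2_spaceD(2)[OF ind] .
    show "AE x in bessel_measure \<delta>. (\<lambda>n. (f n x - f0 x)\<^sup>2) \<longlonglongrightarrow> 0"
      unfolding AE_bessel_iff using AE_half_line_pos
    proof eventually_elim
      case (elim x)
      have "(\<lambda>n. (f n x - f0 x)\<^sup>2) \<longlonglongrightarrow> (f0 x - f0 x)\<^sup>2" by (intro tendsto_intros lim elim)
      then show ?case by simp
    qed
    show "AE x in bessel_measure \<delta>. norm ((f n x - f0 x)\<^sup>2) \<le> (C * indicator {0..b} x)\<^sup>2" for n
      unfolding AE_bessel_iff using AE_half_line_pos
    proof eventually_elim
      case (elim x)
      have "\<bar>f n x - f0 x\<bar>\<^sup>2 \<le> (C * indicator {0..b} x)\<^sup>2" by (rule power_mono[OF bd[OF elim]]) simp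
      then show ?case by simp
    qed
  qed simp_all
  then have "(\<lambda>n. (norm (U \<delta> (f n) - U \<delta> f0))\<^sup>2) \<longlonglongrightarrow> 0" by (simp add: n2)
  then have "(\<lambda>n. sqrt ((norm (U \<delta> (f n) - U \<delta> f0))\<^sup>2)) \<longlonglongrightarrow> sqrt 0" by (rule tendsto_real_sqrt)
  then have "(\<lambda>n. U \<delta> (f n) - U \<delta> f0) \<longlonglongrightarrow> 0" by (simp add: tendsto_norm_zero_iff)
  then show ?thesis by (rule LIM_zero_cancel)
qed

definition test_graph :: "(l2 \<times> l2) set" where
  "test_graph = (\<lambda>f. (U \<delta> f, (1 / sqrt 2) *\<^sub>R U \<delta> (half_line_deriv f))) ` test_functions"

lemma test_graph_Gr: "test_graph \<subseteq> Gr"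
  unfolding test_graph_def using GrI[OF test_L2b test_H_deriv] by auto

lemma subspace_test_graph: "subspace test_graph"
  unfolding subspace_def
proof (intro conjI ballI allI)
  have t0: "(\<lambda>x. 0) \<in> test_functions"
    by (rule test_functionI[where f' = "\<lambda>x. 0" and f'' = "\<lambda>x. 0" and R = 0]) auto
  have "half_line_deriv (\<lambda>x. 0) x = 0" if "0 \<le> x" for x by (rule half_line_deriv_eq[OF that]) simp
  then have "U \<delta> (half_line_deriv (\<lambda>x. 0)) = U \<delta> (\<lambda>x. 0)"
    by (subst U_eq_iff) (auto simp: test_deriv_L2b[OF t0] intro!: AE_I2)
  then show "0 \<in> test_graph"
    unfolding test_graph_def by (intro image_eqI[OF _ t0]) (simp add: zero_prod_def)
  fix a b assume "a \<in> test_graph" "b \<in> test_graph"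
  then obtain f g where f: "f \<in> test_functions" "a = (U \<delta> f, (1 / sqrt 2) *\<^sub>R U \<delta> (half_line_deriv f))"
    and g: "g \<in> test_functions" "b = (U \<delta> g, (1 / sqrt 2) *\<^sub>R U \<delta> (half_line_deriv g))"
    by (auto simp: test_graph_def)
  obtain f'' R where F: "\<And>x. 0 \<le> x \<Longrightarrow> (f has_real_derivative half_line_deriv f x) (at x within {0..})"
    "\<And>x. 0 \<le> x \<Longrightarrow> (half_line_deriv f has_real_derivative f'' x) (at x within {0..})"
    "continuous_on {0..} f''" "half_line_deriv f 0 = 0" "\<And>x. R \<le> x \<Longrightarrow> f x = 0"
    by (rule test_functionE[OF f(1)]) blast
  obtain g'' R' where G: "\<And>x. 0 \<le> x \<Longrightarrow> (g has_real_derivative half_line_deriv g x) (at x within {0..})"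
    "\<And>x. 0 \<le> x \<Longrightarrow> (half_line_deriv g has_real_derivative g'' x) (at x within {0..})"
    "continuous_on {0..} g''" "half_line_deriv g 0 = 0" "\<And>x. R' \<le> x \<Longrightarrow> g x = 0"
    by (rule test_functionE[OF g(1)]) blast
  have d: "((\<lambda>x. f x + g x) has_real_derivative half_line_deriv f x + half_line_deriv g x) (at x within {0..})"
    if "0 \<le> x" for x by (intro DERIV_add F G that)
  have t: "(\<lambda>x. f x + g x) \<in> test_functions"
  proof (rule test_functionI[OF d, where R = "max R R'"])
    show "((\<lambda>x. half_line_deriv f x + half_line_deriv g x) has_real_derivative f'' x + g'' x) (at x within {0..})"
      if "0 \<le> x" for x by (intro DERIV_add F G that)
    show "continuous_on {0..} (\<lambda>x. f'' x + g'' x)" by (intro continuous_intros F G)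
  qed (use F G in auto)
  have "U \<delta> (half_line_deriv (\<lambda>x. f x + g x)) = U \<delta> (\<lambda>x. half_line_deriv f x + half_line_deriv g x)"
    using half_line_deriv_eq[OF _ d]
    by (subst U_eq_iff[OF test_deriv_L2b[OF t] L2_add[OF test_deriv_L2b[OF f(1)] test_deriv_L2b[OF g(1)]]])
       (auto intro!: AE_I2)
  then have "a + b = (U \<delta> (\<lambda>x. f x + g x), (1 / sqrt 2) *\<^sub>R U \<delta> (half_line_deriv (\<lambda>x. f x + g x)))"
    by (simp add: f g U_add test_L2b test_deriv_L2b scaleR_add_right)
  then show "a + b \<in> test_graph" unfolding test_graph_def using t by blast
next
  fix r a assume "a \<in> test_graph"
  then obtain f where f: "f \<in> test_functions" "a = (U \<delta> f, (1 / sqrt 2) *\<^sub>R U \<delta> (half_line_deriv f))"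
    by (auto simp: test_graph_def)
  obtain f'' R where F: "\<And>x. 0 \<le> x \<Longrightarrow> (f has_real_derivative half_line_deriv f x) (at x within {0..})"
    "\<And>x. 0 \<le> x \<Longrightarrow> (half_line_deriv f has_real_derivative f'' x) (at x within {0..})"
    "continuous_on {0..} f''" "half_line_deriv f 0 = 0" "\<And>x. R \<le> x \<Longrightarrow> f x = 0"
    by (rule test_functionE[OF f(1)]) blast
  have d: "((\<lambda>x. r * f x) has_real_derivative r * half_line_deriv f x) (at x within {0..})"
    if "0 \<le> x" for x by (intro DERIV_cmult F that)
  have t: "(\<lambda>x. r * f x) \<in> test_functions"
  proof (rule test_functionI[OF d, where R = R])
    show "((\<lambda>x. r * half_line_deriv f x) has_real_derivative r * f'' x) (at x within {0..})"
      if "0 \<le> x" for x by (intro DERIV_cmult F that)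
    show "continuous_on {0..} (\<lambda>x. r * f'' x)" by (intro continuous_intros F)
  qed (use F in auto)
  have "U \<delta> (half_line_deriv (\<lambda>x. r * f x)) = U \<delta> (\<lambda>x. r * half_line_deriv f x)"
    using half_line_deriv_eq[OF _ d]
    by (subst U_eq_iff[OF test_deriv_L2b[OF t] L2_scale[OF test_deriv_L2b[OF f(1)]]]) (auto intro!: AE_I2)
  then have "r *\<^sub>R a = (U \<delta> (\<lambda>x. r * f x), (1 / sqrt 2) *\<^sub>R U \<delta> (half_line_deriv (\<lambda>x. r * f x)))"
    by (simp add: f U_scale test_L2b test_deriv_L2b)
  then show "r *\<^sub>R a \<in> test_graph" unfolding test_graph_def using t by blast
qed

text \<open>The square of the positive part is continuously differentiable, the positive part itself
  is not; this is why \<open>bump\<close> contains the square of \<open>hat\<close>.\<close>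

lemma max_square_derivative: "((\<lambda>y. (max 0 y)\<^sup>2) has_real_derivative 2 * max 0 y) (at (y::real))"
proof -
  consider "y < 0" | "y > 0" | "y = 0" by linarith
  then show ?thesis
  proof cases
    case 1
    have "((\<lambda>y. (max 0 y)\<^sup>2) has_real_derivative 0) (at y)"
    proof (rule has_field_derivative_transform_within_open[OF DERIV_const])
      show "open {..<0::real}" "y \<in> {..<0}" using 1 by simp_all
      show "0 = (max 0 z)\<^sup>2" if "z \<in> {..<0::real}" for z using that by simp
    qed
    then show ?thesis using 1 by simp
  next
    case 2
    have "((\<lambda>y. (max 0 y)\<^sup>2) has_real_derivative (2 * y)) (at y)"
    proof (rule has_field_derivative_transform_within_open)
      show "((\<lambda>y. y\<^sup>2) has_real_derivative (2 * y)) (at y)" by (auto intro!: derivative_eq_intros)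
      show "open {0::real<..}" "y \<in> {0<..}" using 2 by simp_all
      show "z\<^sup>2 = (max 0 z)\<^sup>2" if "z \<in> {0::real<..}" for z using that by simp
    qed
    then show ?thesis using 2 by simp
  next
    case 3
    have "((\<lambda>h. ((max 0 (0 + h))\<^sup>2 - (max 0 0)\<^sup>2) / h) \<longlongrightarrow> 0) (at (0::real))"
    proof (rule Lim_null_comparison)
      have "norm (((max 0 (0 + h))\<^sup>2 - (max 0 0)\<^sup>2) / h) \<le> \<bar>h\<bar>" for h :: real
        by (cases "0 \<le> h") (simp_all add: power2_eq_square)
      then show "\<forall>\<^sub>F h in at (0::real). norm (((max 0 (0 + h))\<^sup>2 - (max 0 0)\<^sup>2) / h) \<le> \<bar>h\<bar>"
        by (intro always_eventually allI)
      show "((\<lambda>h. \<bar>h\<bar>) \<longlongrightarrow> 0) (at (0::real))" by (rule tendsto_rabs_zero[OF tendsto_ident_at])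
    qed
    then show ?thesis unfolding 3 DERIV_def by simp
  qed
qed

definition hat :: "real \<Rightarrow> real \<Rightarrow> real" where "hat b x = max 0 (b - x)"

lemma hat_L2b: "hat b \<in> L2b \<delta>"
  by (rule continuous_bounded_L2b[where R = b]) (auto simp: hat_def[abs_def] intro!: continuous_intros)

text \<open>\<open>bump b n\<close> is a smooth version of \<open>- indicator {0..b}\<close> that vanishes at \<open>0\<close>.\<close>

definition sat :: "nat \<Rightarrow> real \<Rightarrow> real" where "sat n y = real n * y / (1 + real n * y)"

definition bump :: "real \<Rightarrow> nat \<Rightarrow> real \<Rightarrow> real" where "bump b n x = - (sat n x * sat n ((hat b x)\<^sup>2))"

lemma sat_bounds: "0 \<le> y \<Longrightarrow> 0 \<le> sat n y" "0 \<le> y \<Longrightarrow> sat n y \<le> 1"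
proof -
  assume y: "0 \<le> y"
  then have "0 \<le> real n * y" by simp
  then show "0 \<le> sat n y" "sat n y \<le> 1" by (auto simp: sat_def divide_simps)
qed

lemma sat_derivative:
  assumes "0 \<le> y"
  shows "(sat n has_real_derivative real n / (1 + real n * y)\<^sup>2) (at y within X)"
proof -
  have "1 + real n * y > 0" using assms by (simp add: add_pos_nonneg)
  then show ?thesis unfolding sat_def[abs_def]
    by (auto intro!: derivative_eq_intros simp: power2_eq_square field_simps)
qed

lemma sat_tendsto: "0 < y \<Longrightarrow> (\<lambda>n. sat n y) \<longlonglongrightarrow> 1"
proof -
  assume y: "0 < y"
  have "filterlim (\<lambda>n. 1 + real n * y) at_top sequentially"
    by (intro filterlim_tendsto_add_at_top[OF tendsto_const] filterlim_at_top_mult_tendsto_pos[OF tendsto_const y]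
        filterlim_real_sequentially)
  then have "(\<lambda>n. inverse (1 + real n * y)) \<longlonglongrightarrow> 0" by (rule tendsto_inverse_0_at_top)
  then have "(\<lambda>n. 1 - inverse (1 + real n * y)) \<longlonglongrightarrow> 1 - 0" by (intro tendsto_intros)
  moreover have "1 - inverse (1 + real n * y) = sat n y" for n
  proof -
    have "1 + real n * y > 0" using y by (simp add: add_pos_nonneg)
    then show ?thesis by (simp add: sat_def field_simps)
  qed
  ultimately show ?thesis by simp
qed

lemma sat_0 [simp]: "sat n 0 = 0" by (simp add: sat_def)

lemma bump_bounds: "0 \<le> x \<Longrightarrow> - 1 \<le> bump b n x" "0 \<le> x \<Longrightarrow> bump b n x \<le> 0"
  unfolding bump_def using sat_bounds[of x n] sat_bounds[of "(hat b x)\<^sup>2" n]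
  by (auto intro!: mult_le_one mult_nonneg_nonneg)

lemma bump_beyond: "b \<le> x \<Longrightarrow> bump b n x = 0" by (simp add: bump_def hat_def)

lemma bump_derivative:
  assumes x: "0 \<le> x"
  shows "(bump b n has_real_derivative - (sat n x * (real n / (1 + real n * (hat b x)\<^sup>2)\<^sup>2 * (- 2 * hat b x))
      + real n / (1 + real n * x)\<^sup>2 * sat n ((hat b x)\<^sup>2))) (at x within {0..})"
proof -
  have "((\<lambda>x. b - x) has_real_derivative - 1) (at x within {0..})" by (auto intro!: derivative_eq_intros)
  from DERIV_chain2[OF max_square_derivative this]
  have h: "((\<lambda>x. (hat b x)\<^sup>2) has_real_derivative - 2 * hat b x) (at x within {0..})"
    by (simp add: hat_def)
  have s: "((\<lambda>x. sat n ((hat b x)\<^sup>2)) has_real_derivative real n / (1 + real n * (hat b x)\<^sup>2)\<^sup>2 * (- 2 * hat b x)) (at x within {0..})"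
    by (rule DERIV_chain2[OF sat_derivative h]) simp
  from DERIV_minus[OF DERIV_mult[OF sat_derivative[OF x] s]] show ?thesis
    unfolding bump_def[abs_def] by (simp add: mult_ac add.commute)
qed

lemma bump_continuous: "continuous_on {0..} (bump b n)"
  by (rule DERIV_continuous_half_line[OF bump_derivative])

lemma bump_L2b: "bump b n \<in> L2b \<delta>"
  by (rule continuous_bounded_L2b[OF bump_continuous bump_beyond])

text \<open>The derivative of \<open>hat b\<close> away from its kink, and the pointwise limit of
  \<open>bump b n\<close> on x > 0.\<close>

definition neg_ind :: "real \<Rightarrow> real \<Rightarrow> real" where "neg_ind b x = - indicator {0..<b} x"

lemma neg_ind_L2b: "neg_ind b \<in> L2b \<delta>"
proof (rule L2b_bounded[where C = 1 and R = b])
  show "neg_ind b \<in> borel_measurable half_line"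
    unfolding neg_ind_def[abs_def] by (rule borel_measurable_half_line_of_borel) simp
qed (auto simp: neg_ind_def indicator_def)

lemma U_bump: "(\<lambda>n. U \<delta> (bump b n)) \<longlonglongrightarrow> U \<delta> (neg_ind b)"
proof (rule U_dominated[OF bump_L2b neg_ind_L2b, where C = 1 and b = b])
  fix n and x :: real assume x: "0 < x"
  show "\<bar>bump b n x - neg_ind b x\<bar> \<le> 1 * indicator {0..b} x"
    using bump_bounds[of x b n] bump_beyond[of b x n] x by (auto simp: neg_ind_def indicator_def)
next
  fix x :: real assume x: "0 < x"
  show "(\<lambda>n. bump b n x) \<longlonglongrightarrow> neg_ind b x"
  proof (cases "x < b")
    case True
    have "(\<lambda>n. - (sat n x * sat n ((hat b x)\<^sup>2))) \<longlonglongrightarrow> - (1 * 1)"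
      by (intro tendsto_minus tendsto_mult sat_tendsto) (use x True in \<open>auto simp: hat_def\<close>)
    then show ?thesis using x True by (simp add: bump_def neg_ind_def)
  next
    case False
    then show ?thesis using bump_beyond[of b x] by (simp add: neg_ind_def)
  qed
qed

lemma Prim_neg_ind:
  assumes "0 \<le> x" "0 \<le> b"
  shows "Prim (neg_ind b) x = - min x b"
proof (cases "x < b")
  case True
  have "Prim (neg_ind b) x = (\<integral>z. - indicator {0..x} z \<partial>lborel)"
    unfolding Prim_def by (rule Bochner_Integration.integral_cong) (use True in \<open>auto simp: neg_ind_def indicator_def\<close>)
  then show ?thesis using assms True by simp
next
  case False
  have "Prim (neg_ind b) x = (\<integral>z. - indicator {0..<b} z \<partial>lborel)"
    unfolding Prim_def by (rule Bochner_Integration.integral_cong) (use False in \<open>auto simp: neg_ind_def indicator_def\<close>)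
  then show ?thesis using assms False by simp
qed

lemma Prim_derivative:
  assumes f: "continuous_on {0..} f" "loc_int f" and x: "0 \<le> x"
  shows "(Prim f has_real_derivative f x) (at x within {0..})"
proof -
  have "((\<lambda>u. integral {0..u} f) has_real_derivative f x) (at x within {0..x + 1})"
    by (rule integral_has_real_derivative) (use x in \<open>auto intro: continuous_on_subset[OF f(1)]\<close>)
  moreover have "at x within {0..x + 1} = at x within {0..}"
  proof (rule at_within_nhd[of x "{..<x + 1}"])
    show "{0..x + 1} \<inter> {..<x + 1} - {x} = {0..} \<inter> {..<x + 1} - {x}" by auto
  qed auto
  ultimately show ?thesis by (simp add: Prim_eq_integral(2)[OF f(2), abs_def])
qed

lemma Prim_bump_beyond:
  assumes "0 \<le> b" "b \<le> x"
  shows "Prim (bump b n) x = Prim (bump b n) b"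
  unfolding Prim_def
proof (rule Bochner_Integration.integral_cong[OF refl])
  fix z
  show "indicator {0..x} z * bump b n z = indicator {0..b} z * bump b n z"
    using bump_beyond[of b z n] assms by (cases "z \<le> b") (auto simp: indicator_def)
qed

lemma Prim_bump_bound:
  assumes x: "0 \<le> x"
  shows "\<bar>Prim (bump b n) x\<bar> \<le> x"
proof -
  have i: "integrable lborel (\<lambda>z. indicator {0..x} z * bump b n z)"
    using L2b_loc_int[OF bump_L2b, of b n] unfolding loc_int_def by blast
  have "\<bar>Prim (bump b n) x\<bar> \<le> (\<integral>z. \<bar>indicator {0..x} z * bump b n z\<bar> \<partial>lborel)"
    unfolding Prim_def by (rule integral_abs_bound)
  also have "\<dots> \<le> (\<integral>z. indicator {0..x} z \<partial>lborel)"
  proof (rule integral_mono)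
    show "integrable lborel (\<lambda>z. \<bar>indicator {0..x} z * bump b n z\<bar>)"
      by (rule integrable_abs[OF i])
    show "integrable lborel (indicator {0..x} :: real \<Rightarrow> real)"
      by (rule integrable_real_indicator) (simp_all add: x)
    show "\<bar>indicator {0..x} z * bump b n z\<bar> \<le> indicator {0..x} z" for z
      using bump_bounds[of z b n] by (cases "z \<in> {0..x}") simp_all
  qed
  also have "\<dots> = x" using x by simp
  finally show ?thesis .
qed

text \<open>The primitive of \<open>bump b n\<close>, shifted to vanish at \<open>b\<close>, is a
  test function: its derivative is continuously differentiable and vanishes at 0 and beyond
  \<open>b\<close>. By dominated convergence the derivatives tend to \<open>neg_ind b\<close> and
  the functions to \<open>hat b\<close>. For b > 0 the limit has slope -1 at 0, so the condition
  \<phi>'(0) = 0 is lost in the closure.\<close>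

lemma hat_in_closure:
  assumes b: "0 \<le> b"
  shows "(U \<delta> (hat b), (1 / sqrt 2) *\<^sub>R U \<delta> (neg_ind b)) \<in> closure test_graph"
proof -
  define f where "f = (\<lambda>n x. Prim (bump b n) x - Prim (bump b n) b)"
  note li = L2b_loc_int[OF bump_L2b]
  have d: "(f n has_real_derivative bump b n x) (at x within {0..})" if "0 \<le> x" for n x
    using DERIV_diff[OF Prim_derivative[OF bump_continuous li that] DERIV_const[of "Prim (bump b n) b"]]
    by (simp add: f_def)
  have beyond: "f n x = 0" if "b \<le> x" for n x using Prim_bump_beyond[OF b that] by (simp add: f_def)
  have t: "f n \<in> test_functions" for n
  proof (rule test_functionI[OF d bump_derivative _ _ beyond])
    have c1: "continuous_on {0..} (sat n)" by (rule DERIV_continuous_half_line[OF sat_derivative])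
    have c2: "continuous_on {0..} (\<lambda>x. sat n ((hat b x)\<^sup>2))"
      by (rule continuous_on_compose2[OF c1]) (auto simp: hat_def intro!: continuous_intros)
    have "1 + real n * x \<noteq> 0" if "0 \<le> x" for x using that by (smt (verit) mult_nonneg_nonneg of_nat_0_le_iff)
    then show "continuous_on {0..} (\<lambda>x. - (sat n x * (real n / (1 + real n * (hat b x)\<^sup>2)\<^sup>2 * (- 2 * hat b x))
      + real n / (1 + real n * x)\<^sup>2 * sat n ((hat b x)\<^sup>2)))"
      by (intro continuous_intros c1 c2) (auto simp: hat_def intro!: continuous_intros)
    show "bump b n 0 = 0" by (simp add: bump_def)
  qed
  have U': "U \<delta> (half_line_deriv (f n)) = U \<delta> (bump b n)" for n
    using half_line_deriv_eq[OF _ d]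
    by (subst U_eq_iff) (auto simp: test_deriv_L2b[OF t] bump_L2b intro!: AE_I2)
  have lim1: "(\<lambda>n. U \<delta> (f n)) \<longlonglongrightarrow> U \<delta> (hat b)"
  proof (rule U_dominated[OF test_L2b[OF t] hat_L2b, where C = "3 * b" and b = b])
    fix n and x :: real assume x: "0 < x"
    show "\<bar>f n x - hat b x\<bar> \<le> 3 * b * indicator {0..b} x"
    proof (cases "x \<le> b")
      case True
      have "\<bar>f n x - hat b x\<bar> \<le> x + b + (b - x)"
        using Prim_bump_bound[of x b n] Prim_bump_bound[of b b n] x b True unfolding f_def hat_def by linarith
      also have "\<dots> \<le> 3 * b" using b x by simp
      finally show ?thesis using True x by simp
    next
      case False
      then show ?thesis using beyond[of x n] by (simp add: hat_def)
    qed
  next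
    fix x :: real assume x: "0 < x"
    have "(\<lambda>n. Prim (bump b n) y) \<longlonglongrightarrow> Prim (neg_ind b) y" for y
      unfolding Prim_inner[OF bump_L2b] Prim_inner[OF neg_ind_L2b]
      by (intro tendsto_inner U_bump tendsto_const)
    then have "(\<lambda>n. f n x) \<longlonglongrightarrow> Prim (neg_ind b) x - Prim (neg_ind b) b"
      unfolding f_def by (intro tendsto_diff)
    then show "(\<lambda>n. f n x) \<longlonglongrightarrow> hat b x" using x b by (cases "x \<le> b") (simp_all add: Prim_neg_ind hat_def)
  qed
  have "(\<lambda>n. (U \<delta> (f n), (1 / sqrt 2) *\<^sub>R U \<delta> (half_line_deriv (f n)))) \<longlonglongrightarrow>
      (U \<delta> (hat b), (1 / sqrt 2) *\<^sub>R U \<delta> (neg_ind b))"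
    unfolding U' by (intro tendsto_Pair lim1 tendsto_scaleR tendsto_const U_bump)
  moreover have "(U \<delta> (f n), (1 / sqrt 2) *\<^sub>R U \<delta> (half_line_deriv (f n))) \<in> test_graph" for n
    unfolding test_graph_def using t by blast
  ultimately show ?thesis
    unfolding closure_sequential
    by (intro exI[of _ "\<lambda>n. (U \<delta> (f n), (1 / sqrt 2) *\<^sub>R U \<delta> (half_line_deriv (f n)))"]) simp
qed

lemma closure_test_graph_subset: "closure test_graph \<subseteq> Gr"
  by (rule closure_minimal[OF test_graph_Gr closed_Gr])

text \<open>The integral over [0, b] is the pairing in L^2(d\<mu>) of \<open>h\<close> with an
  indicator.\<close>

lemma wt_loc_int:
  assumes h: "h \<in> L2b \<delta>"
  shows "loc_int (\<lambda>x. (wt \<delta> x)\<^sup>2 * h x)"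
  unfolding loc_int_def
proof
  fix b
  have [measurable]: "h \<in> borel_measurable half_line" using h by (simp add: L2_bessel_iff)
  have [measurable]: "(indicator {0..b} :: real \<Rightarrow> real) \<in> borel_measurable half_line"
    by (rule borel_measurable_half_line_of_borel) simp
  have "integrable (bessel_measure \<delta>) (\<lambda>x. indicator {0..b} x * h x)"
    by (rule L2_mult_integrable[OF indicator_L2b h])
  then have "integrable half_line (\<lambda>x. (wt \<delta> x)\<^sup>2 * (indicator {0..b} x * h x))"
    by (subst (asm) integrable_bessel) measurable
  then have "integrable lborel (\<lambda>x. indicator {0..} x * ((wt \<delta> x)\<^sup>2 * (indicator {0..b} x * h x)))"
    unfolding half_line_integral .
  moreover have "(\<lambda>x. indicator {0..} x * ((wt \<delta> x)\<^sup>2 * (indicator {0..b} x * h x)))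
      = (\<lambda>x. indicator {0..b} x * ((wt \<delta> x)\<^sup>2 * h x))" by (auto simp: indicator_def)
  ultimately show "integrable lborel (\<lambda>x. indicator {0..b} x * ((wt \<delta> x)\<^sup>2 * h x))" by simp
qed

text \<open>Integrating by parts once turns the moment against \<open>hat b\<close> into a repeated primitive.\<close>

lemma inner_hat:
  assumes h: "h \<in> L2b \<delta>" and b: "0 \<le> b"
  shows "U \<delta> h \<bullet> U \<delta> (hat b) = Prim (Prim (\<lambda>x. (wt \<delta> x)\<^sup>2 * h x)) b"
proof -
  let ?q = "\<lambda>x. (wt \<delta> x)\<^sup>2 * h x"
  have q: "loc_int ?q" by (rule wt_loc_int[OF h])
  have m: "loc_int (\<lambda>x. - 1)"
    unfolding loc_int_def
  proof
    fix b :: real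
    have "integrable lborel (indicator {0..b} :: real \<Rightarrow> real)"
      by (cases "0 \<le> b") (auto intro!: integrable_real_indicator)
    then show "integrable lborel (\<lambda>z. indicator {0..b} z * (- 1) :: real)" by simp
  qed
  have P1: "Prim (\<lambda>x. - 1) x = - x" if "0 \<le> x" for x using that by (simp add: Prim_def)
  have [measurable]: "h \<in> borel_measurable half_line" "hat b \<in> borel_measurable half_line"
    using h hat_L2b[of b] by (auto simp: L2_bessel_iff)
  have "U \<delta> h \<bullet> U \<delta> (hat b) = (\<integral>x. (wt \<delta> x)\<^sup>2 * (h x * hat b x) \<partial>half_line)"
    unfolding U_inner[OF h hat_L2b] L2_inner_def by (rule integral_bessel) measurable
  also have "\<dots> = (\<integral>x. indicator {0..b} x * ((wt \<delta> x)\<^sup>2 * (h x * hat b x)) \<partial>lborel)"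
    by (rule half_line_integral_cutoff) (simp add: hat_def)
  also have "\<dots> = (\<integral>x. indicator {0..b} x * ((b + Prim (\<lambda>x. - 1) x) * ?q x) \<partial>lborel)"
    by (rule Bochner_Integration.integral_cong) (auto simp: indicator_def hat_def P1)
  finally have 1: "U \<delta> h \<bullet> U \<delta> (hat b) = (\<integral>x. indicator {0..b} x * ((b + Prim (\<lambda>x. - 1) x) * ?q x) \<partial>lborel)" .
  have "(\<integral>x. indicator {0..b} x * ((b + Prim (\<lambda>x. - 1) x) * ?q x) \<partial>lborel) + (\<integral>x. indicator {0..b} x * ((0 + Prim ?q x) * (- 1)) \<partial>lborel)
     = (\<integral>x. indicator {0..b} x * ((b + Prim (\<lambda>x. - 1) x) * ?q x) + indicator {0..b} x * ((0 + Prim ?q x) * (- 1)) \<partial>lborel)"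
    by (rule Bochner_Integration.integral_add[symmetric, OF Prim_parts(1)[OF m q b] Prim_parts(1)[OF q m b]])
  also have "\<dots> = (\<integral>x. indicator {0..b} x * ((b + Prim (\<lambda>x. - 1) x) * ?q x + (- 1) * (0 + Prim ?q x)) \<partial>lborel)"
    by (simp add: algebra_simps)
  also have "\<dots> = (b + Prim (\<lambda>x. - 1) b) * (0 + Prim ?q b) - b * 0"
    by (rule Prim_parts(2)[OF m q b])
  also have "\<dots> = 0" using P1[OF b] by simp
  finally show ?thesis unfolding 1 by (simp add: Prim_def)
qed

lemma Prim_loc_int: "loc_int k \<Longrightarrow> loc_int (Prim k)"
  unfolding loc_int_def[of "Prim k"]
proof
  assume k: "loc_int k"
  fix b
  have "continuous_on {0..b} (Prim k)" by (rule continuous_on_subset[OF continuous_on_Prim[OF k]]) auto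
  then have "set_integrable lborel {0..b} (Prim k)" by (rule borel_integrable_atLeastAtMost')
  then show "integrable lborel (\<lambda>z. indicator {0..b} z * Prim k z)" by (simp add: set_integrable_def)
qed

lemma wt_mult_AE_0:
  assumes "AE x in half_line. (wt \<delta> x)\<^sup>2 * h x = 0"
  shows "AE x in half_line. h x = 0"
  using assms AE_half_line_pos
proof eventually_elim
  case (elim x)
  then show ?case using wt_pos[of x \<delta>] by simp
qed

text \<open>A vector orthogonal to all hats has, after weighting, a vanishing twofold primitive
  (\<open>inner_hat\<close>); undoing the primitives one at a time shows that the vector is
  0.\<close>

lemma dense_dom_Gr: "closure (fst ` Gr) = UNIV"
proof (rule closed_subspace_eq_UNIV)
  have "subspace (fst ` Gr)" by (rule linear_subspace_image[OF _ subspace_Gr]) (rule linear_fst)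
  then show "subspace (closure (fst ` Gr))" by (rule subspace_closure)
  fix a assume orth: "\<And>w. w \<in> closure (fst ` Gr) \<Longrightarrow> a \<bullet> w = 0"
  let ?q = "\<lambda>x. (wt \<delta> x)\<^sup>2 * V \<delta> a x"
  have q: "loc_int ?q" by (rule wt_loc_int[OF V_in_L2b])
  have "Prim (Prim ?q) b = 0" if b: "0 \<le> b" for b
  proof -
    have "U \<delta> (hat b) \<in> fst ` Gr"
      using hat_in_closure[OF b] closure_test_graph_subset by (metis fst_conv image_eqI subsetD)
    then have "a \<bullet> U \<delta> (hat b) = 0" using orth closure_subset by blast
    then show ?thesis using inner_hat[OF V_in_L2b b, of a] by simp
  qed
  then have "AE x in half_line. Prim ?q x = 0"
    by (intro AE_zero_of_integral_Icc) (use Prim_loc_int[OF q] in \<open>auto simp: loc_int_def Prim_def[of "Prim ?q"]\<close>)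
  then have "AE x in half_line. ?q x = 0"
    by (intro AE_Prim_const(2)[OF q, of 0]) simp
  then have "AE x in half_line. V \<delta> a x = 0" by (rule wt_mult_AE_0)
  then have "U \<delta> (V \<delta> a) = U \<delta> (\<lambda>x. 0)" by (subst U_eq_iff) (auto simp: V_in_L2b)
  then show "a = 0" by simp
qed simp

end

section \<open>The test functions are a core of the form\<close>

context bessel
begin

text \<open>An element of the form domain orthogonal to all hat functions satisfies
  \<open>x\<^sup>\<delta>\<^sup>-\<^sup>1 k / 2 = \<integral>\<^sub>0\<^sup>x z\<^sup>\<delta>\<^sup>-\<^sup>1 h\<close>. Integration by parts then shows that the energy on \<open>[0, R]\<close>
  equals \<open>R\<^sup>\<delta>\<^sup>-\<^sup>1 h(R) k(R) / 2\<close>, which is integrable in \<open>R\<close>, although the energy is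
  nondecreasing in \<open>R\<close>; hence it vanishes.\<close>

lemma orthogonal_to_hats:
  assumes h: "h \<in> L2b \<delta>" "H_deriv \<delta> h k"
    and orth: "\<And>b. 0 \<le> b \<Longrightarrow> (U \<delta> h, (1 / sqrt 2) *\<^sub>R U \<delta> k) \<bullet> (U \<delta> (hat b), (1 / sqrt 2) *\<^sub>R U \<delta> (neg_ind b)) = 0"
  shows "AE x in half_line. h x = 0"
proof -
  have k: "k \<in> L2b \<delta>" by (rule H_deriv_L2b[OF h(2)])
  define q where "q = (\<lambda>x. (wt \<delta> x)\<^sup>2 * h x)"
  define r where "r = (\<lambda>x. (wt \<delta> x)\<^sup>2 * k x)"
  have q: "loc_int q" unfolding q_def by (rule wt_loc_int[OF h(1)])
  have r: "loc_int r" unfolding r_def by (rule wt_loc_int[OF k])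
  have kl: "loc_int k" by (rule L2b_loc_int[OF k])
  have [measurable]: "h \<in> borel_measurable half_line" "k \<in> borel_measurable half_line"
    using h(1) k by (auto simp: L2_bessel_iff)
  have "U \<delta> k \<bullet> U \<delta> (neg_ind b) = - Prim r b" if b: "0 \<le> b" for b
  proof -
    have [measurable]: "neg_ind b \<in> borel_measurable half_line" using neg_ind_L2b by (simp add: L2_bessel_iff)
    have "U \<delta> k \<bullet> U \<delta> (neg_ind b) = (\<integral>x. (wt \<delta> x)\<^sup>2 * (k x * neg_ind b x) \<partial>half_line)"
      unfolding U_inner[OF k neg_ind_L2b] L2_inner_def by (rule integral_bessel) measurable
    also have "\<dots> = (\<integral>x. indicator {0..b} x * ((wt \<delta> x)\<^sup>2 * (k x * neg_ind b x)) \<partial>lborel)"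
      by (rule half_line_integral_cutoff) (simp add: neg_ind_def)
    also have "\<dots> = (\<integral>x. - (indicator {0..b} x * r x) \<partial>lborel)"
    proof (rule integral_cong_AE)
      have m1: "(\<lambda>x. (wt \<delta> x)\<^sup>2 * (k x * neg_ind b x)) \<in> borel_measurable half_line"
        and m2: "r \<in> borel_measurable half_line" unfolding r_def by measurable
      show "(\<lambda>x. indicator {0..b} x * ((wt \<delta> x)\<^sup>2 * (k x * neg_ind b x))) \<in> borel_measurable lborel"
        using borel_measurable_half_line_indicator[OF m1, of b] by simp
      show "(\<lambda>x. - (indicator {0..b} x * r x)) \<in> borel_measurable lborel"
        using borel_measurable_half_line_indicator[OF m2, of b] by simp
      show "AE x in lborel. indicator {0..b} x * ((wt \<delta> x)\<^sup>2 * (k x * neg_ind b x)) = - (indicator {0..b} x * r x)"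
        using AE_lborel_singleton[of b]
      proof eventually_elim
        case (elim x)
        then show ?case by (cases "x \<in> {0..<b}") (auto simp: neg_ind_def r_def indicator_def)
      qed
    qed
    finally show ?thesis by (simp add: Prim_def)
  qed
  then have eq: "Prim (Prim q) b = (1/2) * Prim r b" if b: "0 \<le> b" for b
    using orth[OF b] inner_hat[OF h(1) b] that by (simp add: inner_prod_def q_def real_sqrt_mult_self)
  have diff: "loc_int (\<lambda>x. Prim q x - (1/2) * r x)"
    by (intro loc_int_diff Prim_loc_int[OF q] loc_int_scale[OF r])
  have "AE x in half_line. Prim q x - (1/2) * r x = 0"
  proof (rule AE_zero_of_integral_Icc)
    fix b :: real assume b: "0 \<le> b"
    show "integrable lborel (\<lambda>x. indicator {0..b} x * (Prim q x - (1/2) * r x))"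
      using diff unfolding loc_int_def by blast
    have "Prim (\<lambda>x. Prim q x - (1/2) * r x) b = 0"
      unfolding Prim_diff[OF Prim_loc_int[OF q] loc_int_scale[OF r]] Prim_scale eq[OF b] by (rule diff_self)
    then show "(\<integral>x. indicator {0..b} x * (Prim q x - (1/2) * r x) \<partial>lborel) = 0" by (simp add: Prim_def)
  qed
  then have Q: "AE x in half_line. Prim q x = (1/2) * r x" by eventually_elim simp
  obtain c where c: "AE x in half_line. h x = c + Prim k x" using h(2) by (auto simp: H_deriv_iff)
  \<comment> \<open>The derivative of the product (c + Prim k) * Prim q. Since these factors are
    almost everywhere \<open>h\<close> and \<open>r / 2\<close>, it is also the energy density of
    \<open>h\<close>, which is nonnegative.\<close>
  define e where "e = (\<lambda>x. (c + Prim k x) * q x + k x * (0 + Prim q x))"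
  define E where "E = (\<lambda>R. \<integral>x. indicator {0..R} x * e x \<partial>lborel)"
  have e_pos: "AE x in half_line. e x = (wt \<delta> x)\<^sup>2 * ((h x)\<^sup>2 + (1/2) * (k x)\<^sup>2)"
    using c Q
  proof eventually_elim
    case (elim x)
    have alg: "a * (w * a) + b * ((1/2) * (w * b)) = w * (a\<^sup>2 + (1/2) * b\<^sup>2)" for a b w :: real
      by (simp add: power2_eq_square distrib_left)
    have ex: "e x = (c + Prim k x) * q x + k x * Prim q x" by (simp only: e_def add_0)
    have hx: "c + Prim k x = h x" using elim(1) by (rule sym)
    have "e x = h x * q x + k x * ((1/2) * r x)" by (simp only: ex hx elim(2))
    also have "\<dots> = (wt \<delta> x)\<^sup>2 * ((h x)\<^sup>2 + (1/2) * (k x)\<^sup>2)"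
      unfolding q_def r_def by (rule alg)
    finally show ?case .
  qed
  have ei: "integrable lborel (\<lambda>x. indicator {0..R} x * e x)" if R: "0 \<le> R" for R
  proof -
    have I: "integrable lborel (\<lambda>x. indicator {0..R} x * ((c + Prim k x) * q x) + indicator {0..R} x * ((0 + Prim q x) * k x))"
      by (intro Bochner_Integration.integrable_add Prim_parts(1) kl q R)
    have alg: "i * (a * y) + i * (b * z) = i * (a * y + z * b)" for i a b y z :: real
      by (simp add: distrib_left mult.commute)
    have eq: "indicator {0..R} x * ((c + Prim k x) * q x) + indicator {0..R} x * ((0 + Prim q x) * k x)
        = indicator {0..R} x * e x" for x
      unfolding e_def by (rule alg)
    show ?thesis using I by (simp only: eq)
  qed
  have e0: "AE x in lborel. 0 \<le> x \<longrightarrow> 0 \<le> e x"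
    using e_pos unfolding AE_half_line_iff
  proof eventually_elim
    case (elim x)
    show ?case
    proof
      assume "0 \<le> x"
      have "0 \<le> (wt \<delta> x)\<^sup>2 * ((h x)\<^sup>2 + (1/2) * (k x)\<^sup>2)"
        by (intro mult_nonneg_nonneg add_nonneg_nonneg zero_le_power2) simp
      also have "\<dots> = e x" by (rule elim[rule_format, symmetric]) fact
      finally show "0 \<le> e x" .
    qed
  qed
  have E_mono: "E R \<le> E R'" if "0 \<le> R" "R \<le> R'" for R R'
    unfolding E_def
  proof (rule integral_mono_AE)
    show "integrable lborel (\<lambda>x. indicator {0..R} x * e x)" "integrable lborel (\<lambda>x. indicator {0..R'} x * e x)"
      using that by (auto intro: ei)
    show "AE x in lborel. indicator {0..R} x * e x \<le> indicator {0..R'} x * e x"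
      using e0 by eventually_elim (use that in \<open>auto simp: indicator_def\<close>)
  qed
  have E0: "E 0 = 0" unfolding E_def
    by (rule integral_eq_zero_AE) (use AE_lborel_singleton[of "0::real"] in \<open>eventually_elim, auto simp: indicator_def\<close>)
  have E_eq: "E R = (c + Prim k R) * Prim q R" if "0 \<le> R" for R
    using Prim_parts(2)[OF kl q that, of c 0] by (simp add: E_def e_def)
  have E_AE: "AE R in half_line. E R = (1/2) * ((wt \<delta> R)\<^sup>2 * (h R * k R))"
  proof -
    have "AE R in half_line. E R = (c + Prim k R) * Prim q R"
      using AE_half_line_pos by eventually_elim (simp add: E_eq)
    then show ?thesis using c Q
    proof eventually_elim
      case (elim R)
      have "E R = h R * ((1/2) * r R)" using elim by simp
      then show ?case by (simp add: r_def algebra_simps)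
    qed
  qed
  have "integrable (bessel_measure \<delta>) (\<lambda>x. h x * k x)" by (rule L2_mult_integrable[OF h(1) k])
  then have hk: "integrable half_line (\<lambda>x. (wt \<delta> x)\<^sup>2 * (h x * k x))" by (subst (asm) integrable_bessel) measurable
  \<comment> \<open>If \<open>E\<close> were positive at \<open>R\<close>, monotonicity would keep
    an integrable function at least \<open>2 * E R\<close> on all of [R, infinity).\<close>
  have E_zero: "E R = 0" if R: "0 \<le> R" for R
  proof (rule ccontr)
    assume "E R \<noteq> 0"
    moreover have "0 \<le> E R" using E_mono[OF order_refl R] unfolding E0 .
    ultimately have pos: "0 < E R" by simp
    define s where "s = (\<lambda>x. (wt \<delta> x)\<^sup>2 * (h x * k x))"
    have "integrable lborel (\<lambda>x. indicator {0..} x * s x)" using hk unfolding half_line_integral s_def .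
    then have "(\<integral>\<^sup>+ x. ennreal (norm (indicator {0..} x * s x)) \<partial>lborel) < \<infinity>"
      unfolding integrable_iff_bounded by (rule conjunct2)
    moreover have "(\<integral>\<^sup>+ x. ennreal (2 * E R) * indicator {R..} x \<partial>lborel)
        \<le> (\<integral>\<^sup>+ x. ennreal (norm (indicator {0..} x * s x)) \<partial>lborel)"
    proof (rule nn_integral_mono_AE)
      have "AE x in lborel. 0 \<le> x \<longrightarrow> E x = (1/2) * s x" using E_AE unfolding AE_half_line_iff s_def .
      then show "AE x in lborel. ennreal (2 * E R) * indicator {R..} x \<le> ennreal (norm (indicator {0..} x * s x))"
      proof eventually_elim
        case (elim x)
        show ?case
        proof (cases "R \<le> x")
          case True
          have "2 * E R \<le> s x" using E_mono[OF R True] elim R True by simp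
          then have "2 * E R \<le> norm (indicator {0..} x * s x)" using R True by simp
          then show ?thesis using True by (simp add: ennreal_leI)
        qed simp
      qed
    qed
    moreover have "(\<integral>\<^sup>+ x. ennreal (2 * E R) * indicator {R..} x \<partial>lborel) = \<infinity>"
    proof -
      have "emeasure lborel {R..} = \<infinity>"
      proof (rule ccontr)
        assume "emeasure lborel {R..} \<noteq> \<infinity>"
        then obtain m where m: "0 \<le> m" "emeasure lborel {R..} = ennreal m"
          by (cases "emeasure lborel {R..}" rule: ennreal_cases) auto
        have "ennreal (m + 1) = emeasure lborel {R..R + (m + 1)}" using m(1) by simp
        also have "\<dots> \<le> emeasure lborel {R..}" by (rule emeasure_mono) auto
        finally show False using m by simp
      qed
      then show ?thesis using pos by (simp add: nn_integral_cmult_indicator ennreal_mult_top)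
    qed
    ultimately show False by simp
  qed
  have "AE x in lborel. indicator {0..real n} x * e x = 0" for n
  proof (rule integral_nonneg_eq_0_iff_AE[THEN iffD1])
    show "integrable lborel (\<lambda>x. indicator {0..real n} x * e x)" by (rule ei) simp
    show "AE x in lborel. 0 \<le> indicator {0..real n} x * e x"
      using e0 by eventually_elim (auto simp: indicator_def)
    show "(\<integral>x. indicator {0..real n} x * e x \<partial>lborel) = 0" using E_zero[of "real n"] by (simp add: E_def)
  qed
  then have "AE x in lborel. \<forall>n. indicator {0..real n} x * e x = 0" unfolding AE_all_countable by blast
  then have "AE x in half_line. e x = 0"
    unfolding AE_half_line_iff
  proof eventually_elim
    case (elim x)
    obtain n where "x \<le> real n" using real_arch_simple by blast
    then show ?case using elim[rule_format, of n] by (auto simp: indicator_def)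
  qed
  then show ?thesis using e_pos AE_half_line_pos
  proof eventually_elim
    case (elim x)
    then have "(h x)\<^sup>2 + (1/2) * (k x)\<^sup>2 = 0" using wt_pos[of x \<delta>] by simp
    then have "(h x)\<^sup>2 = 0"
      using zero_le_power2[of "h x"] zero_le_power2[of "k x"] by linarith
    then show ?case by simp
  qed
qed

text \<open>The residual of projecting an element of \<open>Gr\<close> onto the closure is again in
  \<open>Gr\<close> and orthogonal to all hats. Its first component vanishes by
  \<open>orthogonal_to_hats\<close>, its second by \<open>single_Gr\<close>. Consequently the weak
  equation, imposed for test functions only, holds for the entire form domain, and uniqueness rests
  on this.\<close>

lemma closure_test_graph: "closure test_graph = Gr"
proof
  show "closure test_graph \<subseteq> Gr" by (rule closure_test_graph_subset)
  show "Gr \<subseteq> closure test_graph"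
  proof
    fix z assume z: "z \<in> Gr"
    have C: "subspace (closure test_graph)" "closed (closure test_graph)"
      by (simp_all add: subspace_closure subspace_test_graph)
    define d where "d = z - ortho_proj (closure test_graph) z"
    have "d \<in> Gr"
      unfolding d_def using ortho_proj_in[OF C] closure_test_graph_subset
      by (intro subspace_diff[OF subspace_Gr z]) blast
    then obtain h k where hk: "h \<in> L2b \<delta>" "H_deriv \<delta> h k" "d = (U \<delta> h, (1 / sqrt 2) *\<^sub>R U \<delta> k)"
      by (auto simp: Gr_def)
    have "d \<bullet> w = 0" if "w \<in> closure test_graph" for w
      unfolding d_def using ortho_proj_orth[OF C that, of z] by (simp add: inner_diff_left)
    then have "AE x in half_line. h x = 0"
      using hat_in_closure unfolding hk(3) by (intro orthogonal_to_hats[OF hk(1,2)]) blast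
    then have "U \<delta> h = U \<delta> (\<lambda>x. 0)" by (subst U_eq_iff) (auto simp: hk(1))
    then have U0: "U \<delta> h = 0" by simp
    have "(0, (1 / sqrt 2) *\<^sub>R U \<delta> k) \<in> Gr" using \<open>d \<in> Gr\<close> unfolding hk(3) U0 .
    then have "(1 / sqrt 2) *\<^sub>R U \<delta> k = 0" by (rule single_Gr)
    then have "d = 0" unfolding hk(3) U0 by (simp only: zero_prod_def)
    then have "z = ortho_proj (closure test_graph) z" by (simp add: d_def)
    then show "z \<in> closure test_graph" using ortho_proj_in[OF C, of z] by simp
  qed
qed

end

section \<open>Bochner integrability of function-valued maps in terms of Hilbert space valued
  ones\<close>

section \<open>Bochner integrability of function-valued maps\<close>

text \<open>\<Phi> turns \<open>N\<close> into a norm and simple maps into simple maps, so the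
  approximating sequence is carried over and the limit is measurable by completeness of Lebesgue
  measure.\<close>

lemma Bochner_L1_integrable:
  fixes \<Phi> :: "('a \<Rightarrow> real) \<Rightarrow> 'b::{banach, second_countable_topology}" and S :: "real set"
  assumes S: "S \<in> sets lebesgue" and u: "u \<in> Bochner_L1 (lebesgue_on S) Y N"
    and norm: "\<And>h. h \<in> Y \<Longrightarrow> N h = norm (\<Phi> h)"
    and diff: "\<And>h k. h \<in> Y \<Longrightarrow> k \<in> Y \<Longrightarrow> N (\<lambda>x. h x - k x) = norm (\<Phi> h - \<Phi> k)"
  shows "integrable (lebesgue_on S) (\<lambda>t. \<Phi> (u t))"
proof -
  let ?M = "lebesgue_on S"
  obtain s where uY: "AE t in ?M. u t \<in> Y"
    and s: "\<And>n. simple_function ?M (s n)" "\<And>n. s n ` space ?M \<subseteq> Y"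
    and lim: "AE t in ?M. (\<lambda>n. N (\<lambda>x. s n t x - u t x)) \<longlonglongrightarrow> 0"
    and int: "integrable ?M (\<lambda>t. N (u t))"
    using u unfolding Bochner_L1_def by auto
  have conv: "AE t in ?M. (\<lambda>n. \<Phi> (s n t)) \<longlonglongrightarrow> \<Phi> (u t)"
    using uY lim AE_space
  proof eventually_elim
    case (elim t)
    have "s n t \<in> Y" for n using s(2) elim(3) by blast
    then have "N (\<lambda>x. s n t x - u t x) = norm (\<Phi> (s n t) - \<Phi> (u t))" for n by (rule diff[OF _ elim(1)])
    then have "(\<lambda>n. norm (\<Phi> (s n t) - \<Phi> (u t))) \<longlonglongrightarrow> 0" using elim(2) by simp
    then have "(\<lambda>n. \<Phi> (s n t) - \<Phi> (u t)) \<longlonglongrightarrow> 0" by (rule tendsto_norm_zero_cancel)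
    then show ?case by (rule LIM_zero_cancel)
  qed
  have "(\<lambda>t. \<Phi> (s n t)) \<in> borel_measurable ?M" for n
    by (intro borel_measurable_simple_function simple_function_compose1[OF s(1)])
  then have m0: "(\<lambda>t. lim (\<lambda>n. \<Phi> (s n t))) \<in> borel_measurable ?M" by (rule borel_measurable_lim_metric)
  have "AE t in ?M. lim (\<lambda>n. \<Phi> (s n t)) = \<Phi> (u t)" using conv by eventually_elim (rule limI)
  then have m: "(\<lambda>t. \<Phi> (u t)) \<in> borel_measurable ?M" by (rule borel_measurable_lebesgue_on_AE[OF m0 S])
  have "integrable ?M (\<lambda>t. norm (\<Phi> (u t)))"
    by (rule integrable_lebesgue_on_AE[OF int S]) (use uY in eventually_elim, rule norm)
  then show ?thesis using m by (rule integrable_norm_cancel)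
qed

text \<open>The converse direction. Simple approximations of \<open>v\<close> may leave the range of
  \<Phi> on \<open>Y\<close>; \<Psi> brings them back into \<open>Y\<close>, at the price of the
  retraction \<pi>. For \<open>L12_space\<close> this is the identity, for \<open>B_space\<close>
  the orthogonal projection onto \<open>Gr\<close>.\<close>

lemma integrable_Bochner_L1:
  fixes \<Phi> :: "('a \<Rightarrow> real) \<Rightarrow> 'b::{banach, second_countable_topology}" and S :: "real set"
  assumes S: "S \<in> sets lebesgue" and v: "integrable (lebesgue_on S) v"
    and u: "AE t in lebesgue_on S. u t \<in> Y \<and> \<Phi> (u t) = v t"
    and norm: "\<And>h. h \<in> Y \<Longrightarrow> N h = norm (\<Phi> h)"
    and diff: "\<And>h k. h \<in> Y \<Longrightarrow> k \<in> Y \<Longrightarrow> N (\<lambda>x. h x - k x) = norm (\<Phi> h - \<Phi> k)"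
    and \<Psi>: "\<And>b. \<Psi> b \<in> Y" "\<And>b. \<Phi> (\<Psi> b) = \<pi> b"
    and \<pi>: "\<And>b. isCont \<pi> b" "AE t in lebesgue_on S. \<pi> (v t) = v t"
  shows "u \<in> Bochner_L1 (lebesgue_on S) Y N"
proof -
  let ?M = "lebesgue_on S"
  have "v \<in> borel_measurable ?M" using v by simp
  then obtain s where s: "\<And>i. simple_function ?M (s i)" "\<And>x. x \<in> space ?M \<Longrightarrow> (\<lambda>i. s i x) \<longlonglongrightarrow> v x"
    using borel_measurable_implies_sequence_metric[of v ?M 0] by blast
  have "AE t in ?M. (\<lambda>n. N (\<lambda>x. \<Psi> (s n t) x - u t x)) \<longlonglongrightarrow> 0"
    using u \<pi>(2) AE_space
  proof eventually_elim
    case (elim t)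
    have "N (\<lambda>x. \<Psi> (s n t) x - u t x) = norm (\<pi> (s n t) - v t)" for n
      using diff[OF \<Psi>(1)] elim(1) \<Psi>(2) by simp
    moreover have "(\<lambda>n. \<pi> (s n t)) \<longlonglongrightarrow> v t"
      using isCont_tendsto_compose[OF \<pi>(1) s(2)[OF elim(3)]] elim(2) by simp
    ultimately show ?case using tendsto_norm_zero[OF LIM_zero] by simp
  qed
  moreover have "simple_function ?M (\<lambda>t. \<Psi> (s n t))" for n by (rule simple_function_compose1[OF s(1)])
  moreover have "integrable ?M (\<lambda>t. N (u t))"
    by (rule integrable_lebesgue_on_AE[OF integrable_norm[OF v] S])
       (use u in eventually_elim, auto simp: norm)
  moreover have "AE t in ?M. u t \<in> Y" using u by eventually_elim simp
  moreover have "(\<lambda>t. \<Psi> (s n t)) ` space ?M \<subseteq> Y" for n using \<Psi>(1) by blast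
  ultimately show ?thesis unfolding Bochner_L1_def mem_Collect_eq
    by (intro exI[of _ "\<lambda>n t. \<Psi> (s n t)"] conjI allI) assumption+
qed

text \<open>Reconciles two ways of integrating from t to T: over the restricted measure, as in the
  weak equation to be solved, and with a cut-off over the fixed interval, as in the abstract part.
  The endpoint t is a null set.\<close>

lemma integral_lebesgue_on_tail:
  fixes F F' :: "real \<Rightarrow> real"
  assumes t: "t \<in> {0..T}" and F': "F' \<in> borel_measurable (lebesgue_on {0..T})"
    and eq: "AE s in lebesgue_on {0..T}. F s = F' s"
  shows "integral\<^sup>L (lebesgue_on {t..T}) F = (\<integral>s. indicator {t<..} s *\<^sub>R F' s \<partial>lebesgue_on {0..T})"
proof -
  have F: "F \<in> borel_measurable (lebesgue_on {0..T})"
  proof (rule borel_measurable_lebesgue_on_AE[OF F'])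
    show "AE s in lebesgue_on {0..T}. F' s = F s" using eq by eventually_elim simp
  qed simp
  have mF: "(\<lambda>s. indicator {0..T} s *\<^sub>R F s) \<in> borel_measurable lebesgue"
    and mF': "(\<lambda>s. indicator {0..T} s *\<^sub>R F' s) \<in> borel_measurable lebesgue"
    using F F' borel_measurable_restrict_space_iff[of "{0..T}" lebesgue F]
      borel_measurable_restrict_space_iff[of "{0..T}" lebesgue F'] by auto
  have ind: "indicator A \<in> borel_measurable lebesgue" if "A \<in> sets borel" for A :: "real set"
    using that by (intro borel_measurable_indicator) auto
  have "integral\<^sup>L (lebesgue_on {t..T}) F = (\<integral>s. indicator {t..T} s *\<^sub>R F s \<partial>lebesgue)"
    by (rule integral_restrict_space) simp
  also have "\<dots> = (\<integral>s. indicator {0..T} s *\<^sub>R (indicator {t<..} s *\<^sub>R F' s) \<partial>lebesgue)"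
  proof (rule integral_cong_AE)
    have "(\<lambda>s. indicator {t..T} s * (indicator {0..T} s *\<^sub>R F s)) \<in> borel_measurable lebesgue"
      by (rule borel_measurable_times[OF ind mF]) simp
    moreover have "(\<lambda>s. indicator {t..T} s * (indicator {0..T} s *\<^sub>R F s)) = (\<lambda>s. indicator {t..T} s *\<^sub>R F s)"
      using t by (auto simp: indicator_def)
    ultimately show "(\<lambda>s. indicator {t..T} s *\<^sub>R F s) \<in> borel_measurable lebesgue" by simp
    have "(\<lambda>s. indicator {t<..} s * (indicator {0..T} s *\<^sub>R F' s)) \<in> borel_measurable lebesgue"
      by (rule borel_measurable_times[OF ind mF']) simp
    moreover have "(\<lambda>s. indicator {t<..} s * (indicator {0..T} s *\<^sub>R F' s)) = (\<lambda>s. indicator {0..T} s *\<^sub>R (indicator {t<..} s *\<^sub>R F' s))"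
      by (auto simp: indicator_def)
    ultimately show "(\<lambda>s. indicator {0..T} s *\<^sub>R (indicator {t<..} s *\<^sub>R F' s)) \<in> borel_measurable lebesgue" by simp
    have "AE s in lebesgue. s \<in> {0..T} \<longrightarrow> F s = F' s" using eq by (subst (asm) AE_restrict_space_iff) auto
    moreover have "AE s in lebesgue. s \<noteq> t" by (rule AE_completion) (rule AE_lborel_singleton)
    ultimately show "AE s in lebesgue. indicator {t..T} s *\<^sub>R F s = indicator {0..T} s *\<^sub>R (indicator {t<..} s *\<^sub>R F' s)"
      by eventually_elim (use t in \<open>auto simp: indicator_def\<close>)
  qed
  also have "\<dots> = (\<integral>s. indicator {t<..} s *\<^sub>R F' s \<partial>lebesgue_on {0..T})"
    by (rule integral_restrict_space[symmetric]) simp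
  finally show ?thesis .
qed

text \<open>In a separable metric space an open set is a countable union of balls, and preimages of
  balls are sublevel sets of distances. This suits a map whose distances, rather than its values,
  are given by integrals (\<open>N_measurable\<close>).\<close>

lemma borel_measurable_of_dist:
  fixes F :: "'t \<Rightarrow> 'b::{metric_space, second_countable_topology}"
  assumes "\<And>c. (\<lambda>t. dist (F t) c) \<in> borel_measurable M"
  shows "F \<in> borel_measurable M"
proof (rule borel_measurableI)
  fix O' :: "'b set" assume O: "open O'"
  obtain Q :: "'b set" where Q: "countable Q" "closure Q = UNIV"
  proof -
    obtain D :: "'b set" where D: "countable D" "\<And>X. open X \<Longrightarrow> X \<noteq> {} \<Longrightarrow> \<exists>d\<in>D. d \<in> X"
      using countable_dense_exists by blast
    have "x \<in> closure D" for x
      unfolding closure_approachable using D(2)[OF open_ball, of x] by (metis ball_eq_empty dist_commute mem_ball not_le)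
    then show thesis using that D(1) by blast
  qed
  have base: "topological_basis ((\<lambda>(q, r). ball q r) ` (Q \<times> \<rat>))" by (rule topological_basis_of_dense[OF Q(2)])
  obtain B where B: "B \<subseteq> (\<lambda>(q, r). ball q r) ` (Q \<times> \<rat>)" "\<Union>B = O'"
    using base O unfolding topological_basis_def by blast
  have "countable B"
    by (rule countable_subset[OF B(1)]) (intro countable_image countable_SIGMA countable_rat Q(1))
  have "F -` b \<inter> space M \<in> sets M" if b: "b \<in> B" for b
  proof -
    obtain q r where "b = ball q r" using b B(1) by auto
    then have "F -` b \<inter> space M = (\<lambda>t. dist (F t) q) -` {..<r} \<inter> space M" by (auto simp: dist_commute)
    then show ?thesis using measurable_sets[OF assms, of "{..<r}" q] by simp
  qed
  then have "(\<Union>b\<in>B. F -` b \<inter> space M) \<in> sets M" using \<open>countable B\<close> by (intro sets.countable_UN'') auto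
  moreover have "(\<Union>b\<in>B. F -` b \<inter> space M) = F -` O' \<inter> space M" using B(2) by auto
  ultimately show "F -` O' \<inter> space M \<in> sets M" by simp
qed

context bessel
begin

text \<open>Up to null sets this is the isometric bijection from \<open>H_space \<delta>\<close>
  with \<open>H_norm\<close> to \<open>Gr\<close>; applying \<open>V\<close> to the first component
  inverts it (\<open>Gr_section\<close>).\<close>

definition UG :: "(real \<Rightarrow> real) \<Rightarrow> l2 \<times> l2" where
  "UG h = (U \<delta> h, (1 / sqrt 2) *\<^sub>R U \<delta> (H_dx \<delta> h))"

lemma H_dx_deriv:
  assumes "h \<in> H_space \<delta>"
  shows "H_deriv \<delta> h (H_dx \<delta> h)"
proof -
  have "\<exists>k. H_deriv \<delta> h k" using assms unfolding H_space_def by (rule CollectE) (erule conjunct2)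
  then show ?thesis unfolding H_dx_def by (rule someI_ex)
qed

lemma H_space_L2b: "h \<in> H_space \<delta> \<Longrightarrow> h \<in> L2b \<delta>" by (simp add: H_space_def)

lemma H_dx_L2b: "h \<in> H_space \<delta> \<Longrightarrow> H_dx \<delta> h \<in> L2b \<delta>"
  by (rule H_deriv_L2b[OF H_dx_deriv])

lemma UG_in_Gr: "h \<in> H_space \<delta> \<Longrightarrow> UG h \<in> Gr"
  unfolding UG_def by (rule GrI[OF H_space_L2b H_dx_deriv])

lemma Gr_section:
  assumes "(a, b) \<in> Gr"
  shows "V \<delta> a \<in> H_space \<delta>" and "UG (V \<delta> a) = (a, b)"
proof -
  have D: "H_deriv \<delta> (V \<delta> a) (V \<delta> (sqrt 2 *\<^sub>R b))" using assms Gr_iff by simp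
  then show H: "V \<delta> a \<in> H_space \<delta>" using V_in_L2b by (auto simp: H_space_def)
  have "AE x in half_line. H_dx \<delta> (V \<delta> a) x = V \<delta> (sqrt 2 *\<^sub>R b) x"
    by (rule H_deriv_unique[OF H_dx_deriv[OF H] D]) simp
  then have "U \<delta> (H_dx \<delta> (V \<delta> a)) = U \<delta> (V \<delta> (sqrt 2 *\<^sub>R b))"
    by (subst U_eq_iff) (auto simp: H_dx_L2b[OF H] V_in_L2b)
  then show "UG (V \<delta> a) = (a, b)" by (simp add: UG_def)
qed

lemma H_space_diff:
  assumes "h \<in> H_space \<delta>" "k \<in> H_space \<delta>"
  shows "(\<lambda>x. h x - k x) \<in> H_space \<delta>" and "UG (\<lambda>x. h x - k x) = UG h - UG k"
proof -
  have D: "H_deriv \<delta> (\<lambda>x. h x - k x) (\<lambda>x. H_dx \<delta> h x - H_dx \<delta> k x)"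
    by (intro H_deriv_diff H_dx_deriv assms)
  show H: "(\<lambda>x. h x - k x) \<in> H_space \<delta>"
    using D L2_diff[OF H_space_L2b H_space_L2b] assms by (auto simp: H_space_def)
  have "AE x in half_line. H_dx \<delta> (\<lambda>x. h x - k x) x = H_dx \<delta> h x - H_dx \<delta> k x"
    by (rule H_deriv_unique[OF H_dx_deriv[OF H] D]) simp
  then have "U \<delta> (H_dx \<delta> (\<lambda>x. h x - k x)) = U \<delta> (\<lambda>x. H_dx \<delta> h x - H_dx \<delta> k x)"
    by (subst U_eq_iff[OF H_dx_L2b[OF H] L2_diff[OF H_dx_L2b H_dx_L2b]]) (use assms in auto)
  then show "UG (\<lambda>x. h x - k x) = UG h - UG k"
    using assms by (simp add: UG_def U_diff H_dx_L2b H_space_L2b scaleR_diff_right)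
qed

lemma norm_UG: "h \<in> H_space \<delta> \<Longrightarrow> H_norm \<delta> h = norm (UG h)"
  by (simp add: H_norm_def UG_def norm_Pair norm_U[symmetric] H_space_L2b H_dx_L2b power_divide power_mult_distrib)

lemma H_norm_diff:
  "h \<in> H_space \<delta> \<Longrightarrow> k \<in> H_space \<delta> \<Longrightarrow> H_norm \<delta> (\<lambda>x. h x - k x) = norm (UG h - UG k)"
  by (subst norm_UG[OF H_space_diff(1)]) (simp_all only: H_space_diff(2))

lemma L2_norm_diff: "h \<in> L2b \<delta> \<Longrightarrow> k \<in> L2b \<delta> \<Longrightarrow> L2_norm (bessel_measure \<delta>) (\<lambda>x. h x - k x) = norm (U \<delta> h - U \<delta> k)"
  by (simp add: norm_U[symmetric] L2_diff U_diff)

lemma L12_integrable: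
  "u \<in> L12_space \<delta> T \<Longrightarrow> integrable (lebesgue_on {0..T}) (\<lambda>t. U \<delta> (u t))"
  unfolding L12_space_def by (rule Bochner_L1_integrable[OF _ _ norm_U[symmetric] L2_norm_diff]) auto

lemma integrable_L12:
  assumes "integrable (lebesgue_on {0..T}) v" "AE t in lebesgue_on {0..T}. u t \<in> L2b \<delta> \<and> U \<delta> (u t) = v t"
  shows "u \<in> L12_space \<delta> T"
  unfolding L12_space_def
  by (rule integrable_Bochner_L1[OF _ assms norm_U[symmetric] L2_norm_diff, where \<Psi> = "V \<delta>" and \<pi> = "\<lambda>b. b"])
     (auto simp: V_in_L2b)

lemma B_integrable:
  "u \<in> B_space \<delta> T \<Longrightarrow> integrable (lebesgue_on {0..T}) (\<lambda>t. UG (u t))"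
  unfolding B_space_def
  by (rule Bochner_L1_integrable[OF _ _ norm_UG H_norm_diff]) simp_all

lemma integrable_B:
  assumes v: "integrable (lebesgue_on {0..T}) v" and G: "AE t in lebesgue_on {0..T}. v t \<in> Gr"
    and u: "AE t in lebesgue_on {0..T}. u t \<in> H_space \<delta> \<and> UG (u t) = v t"
  shows "u \<in> B_space \<delta> T"
  unfolding B_space_def
proof (rule integrable_Bochner_L1[OF _ v u norm_UG H_norm_diff, where \<Psi> = "\<lambda>b. V \<delta> (fst (ortho_proj Gr b))" and \<pi> = "ortho_proj Gr"])
  fix b
  have "(fst (ortho_proj Gr b), snd (ortho_proj Gr b)) \<in> Gr" using ortho_proj_in[OF subspace_Gr closed_Gr] by simp
  from Gr_section[OF this] show "V \<delta> (fst (ortho_proj Gr b)) \<in> H_space \<delta>"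
    "UG (V \<delta> (fst (ortho_proj Gr b))) = ortho_proj Gr b" by simp_all
  show "isCont (ortho_proj Gr) b"
    by (rule linear_continuous_at[OF bounded_linear_ortho_proj[OF subspace_Gr closed_Gr]])
next
  show "AE t in lebesgue_on {0..T}. ortho_proj Gr (v t) = v t"
    using G by eventually_elim (rule ortho_proj_id[OF subspace_Gr closed_Gr])
qed simp

lemma norm_U_mono:
  assumes "p \<in> L2b \<delta>" "q \<in> L2b \<delta>" "\<And>x. 0 \<le> x \<Longrightarrow> \<bar>p x\<bar> \<le> \<bar>q x\<bar>"
  shows "norm (U \<delta> p) \<le> norm (U \<delta> q)"
proof -
  have "(norm (U \<delta> p))\<^sup>2 = (\<integral>x. (p x)\<^sup>2 \<partial>bessel_measure \<delta>)"
    unfolding power2_norm_eq_inner U_inner[OF assms(1,1)] L2_inner_def by (simp add: power2_eq_square)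
  also have "\<dots> \<le> (\<integral>x. (q x)\<^sup>2 \<partial>bessel_measure \<delta>)"
  proof (rule integral_mono_AE[OF L2_spaceD(2)[OF assms(1)] L2_spaceD(2)[OF assms(2)]])
    show "AE x in bessel_measure \<delta>. (p x)\<^sup>2 \<le> (q x)\<^sup>2"
      unfolding AE_bessel_iff using AE_half_line_pos
      by eventually_elim (rule abs_le_square_iff[THEN iffD1, OF assms(3)], simp)
  qed
  also have "\<dots> = (norm (U \<delta> q))\<^sup>2"
    unfolding power2_norm_eq_inner U_inner[OF assms(2,2)] L2_inner_def by (simp add: power2_eq_square)
  finally show ?thesis by (rule power2_le_imp_le) simp
qed

lemma L2b_abs: "p \<in> L2b \<delta> \<Longrightarrow> (\<lambda>x. \<bar>p x\<bar>) \<in> L2b \<delta>"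
  by (rule L2_bound[of p]) (auto simp: L2_bessel_iff)

end

section \<open>The semilinear Bessel problem as an instance of the abstract one\<close>

section \<open>The semilinear Bessel equation\<close>

locale bessel_problem = bessel +
  fixes T C :: real and f :: "real \<Rightarrow> real \<Rightarrow> real \<Rightarrow> real \<Rightarrow> real" and g :: "real \<Rightarrow> real"
  assumes T_pos: "0 < T" and C_pos: "0 < C"
    and f_borel: "(\<lambda>(t, x, y, z). f t x y z)
        \<in> borel_measurable (restrict_space borel ({0..T} \<times> {0..} \<times> UNIV \<times> UNIV))"
    and f_lip: "\<And>t x y1 y2 z1 z2. t \<in> {0..T} \<Longrightarrow> 0 \<le> x \<Longrightarrow>
        \<bar>f t x y1 z1 - f t x y2 z2\<bar> \<le> C * (\<bar>y1 - y2\<bar> + \<bar>z1 - z2\<bar>)"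
    and f_zero: "(\<lambda>t x. f t x 0 0) \<in> L12_space \<delta> T"
    and g_L2: "g \<in> L2b \<delta>"
begin

lemma f_measurable:
  assumes "\<tau> \<in> borel_measurable M" "\<xi> \<in> borel_measurable M" "h \<in> borel_measurable M" "k \<in> borel_measurable M"
    and ran: "\<And>w. w \<in> space M \<Longrightarrow> \<tau> w \<in> {0..T} \<and> 0 \<le> \<xi> w"
  shows "(\<lambda>w. f (\<tau> w) (\<xi> w) (h w) (k w)) \<in> borel_measurable M"
proof -
  have "(\<lambda>w. (\<tau> w, \<xi> w, h w, k w)) \<in> borel_measurable M" by (intro borel_measurable_Pair assms)
  then have "(\<lambda>w. (\<tau> w, \<xi> w, h w, k w)) \<in> M \<rightarrow>\<^sub>M restrict_space borel ({0..T} \<times> {0..} \<times> UNIV \<times> UNIV)"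
    by (rule measurable_restrict_space2[rotated]) (use ran in auto)
  from measurable_compose[OF this f_borel] show ?thesis by simp
qed

text \<open>The function f(t, x, 0, 0) of x is known to be in L^2(d\<mu>) only for almost every t.
  At other times \<open>N\<close> is set to 0, so that its Lipschitz bound holds at every t.\<close>

definition good :: "real \<Rightarrow> bool" where
  "good t \<longleftrightarrow> t \<in> {0..T} \<and> (\<lambda>x. f t x 0 0) \<in> L2b \<delta>"

lemma AE_good: "AE t in lebesgue_on {0..T}. good t"
proof -
  have "AE t in lebesgue_on {0..T}. (\<lambda>x. f t x 0 0) \<in> L2b \<delta>"
    using f_zero unfolding L12_space_def Bochner_L1_def by blast
  with AE_space show ?thesis by eventually_elim (simp add: good_def)
qed

lemma section_L2b:
  assumes t: "good t" and h: "h \<in> L2b \<delta>" and k: "k \<in> L2b \<delta>"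
  shows "(\<lambda>x. f t x (h x) (k x)) \<in> L2b \<delta>"
proof (rule L2_bound)
  show "(\<lambda>x. \<bar>f t x 0 0\<bar> + C * (\<bar>h x\<bar> + \<bar>k x\<bar>)) \<in> L2b \<delta>"
    using t by (intro L2_add[OF L2b_abs L2_scale[OF L2_add[OF L2b_abs L2b_abs]]] h k) (simp add: good_def)
  have "(\<lambda>x. f t x (h x) (k x)) \<in> borel_measurable half_line"
    by (rule f_measurable)
       (use t h k in \<open>auto simp: good_def L2b_measurable intro!: borel_measurable_half_line_of_borel\<close>)
  then show "(\<lambda>x. f t x (h x) (k x)) \<in> borel_measurable (bessel_measure \<delta>)" by simp
  show "AE x in bessel_measure \<delta>. \<bar>f t x (h x) (k x)\<bar> \<le> \<bar>\<bar>f t x 0 0\<bar> + C * (\<bar>h x\<bar> + \<bar>k x\<bar>)\<bar>"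
    unfolding AE_bessel_iff using AE_half_line_pos
  proof eventually_elim
    case (elim x)
    have "\<bar>f t x (h x) (k x) - f t x 0 0\<bar> \<le> C * (\<bar>h x\<bar> + \<bar>k x\<bar>)"
      using f_lip[of t x "h x" "k x" 0 0] t elim by (simp add: good_def)
    then show ?case by linarith
  qed
qed

text \<open>The superposition operator seen through \<open>U\<close>; the factor sqrt 2 undoes the
  normalisation of second components in \<open>Gr\<close>.\<close>

definition N :: "real \<Rightarrow> l2 \<times> l2 \<Rightarrow> l2" where
  "N t a = (if good t then U \<delta> (\<lambda>x. f t x (V \<delta> (fst a) x) (V \<delta> (sqrt 2 *\<^sub>R snd a) x)) else 0)"

lemma N_eq:
  assumes t: "good t" and h: "h \<in> L2b \<delta>" and k: "k \<in> L2b \<delta>"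
  shows "N t (U \<delta> h, (1 / sqrt 2) *\<^sub>R U \<delta> k) = U \<delta> (\<lambda>x. f t x (h x) (k x))"
proof -
  have "AE x in half_line. V \<delta> (U \<delta> h) x = h x" "AE x in half_line. V \<delta> (U \<delta> k) x = k x"
    by (rule iffD1[OF U_eq_iff[OF V_in_L2b h] U_V], rule iffD1[OF U_eq_iff[OF V_in_L2b k] U_V])
  then have "AE x in half_line. f t x (V \<delta> (U \<delta> h) x) (V \<delta> (U \<delta> k) x) = f t x (h x) (k x)"
    by eventually_elim simp
  then have "U \<delta> (\<lambda>x. f t x (V \<delta> (U \<delta> h) x) (V \<delta> (U \<delta> k) x)) = U \<delta> (\<lambda>x. f t x (h x) (k x))"
    using U_eq_iff[OF section_L2b[OF t V_in_L2b V_in_L2b] section_L2b[OF t h k]] by simp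
  then show ?thesis using t by (simp add: N_def)
qed

text \<open>The pointwise bound gives C (|fst| + sqrt 2 |snd|) for the difference a - b. Each
  component is at most the product norm, and 1 + sqrt 2 \<le> 3.\<close>

lemma N_lipschitz:
  "norm (N t a - N t b) \<le> 3 * C * norm (a - b)"
proof (cases "good t")
  case False
  then show ?thesis using C_pos by (simp add: N_def)
next
  case True
  define h k h' k' where "h = V \<delta> (fst a)" and "k = V \<delta> (sqrt 2 *\<^sub>R snd a)"
    and "h' = V \<delta> (fst b)" and "k' = V \<delta> (sqrt 2 *\<^sub>R snd b)"
  have L: "h \<in> L2b \<delta>" "k \<in> L2b \<delta>" "h' \<in> L2b \<delta>" "k' \<in> L2b \<delta>"
    by (simp_all add: h_def k_def h'_def k'_def V_in_L2b)
  have abs: "norm (U \<delta> (\<lambda>x. \<bar>p x - q x\<bar>)) \<le> norm (U \<delta> p - U \<delta> q)" if "p \<in> L2b \<delta>" "q \<in> L2b \<delta>" for p q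
    unfolding U_diff[OF that, symmetric]
    by (rule norm_U_mono[OF L2b_abs[OF L2_diff[OF that]] L2_diff[OF that]]) simp
  note D = L2b_abs[OF L2_diff[OF L(1,3)]] L2b_abs[OF L2_diff[OF L(2,4)]]
  note S = section_L2b[OF True L(1,2)] section_L2b[OF True L(3,4)]
  have "norm (N t a - N t b) = norm (U \<delta> (\<lambda>x. f t x (h x) (k x) - f t x (h' x) (k' x)))"
    unfolding U_diff[OF S] using True by (simp add: N_def h_def k_def h'_def k'_def)
  also have "\<dots> \<le> norm (U \<delta> (\<lambda>x. C * (\<bar>h x - h' x\<bar> + \<bar>k x - k' x\<bar>)))"
  proof (rule norm_U_mono[OF L2_diff[OF S] L2_scale[OF L2_add[OF D]]])
    fix x :: real assume "0 \<le> x"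
    then have "\<bar>f t x (h x) (k x) - f t x (h' x) (k' x)\<bar> \<le> C * (\<bar>h x - h' x\<bar> + \<bar>k x - k' x\<bar>)"
      using f_lip True by (simp add: good_def)
    then show "\<bar>f t x (h x) (k x) - f t x (h' x) (k' x)\<bar> \<le> \<bar>C * (\<bar>h x - h' x\<bar> + \<bar>k x - k' x\<bar>)\<bar>" by linarith
  qed
  also have "\<dots> = C * norm (U \<delta> (\<lambda>x. \<bar>h x - h' x\<bar>) + U \<delta> (\<lambda>x. \<bar>k x - k' x\<bar>))"
    unfolding U_scale[OF L2_add[OF D]] U_add[OF D] using C_pos by simp
  also have "\<dots> \<le> C * (norm (U \<delta> h - U \<delta> h') + norm (U \<delta> k - U \<delta> k'))"
    using C_pos abs[OF L(1,3)] abs[OF L(2,4)]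
    by (intro mult_left_mono order_trans[OF norm_triangle_ineq] add_mono) auto
  also have "\<dots> = C * (norm (fst (a - b)) + sqrt 2 * norm (snd (a - b)))"
    by (simp add: h_def k_def h'_def k'_def scaleR_diff_right[symmetric])
  also have "\<dots> \<le> C * (norm (a - b) + 2 * norm (a - b))"
  proof -
    have "sqrt 2 \<le> 2" by (rule real_le_lsqrt) auto
    moreover have "norm (fst (a - b)) \<le> norm (a - b)" "norm (snd (a - b)) \<le> norm (a - b)"
      using norm_fst_le[of "fst (a - b)" "snd (a - b)"] norm_snd_le[of "snd (a - b)" "fst (a - b)"]
      unfolding prod.collapse by blast+
    ultimately show ?thesis using C_pos by (intro mult_left_mono add_mono mult_mono) auto
  qed
  finally show ?thesis by (simp add: algebra_simps)
qed

text \<open>The distance to a fixed \<open>c\<close> is, at good times, the square root of an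
  integral over x of a function jointly measurable in t and x, so Tonelli makes it measurable in
  t.\<close>

lemma N_measurable: "(\<lambda>t. N t a) \<in> borel_measurable (lebesgue_on {0..T})"
proof (rule borel_measurable_of_dist)
  fix c
  define h k where "h = V \<delta> (fst a)" and "k = V \<delta> (sqrt 2 *\<^sub>R snd a)"
  have L: "h \<in> L2b \<delta>" "k \<in> L2b \<delta>" by (simp_all add: h_def k_def V_in_L2b)
  define P where "P = (\<lambda>t x. wt \<delta> x * (f t x (h x) (k x) - V \<delta> c x))"
  interpret half_line: sigma_finite_measure half_line
    unfolding half_line_def by (rule sigma_finite_measure_restrict_space) (simp_all add: sigma_finite_lborel)
  let ?L = "lebesgue_on {0..T}"
  have snd_meas: "(\<lambda>w. p (snd w)) \<in> borel_measurable (?L \<Otimes>\<^sub>M half_line)"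
    if "p \<in> borel_measurable half_line" for p :: "real \<Rightarrow> real"
    by (rule measurable_compose[OF measurable_snd that])
  have "(\<lambda>t::real. t) \<in> borel_measurable ?L"
    by (intro measurable_restrict_space1 measurable_completion) simp
  then have fst_meas: "fst \<in> borel_measurable (?L \<Otimes>\<^sub>M half_line)"
    using measurable_compose[OF measurable_fst] by blast
  have "(\<lambda>x::real. x) \<in> borel_measurable half_line" by (rule borel_measurable_half_line_of_borel) simp
  note id_meas = snd_meas[OF this]
  have "(\<lambda>w. f (fst w) (snd w) (h (snd w)) (k (snd w))) \<in> borel_measurable (?L \<Otimes>\<^sub>M half_line)"
    by (rule f_measurable[OF fst_meas id_meas snd_meas[OF L2b_measurable[OF L(1)]] snd_meas[OF L2b_measurable[OF L(2)]]])
       (auto simp: space_pair_measure)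
  then have "(\<lambda>w. (P (fst w) (snd w))\<^sup>2) \<in> borel_measurable (?L \<Otimes>\<^sub>M half_line)"
    unfolding P_def
    by (intro borel_measurable_power borel_measurable_times borel_measurable_diff
        snd_meas[OF wt_measurable] snd_meas[OF L2b_measurable[OF V_in_L2b]])
  then have "(\<lambda>(t, x). ennreal ((P t x)\<^sup>2)) \<in> borel_measurable (?L \<Otimes>\<^sub>M half_line)"
    by (simp add: split_beta')
  from half_line.borel_measurable_nn_integral[OF this]
  have m: "(\<lambda>t. sqrt (enn2real (\<integral>\<^sup>+ x. ennreal ((P t x)\<^sup>2) \<partial>half_line))) \<in> borel_measurable ?L" by measurable
  have "AE t in ?L. sqrt (enn2real (\<integral>\<^sup>+ x. ennreal ((P t x)\<^sup>2) \<partial>half_line)) = dist (N t a) c"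
    using AE_good
  proof eventually_elim
    case (elim t)
    have F: "(\<lambda>x. f t x (h x) (k x)) \<in> L2b \<delta>" by (rule section_L2b[OF elim L])
    have "N t a - c = U \<delta> (\<lambda>x. f t x (h x) (k x) - V \<delta> c x)"
      unfolding U_diff[OF F V_in_L2b] using elim by (simp add: N_def h_def k_def)
    also have "\<dots> = abs_l2 (P t)" by (simp add: U_def P_def)
    finally have e: "N t a - c = abs_l2 (P t)" .
    have "P t \<in> L2_space half_line"
      using L2_diff[OF F V_in_L2b] unfolding P_def by (simp add: L2_bessel_iff)
    from nn_norm_abs_l2[OF this] show ?case by (simp add: dist_norm e)
  qed
  then show "(\<lambda>t. dist (N t a) c) \<in> borel_measurable ?L"
    by (rule borel_measurable_lebesgue_on_AE[OF m, rotated]) simp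
qed

lemma N_zero_integrable: "integrable (lebesgue_on {0..T}) (\<lambda>t. N t 0)"
proof (rule integrable_lebesgue_on_AE[OF L12_integrable[OF f_zero]])
  show "AE t in lebesgue_on {0..T}. U \<delta> (\<lambda>x. f t x 0 0) = N t 0"
    using AE_good
  proof eventually_elim
    case (elim t)
    show ?case using N_eq[OF elim L2_zero L2_zero] by (simp add: U_zero zero_prod_def)
  qed
qed simp

sublocale sp: semilinear_problem Gr T N "3 * C" "U \<delta> g"
proof unfold_locales
  show "subspace Gr" by (rule subspace_Gr)
  show "closed Gr" by (rule closed_Gr)
  show "closure (fst ` Gr) = UNIV" by (rule dense_dom_Gr)
  show "0 < T" by (rule T_pos)
  show "k = 0" if "(0, k) \<in> Gr" for k by (rule single_Gr[OF that])
  show "norm (N t a - N t b) \<le> 3 * C * norm (a - b)" for t a b by (rule N_lipschitz)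
  show "(\<lambda>t. N t a) \<in> borel_measurable (lebesgue_on {0..T})" for a by (rule N_measurable)
  show "integrable (lebesgue_on {0..T}) (\<lambda>t. N t 0)" by (rule N_zero_integrable)
  show "0 \<le> 3 * C" using C_pos by simp
qed

lemma nonlinear_UG:
  assumes "good t" "u t \<in> H_space \<delta>"
  shows "nonlinear_term \<delta> f u t \<in> L2b \<delta>" and "U \<delta> (nonlinear_term \<delta> f u t) = N t (UG (u t))"
  using section_L2b[OF assms(1) H_space_L2b H_dx_L2b, OF assms(2,2)]
    N_eq[OF assms(1) H_space_L2b H_dx_L2b, OF assms(2,2)]
  by (simp_all add: nonlinear_term_def[abs_def] UG_def)

text \<open>A translation term by term. The generator becomes minus the pairing of gradients by
  \<open>generator_parts\<close>, the two factors 1 / sqrt 2 supplying the 1/2.\<close>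

lemma weak_equation_iff:
  assumes uL: "\<And>t. t \<in> {0..T} \<Longrightarrow> u t \<in> L2b \<delta>"
    and u: "AE s in lebesgue_on {0..T}. u s \<in> H_space \<delta> \<and> UG (u s) = (v s, v' s)"
    and v: "integrable (lebesgue_on {0..T}) v" "integrable (lebesgue_on {0..T}) v'"
    and \<phi>: "\<phi> \<in> test_functions" and t: "t \<in> {0..T}" and ut: "U \<delta> (u t) = v t"
    and pq: "p = U \<delta> \<phi>" "q = (1 / sqrt 2) *\<^sub>R U \<delta> (half_line_deriv \<phi>)"
  shows "L2_inner (bessel_measure \<delta>) (u t) \<phi> =
          L2_inner (bessel_measure \<delta>) g \<phi>
          + (\<integral>s. L2_inner (bessel_measure \<delta>) (u s) (bessel_generator \<delta> \<phi>) \<partial>lebesgue_on {t..T})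
          + (\<integral>s. L2_inner (bessel_measure \<delta>) (nonlinear_term \<delta> f u s) \<phi> \<partial>lebesgue_on {t..T})
    \<longleftrightarrow> v t \<bullet> p = U \<delta> g \<bullet> p - (\<integral>s. indicator {t<..} s *\<^sub>R (v' s \<bullet> q) \<partial>lebesgue_on {0..T})
          + (\<integral>s. indicator {t<..} s *\<^sub>R (N s (v s, v' s) \<bullet> p) \<partial>lebesgue_on {0..T})"
proof -
  note \<phi>L = test_L2b[OF \<phi>] test_deriv_L2b[OF \<phi>]
  have "L2_inner (bessel_measure \<delta>) (u t) \<phi> = v t \<bullet> p"
    using U_inner[OF uL[OF t] \<phi>L(1)] by (simp add: ut pq)
  moreover have "L2_inner (bessel_measure \<delta>) g \<phi> = U \<delta> g \<bullet> p"
    using U_inner[OF g_L2 \<phi>L(1)] by (simp add: pq)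
  moreover have "(\<integral>s. L2_inner (bessel_measure \<delta>) (u s) (bessel_generator \<delta> \<phi>) \<partial>lebesgue_on {t..T})
      = (\<integral>s. indicator {t<..} s *\<^sub>R (- (v' s \<bullet> q)) \<partial>lebesgue_on {0..T})"
  proof (rule integral_lebesgue_on_tail[OF t])
    show "(\<lambda>s. - (v' s \<bullet> q)) \<in> borel_measurable (lebesgue_on {0..T})" using v(2) by simp
    show "AE s in lebesgue_on {0..T}. L2_inner (bessel_measure \<delta>) (u s) (bessel_generator \<delta> \<phi>) = - (v' s \<bullet> q)"
      using u
    proof eventually_elim
      case (elim s)
      then have H: "u s \<in> H_space \<delta>" and v': "v' s = (1 / sqrt 2) *\<^sub>R U \<delta> (H_dx \<delta> (u s))" by (auto simp: UG_def)
      have "v' s \<bullet> q = 1 / (sqrt 2 * sqrt 2) * (U \<delta> (H_dx \<delta> (u s)) \<bullet> U \<delta> (half_line_deriv \<phi>))"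
        by (simp add: v' pq)
      also have "\<dots> = 1 / 2 * L2_inner (bessel_measure \<delta>) (H_dx \<delta> (u s)) (half_line_deriv \<phi>)"
        by (simp add: U_inner[OF H_dx_L2b[OF H] \<phi>L(2)])
      finally show ?case using generator_parts[OF H_space_L2b[OF H] H_dx_deriv[OF H] \<phi>] by simp
    qed
  qed
  moreover have "(\<integral>s. L2_inner (bessel_measure \<delta>) (nonlinear_term \<delta> f u s) \<phi> \<partial>lebesgue_on {t..T})
      = (\<integral>s. indicator {t<..} s *\<^sub>R (N s (v s, v' s) \<bullet> p) \<partial>lebesgue_on {0..T})"
  proof (rule integral_lebesgue_on_tail[OF t])
    show "(\<lambda>s. N s (v s, v' s) \<bullet> p) \<in> borel_measurable (lebesgue_on {0..T})"
      using sp.N_integrable[OF sp.integrable_Pair[OF v]] by simp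
    show "AE s in lebesgue_on {0..T}. L2_inner (bessel_measure \<delta>) (nonlinear_term \<delta> f u s) \<phi> = N s (v s, v' s) \<bullet> p"
      using u AE_good
    proof eventually_elim
      case (elim s)
      then have "u s \<in> H_space \<delta>" by simp
      note n = nonlinear_UG[of s u, OF elim(2) this]
      show ?case using U_inner[OF n(1) \<phi>L(1)] elim(1) by (simp add: n(2) pq)
    qed
  qed
  ultimately show ?thesis by simp
qed

text \<open>With the time integrals pulled out of the inner product, both sides of the weak equation
  are continuous in the test pair. Validity on \<open>test_graph\<close> thus extends to its
  closure, which is all of \<open>Gr\<close>. Membership in \<open>B_space\<close> provides
  integrability of the gradient.\<close>

lemma weak_solution_imp_weak_sol:
  assumes ws: "weak_solution \<delta> T f g u" and B: "u \<in> B_space \<delta> T"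
  shows "sp.weak_sol (\<lambda>t. U \<delta> (u t)) (\<lambda>t. snd (UG (u t)))"
proof -
  let ?M = "lebesgue_on {0..T}"
  define v v' where "v = (\<lambda>t. U \<delta> (u t))" and "v' = (\<lambda>t. snd (UG (u t)))"
  have UG: "UG (u t) = (v t, v' t)" for t by (simp add: v_def v'_def UG_def)
  have "integrable ?M (\<lambda>t. (v t, v' t))" using B_integrable[OF B] by (simp add: UG)
  from sp.integrable_fst[OF this] sp.integrable_snd[OF this]
  have v: "integrable ?M v" "integrable ?M v'" by simp_all
  have uL: "\<And>t. t \<in> {0..T} \<Longrightarrow> u t \<in> L2b \<delta>" and uH: "AE t in ?M. u t \<in> H_space \<delta>"
    and eq: "\<And>\<phi> t. \<phi> \<in> test_functions \<Longrightarrow> t \<in> {0..T} \<Longrightarrow> L2_inner (bessel_measure \<delta>) (u t) \<phi> =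
          L2_inner (bessel_measure \<delta>) g \<phi>
          + (\<integral>s. L2_inner (bessel_measure \<delta>) (u s) (bessel_generator \<delta> \<phi>) \<partial>lebesgue_on {t..T})
          + (\<integral>s. L2_inner (bessel_measure \<delta>) (nonlinear_term \<delta> f u s) \<phi> \<partial>lebesgue_on {t..T})"
    using ws unfolding weak_solution_def by simp_all
  have u: "AE s in ?M. u s \<in> H_space \<delta> \<and> UG (u s) = (v s, v' s)" using uH by eventually_elim (simp add: UG)
  define n where "n = (\<lambda>s. N s (v s, v' s))"
  have n: "integrable ?M n" unfolding n_def by (rule sp.N_integrable[OF sp.integrable_Pair[OF v]])
  have weak: "v t \<bullet> fst z = U \<delta> g \<bullet> fst z - (\<integral>s. indicator {t<..} s *\<^sub>R (v' s \<bullet> snd z) \<partial>?M)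
      + (\<integral>s. indicator {t<..} s *\<^sub>R (n s \<bullet> fst z) \<partial>?M)" if t: "t \<in> {0..T}" and z: "z \<in> Gr" for t z
  proof -
    have cut: "integrable ?M (\<lambda>s. indicator {t<..} s *\<^sub>R w s)" if w: "integrable ?M w" for w :: "real \<Rightarrow> l2"
    proof (rule Bochner_Integration.integrable_bound[OF w])
      show "(\<lambda>s. indicator {t<..} s *\<^sub>R w s) \<in> borel_measurable ?M"
        using w by (intro borel_measurable_scaleR sp.indicator_measurable_M) simp
    qed (simp add: indicator_def)
    have pull: "(\<integral>s. indicator {t<..} s *\<^sub>R (w s \<bullet> r) \<partial>?M) = (\<integral>s. indicator {t<..} s *\<^sub>R w s \<partial>?M) \<bullet> r"
      if w: "integrable ?M w" for w :: "real \<Rightarrow> l2" and r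
      using integral_inner_left[OF cut[OF w], of r] by simp
    \<comment> \<open>The pairs for which the equation holds at this t, written with fixed vectors
      so that the set is visibly closed.\<close>
    let ?C = "{z. v t \<bullet> fst z = U \<delta> g \<bullet> fst z - (\<integral>s. indicator {t<..} s *\<^sub>R v' s \<partial>?M) \<bullet> snd z
      + (\<integral>s. indicator {t<..} s *\<^sub>R n s \<partial>?M) \<bullet> fst z}"
    have "closure test_graph \<subseteq> ?C"
    proof (rule closure_minimal)
      show "closed ?C" by (intro closed_Collect_eq continuous_intros)
      show "test_graph \<subseteq> ?C"
      proof
        fix z assume "z \<in> test_graph"
        then obtain \<phi> where \<phi>: "\<phi> \<in> test_functions"
          and z: "z = (U \<delta> \<phi>, (1 / sqrt 2) *\<^sub>R U \<delta> (half_line_deriv \<phi>))" unfolding test_graph_def by blast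
        have "U \<delta> (u t) = v t" by (simp add: v_def)
        from weak_equation_iff[OF uL u v \<phi> t this refl refl] eq[OF \<phi> t]
        have "v t \<bullet> fst z = U \<delta> g \<bullet> fst z - (\<integral>s. indicator {t<..} s *\<^sub>R (v' s \<bullet> snd z) \<partial>?M)
            + (\<integral>s. indicator {t<..} s *\<^sub>R (n s \<bullet> fst z) \<partial>?M)" unfolding z n_def fst_conv snd_conv by blast
        then show "z \<in> ?C" unfolding pull[OF v(2)] pull[OF n] by simp
      qed
    qed
    then have "z \<in> ?C" using z closure_test_graph by blast
    then show ?thesis unfolding pull[OF v(2)] pull[OF n] by simp
  qed
  have "AE t in ?M. (v t, v' t) \<in> Gr" using uH by eventually_elim (metis UG UG_in_Gr)
  then have "sp.weak_sol v v'"
    unfolding sp.weak_sol_def using v weak unfolding n_def by auto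
  then show ?thesis unfolding v_def v'_def .
qed

text \<open>\<open>V\<close> selects representatives at every t. Test functions form part of
  \<open>Gr\<close>, so the equation needed is a special case of the abstract one.\<close>

lemma weak_sol_imp_weak_solution:
  assumes ws: "sp.weak_sol v v'"
  shows "weak_solution \<delta> T f g (\<lambda>t. V \<delta> (v t))" and "(\<lambda>t. V \<delta> (v t)) \<in> B_space \<delta> T"
proof -
  let ?M = "lebesgue_on {0..T}"
  define u where "u = (\<lambda>t. V \<delta> (v t))"
  have v: "integrable ?M v" "integrable ?M v'" and G: "AE t in ?M. (v t, v' t) \<in> Gr"
    and weak: "\<And>p q t. (p, q) \<in> Gr \<Longrightarrow> t \<in> {0..T} \<Longrightarrow> v t \<bullet> p =
      U \<delta> g \<bullet> p - (\<integral>s. indicator {t<..} s *\<^sub>R (v' s \<bullet> q) \<partial>?M)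
      + (\<integral>s. indicator {t<..} s *\<^sub>R (N s (v s, v' s) \<bullet> p) \<partial>?M)"
    using ws unfolding sp.weak_sol_def by blast+
  have uL: "u t \<in> L2b \<delta>" and Uu: "U \<delta> (u t) = v t" for t by (simp_all add: u_def V_in_L2b)
  have u: "AE s in ?M. u s \<in> H_space \<delta> \<and> UG (u s) = (v s, v' s)"
    using G by eventually_elim (simp add: u_def Gr_section)
  have "u \<in> B_space \<delta> T"
    by (rule integrable_B[OF sp.integrable_Pair[OF v] G]) (use u in simp)
  then show "(\<lambda>t. V \<delta> (v t)) \<in> B_space \<delta> T" by (simp add: u_def)
  have "u \<in> L12_space \<delta> T" by (rule integrable_L12[OF v(1)]) (simp add: uL Uu)
  moreover have "AE t in ?M. u t \<in> H_space \<delta>" using u by eventually_elim simp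
  moreover have "nonlinear_term \<delta> f u \<in> L12_space \<delta> T"
  proof (rule integrable_L12[OF sp.N_integrable[OF sp.integrable_Pair[OF v]]])
    show "AE s in ?M. nonlinear_term \<delta> f u s \<in> L2b \<delta> \<and> U \<delta> (nonlinear_term \<delta> f u s) = N s (v s, v' s)"
      using u AE_good by eventually_elim (metis nonlinear_UG)
  qed
  moreover have "L2_inner (bessel_measure \<delta>) (u t) \<phi> =
          L2_inner (bessel_measure \<delta>) g \<phi>
          + (\<integral>s. L2_inner (bessel_measure \<delta>) (u s) (bessel_generator \<delta> \<phi>) \<partial>lebesgue_on {t..T})
          + (\<integral>s. L2_inner (bessel_measure \<delta>) (nonlinear_term \<delta> f u s) \<phi> \<partial>lebesgue_on {t..T})"
    if \<phi>: "\<phi> \<in> test_functions" and t: "t \<in> {0..T}" for \<phi> t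
  proof -
    have "(U \<delta> \<phi>, (1 / sqrt 2) *\<^sub>R U \<delta> (half_line_deriv \<phi>)) \<in> Gr"
      by (rule GrI[OF test_L2b[OF \<phi>] test_H_deriv[OF \<phi>]])
    from weak[OF this t] show ?thesis
      using weak_equation_iff[OF uL u v \<phi> t Uu refl refl] by blast
  qed
  ultimately show "weak_solution \<delta> T f g (\<lambda>t. V \<delta> (v t))"
    unfolding weak_solution_def u_def[symmetric] using uL by blast
qed

end

theorem theorem5p15:
  fixes \<delta> T :: real
    and f :: "real \<Rightarrow> real \<Rightarrow> real \<Rightarrow> real \<Rightarrow> real"
    and g :: "real \<Rightarrow> real"
  assumes "0 < \<delta>" and "\<delta> < 1" and "0 < T"
    and f_borel: "(\<lambda>(t, x, y, z). f t x y z)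
        \<in> borel_measurable (restrict_space borel ({0..T} \<times> {0..} \<times> UNIV \<times> UNIV))"
    and g_borel: "g \<in> borel_measurable (restrict_space borel {0..})"
    and f_lipschitz: "\<exists>C>0. \<forall>t\<in>{0..T}. \<forall>x\<ge>0. \<forall>y1 y2 z1 z2.
        \<bar>f t x y1 z1 - f t x y2 z2\<bar> \<le> C * (\<bar>y1 - y2\<bar> + \<bar>z1 - z2\<bar>)"
    and f_zero: "(\<lambda>t x. f t x 0 0) \<in> L12_space \<delta> T"
    and g_L2: "g \<in> L2_space (bessel_measure \<delta>)"
  shows "(\<exists>u. weak_solution \<delta> T f g u \<and> u \<in> B_space \<delta> T) \<and>
         (\<forall>u v. weak_solution \<delta> T f g u \<and> u \<in> B_space \<delta> T \<and>
                weak_solution \<delta> T f g v \<and> v \<in> B_space \<delta> T \<longrightarrow>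
                (\<forall>t\<in>{0..T}. AE x in bessel_measure \<delta>. u t x = v t x))"
proof -
  obtain C where C: "0 < C" "\<And>t x y1 y2 z1 z2. t \<in> {0..T} \<Longrightarrow> 0 \<le> x \<Longrightarrow>
      \<bar>f t x y1 z1 - f t x y2 z2\<bar> \<le> C * (\<bar>y1 - y2\<bar> + \<bar>z1 - z2\<bar>)"
    using f_lipschitz by metis
  interpret bessel_problem \<delta> T C f g
    by unfold_locales (fact assms C f_borel f_zero g_L2)+
  obtain v v' where "sp.weak_sol v v'" using sp.weak_sol_exists by blast
  from weak_sol_imp_weak_solution[OF this]
  have "\<exists>u. weak_solution \<delta> T f g u \<and> u \<in> B_space \<delta> T" by blast
  moreover have "AE x in bessel_measure \<delta>. u t x = v t x"
    if u: "weak_solution \<delta> T f g u" "u \<in> B_space \<delta> T"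
      and v: "weak_solution \<delta> T f g v" "v \<in> B_space \<delta> T" and t: "t \<in> {0..T}" for u v t
  proof -
    have L: "u t \<in> L2b \<delta>" "v t \<in> L2b \<delta>" using u(1) v(1) t unfolding weak_solution_def by blast+
    \<comment> \<open>Abstract uniqueness holds at every t, and equality in \<open>l2\<close> means
      equality almost everywhere in x.\<close>
    have "U \<delta> (u t) = U \<delta> (v t)"
      by (rule sp.weak_sol_unique[OF weak_solution_imp_weak_sol[OF u] weak_solution_imp_weak_sol[OF v] t])
    then show ?thesis unfolding U_eq_iff[OF L] AE_bessel_iff .
  qed
  ultimately show ?thesis by blast
qed

end
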